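(* Let $n\ge1$ and let $A=\Lambda[x_1,\ldots,x_n]=\Lambda(R^n)$ be the $n$-th exterior algebra over a commutative unital ring $R$. If $R=\mathbb{Z}$, then for every $k\ge0$, $HH_k(A;A)\cong\mathbb{Z}^F\oplus\mathbb{Z}_2^{\,T}$, where $$F=2^{n-1}\binom{n+k-1}{k}+\begin{cases}1&k=0\\0&k\ge1\end{cases}\qquad\text{and}\qquad T=(-1)^{k+1}+2^{n-1}\sum_{0\le i\le k}(-1)^{k-i}\binom{n+i-1}{i}.$$ In particular, if $R=K$ is a field, then for every $k\ge 0$ $$\dim_K HH_k(A;A)=\begin{cases}2^n\binom{n+k-1}{k}&\text{if }\operatorname{char}K=2,\\ 2^{n-1}\binom{n+k-1}{k}&\text{if }\operatorname{char}K\ne2,\ k\ge1,\\ 2^{n-1}+1&\text{if }\operatorname{char}K\ne2,\ k=0.\end{cases}$$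
   Context: $A$ is the associative unital $R$-algebra with $R$-basis $x_\sigma=\bigwedge_{i\in\sigma}x_i$, $\sigma\subseteq\{1,\ldots,n\}$, $x_i^2=0$, $x_ix_j=-x_jx_i$, regarded as an ordinary (ungraded, no sign conventions) algebra. $HH_k(A;A)$ is its Hochschild homology: the degree-$k$ homology of $A\otimes_{A^e}B_\ast$, where $A^e=A\otimes_RA^{\mathrm{op}}$ and $B_\ast$ is the bar resolution, $B_k=A^{\otimes k+2}$ ($k\ge0$, tensors over $R$) with $b_k(a_0\otimes\cdots\otimes a_{k+1})=\sum_{i=0}^k(-1)^ia_0\otimes\cdots\otimes a_ia_{i+1}\otimes\cdots\otimes a_{k+1}$. $\mathbb{Z}_2=\mathbb{Z}/2\mathbb{Z}$. *)

theory Defs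
  imports
    "HOL-Algebra.IntRing"
    "HOL-Algebra.Elementary_Groups"
    "HOL-Algebra.Product_Groups"
    "Jordan_Normal_Form.Missing_VectorSpace"
begin

section \<open>Modules given by generators and relations\<close>

text \<open>The fields \<open>mult\<close> and \<open>one\<close> of a module record carry no meaning here and are left
  \<open>undefined\<close>; the records representing algebras set them.\<close>

definition free_module ::
    "('r, 'm) ring_scheme \<Rightarrow> 'x set \<Rightarrow> ('r, 'x \<Rightarrow> 'r) module" where
  "free_module R S =
    \<lparr>carrier = {f. (\<forall>x. f x \<in> carrier R) \<and> (\<forall>x. x \<notin> S \<longrightarrow> f x = \<zero>\<^bsub>R\<^esub>) \<and>
                   finite {x. f x \<noteq> \<zero>\<^bsub>R\<^esub>}},
     mult = undefined, one = undefined,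
     zero = (\<lambda>_. \<zero>\<^bsub>R\<^esub>), add = (\<lambda>f g x. f x \<oplus>\<^bsub>R\<^esub> g x),
     smult = (\<lambda>r f x. r \<otimes>\<^bsub>R\<^esub> f x)\<rparr>"

definition basis_vec :: "('r, 'm) ring_scheme \<Rightarrow> 'x \<Rightarrow> 'x \<Rightarrow> 'r" where
  "basis_vec R x = (\<lambda>y. if y = x then \<one>\<^bsub>R\<^esub> else \<zero>\<^bsub>R\<^esub>)"

text \<open>The \<open>R\<close>-linear extension to the free module of a map \<open>\<phi>\<close> from the generators to \<open>P\<close>.\<close>

definition lin_ext ::
    "('r, 'm) ring_scheme \<Rightarrow> ('r, 'p, 'q) module_scheme \<Rightarrow> ('x \<Rightarrow> 'p) \<Rightarrow> ('x \<Rightarrow> 'r) \<Rightarrow> 'p" where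
  "lin_ext R P \<phi> f = (\<Oplus>\<^bsub>P\<^esub>x\<in>{x. f x \<noteq> \<zero>\<^bsub>R\<^esub>}. f x \<odot>\<^bsub>P\<^esub> \<phi> x)"

definition quot_module ::
    "('r, 'p, 'q) module_scheme \<Rightarrow> 'p set \<Rightarrow> ('r, 'p set) module" where
  "quot_module M N =
    \<lparr>carrier = a_rcosets\<^bsub>M\<^esub> N, mult = undefined, one = undefined,
     zero = N, add = (\<lambda>X Y. X <+>\<^bsub>M\<^esub> Y),
     smult = (\<lambda>r X. \<Union>x\<in>X. N +>\<^bsub>M\<^esub> (r \<odot>\<^bsub>M\<^esub> x))\<rparr>"

definition presented_module ::
    "('r, 'm) ring_scheme \<Rightarrow> 'x set \<Rightarrow> ('x \<Rightarrow> 'r) set \<Rightarrow> ('r, ('x \<Rightarrow> 'r) set) module" where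
  "presented_module R S rels =
    quot_module (free_module R S) (LinearCombinations.module.span R (free_module R S) rels)"

definition presented_gen ::
    "('r, 'm) ring_scheme \<Rightarrow> 'x set \<Rightarrow> ('x \<Rightarrow> 'r) set \<Rightarrow> 'x \<Rightarrow> ('x \<Rightarrow> 'r) set" where
  "presented_gen R S rels x =
    LinearCombinations.module.span R (free_module R S) rels +>\<^bsub>free_module R S\<^esub> basis_vec R x"

text \<open>The map out of a presented module determined by the images \<open>\<phi>\<close> of the generators. The value
  does not depend on the chosen representative as soon as the linear extension of \<open>\<phi>\<close> kills the
  relations, which is the case wherever it is used below.\<close>

definition presented_lift ::
    "('r, 'm) ring_scheme \<Rightarrow> ('r, 'p, 'q) module_scheme \<Rightarrow> ('x \<Rightarrow> 'p) \<Rightarrow> ('x \<Rightarrow> 'r) set \<Rightarrow> 'p" where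
  "presented_lift R P \<phi> X = lin_ext R P \<phi> (SOME f. f \<in> X)"


section \<open>Tensor products\<close>

text \<open>The tensor power \<open>A \<otimes> \<dots> \<otimes> A\<close> over \<open>R\<close> with \<open>m\<close> factors: generated by the words
  of length \<open>m\<close> over \<open>A\<close>, subject to \<open>R\<close>-multilinearity.\<close>

definition tensor_words :: "('r, 'a, 'q) module_scheme \<Rightarrow> nat \<Rightarrow> 'a list set" where
  "tensor_words A m = {xs. length xs = m \<and> set xs \<subseteq> carrier A}"

definition tensor_rels ::
    "('r, 'm) ring_scheme \<Rightarrow> ('r, 'a, 'q) module_scheme \<Rightarrow> nat \<Rightarrow> ('a list \<Rightarrow> 'r) set" where
  "tensor_rels R A m =
    (let F = free_module R (tensor_words A m); e = basis_vec R in
      {e (xs[i := a \<oplus>\<^bsub>A\<^esub> b]) \<ominus>\<^bsub>F\<^esub> (e (xs[i := a]) \<oplus>\<^bsub>F\<^esub> e (xs[i := b])) | xs i a b.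
         xs \<in> tensor_words A m \<and> i < m \<and> a \<in> carrier A \<and> b \<in> carrier A} \<union>
      {e (xs[i := r \<odot>\<^bsub>A\<^esub> a]) \<ominus>\<^bsub>F\<^esub> (r \<odot>\<^bsub>F\<^esub> e (xs[i := a])) | xs i a r.
         xs \<in> tensor_words A m \<and> i < m \<and> a \<in> carrier A \<and> r \<in> carrier R})"

definition tensor_power ::
    "('r, 'm) ring_scheme \<Rightarrow> ('r, 'a, 'q) module_scheme \<Rightarrow> nat \<Rightarrow> ('r, ('a list \<Rightarrow> 'r) set) module" where
  "tensor_power R A m = presented_module R (tensor_words A m) (tensor_rels R A m)"

definition pure_tensor ::
    "('r, 'm) ring_scheme \<Rightarrow> ('r, 'a, 'q) module_scheme \<Rightarrow> 'a list \<Rightarrow> ('a list \<Rightarrow> 'r) set" where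
  "pure_tensor R A xs =
    presented_gen R (tensor_words A (length xs)) (tensor_rels R A (length xs)) xs"

text \<open>The tensor product \<open>M \<otimes> N\<close> over an \<open>R\<close>-algebra \<open>S\<close>, with \<open>S\<close> acting on \<open>M\<close> from the
  right by \<open>ract\<close> and on \<open>N\<close> from the left by \<open>lact\<close>, both compatibly with the \<open>R\<close>-module
  structures. That scalars move across the tensor sign already follows from balancing; the
  relations involving \<open>R\<close> define the \<open>R\<close>-module structure of the product.\<close>

definition balanced_rels ::
    "('r, 'm) ring_scheme \<Rightarrow> ('r, 's, 'q) module_scheme \<Rightarrow>
     ('r, 'a, 'q1) module_scheme \<Rightarrow> ('a \<Rightarrow> 's \<Rightarrow> 'a) \<Rightarrow>
     ('r, 'b, 'q2) module_scheme \<Rightarrow> ('s \<Rightarrow> 'b \<Rightarrow> 'b) \<Rightarrow> ('a \<times> 'b \<Rightarrow> 'r) set" where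
  "balanced_rels R S M ract N lact =
    (let F = free_module R (carrier M \<times> carrier N); e = basis_vec R in
      {e (x \<oplus>\<^bsub>M\<^esub> x', y) \<ominus>\<^bsub>F\<^esub> (e (x, y) \<oplus>\<^bsub>F\<^esub> e (x', y)) | x x' y.
         x \<in> carrier M \<and> x' \<in> carrier M \<and> y \<in> carrier N} \<union>
      {e (x, y \<oplus>\<^bsub>N\<^esub> y') \<ominus>\<^bsub>F\<^esub> (e (x, y) \<oplus>\<^bsub>F\<^esub> e (x, y')) | x y y'.
         x \<in> carrier M \<and> y \<in> carrier N \<and> y' \<in> carrier N} \<union>
      {e (r \<odot>\<^bsub>M\<^esub> x, y) \<ominus>\<^bsub>F\<^esub> (r \<odot>\<^bsub>F\<^esub> e (x, y)) | r x y.
         r \<in> carrier R \<and> x \<in> carrier M \<and> y \<in> carrier N} \<union>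
      {e (x, r \<odot>\<^bsub>N\<^esub> y) \<ominus>\<^bsub>F\<^esub> (r \<odot>\<^bsub>F\<^esub> e (x, y)) | r x y.
         r \<in> carrier R \<and> x \<in> carrier M \<and> y \<in> carrier N} \<union>
      {e (ract x s, y) \<ominus>\<^bsub>F\<^esub> e (x, lact s y) | x s y.
         x \<in> carrier M \<and> s \<in> carrier S \<and> y \<in> carrier N})"

definition balanced_tensor ::
    "('r, 'm) ring_scheme \<Rightarrow> ('r, 's, 'q) module_scheme \<Rightarrow>
     ('r, 'a, 'q1) module_scheme \<Rightarrow> ('a \<Rightarrow> 's \<Rightarrow> 'a) \<Rightarrow>
     ('r, 'b, 'q2) module_scheme \<Rightarrow> ('s \<Rightarrow> 'b \<Rightarrow> 'b) \<Rightarrow> ('r, ('a \<times> 'b \<Rightarrow> 'r) set) module" where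
  "balanced_tensor R S M ract N lact =
    presented_module R (carrier M \<times> carrier N) (balanced_rels R S M ract N lact)"

definition balanced_pure ::
    "('r, 'm) ring_scheme \<Rightarrow> ('r, 's, 'q) module_scheme \<Rightarrow>
     ('r, 'a, 'q1) module_scheme \<Rightarrow> ('a \<Rightarrow> 's \<Rightarrow> 'a) \<Rightarrow>
     ('r, 'b, 'q2) module_scheme \<Rightarrow> ('s \<Rightarrow> 'b \<Rightarrow> 'b) \<Rightarrow> 'a \<Rightarrow> 'b \<Rightarrow> ('a \<times> 'b \<Rightarrow> 'r) set" where
  "balanced_pure R S M ract N lact x y =
    presented_gen R (carrier M \<times> carrier N) (balanced_rels R S M ract N lact) (x, y)"


section \<open>Hochschild homology\<close>

text \<open>An associative unital \<open>R\<close>-algebra is given by a \<open>module\<close> record whose \<open>mult\<close> and \<open>one\<close> are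
  its ring structure. (The library locale \<open>algebra\<close> would force commutativity.)\<close>

definition opposite :: "('r, 'a, 'q) module_scheme \<Rightarrow> ('r, 'a, 'q) module_scheme" where
  "opposite A = A\<lparr>mult := (\<lambda>x y. y \<otimes>\<^bsub>A\<^esub> x)\<rparr>"

text \<open>The enveloping algebra of \<open>A\<close>, that is, \<open>A\<close> tensored over \<open>R\<close> with its opposite. As \<open>A\<close> and
  \<open>opposite A\<close> have the same underlying module, so does the tensor square of \<open>A\<close>.\<close>

definition enveloping ::
    "('r, 'm) ring_scheme \<Rightarrow> ('r, 'a, 'q) module_scheme \<Rightarrow> ('r, ('a list \<Rightarrow> 'r) set) module" where
  "enveloping R A =
    (let E = tensor_power R A 2 in
      E\<lparr>mult := (\<lambda>X Y. presented_lift R E (\<lambda>u. presented_lift R E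
          (\<lambda>v. pure_tensor R A [u ! 0 \<otimes>\<^bsub>A\<^esub> v ! 0, u ! 1 \<otimes>\<^bsub>opposite A\<^esub> v ! 1]) Y) X),
        one := pure_tensor R A [\<one>\<^bsub>A\<^esub>, \<one>\<^bsub>A\<^esub>]\<rparr>)"

text \<open>\<open>A\<close> as a right module over its enveloping algebra: \<open>x \<cdot> (a \<otimes> b) = b x a\<close>.\<close>

definition env_right_act ::
    "('r, 'm) ring_scheme \<Rightarrow> ('r, 'a, 'q) module_scheme \<Rightarrow> 'a \<Rightarrow> ('a list \<Rightarrow> 'r) set \<Rightarrow> 'a" where
  "env_right_act R A x s = presented_lift R A (\<lambda>u. u ! 1 \<otimes>\<^bsub>A\<^esub> x \<otimes>\<^bsub>A\<^esub> u ! 0) s"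

definition bar_module ::
    "('r, 'm) ring_scheme \<Rightarrow> ('r, 'a, 'q) module_scheme \<Rightarrow> nat \<Rightarrow> ('r, ('a list \<Rightarrow> 'r) set) module" where
  "bar_module R A k = tensor_power R A (k + 2)"

text \<open>The left action \<open>(a \<otimes> b) \<cdot> (a\<^sub>0 \<otimes> \<dots> \<otimes> a\<^sub>k\<^sub>+\<^sub>1) = a a\<^sub>0 \<otimes> \<dots> \<otimes> a\<^sub>k\<^sub>+\<^sub>1 b\<close>.\<close>

definition bar_left_act ::
    "('r, 'm) ring_scheme \<Rightarrow> ('r, 'a, 'q) module_scheme \<Rightarrow> nat \<Rightarrow>
     ('a list \<Rightarrow> 'r) set \<Rightarrow> ('a list \<Rightarrow> 'r) set \<Rightarrow> ('a list \<Rightarrow> 'r) set" where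
  "bar_left_act R A k s y =
    presented_lift R (bar_module R A k) (\<lambda>u. presented_lift R (bar_module R A k)
      (\<lambda>xs. pure_tensor R A
        (xs[0 := u ! 0 \<otimes>\<^bsub>A\<^esub> xs ! 0, k + 1 := xs ! (k + 1) \<otimes>\<^bsub>A\<^esub> u ! 1])) y) s"

definition merge_at :: "('r, 'a, 'q) module_scheme \<Rightarrow> nat \<Rightarrow> 'a list \<Rightarrow> 'a list" where
  "merge_at A i xs = take i xs @ (xs ! i \<otimes>\<^bsub>A\<^esub> xs ! Suc i) # drop (i + 2) xs"

definition ring_sign :: "('r, 'm) ring_scheme \<Rightarrow> nat \<Rightarrow> 'r" where
  "ring_sign R i = (\<ominus>\<^bsub>R\<^esub> \<one>\<^bsub>R\<^esub>) [^]\<^bsub>R\<^esub> i"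

text \<open>The differential from degree \<open>k\<close> to degree \<open>k - 1\<close> of the bar resolution, used for \<open>k \<ge> 1\<close>.
  (For \<open>k = 0\<close> it is the augmentation to the first tensor power, which is not part of the
  resolution.)\<close>

definition bar_diff ::
    "('r, 'm) ring_scheme \<Rightarrow> ('r, 'a, 'q) module_scheme \<Rightarrow> nat \<Rightarrow>
     ('a list \<Rightarrow> 'r) set \<Rightarrow> ('a list \<Rightarrow> 'r) set" where
  "bar_diff R A k =
    presented_lift R (tensor_power R A (k + 1))
      (\<lambda>xs. \<Oplus>\<^bsub>tensor_power R A (k + 1)\<^esub>i\<in>{0..k}.
         ring_sign R i \<odot>\<^bsub>tensor_power R A (k + 1)\<^esub> pure_tensor R A (merge_at A i xs))"

definition hochschild_module ::
    "('r, 'm) ring_scheme \<Rightarrow> ('r, 'a, 'q) module_scheme \<Rightarrow> nat \<Rightarrow>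
     ('r, ('a \<times> ('a list \<Rightarrow> 'r) set \<Rightarrow> 'r) set) module" where
  "hochschild_module R A k =
    balanced_tensor R (enveloping R A) A (env_right_act R A) (bar_module R A k) (bar_left_act R A k)"

definition hochschild_pure ::
    "('r, 'm) ring_scheme \<Rightarrow> ('r, 'a, 'q) module_scheme \<Rightarrow> nat \<Rightarrow>
     'a \<Rightarrow> ('a list \<Rightarrow> 'r) set \<Rightarrow> ('a \<times> ('a list \<Rightarrow> 'r) set \<Rightarrow> 'r) set" where
  "hochschild_pure R A k =
    balanced_pure R (enveloping R A) A (env_right_act R A) (bar_module R A k) (bar_left_act R A k)"

text \<open>The induced differential from degree \<open>k\<close> to degree \<open>k - 1\<close>, for \<open>k \<ge> 1\<close>.\<close>

definition hochschild_diff ::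
    "('r, 'm) ring_scheme \<Rightarrow> ('r, 'a, 'q) module_scheme \<Rightarrow> nat \<Rightarrow>
     ('a \<times> ('a list \<Rightarrow> 'r) set \<Rightarrow> 'r) set \<Rightarrow> ('a \<times> ('a list \<Rightarrow> 'r) set \<Rightarrow> 'r) set" where
  "hochschild_diff R A k =
    presented_lift R (hochschild_module R A (k - 1))
      (\<lambda>(x, y). hochschild_pure R A (k - 1) x (bar_diff R A k y))"

definition hochschild_cycles ::
    "('r, 'm) ring_scheme \<Rightarrow> ('r, 'a, 'q) module_scheme \<Rightarrow> nat \<Rightarrow>
     ('a \<times> ('a list \<Rightarrow> 'r) set \<Rightarrow> 'r) set set" where
  "hochschild_cycles R A k =
    (if k = 0 then carrier (hochschild_module R A 0)
     else {z \<in> carrier (hochschild_module R A k).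
             hochschild_diff R A k z = \<zero>\<^bsub>hochschild_module R A (k - 1)\<^esub>})"

definition hochschild_boundaries ::
    "('r, 'm) ring_scheme \<Rightarrow> ('r, 'a, 'q) module_scheme \<Rightarrow> nat \<Rightarrow>
     ('a \<times> ('a list \<Rightarrow> 'r) set \<Rightarrow> 'r) set set" where
  "hochschild_boundaries R A k =
    hochschild_diff R A (k + 1) ` carrier (hochschild_module R A (k + 1))"

definition hochschild_homology ::
    "('r, 'm) ring_scheme \<Rightarrow> ('r, 'a, 'q) module_scheme \<Rightarrow> nat \<Rightarrow>
     ('r, ('a \<times> ('a list \<Rightarrow> 'r) set \<Rightarrow> 'r) set set) module" where
  "hochschild_homology R A k =
    quot_module ((hochschild_module R A k)\<lparr>carrier := hochschild_cycles R A k\<rparr>)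
      (hochschild_boundaries R A k)"


section \<open>The exterior algebra\<close>

text \<open>The free module on the subsets of \<open>{1..n}\<close>, where \<open>basis_vec R \<sigma>\<close> is the product of the
  \<open>x\<^sub>i\<close>, \<open>i \<in> \<sigma>\<close>, in increasing order. Sorting the concatenation of two such products
  takes one transposition for each pair \<open>i \<in> \<sigma>\<close>, \<open>j \<in> \<tau>\<close> with \<open>j < i\<close>.\<close>

definition ext_basis_mult ::
    "('r, 'm) ring_scheme \<Rightarrow> nat \<Rightarrow> nat set \<Rightarrow> nat set \<Rightarrow> nat set \<Rightarrow> 'r" where
  "ext_basis_mult R n \<sigma> \<tau> =
    (let M = free_module R (Pow {1..n}) in
      if \<sigma> \<inter> \<tau> = {}
      then ring_sign R (card {(i, j). i \<in> \<sigma> \<and> j \<in> \<tau> \<and> j < i}) \<odot>\<^bsub>M\<^esub> basis_vec R (\<sigma> \<union> \<tau>)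
      else \<zero>\<^bsub>M\<^esub>)"

definition exterior_algebra ::
    "('r, 'm) ring_scheme \<Rightarrow> nat \<Rightarrow> ('r, nat set \<Rightarrow> 'r) module" where
  "exterior_algebra R n =
    (let M = free_module R (Pow {1..n}) in
      M\<lparr>mult := (\<lambda>f g. lin_ext R M (\<lambda>\<sigma>. lin_ext R M (\<lambda>\<tau>. ext_basis_mult R n \<sigma> \<tau>) g) f),
        one := basis_vec R {}\<rparr>)"


section \<open>Characteristic of a ring\<close>

definition ring_characteristic :: "('r, 'm) ring_scheme \<Rightarrow> nat" where
  "ring_characteristic R =
    (if \<exists>m::nat. m > 0 \<and> [m] \<cdot>\<^bsub>R\<^esub> \<one>\<^bsub>R\<^esub> = \<zero>\<^bsub>R\<^esub>
     then LEAST m::nat. m > 0 \<and> [m] \<cdot>\<^bsub>R\<^esub> \<one>\<^bsub>R\<^esub> = \<zero>\<^bsub>R\<^esub> else 0)"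


section \<open>The exterior algebra has the expected basis and relations\<close>

lemma (in cring) module_free_module: "module R (free_module R S)"
proof (rule moduleI)
  have fin: "finite {x. f x \<oplus> g x \<noteq> \<zero>}"
    if "finite {x. f x \<noteq> \<zero>}" "finite {x. g x \<noteq> \<zero>}" for f g :: "'x \<Rightarrow> 'a"
    by (rule finite_subset[OF _ finite_UnI[OF that]]) auto
  have finm: "finite {x. r \<otimes> f x \<noteq> \<zero>}"
    if "finite {x. f x \<noteq> \<zero>}" "r \<in> carrier R" for f :: "'x \<Rightarrow> 'a" and r
    by (rule finite_subset[OF _ that(1)]) (use that(2) in auto)
  show "abelian_group (free_module R S)"
  proof (rule abelian_groupI)
    fix f assume f: "f \<in> carrier (free_module R S)"
    have "{x. \<ominus> f x \<noteq> \<zero>} \<subseteq> {x. f x \<noteq> \<zero>}"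
      using f by (auto simp: free_module_def)
    then have "(\<lambda>x. \<ominus> f x) \<in> carrier (free_module R S)"
      using f by (auto simp: free_module_def intro: finite_subset)
    moreover have "(\<lambda>x. \<ominus> f x) \<oplus>\<^bsub>free_module R S\<^esub> f = \<zero>\<^bsub>free_module R S\<^esub>"
      using f by (auto simp: free_module_def l_neg)
    ultimately show "\<exists>g\<in>carrier (free_module R S).
        g \<oplus>\<^bsub>free_module R S\<^esub> f = \<zero>\<^bsub>free_module R S\<^esub>" by blast
  qed (auto simp: free_module_def fin a_ac)
  show "r \<odot>\<^bsub>free_module R S\<^esub> f \<in> carrier (free_module R S)"
    if "r \<in> carrier R" "f \<in> carrier (free_module R S)" for r f
    using that finm by (auto simp: free_module_def)
qed (auto simp: free_module_def is_cring l_distr r_distr m_assoc)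

lemma (in cring) basis_vec_closed: "x \<in> S \<Longrightarrow> basis_vec R x \<in> carrier (free_module R S)"
  by (auto simp: free_module_def basis_vec_def intro: finite_subset[of _ "{x}"])

lemma (in cring) ring_sign_closed: "ring_sign R i \<in> carrier R"
  by (simp add: ring_sign_def)

lemma (in cring) lin_ext_basis_vec:
  assumes "module R P" "\<phi> x \<in> carrier P"
  shows "lin_ext R P \<phi> (basis_vec R x) = \<phi> x"
proof -
  interpret P: module R P by fact
  show ?thesis
  proof (cases "\<one> = \<zero>")
    case True
    have "\<phi> x = \<zero>\<^bsub>P\<^esub>"
      using P.smult_one[OF assms(2)] P.smult_l_null[OF assms(2)] True by simp
    moreover have "{y. basis_vec R x y \<noteq> \<zero>} = {}"
      using True by (auto simp: basis_vec_def)
    ultimately show ?thesis by (simp add: lin_ext_def)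
  next
    case False
    then have "{y. basis_vec R x y \<noteq> \<zero>} = {x}" by (auto simp: basis_vec_def)
    then have "lin_ext R P \<phi> (basis_vec R x) = (\<Oplus>\<^bsub>P\<^esub>y\<in>{x}. basis_vec R x y \<odot>\<^bsub>P\<^esub> \<phi> y)"
      by (simp add: lin_ext_def)
    also have "\<dots> = basis_vec R x x \<odot>\<^bsub>P\<^esub> \<phi> x"
      using assms(2) by (subst P.finsum_insert) (auto simp: basis_vec_def)
    finally show ?thesis using assms(2) by (simp add: basis_vec_def)
  qed
qed

lemma (in cring) ext_basis_mult_closed:
  assumes "\<sigma> \<subseteq> {1..n}" "\<tau> \<subseteq> {1..n}"
  shows "ext_basis_mult R n \<sigma> \<tau> \<in> carrier (free_module R (Pow {1..n}))"
proof -
  interpret M: module R "free_module R (Pow {1..n})" by (rule module_free_module)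
  have "basis_vec R (\<sigma> \<union> \<tau>) \<in> carrier (free_module R (Pow {1..n}))"
    using assms by (intro basis_vec_closed) auto
  then show ?thesis
    by (simp add: ext_basis_mult_def Let_def ring_sign_closed del: One_nat_def)
qed

lemma (in cring) exterior_mult_basis:
  assumes "\<sigma> \<subseteq> {1..n}" "\<tau> \<subseteq> {1..n}"
  shows "basis_vec R \<sigma> \<otimes>\<^bsub>exterior_algebra R n\<^esub> basis_vec R \<tau> = ext_basis_mult R n \<sigma> \<tau>"
  using assms
  by (simp add: exterior_algebra_def Let_def lin_ext_basis_vec module_free_module
      ext_basis_mult_closed del: One_nat_def)

lemma (in cring) exterior_square:
  assumes "i \<in> {1..n}"
  shows "basis_vec R {i} \<otimes>\<^bsub>exterior_algebra R n\<^esub> basis_vec R {i} = \<zero>\<^bsub>exterior_algebra R n\<^esub>"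
proof -
  have "basis_vec R {i} \<otimes>\<^bsub>exterior_algebra R n\<^esub> basis_vec R {i} = ext_basis_mult R n {i} {i}"
    using assms by (intro exterior_mult_basis) auto
  then show ?thesis by (simp add: ext_basis_mult_def exterior_algebra_def Let_def)
qed

lemma (in cring) exterior_prepend:
  assumes "i \<in> {1..n}" "\<tau> \<subseteq> {1..n}" "\<And>j. j \<in> \<tau> \<Longrightarrow> i < j"
  shows "basis_vec R {i} \<otimes>\<^bsub>exterior_algebra R n\<^esub> basis_vec R \<tau> = basis_vec R (insert i \<tau>)"
proof -
  interpret M: module R "free_module R (Pow {1..n})" by (rule module_free_module)
  have "i \<notin> \<tau>" using assms(3) by blast
  moreover have "card {(i', j). i' = i \<and> j \<in> \<tau> \<and> j < i'} = 0"
    using assms(3) by (auto dest: less_asym simp: card_eq_0_iff)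
  moreover have "basis_vec R (insert i \<tau>) \<in> carrier (free_module R (Pow {1..n}))"
    using assms by (intro basis_vec_closed) auto
  ultimately show ?thesis
    using assms(1,2) by (simp add: exterior_mult_basis ext_basis_mult_def Let_def ring_sign_def
        del: One_nat_def)
qed

lemma (in cring) exterior_anticommute:
  assumes "i \<in> {1..n}" "j \<in> {1..n}" "i < j"
  shows "basis_vec R {j} \<otimes>\<^bsub>exterior_algebra R n\<^esub> basis_vec R {i} =
    \<ominus>\<^bsub>exterior_algebra R n\<^esub> (basis_vec R {i} \<otimes>\<^bsub>exterior_algebra R n\<^esub> basis_vec R {j})"
proof -
  interpret M: module R "free_module R (Pow {1..n})" by (rule module_free_module)
  have uminus: "\<ominus>\<^bsub>exterior_algebra R n\<^esub> x = \<ominus>\<^bsub>free_module R (Pow {1..n})\<^esub> x" for x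
    by (simp add: exterior_algebra_def Let_def a_inv_def m_inv_def)
  have "{(i', j'). i' = j \<and> j' = i \<and> j' < i'} = {(j, i)}" using assms(3) by auto
  moreover have "basis_vec R {j, i} \<in> carrier (free_module R (Pow {1..n}))"
    using assms by (intro basis_vec_closed) auto
  ultimately have "basis_vec R {j} \<otimes>\<^bsub>exterior_algebra R n\<^esub> basis_vec R {i} =
      \<ominus>\<^bsub>free_module R (Pow {1..n})\<^esub> basis_vec R {j, i}"
    using assms
    by (simp add: exterior_mult_basis ext_basis_mult_def Let_def ring_sign_def
        M.smult_l_minus insert_commute del: One_nat_def)
  moreover have "basis_vec R {i} \<otimes>\<^bsub>exterior_algebra R n\<^esub> basis_vec R {j} = basis_vec R {i, j}"
    using assms by (intro exterior_prepend) auto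
  ultimately show ?thesis by (simp add: uminus insert_commute)
qed

end

(* The bar resolution of A can be replaced by the Koszul resolution, whose term of degree k is the
   free A-bimodule on the divided power monomials y^m of degree k in n variables. Both are complexes
   of free bimodules with explicit contractions over the integers, so lifting gives a homotopy
   equivalence between them, which survives tensoring with A and base change to any ring.

   Tensoring the Koszul resolution with A leaves the complex with basis x_c y^m, where c is a subset
   of {1..n}. Its differential is zero when |c| + |m| is odd and twice the Koszul differential
   x_c y^m |-> sum over i of +-x_c x_i y^(m-i) when |c| + |m| is even, and the Koszul differential is
   contracted by moving the largest variable from x to y. Hence the odd part together with 1 gives
   free summands, and the rest of the even part gives one copy of R/2R and one of the 2-torsion for
   each image of the contraction. Over the integers only the former remains; over a field both are
   the whole field or zero according to the characteristic. *)
theory Submission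
  imports Defs "HOL-Library.Poly_Mapping" "HOL-Library.Multiset"
begin

section \<open>Presented modules\<close>

text \<open>All chain maps and homotopies are integral matrices in fixed bases, so one comparison
  over the integers serves every ring; only the last step depends on whether 2 vanishes, is
  invertible, or is neither. The factor 2 or 0 arises because the Koszul differential has a left and
  a right half with relative sign (-1)^|m|. Tensoring rotates the right factor x_i to the front of
  x_c, and carrying it past x_c costs (-1)^|c|; the halves therefore add or cancel according to the
  parity of |c| + |m|. The contraction that moves the largest variable respects neither the left
  action nor the right half, so it does not contract the whole resolution at once. Exactness is
  obtained by correcting a cycle repeatedly; each correction raises the exterior degree on the
  right, which is at most n. After tensoring, the contraction identity holds only in doubled form.
  It may be divided by 2 over the integers, where chain groups are torsion free, and over a field in
  which 2 is invertible. Over the integers, the coordinates of the contraction modulo 2 are exactly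
  what keeps a cycle without free part from being a boundary.\<close>

lemma module_homI:
  assumes "\<And>x. x \<in> carrier M \<Longrightarrow> f x \<in> carrier N"
    and "\<And>x y. x \<in> carrier M \<Longrightarrow> y \<in> carrier M \<Longrightarrow> f (x \<oplus>\<^bsub>M\<^esub> y) = f x \<oplus>\<^bsub>N\<^esub> f y"
    and "\<And>r x. r \<in> carrier R \<Longrightarrow> x \<in> carrier M \<Longrightarrow> f (r \<odot>\<^bsub>M\<^esub> x) = r \<odot>\<^bsub>N\<^esub> f x"
  shows "f \<in> module_hom R M N"
  using assms by (auto simp: module_hom_def)

lemma module_hom_comp:
  "f \<in> module_hom R M N \<Longrightarrow> g \<in> module_hom R N P \<Longrightarrow> (\<lambda>x. g (f x)) \<in> module_hom R M P"
  by (auto simp: module_hom_def Pi_def)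

lemma module_hom_in_carrier: "f \<in> module_hom R M N \<Longrightarrow> x \<in> carrier M \<Longrightarrow> f x \<in> carrier N"
  by (auto simp: module_hom_def)

lemma module_hom_zero:
  assumes "module R M" "module R N" "f \<in> module_hom R M N"
  shows "f \<zero>\<^bsub>M\<^esub> = \<zero>\<^bsub>N\<^esub>"
  using assms mod_hom.f0_is_0 by (metis mod_hom_axioms.intro mod_hom_def)

lemma module_hom_minus:
  assumes "module R M" "module R N" "f \<in> module_hom R M N" "x \<in> carrier M" "y \<in> carrier M"
  shows "f (x \<ominus>\<^bsub>M\<^esub> y) = f x \<ominus>\<^bsub>N\<^esub> f y"
  using assms mod_hom.f_minus by (metis mod_hom_axioms.intro mod_hom_def)

lemma module_hom_finsum:
  assumes M: "module R M" and N: "module R N" and f: "f \<in> module_hom R M N"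
    and "finite A" and "\<And>a. a \<in> A \<Longrightarrow> g a \<in> carrier M"
  shows "f (\<Oplus>\<^bsub>M\<^esub>a\<in>A. g a) = (\<Oplus>\<^bsub>N\<^esub>a\<in>A. f (g a))"
proof -
  interpret M: module R M by fact
  interpret N: module R N by fact
  show ?thesis
    using assms(4,5)
  proof (induction A)
    case empty
    then show ?case by (simp add: module_hom_zero[OF M N f])
  next
    case (insert a A)
    then show ?case
      using module_hom_in_carrier[OF f] by (simp add: Pi_def module_hom_add[OF f])
  qed
qed

lemma module_hom_kernel_submodule:
  assumes "module R M" "module R N" "f \<in> module_hom R M N"
  shows "submodule R {x \<in> carrier M. f x = \<zero>\<^bsub>N\<^esub>} M"
proof -
  interpret f: mod_hom R M N f using assms by (simp add: mod_hom_def mod_hom_axioms_def)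
  show ?thesis using f.ker_is_submodule by (simp add: f.ker_def)
qed

lemma submodule_abelian_subgroup:
  assumes "submodule R N M"
  shows "abelian_subgroup N M"
proof -
  interpret N: submodule R N M by fact
  interpret M: module R M by (rule N.module)
  have inv: "\<ominus>\<^bsub>M\<^esub> x \<in> N" if "x \<in> N" for x
  proof -
    have "\<ominus>\<^bsub>M\<^esub> x = (\<ominus>\<^bsub>R\<^esub> \<one>\<^bsub>R\<^esub>) \<odot>\<^bsub>M\<^esub> x"
      using that N.subset M.smult_l_minus by auto
    then show ?thesis using that by simp
  qed
  have "N \<noteq> {}" using N.zero_closed by blast
  then have "additive_subgroup N M"
    unfolding additive_subgroup_def using N.subset inv
    by (intro group.subgroupI[OF M.a_group]) (auto simp: a_inv_def)
  then show ?thesis by (intro abelian_subgroupI3 M.abelian_group_axioms)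
qed

context module
begin

context
  fixes N assumes N: "submodule R N M"
begin

interpretation N: submodule R N M by (rule N)
interpretation sub: abelian_subgroup N M by (rule submodule_abelian_subgroup[OF N])

lemma quot_rep_eq_iff:
  assumes "x \<in> carrier M" "y \<in> carrier M"
  shows "N +>\<^bsub>M\<^esub> x = N +>\<^bsub>M\<^esub> y \<longleftrightarrow> x \<ominus>\<^bsub>M\<^esub> y \<in> N"
proof -
  have "N +>\<^bsub>M\<^esub> x = N +>\<^bsub>M\<^esub> y \<longleftrightarrow> x \<in> N +>\<^bsub>M\<^esub> y"
    using assms sub.a_repr_independence'[of x y] sub.a_rcos_self[of x] by auto
  then show ?thesis using sub.a_rcos_module[of y x] assms by (simp add: M.minus_eq)
qed

lemma carrier_quot: "carrier (quot_module M N) = (\<lambda>x. N +>\<^bsub>M\<^esub> x) ` carrier M"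
  by (auto simp: quot_module_def A_RCOSETS_def' )

lemma quot_add:
  assumes "x \<in> carrier M" "y \<in> carrier M"
  shows "(N +>\<^bsub>M\<^esub> x) \<oplus>\<^bsub>quot_module M N\<^esub> (N +>\<^bsub>M\<^esub> y) = N +>\<^bsub>M\<^esub> (x \<oplus>\<^bsub>M\<^esub> y)"
  using assms by (simp add: quot_module_def sub.a_rcos_sum)

text \<open>\<open>quot_module\<close> defines scalar multiplication as a union over all
  representatives of the coset. The union is a single coset because multiples of congruent elements
  are congruent, and because it is taken over a nonempty set.\<close>

lemma quot_smult:
  assumes "r \<in> carrier R" "x \<in> carrier M"
  shows "r \<odot>\<^bsub>quot_module M N\<^esub> (N +>\<^bsub>M\<^esub> x) = N +>\<^bsub>M\<^esub> (r \<odot>\<^bsub>M\<^esub> x)"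
proof -
  have "N +>\<^bsub>M\<^esub> (r \<odot>\<^bsub>M\<^esub> y) = N +>\<^bsub>M\<^esub> (r \<odot>\<^bsub>M\<^esub> x)" if "y \<in> N +>\<^bsub>M\<^esub> x" for y
  proof -
    have y: "y \<in> carrier M" using that assms N.subset M.a_r_coset_subset_G by blast
    have "y \<ominus>\<^bsub>M\<^esub> x \<in> N"
      using that quot_rep_eq_iff[OF y assms(2)] sub.a_repr_independence'[of y x] assms(2) by simp
    moreover have "r \<odot>\<^bsub>M\<^esub> y \<ominus>\<^bsub>M\<^esub> r \<odot>\<^bsub>M\<^esub> x = r \<odot>\<^bsub>M\<^esub> (y \<ominus>\<^bsub>M\<^esub> x)"
      using assms y by (simp add: M.minus_eq smult_r_distr smult_r_minus)
    ultimately show ?thesis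
      using assms y by (subst quot_rep_eq_iff) auto
  qed
  then have "(\<Union>y\<in>N +>\<^bsub>M\<^esub> x. N +>\<^bsub>M\<^esub> (r \<odot>\<^bsub>M\<^esub> y)) = (\<Union>y\<in>N +>\<^bsub>M\<^esub> x. N +>\<^bsub>M\<^esub> (r \<odot>\<^bsub>M\<^esub> x))"
    by (rule SUP_cong[OF refl])
  moreover have "N +>\<^bsub>M\<^esub> x \<noteq> {}" using sub.a_rcos_self assms by blast
  ultimately show ?thesis by (simp add: quot_module_def)
qed

lemma quot_zero: "\<zero>\<^bsub>quot_module M N\<^esub> = N +>\<^bsub>M\<^esub> \<zero>\<^bsub>M\<^esub>"
  using M.a_coset_join2[OF _ sub.a_subgroup, of "\<zero>\<^bsub>M\<^esub>"] by (simp add: quot_module_def)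

lemma module_quot_module: "module R (quot_module M N)"
proof (rule module_criteria)
  show "\<forall>v\<in>carrier (quot_module M N). \<exists>w\<in>carrier (quot_module M N).
      v \<oplus>\<^bsub>quot_module M N\<^esub> w = \<zero>\<^bsub>quot_module M N\<^esub>"
  proof
    fix v assume "v \<in> carrier (quot_module M N)"
    then obtain x where x: "x \<in> carrier M" "v = N +>\<^bsub>M\<^esub> x" by (auto simp: carrier_quot)
    have "v \<oplus>\<^bsub>quot_module M N\<^esub> (N +>\<^bsub>M\<^esub> \<ominus>\<^bsub>M\<^esub> x) = \<zero>\<^bsub>quot_module M N\<^esub>"
      using x by (simp add: quot_add quot_zero M.r_neg)
    then show "\<exists>w\<in>carrier (quot_module M N). v \<oplus>\<^bsub>quot_module M N\<^esub> w = \<zero>\<^bsub>quot_module M N\<^esub>"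
      using x by (auto simp: carrier_quot)
  qed
qed (auto simp: carrier_quot quot_add quot_smult quot_zero smult_r_distr smult_l_distr smult_assoc1
    M.a_ac R.is_cring)

lemma quot_proj_hom: "(\<lambda>x. N +>\<^bsub>M\<^esub> x) \<in> module_hom R M (quot_module M N)"
  by (rule module_homI) (auto simp: carrier_quot quot_add quot_smult)

end
end


context cring
begin

lemma free_module_simps:
  "f \<oplus>\<^bsub>free_module R S\<^esub> g = (\<lambda>x. f x \<oplus> g x)"
  "r \<odot>\<^bsub>free_module R S\<^esub> f = (\<lambda>x. r \<otimes> f x)"
  "\<zero>\<^bsub>free_module R S\<^esub> = (\<lambda>_. \<zero>)"
  by (simp_all add: free_module_def)

lemma carrier_free_moduleD:
  assumes "f \<in> carrier (free_module R S)"
  shows "f x \<in> carrier R" "x \<notin> S \<Longrightarrow> f x = \<zero>" "finite {x. f x \<noteq> \<zero>}" "{x. f x \<noteq> \<zero>} \<subseteq> S"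
  using assms by (auto simp: free_module_def)

lemma free_module_induct [consumes 1, case_names zero add]:
  assumes f: "f \<in> carrier (free_module R S)"
    and zero: "P \<zero>\<^bsub>free_module R S\<^esub>"
    and add: "\<And>f r x. f \<in> carrier (free_module R S) \<Longrightarrow> P f \<Longrightarrow> r \<in> carrier R \<Longrightarrow> x \<in> S \<Longrightarrow>
      P (f \<oplus>\<^bsub>free_module R S\<^esub> r \<odot>\<^bsub>free_module R S\<^esub> basis_vec R x)"
  shows "P f"
proof -
  have "finite {x. f x \<noteq> \<zero>}" using f by (rule carrier_free_moduleD)
  then show ?thesis
    using f
  proof (induction "{x. f x \<noteq> \<zero>}" arbitrary: f rule: finite_induct)
    case empty
    then have "f = \<zero>\<^bsub>free_module R S\<^esub>" by (auto simp: free_module_simps)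
    then show ?case using zero by simp
  next
    case (insert a A)
    define g where "g = f(a := \<zero>)"
    have gA: "{x. g x \<noteq> \<zero>} = A" using insert.hyps by (auto simp: g_def)
    have g: "g \<in> carrier (free_module R S)"
      using insert.prems insert.hyps(1) gA by (auto simp: free_module_def g_def)
    have "a \<in> S" using insert.hyps(4) insert.prems by (auto simp: free_module_def)
    moreover have "f a \<in> carrier R" using insert.prems by (rule carrier_free_moduleD)
    moreover have "f = g \<oplus>\<^bsub>free_module R S\<^esub> f a \<odot>\<^bsub>free_module R S\<^esub> basis_vec R a"
      using carrier_free_moduleD(1)[OF insert.prems]
      by (auto simp: free_module_simps g_def basis_vec_def)
    ultimately show ?case using add[OF g insert.hyps(3)[OF gA[symmetric] g]] by metis
  qed
qed

text \<open>\<open>lin_ext\<close> sums over the support of its argument, and supports change under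
  addition and scaling. Summing over a common finite superset lets two such sums be compared term by
  term.\<close>

lemma lin_ext_superset:
  assumes P: "module R P" and \<phi>: "\<And>x. x \<in> S \<Longrightarrow> \<phi> x \<in> carrier P"
    and f: "f \<in> carrier (free_module R S)"
    and A: "finite A" "A \<subseteq> S" "{x. f x \<noteq> \<zero>} \<subseteq> A"
  shows "lin_ext R P \<phi> f = (\<Oplus>\<^bsub>P\<^esub>x\<in>A. f x \<odot>\<^bsub>P\<^esub> \<phi> x)"
proof -
  interpret P: module R P by (rule P)
  show ?thesis
    unfolding lin_ext_def
    by (rule P.add.finprod_mono_neutral_cong_left)
      (use A \<phi> carrier_free_moduleD[OF f] in \<open>auto simp: Pi_def subset_iff\<close>)
qed

lemma lin_ext_hom:
  assumes P: "module R P" and \<phi>: "\<And>x. x \<in> S \<Longrightarrow> \<phi> x \<in> carrier P"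
  shows "lin_ext R P \<phi> \<in> module_hom R (free_module R S) P"
proof -
  interpret P: module R P by (rule P)
  interpret F: module R "free_module R S" by (rule module_free_module)
  show ?thesis
  proof (rule module_homI)
    fix f assume f: "f \<in> carrier (free_module R S)"
    then show "lin_ext R P \<phi> f \<in> carrier P"
      using \<phi> carrier_free_moduleD[OF f] unfolding lin_ext_def by (intro P.finsum_closed) auto
    fix r assume r: "r \<in> carrier R"
    let ?A = "{x. f x \<noteq> \<zero>}"
    have rf: "r \<odot>\<^bsub>free_module R S\<^esub> f \<in> carrier (free_module R S)" using f r by simp
    have "lin_ext R P \<phi> (r \<odot>\<^bsub>free_module R S\<^esub> f) = (\<Oplus>\<^bsub>P\<^esub>x\<in>?A. (r \<odot>\<^bsub>free_module R S\<^esub> f) x \<odot>\<^bsub>P\<^esub> \<phi> x)"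
      by (rule lin_ext_superset[OF P \<phi> rf])
        (use r carrier_free_moduleD[OF f] in \<open>auto simp: free_module_simps\<close>)
    also have "\<dots> = (\<Oplus>\<^bsub>P\<^esub>x\<in>?A. r \<odot>\<^bsub>P\<^esub> (f x \<odot>\<^bsub>P\<^esub> \<phi> x))"
      by (rule P.finsum_cong')
        (use r \<phi> carrier_free_moduleD[OF f] in \<open>auto simp: free_module_simps P.smult_assoc1\<close>)
    also have "\<dots> = r \<odot>\<^bsub>P\<^esub> lin_ext R P \<phi> f"
      unfolding lin_ext_def
      by (rule P.finsum_smult[symmetric]) (use r \<phi> carrier_free_moduleD[OF f] in auto)
    finally show "lin_ext R P \<phi> (r \<odot>\<^bsub>free_module R S\<^esub> f) = r \<odot>\<^bsub>P\<^esub> lin_ext R P \<phi> f" .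
  next
    fix f g assume f: "f \<in> carrier (free_module R S)" and g: "g \<in> carrier (free_module R S)"
    let ?A = "{x. f x \<noteq> \<zero>} \<union> {x. g x \<noteq> \<zero>}"
    note cf = carrier_free_moduleD[OF f] and cg = carrier_free_moduleD[OF g]
    have A: "finite ?A" "?A \<subseteq> S" using cf cg by auto
    have A\<phi>: "\<phi> x \<in> carrier P" if "x \<in> ?A" for x using that A(2) \<phi> by blast
    have fg: "f \<oplus>\<^bsub>free_module R S\<^esub> g \<in> carrier (free_module R S)" using f g by simp
    have "lin_ext R P \<phi> (f \<oplus>\<^bsub>free_module R S\<^esub> g)
        = (\<Oplus>\<^bsub>P\<^esub>x\<in>?A. (f \<oplus>\<^bsub>free_module R S\<^esub> g) x \<odot>\<^bsub>P\<^esub> \<phi> x)"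
      by (rule lin_ext_superset[OF P \<phi> fg A]) (auto simp: free_module_simps)
    also have "\<dots> = (\<Oplus>\<^bsub>P\<^esub>x\<in>?A. f x \<odot>\<^bsub>P\<^esub> \<phi> x \<oplus>\<^bsub>P\<^esub> g x \<odot>\<^bsub>P\<^esub> \<phi> x)"
      by (rule P.finsum_cong')
        (use A\<phi> cf(1) cg(1) in \<open>auto simp: free_module_simps P.smult_l_distr\<close>)
    also have "\<dots> = (\<Oplus>\<^bsub>P\<^esub>x\<in>?A. f x \<odot>\<^bsub>P\<^esub> \<phi> x) \<oplus>\<^bsub>P\<^esub> (\<Oplus>\<^bsub>P\<^esub>x\<in>?A. g x \<odot>\<^bsub>P\<^esub> \<phi> x)"
      by (rule P.finsum_addf) (use A\<phi> cf(1) cg(1) in auto)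
    also have "\<dots> = lin_ext R P \<phi> f \<oplus>\<^bsub>P\<^esub> lin_ext R P \<phi> g"
      using lin_ext_superset[OF P \<phi> f A] lin_ext_superset[OF P \<phi> g A] by auto
    finally show "lin_ext R P \<phi> (f \<oplus>\<^bsub>free_module R S\<^esub> g) = lin_ext R P \<phi> f \<oplus>\<^bsub>P\<^esub> lin_ext R P \<phi> g" .
  qed
qed

lemma free_module_hom_eqI:
  assumes P: "module R P"
    and h: "h \<in> module_hom R (free_module R S) P" "h' \<in> module_hom R (free_module R S) P"
    and eq: "\<And>x. x \<in> S \<Longrightarrow> h (basis_vec R x) = h' (basis_vec R x)"
    and f: "f \<in> carrier (free_module R S)"
  shows "h f = h' f"
  using f
proof (induction rule: free_module_induct)
  case zero
  show ?case using module_hom_zero[OF module_free_module P] h by metis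
next
  case (add f r x)
  interpret F: module R "free_module R S" by (rule module_free_module)
  show ?case
    using add eq basis_vec_closed[of x S] h
    by (simp add: module_hom_add[OF h(1)] module_hom_add[OF h(2)]
        module_hom_smult[OF h(1)] module_hom_smult[OF h(2)])
qed

end

text \<open>Both kinds of tensor product are instances, so their universal properties and induction
  principles come from here.\<close>

locale presentation = cring R for R (structure) +
  fixes S :: "'x set" and rels :: "('x \<Rightarrow> 'a) set"
  assumes rels_closed: "rels \<subseteq> carrier (free_module R S)"
begin

sublocale F: module R "free_module R S" by (rule module_free_module)

abbreviation "rel_span \<equiv> F.span rels"
abbreviation "gen \<equiv> presented_gen R S rels"
abbreviation "presented \<equiv> presented_module R S rels"

lemma rel_span_submodule: "submodule R rel_span (free_module R S)"
  by (rule F.span_is_submodule[OF rels_closed])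

lemma module_presented: "module R presented"
  unfolding presented_module_def by (rule F.module_quot_module[OF rel_span_submodule])

lemma proj_hom:
  "(\<lambda>f. rel_span +>\<^bsub>free_module R S\<^esub> f) \<in> module_hom R (free_module R S) presented"
  unfolding presented_module_def by (rule F.quot_proj_hom[OF rel_span_submodule])

lemma carrier_presented:
  "carrier presented = (\<lambda>f. rel_span +>\<^bsub>free_module R S\<^esub> f) ` carrier (free_module R S)"
  unfolding presented_module_def by (rule F.carrier_quot[OF rel_span_submodule])

lemma gen_closed: "x \<in> S \<Longrightarrow> gen x \<in> carrier presented"
  by (auto simp: presented_gen_def carrier_presented basis_vec_closed)

lemma presented_induct [consumes 1, case_names zero add]:
  assumes X: "X \<in> carrier presented"
    and zero: "P \<zero>\<^bsub>presented\<^esub>"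
    and add: "\<And>X r x. X \<in> carrier presented \<Longrightarrow> P X \<Longrightarrow> r \<in> carrier R \<Longrightarrow> x \<in> S \<Longrightarrow>
      P (X \<oplus>\<^bsub>presented\<^esub> r \<odot>\<^bsub>presented\<^esub> gen x)"
  shows "P X"
proof -
  let ?\<pi> = "\<lambda>f. rel_span +>\<^bsub>free_module R S\<^esub> f"
  obtain f where f: "f \<in> carrier (free_module R S)" "X = ?\<pi> f"
    using X by (auto simp: carrier_presented)
  have "P (?\<pi> f)"
    using f(1)
  proof (induction rule: free_module_induct)
    case zero
    then show ?case
      using assms(2) module_hom_zero[OF F.module_axioms module_presented proj_hom] by simp
  next
    case (add f r x)
    then have "?\<pi> (f \<oplus>\<^bsub>free_module R S\<^esub> r \<odot>\<^bsub>free_module R S\<^esub> basis_vec R x)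
        = ?\<pi> f \<oplus>\<^bsub>presented\<^esub> r \<odot>\<^bsub>presented\<^esub> gen x"
      by (simp add: module_hom_add[OF proj_hom] module_hom_smult[OF proj_hom]
          basis_vec_closed presented_gen_def)
    then show ?case using add assms(3) module_hom_in_carrier[OF proj_hom] by simp
  qed
  then show ?thesis using f by simp
qed

lemma presented_hom_eqI:
  assumes P: "module R P"
    and h: "h \<in> module_hom R presented P" "h' \<in> module_hom R presented P"
    and eq: "\<And>x. x \<in> S \<Longrightarrow> h (gen x) = h' (gen x)"
    and X: "X \<in> carrier presented"
  shows "h X = h' X"
  using X
proof (induction rule: presented_induct)
  case zero
  show ?case using module_hom_zero[OF module_presented P] h by metis
next
  case (add X r x)
  interpret M: module R presented by (rule module_presented)
  show ?case
    using add eq gen_closed[of x] h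
    by (simp add: module_hom_add[OF h(1)] module_hom_add[OF h(2)]
        module_hom_smult[OF h(1)] module_hom_smult[OF h(2)])
qed

context
  fixes P (structure) and \<phi>
  assumes P: "module R P" and \<phi>: "\<And>x. x \<in> S \<Longrightarrow> \<phi> x \<in> carrier P"
    and kills: "\<And>f. f \<in> rels \<Longrightarrow> lin_ext R P \<phi> f = \<zero>\<^bsub>P\<^esub>"
begin

text \<open>\<open>presented_lift\<close> evaluates on a representative picked by
  \<open>SOME\<close>. Two representatives differ by an element of the span of the relations, and
  that span lies in the kernel of the linear extension as soon as the relations do.\<close>

lemma presented_lift_rep:
  assumes f: "f \<in> carrier (free_module R S)"
  shows "presented_lift R P \<phi> (rel_span +>\<^bsub>free_module R S\<^esub> f) = lin_ext R P \<phi> f"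
proof -
  interpret P: module R P by (rule P)
  interpret sub: abelian_subgroup rel_span "free_module R S"
    by (rule submodule_abelian_subgroup[OF rel_span_submodule])
  let ?K = "{g \<in> carrier (free_module R S). lin_ext R P \<phi> g = \<zero>\<^bsub>P\<^esub>}"
  note hom = lin_ext_hom[of P S \<phi>, OF P \<phi>]
  have sub: "rel_span \<subseteq> ?K"
    by (rule F.span_is_subset[OF _ module_hom_kernel_submodule[OF F.module_axioms P hom]])
      (use rels_closed kills in auto)
  define g where "g = (SOME g. g \<in> rel_span +>\<^bsub>free_module R S\<^esub> f)"
  have "g \<in> rel_span +>\<^bsub>free_module R S\<^esub> f"
    unfolding g_def by (rule someI[of "\<lambda>g. g \<in> _", OF sub.a_rcos_self[OF f]])
  then obtain k where k: "k \<in> rel_span" "g = k \<oplus>\<^bsub>free_module R S\<^esub> f"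
    by (auto simp: a_r_coset_def')
  then have "k \<in> carrier (free_module R S)" "lin_ext R P \<phi> k = \<zero>\<^bsub>P\<^esub>"
    using sub by auto
  then have "lin_ext R P \<phi> g = lin_ext R P \<phi> f"
    using f k(2) module_hom_add[OF hom] module_hom_in_carrier[OF hom f] by simp
  then show ?thesis by (simp add: presented_lift_def g_def)
qed

lemma presented_lift_hom: "presented_lift R P \<phi> \<in> module_hom R presented P"
proof (rule module_homI)
  note hom = lin_ext_hom[of P S \<phi>, OF P \<phi>]
  fix X assume "X \<in> carrier presented"
  then obtain f where f: "f \<in> carrier (free_module R S)" "X = rel_span +>\<^bsub>free_module R S\<^esub> f"
    by (auto simp: carrier_presented)
  then show "presented_lift R P \<phi> X \<in> carrier P"
    using module_hom_in_carrier[OF hom] by (simp add: presented_lift_rep)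
  {
    fix r assume "r \<in> carrier R"
    then show "presented_lift R P \<phi> (r \<odot>\<^bsub>presented\<^esub> X) = r \<odot>\<^bsub>P\<^esub> presented_lift R P \<phi> X"
      using f by (simp add: module_hom_smult[OF proj_hom, symmetric] presented_lift_rep
          module_hom_smult[OF hom])
  }
  {
    fix Y assume "Y \<in> carrier presented"
    then obtain g where g: "g \<in> carrier (free_module R S)" "Y = rel_span +>\<^bsub>free_module R S\<^esub> g"
      by (auto simp: carrier_presented)
    then show "presented_lift R P \<phi> (X \<oplus>\<^bsub>presented\<^esub> Y)
        = presented_lift R P \<phi> X \<oplus>\<^bsub>P\<^esub> presented_lift R P \<phi> Y"
      using f by (simp add: module_hom_add[OF proj_hom, symmetric] presented_lift_rep
          module_hom_add[OF hom])
  }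
qed

lemma presented_lift_gen: "x \<in> S \<Longrightarrow> presented_lift R P \<phi> (gen x) = \<phi> x"
  by (simp add: presented_gen_def presented_lift_rep basis_vec_closed lin_ext_basis_vec P \<phi>)

end

lemma gen_rel_eq:
  assumes "f \<in> carrier (free_module R S)" "g \<in> carrier (free_module R S)"
    "f \<ominus>\<^bsub>free_module R S\<^esub> g \<in> rels"
  shows "rel_span +>\<^bsub>free_module R S\<^esub> f = rel_span +>\<^bsub>free_module R S\<^esub> g"
  using assms F.in_own_span[OF rels_closed] by (auto simp: F.quot_rep_eq_iff[OF rel_span_submodule])

end

section \<open>Tensor powers\<close>

lemma (in module) diff_diff_in_rels:
  assumes "x \<in> carrier M" "y \<in> carrier M" "x = y"
  shows "x \<ominus>\<^bsub>M\<^esub> y = \<zero>\<^bsub>M\<^esub>"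
  using assms by (simp add: M.minus_eq M.r_neg)

definition multilin ::
    "('r, 'm) ring_scheme \<Rightarrow> ('r, 'a, 'q) module_scheme \<Rightarrow> nat \<Rightarrow> ('r, 'p, 'q1) module_scheme \<Rightarrow>
     ('a list \<Rightarrow> 'p) \<Rightarrow> bool" where
  "multilin R A m P \<phi> \<longleftrightarrow>
    (\<forall>xs \<in> tensor_words A m. \<phi> xs \<in> carrier P) \<and>
    (\<forall>xs \<in> tensor_words A m. \<forall>i < m. \<forall>a \<in> carrier A. \<forall>b \<in> carrier A.
      \<phi> (xs[i := a \<oplus>\<^bsub>A\<^esub> b]) = \<phi> (xs[i := a]) \<oplus>\<^bsub>P\<^esub> \<phi> (xs[i := b])) \<and>
    (\<forall>xs \<in> tensor_words A m. \<forall>i < m. \<forall>a \<in> carrier A. \<forall>r \<in> carrier R.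
      \<phi> (xs[i := r \<odot>\<^bsub>A\<^esub> a]) = r \<odot>\<^bsub>P\<^esub> \<phi> (xs[i := a]))"

lemma multilinI:
  assumes "\<And>xs. xs \<in> tensor_words A m \<Longrightarrow> \<phi> xs \<in> carrier P"
    and "\<And>xs i a b. xs \<in> tensor_words A m \<Longrightarrow> i < m \<Longrightarrow> a \<in> carrier A \<Longrightarrow> b \<in> carrier A \<Longrightarrow>
      \<phi> (xs[i := a \<oplus>\<^bsub>A\<^esub> b]) = \<phi> (xs[i := a]) \<oplus>\<^bsub>P\<^esub> \<phi> (xs[i := b])"
    and "\<And>xs i a r. xs \<in> tensor_words A m \<Longrightarrow> i < m \<Longrightarrow> a \<in> carrier A \<Longrightarrow> r \<in> carrier R \<Longrightarrow>
      \<phi> (xs[i := r \<odot>\<^bsub>A\<^esub> a]) = r \<odot>\<^bsub>P\<^esub> \<phi> (xs[i := a])"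
  shows "multilin R A m P \<phi>"
  using assms by (auto simp: multilin_def)

lemma multilinD:
  assumes "multilin R A m P \<phi>" "xs \<in> tensor_words A m"
  shows "\<phi> xs \<in> carrier P"
    and "i < m \<Longrightarrow> a \<in> carrier A \<Longrightarrow> b \<in> carrier A \<Longrightarrow>
      \<phi> (xs[i := a \<oplus>\<^bsub>A\<^esub> b]) = \<phi> (xs[i := a]) \<oplus>\<^bsub>P\<^esub> \<phi> (xs[i := b])"
    and "i < m \<Longrightarrow> a \<in> carrier A \<Longrightarrow> r \<in> carrier R \<Longrightarrow>
      \<phi> (xs[i := r \<odot>\<^bsub>A\<^esub> a]) = r \<odot>\<^bsub>P\<^esub> \<phi> (xs[i := a])"
  using assms by (auto simp: multilin_def)

lemma tensor_words_update:
  "xs \<in> tensor_words A m \<Longrightarrow> a \<in> carrier A \<Longrightarrow> xs[i := a] \<in> tensor_words A m"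
  using set_update_subset_insert[of xs i a] by (auto simp: tensor_words_def)

lemma tensor_words_nth: "xs \<in> tensor_words A m \<Longrightarrow> i < m \<Longrightarrow> xs ! i \<in> carrier A"
  by (auto simp: tensor_words_def)

lemma tensor_words_length: "xs \<in> tensor_words A m \<Longrightarrow> length xs = m"
  by (auto simp: tensor_words_def)

lemma (in cring) lin_ext_minus_basis:
  assumes P: "module R P" and \<phi>: "\<And>x. x \<in> S \<Longrightarrow> \<phi> x \<in> carrier P"
    and f: "f \<in> carrier (free_module R S)" "g \<in> carrier (free_module R S)"
  shows "lin_ext R P \<phi> (f \<ominus>\<^bsub>free_module R S\<^esub> g) = lin_ext R P \<phi> f \<ominus>\<^bsub>P\<^esub> lin_ext R P \<phi> g"
  using module_hom_minus[OF module_free_module P lin_ext_hom[of P S \<phi>, OF P \<phi>] f] .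

context module
begin

lemma multilin_comp_hom:
  assumes "multilin R M m P \<phi>" "f \<in> module_hom R P Q"
  shows "multilin R M m Q (\<lambda>xs. f (\<phi> xs))"
  by (rule multilinI)
    (use assms in \<open>auto simp: multilinD tensor_words_update module_hom_add[OF assms(2)]
      module_hom_smult[OF assms(2)] module_hom_in_carrier[OF assms(2)]\<close>)

lemma tensor_rels_closed: "tensor_rels R M m \<subseteq> carrier (free_module R (tensor_words M m))"
proof -
  interpret F: module R "free_module R (tensor_words M m)" by (rule module_free_module)
  show ?thesis
    by (auto simp: tensor_rels_def Let_def basis_vec_closed tensor_words_update)
qed

interpretation T: presentation R "tensor_words M m" "tensor_rels R M m" for m
  by unfold_locales (rule tensor_rels_closed)

lemma module_tensor_power: "module R (tensor_power R M m)"
  unfolding tensor_power_def by (rule T.module_presented)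

lemma pure_tensor_eq_gen:
  "xs \<in> tensor_words M m \<Longrightarrow> pure_tensor R M xs = presented_gen R (tensor_words M m) (tensor_rels R M m) xs"
  by (simp add: pure_tensor_def tensor_words_length)

lemma pure_tensor_closed: "xs \<in> tensor_words M m \<Longrightarrow> pure_tensor R M xs \<in> carrier (tensor_power R M m)"
  by (simp add: pure_tensor_eq_gen tensor_power_def T.gen_closed)

text \<open>The universal property of the tensor power: multilinearity on words is exactly what
  makes the linear extension vanish on \<open>tensor_rels\<close>.\<close>

lemma
  assumes P: "module R P" and \<phi>: "multilin R M m P \<phi>"
  shows tensor_lift_hom: "presented_lift R P \<phi> \<in> module_hom R (tensor_power R M m) P"
    and tensor_lift_pure: "xs \<in> tensor_words M m \<Longrightarrow> presented_lift R P \<phi> (pure_tensor R M xs) = \<phi> xs"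
proof -
  interpret P: module R P by (rule P)
  interpret F: module R "free_module R (tensor_words M m)" by (rule module_free_module)
  note \<phi>c = multilinD(1)[OF \<phi>]
  note lin = lin_ext_hom[of P "tensor_words M m" \<phi>, OF P \<phi>c]
    lin_ext_minus_basis[of P "tensor_words M m" \<phi>, OF P \<phi>c]
  have le: "lin_ext R P \<phi> (basis_vec R x) = \<phi> x" if "x \<in> tensor_words M m" for x
    using that \<phi>c by (intro lin_ext_basis_vec P)
  have kills: "lin_ext R P \<phi> f = \<zero>\<^bsub>P\<^esub>" if "f \<in> tensor_rels R M m" for f
    using that
    by (auto simp: tensor_rels_def Let_def lin(2) basis_vec_closed tensor_words_update le
        module_hom_add[OF lin(1)] module_hom_smult[OF lin(1)] \<phi>c multilinD(2,3)[OF \<phi>]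
        P.diff_diff_in_rels)
  show "presented_lift R P \<phi> \<in> module_hom R (tensor_power R M m) P"
    unfolding tensor_power_def by (rule T.presented_lift_hom[OF P \<phi>c kills])
  show "xs \<in> tensor_words M m \<Longrightarrow> presented_lift R P \<phi> (pure_tensor R M xs) = \<phi> xs"
    by (simp add: pure_tensor_eq_gen T.presented_lift_gen[OF P \<phi>c kills])
qed

lemma multilin_pure: "multilin R M m (tensor_power R M m) (pure_tensor R M)"
proof (rule multilinI)
  interpret F: module R "free_module R (tensor_words M m)" by (rule module_free_module)
  show "pure_tensor R M xs \<in> carrier (tensor_power R M m)" if "xs \<in> tensor_words M m" for xs
    using that by (rule pure_tensor_closed)
  fix xs i a assume xs: "xs \<in> tensor_words M m" "i < m" and a: "a \<in> carrier M"
  have u: "xs[i := c] \<in> tensor_words M m" if "c \<in> carrier M" for c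
    using xs that by (simp add: tensor_words_update)
  note [simp] = basis_vec_closed u pure_tensor_eq_gen
  {
    fix b assume b: "b \<in> carrier M"
    have "basis_vec R (xs[i := a \<oplus>\<^bsub>M\<^esub> b]) \<ominus>\<^bsub>free_module R (tensor_words M m)\<^esub>
        (basis_vec R (xs[i := a]) \<oplus>\<^bsub>free_module R (tensor_words M m)\<^esub> basis_vec R (xs[i := b]))
        \<in> tensor_rels R M m"
      using xs a b by (auto simp: tensor_rels_def Let_def)
    from T.gen_rel_eq[OF _ _ this]
    show "pure_tensor R M (xs[i := a \<oplus>\<^bsub>M\<^esub> b])
        = pure_tensor R M (xs[i := a]) \<oplus>\<^bsub>tensor_power R M m\<^esub> pure_tensor R M (xs[i := b])"
      using a b u[of a] u[of b] u[of "a \<oplus>\<^bsub>M\<^esub> b"]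
      by (simp add: module_hom_add[OF T.proj_hom] presented_gen_def tensor_power_def
          pure_tensor_eq_gen[of _ m])
  }
  {
    fix r assume r: "r \<in> carrier R"
    have "basis_vec R (xs[i := r \<odot>\<^bsub>M\<^esub> a]) \<ominus>\<^bsub>free_module R (tensor_words M m)\<^esub>
        (r \<odot>\<^bsub>free_module R (tensor_words M m)\<^esub> basis_vec R (xs[i := a]))
        \<in> tensor_rels R M m"
      using xs a r by (auto simp: tensor_rels_def Let_def)
    from T.gen_rel_eq[OF _ _ this]
    show "pure_tensor R M (xs[i := r \<odot>\<^bsub>M\<^esub> a])
        = r \<odot>\<^bsub>tensor_power R M m\<^esub> pure_tensor R M (xs[i := a])"
      using a r u[of a] u[of "r \<odot>\<^bsub>M\<^esub> a"]
      by (simp add: module_hom_smult[OF T.proj_hom] presented_gen_def tensor_power_def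
          pure_tensor_eq_gen[of _ m])
  }
qed

lemma tensor_induct [consumes 1, case_names zero add]:
  assumes "X \<in> carrier (tensor_power R M m)"
    and "P \<zero>\<^bsub>tensor_power R M m\<^esub>"
    and "\<And>X r xs. X \<in> carrier (tensor_power R M m) \<Longrightarrow> P X \<Longrightarrow> r \<in> carrier R \<Longrightarrow> xs \<in> tensor_words M m \<Longrightarrow>
      P (X \<oplus>\<^bsub>tensor_power R M m\<^esub> r \<odot>\<^bsub>tensor_power R M m\<^esub> pure_tensor R M xs)"
  shows "P X"
  using assms(1)[unfolded tensor_power_def]
  by (rule T.presented_induct) (use assms(2,3) in \<open>auto simp: tensor_power_def pure_tensor_eq_gen\<close>)

lemma tensor_hom_eqI:
  assumes "module R P"
    and "h \<in> module_hom R (tensor_power R M m) P" "h' \<in> module_hom R (tensor_power R M m) P"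
    and "\<And>xs. xs \<in> tensor_words M m \<Longrightarrow> h (pure_tensor R M xs) = h' (pure_tensor R M xs)"
    and "X \<in> carrier (tensor_power R M m)"
  shows "h X = h' X"
  using assms unfolding tensor_power_def
  by (intro T.presented_hom_eqI[of P h m h' X]) (auto simp: pure_tensor_eq_gen)

end

section \<open>Balanced tensor products\<close>

locale balanced = M: module R M + N: module R N
  for R :: "('r, 'm) ring_scheme" and M :: "('r, 'a, 'q1) module_scheme"
    and N :: "('r, 'b, 'q2) module_scheme" +
  fixes S :: "('r, 's, 'q) module_scheme" and ract :: "'a \<Rightarrow> 's \<Rightarrow> 'a" and lact :: "'s \<Rightarrow> 'b \<Rightarrow> 'b"
  assumes ract_closed: "x \<in> carrier M \<Longrightarrow> s \<in> carrier S \<Longrightarrow> ract x s \<in> carrier M"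
    and lact_closed: "s \<in> carrier S \<Longrightarrow> y \<in> carrier N \<Longrightarrow> lact s y \<in> carrier N"
begin

abbreviation "BT \<equiv> balanced_tensor R S M ract N lact"
abbreviation "bp \<equiv> balanced_pure R S M ract N lact"

lemma balanced_rels_closed:
  "balanced_rels R S M ract N lact \<subseteq> carrier (free_module R (carrier M \<times> carrier N))"
proof -
  interpret F: module R "free_module R (carrier M \<times> carrier N)" by (rule M.module_free_module)
  show ?thesis
    by (auto simp: balanced_rels_def Let_def M.basis_vec_closed ract_closed lact_closed)
qed

sublocale B: presentation R "carrier M \<times> carrier N" "balanced_rels R S M ract N lact"
  by unfold_locales (rule balanced_rels_closed)

lemma module_balanced: "module R BT"
  unfolding balanced_tensor_def by (rule B.module_presented)

lemma balanced_pure_closed: "x \<in> carrier M \<Longrightarrow> y \<in> carrier N \<Longrightarrow> bp x y \<in> carrier BT"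
  by (simp add: balanced_pure_def balanced_tensor_def B.gen_closed)

text \<open>The universal property of the balanced tensor product. Linearity in each variable kills
  the first four families of relations, and \<open>bal\<close> the last one.\<close>

lemma balanced_lift:
  assumes P: "module R P"
    and hom1: "\<And>x. x \<in> carrier M \<Longrightarrow> f x \<in> module_hom R N P"
    and hom2: "\<And>y. y \<in> carrier N \<Longrightarrow> (\<lambda>x. f x y) \<in> module_hom R M P"
    and bal: "\<And>x s y. x \<in> carrier M \<Longrightarrow> s \<in> carrier S \<Longrightarrow> y \<in> carrier N \<Longrightarrow> f (ract x s) y = f x (lact s y)"
  shows balanced_lift_hom: "presented_lift R P (\<lambda>(x, y). f x y) \<in> module_hom R BT P"
    and balanced_lift_pure: "x \<in> carrier M \<Longrightarrow> y \<in> carrier N \<Longrightarrow>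
      presented_lift R P (\<lambda>(x, y). f x y) (bp x y) = f x y"
proof -
  let ?\<phi> = "\<lambda>(x, y). f x y" and ?F = "free_module R (carrier M \<times> carrier N)"
  interpret P: module R P by (rule P)
  interpret F: module R ?F by (rule M.module_free_module)
  have \<phi>c: "?\<phi> x \<in> carrier P" if "x \<in> carrier M \<times> carrier N" for x
    using that module_hom_in_carrier[OF hom1] by auto
  note lin = M.lin_ext_hom[of P "carrier M \<times> carrier N" ?\<phi>, OF P \<phi>c]
    M.lin_ext_minus_basis[of P "carrier M \<times> carrier N" ?\<phi>, OF P \<phi>c]
  have le: "lin_ext R P ?\<phi> (basis_vec R (x, y)) = f x y" if "x \<in> carrier M" "y \<in> carrier N" for x y
    using that \<phi>c[of "(x, y)"] by (subst M.lin_ext_basis_vec[OF P]) auto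
  have fc: "f x y \<in> carrier P" if "x \<in> carrier M" "y \<in> carrier N" for x y
    using \<phi>c[of "(x, y)"] that by simp
  have kills: "lin_ext R P ?\<phi> g = \<zero>\<^bsub>P\<^esub>" if "g \<in> balanced_rels R S M ract N lact" for g
    using that
    apply (simp add: balanced_rels_def Let_def)
    apply (elim disjE exE conjE)
        apply (simp_all add: lin(2) M.basis_vec_closed le fc
        module_hom_add[OF lin(1)] module_hom_smult[OF lin(1)] ract_closed lact_closed bal
        module_hom_add[OF hom1] module_hom_smult[OF hom1]
        module_hom_add[OF hom2] module_hom_smult[OF hom2] P.diff_diff_in_rels)
    done
  show "presented_lift R P ?\<phi> \<in> module_hom R BT P"
    unfolding balanced_tensor_def by (rule B.presented_lift_hom[OF P \<phi>c kills])
  show "presented_lift R P ?\<phi> (bp x y) = f x y" if "x \<in> carrier M" "y \<in> carrier N"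
    using that B.presented_lift_gen[of P ?\<phi> "(x, y)", OF P \<phi>c kills] by (simp add: balanced_pure_def)
qed

lemma pure_hom_right:
  assumes x: "x \<in> carrier M" shows "bp x \<in> module_hom R N BT"
proof (rule module_homI)
  let ?F = "free_module R (carrier M \<times> carrier N)"
  interpret F: module R ?F by (rule M.module_free_module)
  note [simp] = M.basis_vec_closed
  fix y assume y: "y \<in> carrier N"
  show "bp x y \<in> carrier BT" using x y by (rule balanced_pure_closed)
  {
    fix y' assume y': "y' \<in> carrier N"
    have "basis_vec R (x, y \<oplus>\<^bsub>N\<^esub> y') \<ominus>\<^bsub>?F\<^esub> (basis_vec R (x, y) \<oplus>\<^bsub>?F\<^esub> basis_vec R (x, y'))
        \<in> balanced_rels R S M ract N lact"
      using x y y' unfolding balanced_rels_def Let_def by blast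
    from B.gen_rel_eq[OF _ _ this] show "bp x (y \<oplus>\<^bsub>N\<^esub> y') = bp x y \<oplus>\<^bsub>BT\<^esub> bp x y'"
      using x y y'
      by (simp add: module_hom_add[OF B.proj_hom] presented_gen_def balanced_pure_def balanced_tensor_def)
  }
  {
    fix r assume r: "r \<in> carrier R"
    have "basis_vec R (x, r \<odot>\<^bsub>N\<^esub> y) \<ominus>\<^bsub>?F\<^esub> (r \<odot>\<^bsub>?F\<^esub> basis_vec R (x, y))
        \<in> balanced_rels R S M ract N lact"
      using x y r unfolding balanced_rels_def Let_def by blast
    from B.gen_rel_eq[OF _ _ this] show "bp x (r \<odot>\<^bsub>N\<^esub> y) = r \<odot>\<^bsub>BT\<^esub> bp x y"
      using x y r
      by (simp add: module_hom_smult[OF B.proj_hom] presented_gen_def balanced_pure_def balanced_tensor_def)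
  }
qed

lemma pure_hom_left:
  assumes y: "y \<in> carrier N" shows "(\<lambda>x. bp x y) \<in> module_hom R M BT"
proof (rule module_homI)
  let ?F = "free_module R (carrier M \<times> carrier N)"
  interpret F: module R ?F by (rule M.module_free_module)
  note [simp] = M.basis_vec_closed
  fix x assume x: "x \<in> carrier M"
  show "bp x y \<in> carrier BT" using x y by (rule balanced_pure_closed)
  {
    fix x' assume x': "x' \<in> carrier M"
    have "basis_vec R (x \<oplus>\<^bsub>M\<^esub> x', y) \<ominus>\<^bsub>?F\<^esub> (basis_vec R (x, y) \<oplus>\<^bsub>?F\<^esub> basis_vec R (x', y))
        \<in> balanced_rels R S M ract N lact"
      using x y x' unfolding balanced_rels_def Let_def by blast
    from B.gen_rel_eq[OF _ _ this] show "bp (x \<oplus>\<^bsub>M\<^esub> x') y = bp x y \<oplus>\<^bsub>BT\<^esub> bp x' y"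
      using x y x'
      by (simp add: module_hom_add[OF B.proj_hom] presented_gen_def balanced_pure_def balanced_tensor_def)
  }
  {
    fix r assume r: "r \<in> carrier R"
    have "basis_vec R (r \<odot>\<^bsub>M\<^esub> x, y) \<ominus>\<^bsub>?F\<^esub> (r \<odot>\<^bsub>?F\<^esub> basis_vec R (x, y))
        \<in> balanced_rels R S M ract N lact"
      using x y r unfolding balanced_rels_def Let_def by blast
    from B.gen_rel_eq[OF _ _ this] show "bp (r \<odot>\<^bsub>M\<^esub> x) y = r \<odot>\<^bsub>BT\<^esub> bp x y"
      using x y r
      by (simp add: module_hom_smult[OF B.proj_hom] presented_gen_def balanced_pure_def balanced_tensor_def)
  }
qed

lemma pure_balanced:
  assumes "x \<in> carrier M" "s \<in> carrier S" "y \<in> carrier N"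
  shows "bp (ract x s) y = bp x (lact s y)"
proof -
  let ?F = "free_module R (carrier M \<times> carrier N)"
  interpret F: module R ?F by (rule M.module_free_module)
  have "basis_vec R (ract x s, y) \<ominus>\<^bsub>?F\<^esub> basis_vec R (x, lact s y) \<in> balanced_rels R S M ract N lact"
    using assms unfolding balanced_rels_def Let_def by blast
  from B.gen_rel_eq[OF _ _ this] show ?thesis
    using assms by (simp add: presented_gen_def balanced_pure_def M.basis_vec_closed ract_closed lact_closed)
qed

text \<open>Scalars are absorbed into the left factor, so every element is a plain sum of pure
  elements and the induction step carries no coefficient.\<close>

lemma balanced_induct [consumes 1, case_names zero add]:
  assumes "X \<in> carrier BT"
    and "P \<zero>\<^bsub>BT\<^esub>"
    and "\<And>X x y. X \<in> carrier BT \<Longrightarrow> P X \<Longrightarrow> x \<in> carrier M \<Longrightarrow> y \<in> carrier N \<Longrightarrow> P (X \<oplus>\<^bsub>BT\<^esub> bp x y)"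
  shows "P X"
  using assms(1)[unfolded balanced_tensor_def]
proof (rule B.presented_induct)
  fix X r p assume *: "X \<in> carrier B.presented" "P X" "r \<in> carrier R" "p \<in> carrier M \<times> carrier N"
  obtain x y where p: "p = (x, y)" "x \<in> carrier M" "y \<in> carrier N" using * by auto
  have "r \<odot>\<^bsub>BT\<^esub> bp x y = bp (r \<odot>\<^bsub>M\<^esub> x) y"
    using module_hom_smult[OF pure_hom_left[OF p(3)] *(3) p(2)] by simp
  then show "P (X \<oplus>\<^bsub>B.presented\<^esub> r \<odot>\<^bsub>B.presented\<^esub> B.gen p)"
    using assms(3)[of X "r \<odot>\<^bsub>M\<^esub> x" y] * p by (simp add: balanced_tensor_def balanced_pure_def)
qed (use assms(2) in \<open>simp add: balanced_tensor_def\<close>)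

end

section \<open>The Hochschild complex of an algebra\<close>

lemma nth_merge_at:
  assumes "Suc i < length xs" "j < length xs - 1"
  shows "merge_at A i xs ! j =
    (if j < i then xs ! j else if j = i then xs ! i \<otimes>\<^bsub>A\<^esub> xs ! Suc i else xs ! Suc j)"
  using assms by (auto simp: merge_at_def nth_append nth_Cons')

lemma length_merge_at: "Suc i < length xs \<Longrightarrow> length (merge_at A i xs) = length xs - 1"
  by (simp add: merge_at_def)

lemma module_hom_cong:
  assumes "f \<in> module_hom R M N" "\<And>x. x \<in> carrier M \<Longrightarrow> f x = g x"
    and "module R M"
  shows "g \<in> module_hom R M N"
proof -
  interpret module R M by fact
  show ?thesis using assms(1) by (intro module_homI) (auto simp: module_hom_def assms(2)[symmetric])
qed

lemma multilin_cong:
  assumes "multilin R A m P \<phi>" "module R A" "\<And>xs. xs \<in> tensor_words A m \<Longrightarrow> \<phi> xs = \<psi> xs"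
  shows "multilin R A m P \<psi>"
proof -
  interpret module R A by fact
  show ?thesis using assms(1) by (simp add: multilin_def assms(3)[symmetric] tensor_words_update)
qed

context module
begin

lemma module_hom_pointwise_add:
  assumes "f \<in> module_hom R N M" "g \<in> module_hom R N M"
  shows "(\<lambda>x. f x \<oplus>\<^bsub>M\<^esub> g x) \<in> module_hom R N M"
  by (rule module_homI)
    (use assms in \<open>auto simp: module_hom_def Pi_def M.a_ac smult_r_distr\<close>)

lemma module_hom_pointwise_smult:
  assumes "f \<in> module_hom R N M" "r \<in> carrier R"
  shows "(\<lambda>x. r \<odot>\<^bsub>M\<^esub> f x) \<in> module_hom R N M"
  by (rule module_homI)
    (use assms in \<open>auto simp: module_hom_def Pi_def smult_r_distr smult_assoc1[symmetric] R.m_comm\<close>)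

lemma module_hom_id: "(\<lambda>x. x) \<in> module_hom R M M"
  by (rule module_homI) auto

lemma multilin_smult:
  assumes "multilin R A m M \<phi>" "r \<in> carrier R"
  shows "multilin R A m M (\<lambda>xs. r \<odot>\<^bsub>M\<^esub> \<phi> xs)"
  by (rule multilinI)
    (use assms in \<open>auto simp: multilinD tensor_words_update smult_r_distr smult_assoc1[symmetric] R.m_comm\<close>)

lemma multilin_add:
  assumes "multilin R A m M \<phi>" "multilin R A m M \<psi>"
  shows "multilin R A m M (\<lambda>xs. \<phi> xs \<oplus>\<^bsub>M\<^esub> \<psi> xs)"
  by (rule multilinI)
    (use assms in \<open>auto simp: multilinD tensor_words_update smult_r_distr M.a_ac\<close>)

lemma multilin_zero: "multilin R A m M (\<lambda>xs. \<zero>\<^bsub>M\<^esub>)"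
  by (rule multilinI) auto

lemma multilin_finsum:
  assumes A: "module R A" and "finite I" "\<And>i. i \<in> I \<Longrightarrow> multilin R A m M (\<phi> i)"
  shows "multilin R A m M (\<lambda>xs. \<Oplus>\<^bsub>M\<^esub>i\<in>I. \<phi> i xs)"
  using assms(2,3)
proof (induction I)
  case empty
  then show ?case by (simp add: multilin_zero)
next
  case (insert i I)
  have *: "(\<Oplus>\<^bsub>M\<^esub>i\<in>insert i I. \<phi> i xs) = \<phi> i xs \<oplus>\<^bsub>M\<^esub> (\<Oplus>\<^bsub>M\<^esub>i\<in>I. \<phi> i xs)"
    if "xs \<in> tensor_words A m" for xs
    using insert.hyps multilinD(1)[OF insert.prems that] by simp
  have "multilin R A m M (\<lambda>xs. \<phi> i xs \<oplus>\<^bsub>M\<^esub> (\<Oplus>\<^bsub>M\<^esub>i\<in>I. \<phi> i xs))"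
    using insert by (intro multilin_add) auto
  then show ?case
    by (rule multilin_cong[OF _ A]) (simp add: *)
qed

end

text \<open>The word operations of the bar complex (outer multiplication, merging neighbours,
  padding with units) change one output letter linearly when one input letter changes. This reduces
  their multilinearity to naming that position \<open>j\<close> and that linear map
  \<open>h\<close>.\<close>

lemma multilin_reindex:
  assumes \<psi>: "multilin R A m' P \<psi>" and "module R A"
    and g: "\<And>xs. xs \<in> tensor_words A m \<Longrightarrow> g xs \<in> tensor_words A m'"
    and upd: "\<And>xs i. xs \<in> tensor_words A m \<Longrightarrow> i < m \<Longrightarrow>
      \<exists>j < m'. \<exists>h \<in> module_hom R A A. \<forall>a \<in> carrier A. g (xs[i := a]) = (g xs)[j := h a]"
  shows "multilin R A m P (\<lambda>xs. \<psi> (g xs))"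
proof -
  interpret module R A by fact
  show ?thesis
  proof (rule multilinI)
    fix xs assume xs: "xs \<in> tensor_words A m"
    then show "\<psi> (g xs) \<in> carrier P" using \<psi> g by (auto intro: multilinD(1))
    fix i a assume i: "i < m" and a: "a \<in> carrier A"
    obtain j h where jh: "j < m'" "h \<in> module_hom R A A"
      "\<And>a. a \<in> carrier A \<Longrightarrow> g (xs[i := a]) = (g xs)[j := h a]"
      using upd[OF xs i] by blast
    note hc = module_hom_in_carrier[OF jh(2)]
    show "\<psi> (g (xs[i := a \<oplus>\<^bsub>A\<^esub> b])) = \<psi> (g (xs[i := a])) \<oplus>\<^bsub>P\<^esub> \<psi> (g (xs[i := b]))"
      if "b \<in> carrier A" for b
      using a that g[OF xs] jh(1) by (simp add: jh(3) hc module_hom_add[OF jh(2)] multilinD(2)[OF \<psi>])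
    show "\<psi> (g (xs[i := r \<odot>\<^bsub>A\<^esub> a])) = r \<odot>\<^bsub>P\<^esub> \<psi> (g (xs[i := a]))"
      if "r \<in> carrier R" for r
      using a that g[OF xs] jh(1) by (simp add: jh(3) hc module_hom_smult[OF jh(2)] multilinD(3)[OF \<psi>])
  qed
qed

section \<open>Bimodule actions and the differential on the bar modules\<close>

locale assoc_algebra = module R A
  for R :: "('r, 'm) ring_scheme" and A :: "('r, 'a, 'q) module_scheme" +
  assumes amult_closed: "a \<in> carrier A \<Longrightarrow> b \<in> carrier A \<Longrightarrow> a \<otimes>\<^bsub>A\<^esub> b \<in> carrier A"
    and aone_closed: "\<one>\<^bsub>A\<^esub> \<in> carrier A"
    and amult_assoc: "a \<in> carrier A \<Longrightarrow> b \<in> carrier A \<Longrightarrow> c \<in> carrier A \<Longrightarrow>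
      (a \<otimes>\<^bsub>A\<^esub> b) \<otimes>\<^bsub>A\<^esub> c = a \<otimes>\<^bsub>A\<^esub> (b \<otimes>\<^bsub>A\<^esub> c)"
    and al_one: "a \<in> carrier A \<Longrightarrow> \<one>\<^bsub>A\<^esub> \<otimes>\<^bsub>A\<^esub> a = a"
    and ar_one: "a \<in> carrier A \<Longrightarrow> a \<otimes>\<^bsub>A\<^esub> \<one>\<^bsub>A\<^esub> = a"
    and amult_hom_right: "a \<in> carrier A \<Longrightarrow> (\<lambda>b. a \<otimes>\<^bsub>A\<^esub> b) \<in> module_hom R A A"
    and amult_hom_left: "a \<in> carrier A \<Longrightarrow> (\<lambda>b. b \<otimes>\<^bsub>A\<^esub> a) \<in> module_hom R A A"
begin

abbreviation "TP \<equiv> tensor_power R A"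
abbreviation "TW \<equiv> tensor_words A"

lemma carrier_enveloping: "carrier (enveloping R A) = carrier (TP 2)"
  by (simp add: enveloping_def Let_def)

lemma multilin_env_act:
  assumes x: "x \<in> carrier A"
  shows "multilin R A 2 A (\<lambda>u. u ! 1 \<otimes>\<^bsub>A\<^esub> x \<otimes>\<^bsub>A\<^esub> u ! 0)"
proof (rule multilinI)
  fix u i a assume u: "u \<in> TW 2" and i: "i < (2::nat)" and a: "a \<in> carrier A"
  have u01: "u ! 0 \<in> carrier A" "u ! 1 \<in> carrier A" "length u = 2"
    using u by (auto intro: tensor_words_nth simp: tensor_words_length)
  note homs = module_hom_add[OF amult_hom_left] module_hom_add[OF amult_hom_right]
    module_hom_smult[OF amult_hom_left] module_hom_smult[OF amult_hom_right]
  have "i = 0 \<or> i = 1" using i by auto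
  then show "u[i := a \<oplus>\<^bsub>A\<^esub> b] ! 1 \<otimes>\<^bsub>A\<^esub> x \<otimes>\<^bsub>A\<^esub> u[i := a \<oplus>\<^bsub>A\<^esub> b] ! 0 =
      (u[i := a] ! 1 \<otimes>\<^bsub>A\<^esub> x \<otimes>\<^bsub>A\<^esub> u[i := a] ! 0) \<oplus>\<^bsub>A\<^esub> (u[i := b] ! 1 \<otimes>\<^bsub>A\<^esub> x \<otimes>\<^bsub>A\<^esub> u[i := b] ! 0)"
    if "b \<in> carrier A" for b
    using u01 a x that by (auto simp: homs amult_closed)
  show "u[i := r \<odot>\<^bsub>A\<^esub> a] ! 1 \<otimes>\<^bsub>A\<^esub> x \<otimes>\<^bsub>A\<^esub> u[i := r \<odot>\<^bsub>A\<^esub> a] ! 0 =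
      r \<odot>\<^bsub>A\<^esub> (u[i := a] ! 1 \<otimes>\<^bsub>A\<^esub> x \<otimes>\<^bsub>A\<^esub> u[i := a] ! 0)" if "r \<in> carrier R" for r
    using u01 a x that \<open>i = 0 \<or> i = 1\<close> by (auto simp: homs amult_closed)
qed (use x in \<open>simp add: amult_closed tensor_words_nth\<close>)

lemma env_act_hom: "x \<in> carrier A \<Longrightarrow> env_right_act R A x \<in> module_hom R (TP 2) A"
  unfolding env_right_act_def[abs_def] by (rule tensor_lift_hom[OF module_axioms multilin_env_act])

lemma env_act_pure:
  assumes "x \<in> carrier A" "a \<in> carrier A" "b \<in> carrier A"
  shows "env_right_act R A x (pure_tensor R A [a, b]) = b \<otimes>\<^bsub>A\<^esub> x \<otimes>\<^bsub>A\<^esub> a"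
  unfolding env_right_act_def using assms
  by (subst tensor_lift_pure[OF module_axioms multilin_env_act]) (auto simp: tensor_words_def)

definition outer_mult :: "nat \<Rightarrow> 'a list \<Rightarrow> 'a list \<Rightarrow> 'a list" where
  "outer_mult k u xs = xs[0 := u ! 0 \<otimes>\<^bsub>A\<^esub> xs ! 0, Suc k := xs ! (Suc k) \<otimes>\<^bsub>A\<^esub> u ! 1]"

lemma outer_mult_closed:
  assumes "u \<in> TW 2" "xs \<in> TW (Suc (Suc k))" shows "outer_mult k u xs \<in> TW (Suc (Suc k))"
  using assms by (simp add: outer_mult_def tensor_words_update amult_closed tensor_words_nth)

lemma multilin_outer_right:
  assumes u: "u \<in> TW 2"
  shows "multilin R A (Suc (Suc k)) (TP (Suc (Suc k))) (\<lambda>xs. pure_tensor R A (outer_mult k u xs))"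
proof (rule multilin_reindex[OF multilin_pure module_axioms outer_mult_closed[OF u]])
  fix xs i assume xs: "xs \<in> TW (Suc (Suc k))" and i: "i < Suc (Suc k)"
  have u01: "u ! 0 \<in> carrier A" "u ! 1 \<in> carrier A" using u by (auto intro: tensor_words_nth)
  have len: "length xs = Suc (Suc k)" using xs by (rule tensor_words_length)
  define h where "h = (if i = 0 then \<lambda>a. u ! 0 \<otimes>\<^bsub>A\<^esub> a else if i = Suc k then \<lambda>a. a \<otimes>\<^bsub>A\<^esub> u ! 1 else (\<lambda>a. a))"
  have "h \<in> module_hom R A A"
    using u01 by (simp add: h_def amult_hom_left amult_hom_right module_hom_id)
  moreover have "outer_mult k u (xs[i := a]) = (outer_mult k u xs)[i := h a]" for a
    using i len by (auto simp: outer_mult_def h_def nth_list_update intro!: nth_equalityI)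
  ultimately show "\<exists>j<Suc (Suc k). \<exists>h\<in>module_hom R A A. \<forall>a\<in>carrier A.
      outer_mult k u (xs[i := a]) = (outer_mult k u xs)[j := h a]"
    using i by blast
qed

lemma multilin_outer_left:
  assumes xs: "xs \<in> TW (Suc (Suc k))"
  shows "multilin R A 2 (TP (Suc (Suc k))) (\<lambda>u. pure_tensor R A (outer_mult k u xs))"
proof (rule multilin_reindex[OF multilin_pure module_axioms outer_mult_closed[OF _ xs]])
  fix u i assume u: "u \<in> TW 2" and i: "i < (2::nat)"
  have x01: "xs ! 0 \<in> carrier A" "xs ! (Suc k) \<in> carrier A" using xs by (auto intro: tensor_words_nth)
  have len: "length xs = Suc (Suc k)" using xs by (rule tensor_words_length)
  have lenu: "length u = 2" using u by (rule tensor_words_length)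
  define h where "h = (if i = 0 then \<lambda>a. a \<otimes>\<^bsub>A\<^esub> xs ! 0 else (\<lambda>a. xs ! (Suc k) \<otimes>\<^bsub>A\<^esub> a))"
  define j where "j = (if i = 0 then 0 else Suc k)"
  have "h \<in> module_hom R A A"
    using x01 by (simp add: h_def amult_hom_left amult_hom_right)
  moreover have "outer_mult k (u[i := a]) xs = (outer_mult k u xs)[j := h a]" for a
    using i len lenu less_2_cases[of i] by (auto simp: outer_mult_def h_def j_def nth_list_update intro!: nth_equalityI)
  ultimately show "\<exists>j<Suc (Suc k). \<exists>h\<in>module_hom R A A. \<forall>a\<in>carrier A.
      outer_mult k (u[i := a]) xs = (outer_mult k u xs)[j := h a]"
    by (intro exI[of _ j]) (auto simp: j_def)
qed

text \<open>\<open>bar_left_act\<close> is a lift over the enveloping algebra of a lift over the bar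
  module. This is the inner lift, for a fixed word \<open>u\<close>; it must be linear in the bar
  element and multilinear in \<open>u\<close> before the outer lift makes sense.\<close>

definition outer_map :: "nat \<Rightarrow> 'a list \<Rightarrow> ('a list \<Rightarrow> 'r) set \<Rightarrow> ('a list \<Rightarrow> 'r) set" where
  "outer_map k u = presented_lift R (TP (Suc (Suc k))) (\<lambda>xs. pure_tensor R A (outer_mult k u xs))"

lemma outer_map_hom: "u \<in> TW 2 \<Longrightarrow> outer_map k u \<in> module_hom R (TP (Suc (Suc k))) (TP (Suc (Suc k)))"
  unfolding outer_map_def by (rule tensor_lift_hom[OF module_tensor_power multilin_outer_right])

lemma outer_map_pure:
  "u \<in> TW 2 \<Longrightarrow> xs \<in> TW (Suc (Suc k)) \<Longrightarrow> outer_map k u (pure_tensor R A xs) = pure_tensor R A (outer_mult k u xs)"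
  unfolding outer_map_def by (rule tensor_lift_pure[OF module_tensor_power multilin_outer_right])

lemma multilin_outer_map:
  assumes y: "y \<in> carrier (TP (Suc (Suc k)))"
  shows "multilin R A 2 (TP (Suc (Suc k))) (\<lambda>u. outer_map k u y)"
proof (rule multilinI)
  interpret T: module R "TP (Suc (Suc k))" by (rule module_tensor_power)
  fix u assume u: "u \<in> TW 2"
  show "outer_map k u y \<in> carrier (TP (Suc (Suc k)))" using outer_map_hom[OF u] y by (rule module_hom_in_carrier)
  fix i a assume i: "i < (2::nat)" and a: "a \<in> carrier A"
  note up = tensor_words_update[OF u]
  show "outer_map k (u[i := a \<oplus>\<^bsub>A\<^esub> b]) y = outer_map k (u[i := a]) y \<oplus>\<^bsub>TP (Suc (Suc k))\<^esub> outer_map k (u[i := b]) y"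
    if b: "b \<in> carrier A" for b
    by (rule tensor_hom_eqI[OF module_tensor_power outer_map_hom T.module_hom_pointwise_add[OF outer_map_hom outer_map_hom] _ y])
      (use a b i u up in \<open>auto simp: outer_map_pure multilinD(2)[OF multilin_outer_left]\<close>)
  show "outer_map k (u[i := r \<odot>\<^bsub>A\<^esub> a]) y = r \<odot>\<^bsub>TP (Suc (Suc k))\<^esub> outer_map k (u[i := a]) y"
    if r: "r \<in> carrier R" for r
    by (rule tensor_hom_eqI[OF module_tensor_power outer_map_hom T.module_hom_pointwise_smult[OF outer_map_hom] _ y])
      (use a r i u up in \<open>auto simp: outer_map_pure multilinD(3)[OF multilin_outer_left]\<close>)
qed

lemma bar_left_act_eq: "bar_left_act R A k s y = presented_lift R (TP (Suc (Suc k))) (\<lambda>u. outer_map k u y) s"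
  by (simp add: bar_left_act_def bar_module_def outer_map_def outer_mult_def)

lemma bar_act_hom_left:
  "y \<in> carrier (TP (Suc (Suc k))) \<Longrightarrow> (\<lambda>s. bar_left_act R A k s y) \<in> module_hom R (TP 2) (TP (Suc (Suc k)))"
  unfolding bar_left_act_eq by (rule tensor_lift_hom[OF module_tensor_power multilin_outer_map])

lemma bar_act_pure_left:
  "u \<in> TW 2 \<Longrightarrow> y \<in> carrier (TP (Suc (Suc k))) \<Longrightarrow> bar_left_act R A k (pure_tensor R A u) y = outer_map k u y"
  unfolding bar_left_act_eq by (rule tensor_lift_pure[OF module_tensor_power multilin_outer_map])

lemma bar_act_hom_right:
  assumes s: "s \<in> carrier (TP 2)"
  shows "bar_left_act R A k s \<in> module_hom R (TP (Suc (Suc k))) (TP (Suc (Suc k)))"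
proof (rule module_homI)
  interpret T: module R "TP (Suc (Suc k))" by (rule module_tensor_power)
  fix y assume y: "y \<in> carrier (TP (Suc (Suc k)))"
  show "bar_left_act R A k s y \<in> carrier (TP (Suc (Suc k)))"
    using bar_act_hom_left[OF y] s by (rule module_hom_in_carrier)
  show "bar_left_act R A k s (y \<oplus>\<^bsub>TP (Suc (Suc k))\<^esub> z) =
      bar_left_act R A k s y \<oplus>\<^bsub>TP (Suc (Suc k))\<^esub> bar_left_act R A k s z" if z: "z \<in> carrier (TP (Suc (Suc k)))" for z
    by (rule tensor_hom_eqI[OF module_tensor_power bar_act_hom_left T.module_hom_pointwise_add[OF bar_act_hom_left bar_act_hom_left] _ s])
      (use y z in \<open>auto simp: bar_act_pure_left module_hom_add[OF outer_map_hom]\<close>)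
  show "bar_left_act R A k s (r \<odot>\<^bsub>TP (Suc (Suc k))\<^esub> y) = r \<odot>\<^bsub>TP (Suc (Suc k))\<^esub> bar_left_act R A k s y"
    if r: "r \<in> carrier R" for r
    by (rule tensor_hom_eqI[OF module_tensor_power bar_act_hom_left T.module_hom_pointwise_smult[OF bar_act_hom_left] _ s])
      (use y r in \<open>auto simp: bar_act_pure_left module_hom_smult[OF outer_map_hom]\<close>)
qed

lemma merge_at_closed:
  assumes "xs \<in> TW (Suc (Suc k))" "i \<le> k" shows "merge_at A i xs \<in> TW (Suc k)"
proof -
  have "merge_at A i xs ! j \<in> carrier A" if "j < Suc k" for j
    using assms that by (subst nth_merge_at) (auto simp: tensor_words_length tensor_words_nth amult_closed)
  then show ?thesis
    using assms by (auto simp: tensor_words_def length_merge_at in_set_conv_nth)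
qed

lemma multilin_merge_at:
  assumes i: "i \<le> k"
  shows "multilin R A (Suc (Suc k)) (TP (Suc k)) (\<lambda>xs. pure_tensor R A (merge_at A i xs))"
proof (rule multilin_reindex[OF multilin_pure module_axioms merge_at_closed[OF _ i]])
  fix xs p assume xs: "xs \<in> TW (Suc (Suc k))" and p: "p < Suc (Suc k)"
  have len: "length xs = Suc (Suc k)" using xs by (rule tensor_words_length)
  define h where "h = (if p = i then \<lambda>a. a \<otimes>\<^bsub>A\<^esub> xs ! Suc i else if p = Suc i then \<lambda>a. xs ! i \<otimes>\<^bsub>A\<^esub> a else (\<lambda>a. a))"
  define j where "j = (if p \<le> i then p else p - 1)"
  have "h \<in> module_hom R A A"
    using xs i by (simp add: h_def amult_hom_left amult_hom_right module_hom_id tensor_words_nth)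
  moreover have "merge_at A i (xs[p := a]) = (merge_at A i xs)[j := h a]" for a
  proof (rule nth_equalityI)
    show "length (merge_at A i (xs[p := a])) = length ((merge_at A i xs)[j := h a])"
      using i len by (simp add: length_merge_at)
    fix q assume "q < length (merge_at A i (xs[p := a]))"
    then have q: "q < Suc k" using i len by (simp add: length_merge_at)
    then show "merge_at A i (xs[p := a]) ! q = (merge_at A i xs)[j := h a] ! q"
      using i len p by (auto simp: nth_merge_at length_merge_at nth_list_update h_def j_def)
  qed
  moreover have "j < Suc k" using p i by (auto simp: j_def)
  ultimately show "\<exists>j<Suc k. \<exists>h\<in>module_hom R A A. \<forall>a\<in>carrier A.
      merge_at A i (xs[p := a]) = (merge_at A i xs)[j := h a]"
    by blast
qed

lemma multilin_bar:
  "multilin R A (Suc (Suc k)) (TP (Suc k)) (\<lambda>xs. \<Oplus>\<^bsub>TP (Suc k)\<^esub>i\<in>{0..k}.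
      ring_sign R i \<odot>\<^bsub>TP (Suc k)\<^esub> pure_tensor R A (merge_at A i xs))"
proof -
  interpret T: module R "TP (Suc k)" by (rule module_tensor_power)
  show ?thesis
    by (rule T.multilin_finsum[OF module_axioms]) (auto intro!: T.multilin_smult multilin_merge_at simp: R.ring_sign_closed)
qed

lemma bar_diff_hom: "bar_diff R A k \<in> module_hom R (TP (Suc (Suc k))) (TP (Suc k))"
  unfolding bar_diff_def Suc_eq_plus1[symmetric] by (rule tensor_lift_hom[OF module_tensor_power multilin_bar])

lemma bar_diff_pure:
  "xs \<in> TW (Suc (Suc k)) \<Longrightarrow> bar_diff R A k (pure_tensor R A xs) = (\<Oplus>\<^bsub>TP (Suc k)\<^esub>i\<in>{0..k}.
      ring_sign R i \<odot>\<^bsub>TP (Suc k)\<^esub> pure_tensor R A (merge_at A i xs))"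
  unfolding bar_diff_def Suc_eq_plus1[symmetric] by (rule tensor_lift_pure[OF module_tensor_power multilin_bar])

text \<open>Associativity matters only at the two end positions, where the merged product contains
  an outer letter; elsewhere the two operations touch different letters.\<close>

lemma merge_outer_mult:
  assumes u: "u \<in> TW 2" and xs: "xs \<in> TW (Suc (Suc (Suc k)))" and i: "i \<le> Suc k"
  shows "merge_at A i (outer_mult (Suc k) u xs) = outer_mult k u (merge_at A i xs)"
proof (rule nth_equalityI)
  have len: "length xs = Suc (Suc (Suc k))" using xs by (simp add: tensor_words_length)
  then show "length (merge_at A i (outer_mult (Suc k) u xs)) = length (outer_mult k u (merge_at A i xs))"
    using i by (simp add: length_merge_at outer_mult_def)
  have u01: "u ! 0 \<in> carrier A" "u ! 1 \<in> carrier A" using u by (auto intro: tensor_words_nth)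
  have xc: "xs ! j \<in> carrier A" if "j < Suc (Suc (Suc k))" for j using xs that by (simp add: tensor_words_nth)
  fix q assume "q < length (merge_at A i (outer_mult (Suc k) u xs))"
  then have q: "q < Suc (Suc k)" using i len by (simp add: length_merge_at outer_mult_def)
  then show "merge_at A i (outer_mult (Suc k) u xs) ! q = outer_mult k u (merge_at A i xs) ! q"
    using i len u01
    by (auto simp: nth_merge_at length_merge_at nth_list_update outer_mult_def xc amult_assoc amult_closed)
qed

text \<open>This linearity over the enveloping algebra makes the differential respect the balancing
  relations, so that it descends to the Hochschild modules.\<close>

lemma bar_diff_act:
  assumes s: "s \<in> carrier (TP 2)" and y: "y \<in> carrier (TP (Suc (Suc (Suc k))))"
  shows "bar_diff R A (Suc k) (bar_left_act R A (Suc k) s y) = bar_left_act R A k s (bar_diff R A (Suc k) y)"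
proof -
  have bdh: "bar_diff R A (Suc k) \<in> module_hom R (TP (Suc (Suc (Suc k)))) (TP (Suc (Suc k)))"
    using bar_diff_hom[of "Suc k"] by simp
  interpret T: module R "TP (Suc (Suc k))" by (rule module_tensor_power)
  have pure: "bar_diff R A (Suc k) (outer_map (Suc k) u y) = outer_map k u (bar_diff R A (Suc k) y)"
    if u: "u \<in> TW 2" for u
  proof (rule tensor_hom_eqI[OF module_tensor_power module_hom_comp[OF outer_map_hom[OF u] bdh] module_hom_comp[OF bdh outer_map_hom[OF u]] _ y])
    fix xs assume xs: "xs \<in> TW (Suc (Suc (Suc k)))"
    have mc: "merge_at A i xs \<in> TW (Suc (Suc k))" if "i \<le> Suc k" for i
      using merge_at_closed[OF xs that] by simp
    have pc: "pure_tensor R A (merge_at A i xs) \<in> carrier (TP (Suc (Suc k)))" if "i \<in> {0..Suc k}" for i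
      using mc[of i] that by (simp add: pure_tensor_closed)
    have "outer_map k u (bar_diff R A (Suc k) (pure_tensor R A xs)) =
        (\<Oplus>\<^bsub>TP (Suc (Suc k))\<^esub>i\<in>{0..Suc k}. outer_map k u (ring_sign R i \<odot>\<^bsub>TP (Suc (Suc k))\<^esub> pure_tensor R A (merge_at A i xs)))"
      unfolding bar_diff_pure[OF xs]
      by (rule module_hom_finsum[OF module_tensor_power module_tensor_power outer_map_hom[OF u]])
        (use pc R.ring_sign_closed in auto)
    also have "\<dots> = (\<Oplus>\<^bsub>TP (Suc (Suc k))\<^esub>i\<in>{0..Suc k}. ring_sign R i \<odot>\<^bsub>TP (Suc (Suc k))\<^esub>
        pure_tensor R A (merge_at A i (outer_mult (Suc k) u xs)))"
      by (rule T.finsum_cong') (use pc mc R.ring_sign_closed merge_outer_mult[OF u xs] outer_mult_closed[OF u]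
        in \<open>auto simp: module_hom_smult[OF outer_map_hom[OF u]] outer_map_pure u pure_tensor_closed\<close>)
    also have "\<dots> = bar_diff R A (Suc k) (outer_map (Suc k) u (pure_tensor R A xs))"
      using bar_diff_pure[OF outer_mult_closed[OF u xs]] outer_map_pure[OF u xs] by simp
    finally show "bar_diff R A (Suc k) (outer_map (Suc k) u (pure_tensor R A xs)) =
        outer_map k u (bar_diff R A (Suc k) (pure_tensor R A xs))" by simp
  qed
  have dy: "bar_diff R A (Suc k) y \<in> carrier (TP (Suc (Suc k)))" using bdh y by (rule module_hom_in_carrier)
  show ?thesis
    by (rule tensor_hom_eqI[OF module_tensor_power module_hom_comp[OF bar_act_hom_left[OF y] bdh] bar_act_hom_left[OF dy] _ s])
      (use y dy pure in \<open>simp add: bar_act_pure_left\<close>)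
qed

end

section \<open>The Hochschild modules as tensor powers of the algebra\<close>

context assoc_algebra
begin

abbreviation "HM \<equiv> hochschild_module R A"

lemma balanced_bar: "balanced R A (TP (Suc (Suc k))) (enveloping R A) (env_right_act R A) (bar_left_act R A k)"
proof -
  interpret T: module R "TP (Suc (Suc k))" by (rule module_tensor_power)
  show ?thesis
  proof
    show "env_right_act R A x s \<in> carrier A" if "x \<in> carrier A" "s \<in> carrier (enveloping R A)" for x s
      using that env_act_hom module_hom_in_carrier by (metis carrier_enveloping)
    show "bar_left_act R A k s y \<in> carrier (TP (Suc (Suc k)))"
      if "s \<in> carrier (enveloping R A)" "y \<in> carrier (TP (Suc (Suc k)))" for s y
      using that bar_act_hom_right module_hom_in_carrier by (metis carrier_enveloping)
  qed
qed

interpretation H: balanced R A "TP (Suc (Suc k))" "enveloping R A" "env_right_act R A" "bar_left_act R A k" for k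
  by (rule balanced_bar)

lemma HM_eq: "HM k = H.BT k"
  by (simp add: hochschild_module_def bar_module_def)

lemma hochschild_pure_eq: "hochschild_pure R A k = H.bp k"
  by (simp add: hochschild_pure_def bar_module_def fun_eq_iff)

lemma module_hochschild: "module R (HM k)"
  unfolding HM_eq by (rule H.module_balanced)

lemma
  shows hochschild_diff_hom: "hochschild_diff R A (Suc k) \<in> module_hom R (HM (Suc k)) (HM k)"
    and hochschild_diff_pure: "x \<in> carrier A \<Longrightarrow> y \<in> carrier (TP (Suc (Suc (Suc k)))) \<Longrightarrow>
      hochschild_diff R A (Suc k) (hochschild_pure R A (Suc k) x y) =
      hochschild_pure R A k x (bar_diff R A (Suc k) y)"
proof -
  let ?f = "\<lambda>x y. H.bp k x (bar_diff R A (Suc k) y)"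
  have dc: "bar_diff R A (Suc k) y \<in> carrier (TP (Suc (Suc k)))"
    if "y \<in> carrier (TP (Suc (Suc (Suc k))))" for y
    using bar_diff_hom that by (rule module_hom_in_carrier)
  have hom1: "?f x \<in> module_hom R (TP (Suc (Suc (Suc k)))) (H.BT k)" if "x \<in> carrier A" for x
    using module_hom_comp[OF bar_diff_hom H.pure_hom_right[OF that]] .
  have hom2: "(\<lambda>x. ?f x y) \<in> module_hom R A (H.BT k)" if "y \<in> carrier (TP (Suc (Suc (Suc k))))" for y
    using H.pure_hom_left[OF dc[OF that]] .
  have bal: "?f (env_right_act R A x s) y = ?f x (bar_left_act R A (Suc k) s y)"
    if "x \<in> carrier A" "s \<in> carrier (enveloping R A)" "y \<in> carrier (TP (Suc (Suc (Suc k))))" for x s y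
    using that dc by (simp add: H.pure_balanced bar_diff_act carrier_enveloping)
  note lift = H.balanced_lift[of "H.BT k" ?f, OF H.module_balanced hom1 hom2 bal]
  have e: "hochschild_diff R A (Suc k) = presented_lift R (H.BT k) (\<lambda>(x, y). ?f x y)"
    by (simp add: hochschild_diff_def HM_eq hochschild_pure_eq)
  show "hochschild_diff R A (Suc k) \<in> module_hom R (HM (Suc k)) (HM k)"
    unfolding e HM_eq by (rule lift(1))
  show "x \<in> carrier A \<Longrightarrow> y \<in> carrier (TP (Suc (Suc (Suc k)))) \<Longrightarrow>
      hochschild_diff R A (Suc k) (hochschild_pure R A (Suc k) x y) =
      hochschild_pure R A k x (bar_diff R A (Suc k) y)"
    unfolding e hochschild_pure_eq by (rule lift(2))
qed

text \<open>The class of \<open>a \<otimes> (1 \<otimes> ws \<otimes> 1)\<close>, under the usual identification of the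
  Hochschild complex with \<open>A \<otimes> A \<otimes> \<dots> \<otimes> A\<close>.\<close>

definition hcls :: "'a \<Rightarrow> 'a list \<Rightarrow> ('a \<times> ('a list \<Rightarrow> 'r) set \<Rightarrow> 'r) set" where
  "hcls a ws = hochschild_pure R A (length ws) a (pure_tensor R A (\<one>\<^bsub>A\<^esub> # ws @ [\<one>\<^bsub>A\<^esub>]))"

lemma one_word_closed: "ws \<in> TW k \<Longrightarrow> \<one>\<^bsub>A\<^esub> # ws @ [\<one>\<^bsub>A\<^esub>] \<in> TW (Suc (Suc k))"
  by (auto simp: tensor_words_def aone_closed)

text \<open>The word with outer letters \<open>b\<close> and \<open>c\<close> is the action of b
  \<otimes> c on the word with outer letters 1. Balancing moves this action to the left tensor
  factor, where it becomes multiplication by \<open>c\<close> on the left and by \<open>b\<close> on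
  the right.\<close>

lemma hochschild_pure_word:
  assumes a: "a \<in> carrier A" and b: "b \<in> carrier A" and c: "c \<in> carrier A" and ws: "ws \<in> TW k"
  shows "hochschild_pure R A k a (pure_tensor R A (b # ws @ [c])) = hcls (c \<otimes>\<^bsub>A\<^esub> a \<otimes>\<^bsub>A\<^esub> b) ws"
proof -
  have u: "[b, c] \<in> TW 2" using b c by (simp add: tensor_words_def)
  have len: "length ws = k" using ws by (rule tensor_words_length)
  have "outer_mult k [b, c] (\<one>\<^bsub>A\<^esub> # ws @ [\<one>\<^bsub>A\<^esub>]) = b # ws @ [c]"
    using len b c by (simp add: outer_mult_def al_one ar_one nth_append list_update_append)
  then have "pure_tensor R A (b # ws @ [c]) =
      bar_left_act R A k (pure_tensor R A [b, c]) (pure_tensor R A (\<one>\<^bsub>A\<^esub> # ws @ [\<one>\<^bsub>A\<^esub>]))"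
    using one_word_closed[OF ws] u by (simp add: bar_act_pure_left outer_map_pure pure_tensor_closed)
  then have "H.bp k a (pure_tensor R A (b # ws @ [c])) =
      H.bp k (env_right_act R A a (pure_tensor R A [b, c])) (pure_tensor R A (\<one>\<^bsub>A\<^esub> # ws @ [\<one>\<^bsub>A\<^esub>]))"
    using H.pure_balanced[OF a _ pure_tensor_closed[OF one_word_closed[OF ws]], of "pure_tensor R A [b, c]"]
      pure_tensor_closed[OF u] by (simp add: carrier_enveloping)
  then show ?thesis
    using a b c len by (simp add: hcls_def hochschild_pure_eq env_act_pure)
qed

lemma tensor_word_split:
  assumes "xs \<in> TW (Suc (Suc k))"
  obtains b ws c where "b \<in> carrier A" "c \<in> carrier A" "ws \<in> TW k" "xs = b # ws @ [c]"
proof -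
  have len: "length xs = Suc (Suc k)" and sub: "set xs \<subseteq> carrier A"
    using assms by (auto simp: tensor_words_def)
  obtain b ys where ys: "xs = b # ys" "length ys = Suc k" using len by (cases xs) auto
  obtain ws c where ws: "ys = ws @ [c]" using ys(2) by (cases ys rule: rev_cases) auto
  show thesis
    by (rule that[of b c ws]) (use ys ws sub in \<open>auto simp: tensor_words_def\<close>)
qed

lemma hcls_closed: "a \<in> carrier A \<Longrightarrow> ws \<in> TW k \<Longrightarrow> hcls a ws \<in> carrier (HM k)"
  unfolding hcls_def hochschild_pure_eq HM_eq
  by (simp only: tensor_words_length H.balanced_pure_closed pure_tensor_closed one_word_closed)

lemma hochschild_induct [consumes 1, case_names zero add]:
  assumes X: "X \<in> carrier (HM k)"
    and zero: "P \<zero>\<^bsub>HM k\<^esub>"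
    and add: "\<And>X a ws. X \<in> carrier (HM k) \<Longrightarrow> P X \<Longrightarrow> a \<in> carrier A \<Longrightarrow> ws \<in> TW k \<Longrightarrow>
      P (X \<oplus>\<^bsub>HM k\<^esub> hcls a ws)"
  shows "P X"
  using X[unfolded HM_eq]
proof (induction rule: H.balanced_induct)
  case zero
  then show ?case using assms(2) by (simp add: HM_eq)
next
  case (add X x y)
  interpret HMk: module R "HM k" by (rule module_hochschild)
  interpret T: module R "TP (Suc (Suc k))" by (rule module_tensor_power)
  \<comment> \<open>A second induction, now over the bar element \<open>y\<close>:
    \<open>hochschild_pure_word\<close> turns each of its words into one \<open>hcls\<close>
    summand, the scalar being absorbed into \<open>x\<close>.\<close>
  have "\<forall>x \<in> carrier A. \<forall>X \<in> carrier (HM k). P X \<longrightarrow> P (X \<oplus>\<^bsub>HM k\<^esub> H.bp k x y)"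
    using add(3)
  proof (induction rule: tensor_induct)
    case zero
    have "H.bp k x \<zero>\<^bsub>TP (Suc (Suc k))\<^esub> = \<zero>\<^bsub>HM k\<^esub>" if "x \<in> carrier A" for x
      using module_hom_zero[OF module_tensor_power H.module_balanced H.pure_hom_right[OF that]]
      by (simp add: HM_eq)
    then show ?case by simp
  next
    case (add Y r xs)
    show ?case
    proof (intro ballI impI)
      fix x X assume x: "x \<in> carrier A" and X: "X \<in> carrier (HM k)" and P: "P X"
      obtain b ws c where w: "b \<in> carrier A" "c \<in> carrier A" "ws \<in> TW k" "xs = b # ws @ [c]"
        by (rule tensor_word_split[OF add(3)])
      have rx: "r \<odot>\<^bsub>A\<^esub> x \<in> carrier A" using x add(2) by simp
      have p: "pure_tensor R A xs \<in> carrier (TP (Suc (Suc k)))" using add(3) by (rule pure_tensor_closed)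
      note hr = H.pure_hom_right[OF x, of k, folded HM_eq]
      have "H.bp k x (r \<odot>\<^bsub>TP (Suc (Suc k))\<^esub> pure_tensor R A xs) = H.bp k (r \<odot>\<^bsub>A\<^esub> x) (pure_tensor R A xs)"
        using x p add(2) by (simp add: module_hom_smult[OF H.pure_hom_right] module_hom_smult[OF H.pure_hom_left])
      also have "\<dots> = hcls (c \<otimes>\<^bsub>A\<^esub> (r \<odot>\<^bsub>A\<^esub> x) \<otimes>\<^bsub>A\<^esub> b) ws"
        using hochschild_pure_word[OF rx w(1,2,3)] w(4) by (simp add: hochschild_pure_eq)
      finally have e: "H.bp k x (r \<odot>\<^bsub>TP (Suc (Suc k))\<^esub> pure_tensor R A xs) = hcls (c \<otimes>\<^bsub>A\<^esub> (r \<odot>\<^bsub>A\<^esub> x) \<otimes>\<^bsub>A\<^esub> b) ws" .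
      have XY: "P (X \<oplus>\<^bsub>HM k\<^esub> H.bp k x Y)" using add(4) x X P by blast
      have bY: "H.bp k x Y \<in> carrier (HM k)" using module_hom_in_carrier[OF hr add(1)] .
      have cl: "c \<otimes>\<^bsub>A\<^esub> (r \<odot>\<^bsub>A\<^esub> x) \<otimes>\<^bsub>A\<^esub> b \<in> carrier A" using w rx by (simp add: amult_closed)
      have "P (X \<oplus>\<^bsub>HM k\<^esub> H.bp k x Y \<oplus>\<^bsub>HM k\<^esub> hcls (c \<otimes>\<^bsub>A\<^esub> (r \<odot>\<^bsub>A\<^esub> x) \<otimes>\<^bsub>A\<^esub> b) ws)"
        using assms(3)[OF _ XY cl w(3)] X bY by simp
      then show "P (X \<oplus>\<^bsub>HM k\<^esub> H.bp k x (Y \<oplus>\<^bsub>TP (Suc (Suc k))\<^esub> r \<odot>\<^bsub>TP (Suc (Suc k))\<^esub> pure_tensor R A xs))"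
        using add(1,2) p X bY hcls_closed[OF cl w(3)] by (simp add: module_hom_add[OF hr] e HMk.M.a_assoc)
    qed
  qed
  then show ?case using add by (simp add: HM_eq)
qed

lemma hochschild_hom_eqI:
  assumes P: "module R P"
    and h: "h \<in> module_hom R (HM k) P" "h' \<in> module_hom R (HM k) P"
    and eq: "\<And>a ws. a \<in> carrier A \<Longrightarrow> ws \<in> TW k \<Longrightarrow> h (hcls a ws) = h' (hcls a ws)"
    and X: "X \<in> carrier (HM k)"
  shows "h X = h' X"
  using X
proof (induction rule: hochschild_induct)
  case zero
  show ?case using module_hom_zero[OF module_hochschild P] h by metis
next
  case (add X a ws)
  then show ?case using eq hcls_closed[of a ws k] by (simp add: module_hom_add[OF h(1)] module_hom_add[OF h(2)])
qed

lemma multilin_hcls: "multilin R A (Suc k) (HM k) (\<lambda>v. hcls (hd v) (tl v))"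
proof -
  let ?u = "\<lambda>ws. \<one>\<^bsub>A\<^esub> # ws @ [\<one>\<^bsub>A\<^esub>]"
  have ml: "multilin R A k (H.BT k) (\<lambda>ws. H.bp k a (pure_tensor R A (?u ws)))" if a: "a \<in> carrier A" for a
  proof (rule multilin_comp_hom[OF _ H.pure_hom_right[OF a]], rule multilin_reindex[OF multilin_pure module_axioms one_word_closed])
    fix xs i assume xs: "xs \<in> TW k" and i: "i < k"
    then have "?u (xs[i := b]) = (?u xs)[Suc i := b]" for b
      by (simp add: list_update_append tensor_words_length)
    then show "\<exists>j<Suc (Suc k). \<exists>h\<in>module_hom R A A. \<forall>b\<in>carrier A. ?u (xs[i := b]) = (?u xs)[j := h b]"
      using module_hom_id i by (intro exI[of _ "Suc i"]) (auto intro!: bexI[of _ "\<lambda>x. x"])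
  qed
  have hc: "hcls a ws = H.bp k a (pure_tensor R A (?u ws))" if "ws \<in> TW k" for a ws
    using tensor_words_length[OF that] by (simp add: hcls_def hochschild_pure_eq)
  have split: "\<exists>a ws. v = a # ws \<and> a \<in> carrier A \<and> ws \<in> TW k" if "v \<in> TW (Suc k)" for v
    using that by (cases v) (auto simp: tensor_words_def)
  show ?thesis
    unfolding HM_eq
  proof (rule multilinI)
    fix v assume v: "v \<in> TW (Suc k)"
    obtain a ws where w: "v = a # ws" "a \<in> carrier A" "ws \<in> TW k" using split[OF v] by blast
    show "hcls (hd v) (tl v) \<in> carrier (H.BT k)" using hcls_closed[OF w(2,3)] w(1) by (simp add: HM_eq)
    fix i b assume i: "i < Suc k" and b: "b \<in> carrier A"
    note upd = tensor_words_update[OF w(3)]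
    note pl = H.pure_hom_left[OF pure_tensor_closed[OF one_word_closed[OF w(3)]]]
    show "hcls (hd (v[i := b \<oplus>\<^bsub>A\<^esub> c])) (tl (v[i := b \<oplus>\<^bsub>A\<^esub> c])) =
        hcls (hd (v[i := b])) (tl (v[i := b])) \<oplus>\<^bsub>H.BT k\<^esub> hcls (hd (v[i := c])) (tl (v[i := c]))"
      if c: "c \<in> carrier A" for c
      using i b c w upd
      by (cases i) (auto simp: hc multilinD(2)[OF ml] module_hom_add[OF pl])
    show "hcls (hd (v[i := r \<odot>\<^bsub>A\<^esub> b])) (tl (v[i := r \<odot>\<^bsub>A\<^esub> b])) =
        r \<odot>\<^bsub>H.BT k\<^esub> hcls (hd (v[i := b])) (tl (v[i := b]))"
      if r: "r \<in> carrier R" for r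
      using i b r w upd
      by (cases i) (auto simp: hc multilinD(3)[OF ml] module_hom_smult[OF pl])
  qed
qed

text \<open>Together with \<open>multilin_hcls\<close> this is the identification of the Hochschild
  module of degree \<open>k\<close> with the tensor power of length \<open>k + 1\<close>, phrased as
  a universal property.\<close>

lemma hochschild_lift:
  assumes P: "module R P" and \<psi>: "multilin R A (Suc k) P \<psi>"
  obtains h where "h \<in> module_hom R (HM k) P"
    and "\<And>a ws. a \<in> carrier A \<Longrightarrow> ws \<in> TW k \<Longrightarrow> h (hcls a ws) = \<psi> (a # ws)"
proof -
  interpret P: module R P by (rule P)
  \<comment> \<open>The inverse identification on words: closing the word to a cycle multiplies the
    last letter, \<open>x\<close> and the first letter, in this order.\<close>
  define g where "g x xs = (xs ! Suc k \<otimes>\<^bsub>A\<^esub> x \<otimes>\<^bsub>A\<^esub> xs ! 0) # butlast (tl xs)" for x xs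
  have gw: "g x (b # ws @ [c]) = (c \<otimes>\<^bsub>A\<^esub> x \<otimes>\<^bsub>A\<^esub> b) # ws" if "ws \<in> TW k" for x b c ws
    using tensor_words_length[OF that] by (simp add: g_def nth_append)
  have gc: "g x xs \<in> TW (Suc k)" if x: "x \<in> carrier A" and xs: "xs \<in> TW (Suc (Suc k))" for x xs
  proof -
    obtain b ws c where w: "b \<in> carrier A" "c \<in> carrier A" "ws \<in> TW k" "xs = b # ws @ [c]"
      by (rule tensor_word_split[OF xs])
    have "c \<otimes>\<^bsub>A\<^esub> x \<otimes>\<^bsub>A\<^esub> b \<in> carrier A" using w x by (simp add: amult_closed)
    then show ?thesis unfolding w(4) gw[OF w(3)] using w(3) by (simp add: tensor_words_def)
  qed
  have mlg: "multilin R A (Suc (Suc k)) P (\<lambda>xs. \<psi> (g x xs))" if x: "x \<in> carrier A" for x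
  proof (rule multilin_reindex[OF \<psi> module_axioms gc[OF x]])
    fix xs i assume xs: "xs \<in> TW (Suc (Suc k))" and i: "i < Suc (Suc k)"
    obtain b ws c where w: "b \<in> carrier A" "c \<in> carrier A" "ws \<in> TW k" "xs = b # ws @ [c]"
      by (rule tensor_word_split[OF xs])
    have len: "length ws = k" using w(3) by (rule tensor_words_length)
    consider "i = 0" | "i = Suc k" | j where "i = Suc j" "j < k"
      using i by (cases i) (auto simp: less_Suc_eq)
    then show "\<exists>j<Suc k. \<exists>h\<in>module_hom R A A. \<forall>a\<in>carrier A. g x (xs[i := a]) = (g x xs)[j := h a]"
    proof cases
      case 1
      have "(\<lambda>a. c \<otimes>\<^bsub>A\<^esub> x \<otimes>\<^bsub>A\<^esub> a) \<in> module_hom R A A"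
        using w x by (intro amult_hom_right amult_closed)
      moreover have "\<forall>a\<in>carrier A. g x (xs[i := a]) = (g x xs)[0 := c \<otimes>\<^bsub>A\<^esub> x \<otimes>\<^bsub>A\<^esub> a]"
        using 1 w gw by simp
      ultimately show ?thesis by blast
    next
      case 2
      have "(\<lambda>a. a \<otimes>\<^bsub>A\<^esub> x \<otimes>\<^bsub>A\<^esub> b) \<in> module_hom R A A"
        using module_hom_comp[OF amult_hom_left[OF x] amult_hom_left[OF w(1)]] .
      moreover have "xs[i := a] = b # ws @ [a]" for a
        using 2 w len by (simp add: list_update_append)
      then have "\<forall>a\<in>carrier A. g x (xs[i := a]) = (g x xs)[0 := a \<otimes>\<^bsub>A\<^esub> x \<otimes>\<^bsub>A\<^esub> b]"
        using w gw by simp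
      ultimately show ?thesis
        by (intro exI[of _ 0] conjI bexI[where x="\<lambda>a. a \<otimes>\<^bsub>A\<^esub> x \<otimes>\<^bsub>A\<^esub> b"]) auto
    next
      case 3
      have "xs[i := a] = b # ws[j := a] @ [c]" for a
        using 3 w len by (simp add: list_update_append)
      then have "\<forall>a\<in>carrier A. g x (xs[i := a]) = (g x xs)[i := a]"
        using w gw 3 by (simp add: tensor_words_update)
      then show ?thesis using module_hom_id 3 by (intro exI[of _ i]) (auto intro!: bexI[of _ "\<lambda>x. x"])
    qed
  qed
  define f where "f x y = presented_lift R P (\<lambda>xs. \<psi> (g x xs)) y" for x y
  have f_hom: "f x \<in> module_hom R (TP (Suc (Suc k))) P" if "x \<in> carrier A" for x
    unfolding f_def[abs_def] by (rule tensor_lift_hom[OF P mlg[OF that]])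
  have f_pure: "f x (pure_tensor R A xs) = \<psi> (g x xs)" if "x \<in> carrier A" "xs \<in> TW (Suc (Suc k))" for x xs
    unfolding f_def using that by (intro tensor_lift_pure[OF P mlg])
  have \<psi>0: "\<psi> (x # ws) \<in> carrier P" if "x \<in> carrier A" "ws \<in> TW k" for x ws
    using that by (intro multilinD(1)[OF \<psi>]) (auto simp: tensor_words_def)
  have \<psi>_hom: "(\<lambda>x. \<psi> (x # ws)) \<in> module_hom R A P" if ws: "ws \<in> TW k" for ws
  proof (rule module_homI)
    fix x assume x: "x \<in> carrier A"
    have v: "x # ws \<in> TW (Suc k)" using x ws by (auto simp: tensor_words_def)
    show "\<psi> (x # ws) \<in> carrier P" using x ws by (rule \<psi>0)
    show "\<psi> ((x \<oplus>\<^bsub>A\<^esub> y) # ws) = \<psi> (x # ws) \<oplus>\<^bsub>P\<^esub> \<psi> (y # ws)" if "y \<in> carrier A" for y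
      using multilinD(2)[OF \<psi> v, of 0 x y] x that by simp
    show "\<psi> ((r \<odot>\<^bsub>A\<^esub> x) # ws) = r \<odot>\<^bsub>P\<^esub> \<psi> (x # ws)" if "r \<in> carrier R" for r
      using multilinD(3)[OF \<psi> v, of 0 x r] x that by simp
  qed
  have f_hom2: "(\<lambda>x. f x y) \<in> module_hom R A P" if y: "y \<in> carrier (TP (Suc (Suc k)))" for y
  proof (rule module_homI)
    fix x assume x: "x \<in> carrier A"
    show "f x y \<in> carrier P" using f_hom[OF x] y by (rule module_hom_in_carrier)
    show "f (x \<oplus>\<^bsub>A\<^esub> x') y = f x y \<oplus>\<^bsub>P\<^esub> f x' y" if x': "x' \<in> carrier A" for x'
    proof (rule tensor_hom_eqI[OF P f_hom P.module_hom_pointwise_add[OF f_hom f_hom] _ y])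
      fix xs assume xs: "xs \<in> TW (Suc (Suc k))"
      obtain b ws c where w: "b \<in> carrier A" "c \<in> carrier A" "ws \<in> TW k" "xs = b # ws @ [c]"
        by (rule tensor_word_split[OF xs])
      show "f (x \<oplus>\<^bsub>A\<^esub> x') (pure_tensor R A xs) = f x (pure_tensor R A xs) \<oplus>\<^bsub>P\<^esub> f x' (pure_tensor R A xs)"
        using w xs x x' by (simp add: f_pure gw amult_closed module_hom_add[OF amult_hom_right]
            module_hom_add[OF amult_hom_left] module_hom_add[OF \<psi>_hom])
    qed (use x x' in auto)
    show "f (r \<odot>\<^bsub>A\<^esub> x) y = r \<odot>\<^bsub>P\<^esub> f x y" if r: "r \<in> carrier R" for r
    proof (rule tensor_hom_eqI[OF P f_hom P.module_hom_pointwise_smult[OF f_hom] _ y])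
      fix xs assume xs: "xs \<in> TW (Suc (Suc k))"
      obtain b ws c where w: "b \<in> carrier A" "c \<in> carrier A" "ws \<in> TW k" "xs = b # ws @ [c]"
        by (rule tensor_word_split[OF xs])
      show "f (r \<odot>\<^bsub>A\<^esub> x) (pure_tensor R A xs) = r \<odot>\<^bsub>P\<^esub> f x (pure_tensor R A xs)"
        using w xs x r by (simp add: f_pure gw amult_closed module_hom_smult[OF amult_hom_right]
            module_hom_smult[OF amult_hom_left] module_hom_smult[OF \<psi>_hom])
    qed (use x r in auto)
  qed
  have bal: "f (env_right_act R A x s) y = f x (bar_left_act R A k s y)"
    if x: "x \<in> carrier A" and s: "s \<in> carrier (enveloping R A)" and y: "y \<in> carrier (TP (Suc (Suc k)))" for x s y
  proof (rule tensor_hom_eqI[OF P module_hom_comp[OF env_act_hom[OF x] f_hom2[OF y]]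
        module_hom_comp[OF bar_act_hom_left[OF y] f_hom[OF x]] _ s[unfolded carrier_enveloping]])
    fix u assume u: "u \<in> TW 2"
    obtain a0 a1 where a: "u = [a0, a1]" "a0 \<in> carrier A" "a1 \<in> carrier A"
      using u by (auto simp: tensor_words_def numeral_2_eq_2 length_Suc_conv)
    have xa: "env_right_act R A x (pure_tensor R A u) = a1 \<otimes>\<^bsub>A\<^esub> x \<otimes>\<^bsub>A\<^esub> a0"
      using a x by (simp add: env_act_pure)
    have xac: "a1 \<otimes>\<^bsub>A\<^esub> x \<otimes>\<^bsub>A\<^esub> a0 \<in> carrier A" using a x by (simp add: amult_closed)
    have "f (a1 \<otimes>\<^bsub>A\<^esub> x \<otimes>\<^bsub>A\<^esub> a0) y = f x (outer_map k u y)"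
    proof (rule tensor_hom_eqI[OF P f_hom[OF xac] module_hom_comp[OF outer_map_hom[OF u] f_hom[OF x]] _ y])
      fix xs assume xs: "xs \<in> TW (Suc (Suc k))"
      obtain b ws c where w: "b \<in> carrier A" "c \<in> carrier A" "ws \<in> TW k" "xs = b # ws @ [c]"
        by (rule tensor_word_split[OF xs])
      have "outer_mult k u xs = (a0 \<otimes>\<^bsub>A\<^esub> b) # ws @ [c \<otimes>\<^bsub>A\<^esub> a1]"
        using w a tensor_words_length[OF w(3)] by (simp add: outer_mult_def nth_append list_update_append)
      then show "f (a1 \<otimes>\<^bsub>A\<^esub> x \<otimes>\<^bsub>A\<^esub> a0) (pure_tensor R A xs) = f x (outer_map k u (pure_tensor R A xs))"
        using w xs x xac u a outer_mult_closed[OF u xs]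
        by (simp add: outer_map_pure f_pure gw amult_assoc amult_closed)
    qed
    then show "f (env_right_act R A x (pure_tensor R A u)) y = f x (bar_left_act R A k (pure_tensor R A u) y)"
      using u y by (simp add: xa bar_act_pure_left)
  qed
  note lift = H.balanced_lift[of P f, OF P f_hom f_hom2 bal]
  have lp: "presented_lift R P (\<lambda>(x, y). f x y) (H.bp k x y) = f x y"
    if "x \<in> carrier A" "y \<in> carrier (TP (Suc (Suc k)))" for x y
    by (rule lift(2)) (use that in auto)
  show thesis
  proof (rule that)
    show "presented_lift R P (\<lambda>(x, y). f x y) \<in> module_hom R (HM k) P"
      unfolding HM_eq by (rule lift(1))
    fix a ws assume aw: "a \<in> carrier A" "ws \<in> TW k"
    then show "presented_lift R P (\<lambda>(x, y). f x y) (hcls a ws) = \<psi> (a # ws)"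
      using lp[OF aw(1) pure_tensor_closed[OF one_word_closed[OF aw(2)]]] one_word_closed[OF aw(2)]
      by (simp add: hcls_def hochschild_pure_eq tensor_words_length f_pure gw ar_one al_one)
  qed
qed

end

section \<open>Additive maps between free abelian groups\<close>

text \<open>Chain maps and homotopies are kept as maps between finitely supported integer functions.
  Additivity alone makes them determined by their values on the basis and compatible with integer
  multiples.\<close>

definition additive :: "(('a \<Rightarrow>\<^sub>0 int) \<Rightarrow> ('b \<Rightarrow>\<^sub>0 int)) \<Rightarrow> bool" where
  "additive f \<longleftrightarrow> (\<forall>x y. f (x + y) = f x + f y)"

lemma additive_add: "additive f \<Longrightarrow> f (x + y) = f x + f y"
  by (simp add: additive_def)

lemma additive_zero: "additive f \<Longrightarrow> f 0 = 0"
  using additive_add[of f 0 0] by simp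

lemma additive_uminus: "additive f \<Longrightarrow> f (- x) = - f x"
  using additive_add[of f x "- x"] by (simp add: additive_zero eq_neg_iff_add_eq_0 add.commute)

lemma additive_diff: "additive f \<Longrightarrow> f (x - y) = f x - f y"
  using additive_add[of f x "- y"] by (simp add: additive_uminus)

lemma additive_sum: "additive f \<Longrightarrow> f (sum g A) = (\<Sum>i\<in>A. f (g i))"
  by (induction A rule: infinite_finite_induct) (simp_all add: additive_zero additive_add)

lemma additive_frag_extend: "additive (frag_extend f)"
  by (simp add: additive_def frag_extend_add)

lemma additive_comp: "additive f \<Longrightarrow> additive g \<Longrightarrow> additive (\<lambda>x. f (g x))"
  by (simp add: additive_def)

lemma additive_plus: "additive f \<Longrightarrow> additive g \<Longrightarrow> additive (\<lambda>x. f x + g x :: 'a \<Rightarrow>\<^sub>0 int)"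
  by (simp add: additive_def algebra_simps)

lemma additive_minus: "additive f \<Longrightarrow> additive g \<Longrightarrow> additive (\<lambda>x. f x - g x :: 'a \<Rightarrow>\<^sub>0 int)"
  by (simp add: additive_def algebra_simps)

lemma additive_cmul: "additive f \<Longrightarrow> additive (\<lambda>x. frag_cmul c (f x))"
  by (simp add: additive_def frag_cmul_distrib2)

lemma additive_id: "additive (\<lambda>x. x)"
  by (simp add: additive_def)

lemma additive_zero_map: "additive (\<lambda>x. 0 :: 'a \<Rightarrow>\<^sub>0 int)"
  by (simp add: additive_def)

lemmas additive_intros = additive_frag_extend additive_plus additive_minus additive_cmul additive_id
  additive_zero_map

lemma additive_frag_cmul:
  fixes f :: "('a \<Rightarrow>\<^sub>0 int) \<Rightarrow> ('b \<Rightarrow>\<^sub>0 int)"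
  assumes "additive f" shows "f (frag_cmul c x) = frag_cmul c (f x)"
proof -
  have nat: "f (frag_cmul (int n) x) = frag_cmul (int n) (f x)" for n
    by (induction n) (simp_all add: additive_zero[OF assms] frag_cmul_distrib additive_add[OF assms])
  show ?thesis
  proof (cases c rule: int_cases2)
    case (nonpos m)
    then show ?thesis by (simp add: additive_uminus[OF assms] nat flip: minus_frag_cmul)
  qed (simp add: nat)
qed

lemma additive_eqI:
  fixes f g :: "('a \<Rightarrow>\<^sub>0 int) \<Rightarrow> ('b \<Rightarrow>\<^sub>0 int)"
  assumes "additive f" "additive g" "Poly_Mapping.keys p \<subseteq> S"
    and "\<And>x. x \<in> S \<Longrightarrow> f (frag_of x) = g (frag_of x)"
  shows "f p = g p"
  using assms(3)
  by (induction rule: frag_induction)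
    (simp_all add: additive_zero[OF assms(1)] additive_zero[OF assms(2)] assms(4)
      additive_diff[OF assms(1)] additive_diff[OF assms(2)])

lemma additive_eqI_UNIV:
  fixes f g :: "('a \<Rightarrow>\<^sub>0 int) \<Rightarrow> ('b \<Rightarrow>\<^sub>0 int)"
  assumes "additive f" "additive g" "\<And>x. f (frag_of x) = g (frag_of x)"
  shows "f p = g p"
  by (rule additive_eqI[OF assms(1,2) subset_UNIV assms(3)])

lemma keys_additive:
  fixes f :: "('a \<Rightarrow>\<^sub>0 int) \<Rightarrow> ('b \<Rightarrow>\<^sub>0 int)"
  assumes "additive f" "Poly_Mapping.keys p \<subseteq> S"
    and "\<And>x. x \<in> S \<Longrightarrow> Poly_Mapping.keys (f (frag_of x)) \<subseteq> T"
  shows "Poly_Mapping.keys (f p) \<subseteq> T"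
  using assms(2)
proof (induction rule: frag_induction)
  case (diff a b)
  then show ?case using keys_diff[of "f a" "f b"] by (auto simp: additive_diff[OF assms(1)])
qed (use assms in \<open>auto simp: additive_zero\<close>)

lemma keys_cmul_frag_of_subset:
  "(c \<noteq> 0 \<Longrightarrow> x \<in> T) \<Longrightarrow> Poly_Mapping.keys (frag_cmul c (frag_of x)) \<subseteq> T"
  by (cases "c = 0") (use keys_cmul[of c "frag_of x"] in auto)

lemma keys_sum_subset:
  fixes f :: "'i \<Rightarrow> 'a \<Rightarrow>\<^sub>0 int"
  assumes "\<And>i. i \<in> I \<Longrightarrow> Poly_Mapping.keys (f i) \<subseteq> T"
  shows "Poly_Mapping.keys (sum f I) \<subseteq> T"
  using assms
proof (induction I rule: infinite_finite_induct)
  case (insert x F)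
  then show ?case using Poly_Mapping.keys_add[of "f x" "sum f F"] by fastforce
qed auto

lemma keys_add_subset:
  fixes p q :: "'a \<Rightarrow>\<^sub>0 int"
  shows "Poly_Mapping.keys p \<subseteq> T \<Longrightarrow> Poly_Mapping.keys q \<subseteq> T \<Longrightarrow> Poly_Mapping.keys (p + q) \<subseteq> T"
  using Poly_Mapping.keys_add[of p q] by blast

lemma keys_diff_subset:
  fixes p q :: "'a \<Rightarrow>\<^sub>0 int"
  shows "Poly_Mapping.keys p \<subseteq> T \<Longrightarrow> Poly_Mapping.keys q \<subseteq> T \<Longrightarrow> Poly_Mapping.keys (p - q) \<subseteq> T"
  using keys_diff[of p q] by blast

lemma frag_add_self_eq_0:
  fixes x :: "'a \<Rightarrow>\<^sub>0 int"
  assumes "x + x = 0" shows "x = 0"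
proof -
  have "frag_cmul 2 x = 0" using assms frag_cmul_distrib[of 1 1 x] by simp
  then show ?thesis by (simp only: frag_cmul_eq_0_iff) simp
qed

section \<open>Free bimodules over the exterior algebra\<close>

locale exterior =
  fixes n :: nat
begin

text \<open>The sign with \<open>x\<^sub>\<sigma> x\<^sub>\<tau> = sg \<sigma> \<tau> x\<^sub>\<sigma>\<^sub>\<union>\<^sub>\<tau>\<close>. Restricting the inversions
  to \<open>{..n}\<close> keeps the cocycle identity valid for arbitrary sets.\<close>

definition inv_pairs :: "nat set \<Rightarrow> nat set \<Rightarrow> (nat \<times> nat) set" where
  "inv_pairs \<sigma> \<tau> = {(i, j). i \<in> \<sigma> \<and> j \<in> \<tau> \<and> j < i \<and> i \<le> n}"

definition sg :: "nat set \<Rightarrow> nat set \<Rightarrow> int" where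
  "sg \<sigma> \<tau> = (if \<sigma> \<inter> \<tau> = {} then (-1) ^ card (inv_pairs \<sigma> \<tau>) else 0)"

lemma finite_inv_pairs: "finite (inv_pairs \<sigma> \<tau>)"
  by (rule finite_subset[of _ "{..n} \<times> {..n}"]) (auto simp: inv_pairs_def)

lemma sg_empty [simp]: "sg {} \<tau> = 1" "sg \<sigma> {} = 1"
  by (simp_all add: sg_def inv_pairs_def)

text \<open>For pairwise disjoint sets both exponents count the inversions between all three pairs;
  otherwise both sides vanish. This is associativity of the exterior product on basis
  elements.\<close>

lemma sg_assoc: "sg \<sigma> \<tau> * sg (\<sigma> \<union> \<tau>) \<rho> = sg \<tau> \<rho> * sg \<sigma> (\<tau> \<union> \<rho>)"
proof (cases "\<sigma> \<inter> \<tau> = {} \<and> \<sigma> \<inter> \<rho> = {} \<and> \<tau> \<inter> \<rho> = {}")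
  case True
  have "inv_pairs (\<sigma> \<union> \<tau>) \<rho> = inv_pairs \<sigma> \<rho> \<union> inv_pairs \<tau> \<rho>"
    "inv_pairs \<sigma> (\<tau> \<union> \<rho>) = inv_pairs \<sigma> \<tau> \<union> inv_pairs \<sigma> \<rho>"
    by (auto simp: inv_pairs_def)
  moreover have "inv_pairs \<sigma> \<rho> \<inter> inv_pairs \<tau> \<rho> = {}" "inv_pairs \<sigma> \<tau> \<inter> inv_pairs \<sigma> \<rho> = {}"
    using True by (auto simp: inv_pairs_def)
  ultimately have "card (inv_pairs (\<sigma> \<union> \<tau>) \<rho>) = card (inv_pairs \<sigma> \<rho>) + card (inv_pairs \<tau> \<rho>)"
    "card (inv_pairs \<sigma> (\<tau> \<union> \<rho>)) = card (inv_pairs \<sigma> \<tau>) + card (inv_pairs \<sigma> \<rho>)"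
    by (simp_all add: card_Un_disjoint finite_inv_pairs)
  then show ?thesis using True by (simp add: sg_def Int_Un_distrib Int_Un_distrib2 power_add)
next
  case False
  then show ?thesis by (auto simp: sg_def Int_Un_distrib Int_Un_distrib2)
qed

lemma sg_nonzero: "sg \<sigma> \<tau> \<noteq> 0 \<longleftrightarrow> \<sigma> \<inter> \<tau> = {}"
  by (simp add: sg_def)

abbreviation "XS \<equiv> Pow {1..n}"

text \<open>The triple \<open>(a, g, b)\<close> encodes the basis element x_a \<otimes> g \<otimes>
  x_b of the free bimodule on the generators \<open>g\<close>. Only basis elements of the algebra
  act, which suffices by additivity.\<close>

definition lact :: "nat set \<Rightarrow> (nat set \<times> 'g \<times> nat set \<Rightarrow>\<^sub>0 int) \<Rightarrow> (nat set \<times> 'g \<times> nat set \<Rightarrow>\<^sub>0 int)" where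
  "lact \<sigma> = frag_extend (\<lambda>(a, g, b). frag_cmul (sg \<sigma> a) (frag_of (\<sigma> \<union> a, g, b)))"

definition ract :: "(nat set \<times> 'g \<times> nat set \<Rightarrow>\<^sub>0 int) \<Rightarrow> nat set \<Rightarrow> (nat set \<times> 'g \<times> nat set \<Rightarrow>\<^sub>0 int)" where
  "ract p \<tau> = frag_extend (\<lambda>(a, g, b). frag_cmul (sg b \<tau>) (frag_of (a, g, b \<union> \<tau>))) p"

lemma lact_of: "lact \<sigma> (frag_of (a, g, b)) = frag_cmul (sg \<sigma> a) (frag_of (\<sigma> \<union> a, g, b))"
  by (simp add: lact_def)

lemma ract_of: "ract (frag_of (a, g, b)) \<tau> = frag_cmul (sg b \<tau>) (frag_of (a, g, b \<union> \<tau>))"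
  by (simp add: ract_def)

lemma additive_lact: "additive (lact \<sigma>)"
  unfolding lact_def by (rule additive_frag_extend)

lemma additive_ract: "additive (\<lambda>p. ract p \<tau>)"
  unfolding ract_def by (rule additive_frag_extend)

lemmas lact_simps = lact_of additive_frag_cmul[OF additive_lact] additive_add[OF additive_lact]
  additive_diff[OF additive_lact] additive_sum[OF additive_lact] additive_zero[OF additive_lact]

lemmas ract_simps = ract_of additive_frag_cmul[OF additive_ract] additive_add[OF additive_ract]
  additive_diff[OF additive_ract] additive_sum[OF additive_ract] additive_zero[OF additive_ract]

lemma lact_lact: "lact \<sigma> (lact \<tau> p) = frag_cmul (sg \<sigma> \<tau>) (lact (\<sigma> \<union> \<tau>) p)"
proof (rule additive_eqI_UNIV[of "\<lambda>p. lact \<sigma> (lact \<tau> p)"])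
  fix x :: "nat set \<times> 'g \<times> nat set"
  obtain a g b where x: "x = (a, g, b)" by (cases x)
  show "lact \<sigma> (lact \<tau> (frag_of x)) = frag_cmul (sg \<sigma> \<tau>) (lact (\<sigma> \<union> \<tau>) (frag_of x))"
    using sg_assoc[of \<sigma> \<tau> a] by (simp add: x lact_simps Un_assoc)
qed (intro additive_intros additive_comp[OF additive_lact] additive_lact)+

lemma ract_ract: "ract (ract p \<sigma>) \<tau> = frag_cmul (sg \<sigma> \<tau>) (ract p (\<sigma> \<union> \<tau>))"
proof (rule additive_eqI_UNIV[of "\<lambda>p. ract (ract p \<sigma>) \<tau>"])
  fix x :: "nat set \<times> 'g \<times> nat set"
  obtain a g b where x: "x = (a, g, b)" by (cases x)
  show "ract (ract (frag_of x) \<sigma>) \<tau> = frag_cmul (sg \<sigma> \<tau>) (ract (frag_of x) (\<sigma> \<union> \<tau>))"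
    using sg_assoc[of b \<sigma> \<tau>] by (simp add: x ract_simps Un_assoc)
qed (intro additive_intros additive_comp[OF additive_ract] additive_ract)+

lemma lact_ract: "lact \<sigma> (ract p \<tau>) = ract (lact \<sigma> p) \<tau>"
proof (rule additive_eqI_UNIV[of "\<lambda>p. lact \<sigma> (ract p \<tau>)"])
  fix x :: "nat set \<times> 'g \<times> nat set"
  obtain a g b where x: "x = (a, g, b)" by (cases x)
  show "lact \<sigma> (ract (frag_of x) \<tau>) = ract (lact \<sigma> (frag_of x)) \<tau>"
    by (simp add: x ract_simps lact_simps mult.commute)
qed (intro additive_comp[OF additive_lact] additive_comp[OF additive_ract] additive_lact additive_ract)+

lemma frag_of_triple: "frag_of (a, g, b) = lact a (ract (frag_of ({}, g, {})) b)"
  by (simp add: lact_simps ract_simps)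

definition bihom :: "((nat set \<times> 'g \<times> nat set \<Rightarrow>\<^sub>0 int) \<Rightarrow> (nat set \<times> 'h \<times> nat set \<Rightarrow>\<^sub>0 int)) \<Rightarrow> bool" where
  "bihom f \<longleftrightarrow> additive f \<and> (\<forall>\<sigma> p. f (lact \<sigma> p) = lact \<sigma> (f p)) \<and> (\<forall>p \<tau>. f (ract p \<tau>) = ract (f p) \<tau>)"

lemma bihomD:
  assumes "bihom f"
  shows "additive f" "f (lact \<sigma> p) = lact \<sigma> (f p)" "f (ract p \<tau>) = ract (f p) \<tau>"
  using assms by (auto simp: bihom_def)

lemma bihomI_basis:
  assumes f: "additive f"
    and "\<And>\<sigma> a g b. f (lact \<sigma> (frag_of (a, g, b))) = lact \<sigma> (f (frag_of (a, g, b)))"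
    and "\<And>\<tau> a g b. f (ract (frag_of (a, g, b)) \<tau>) = ract (f (frag_of (a, g, b))) \<tau>"
  shows "bihom f"
  unfolding bihom_def
proof (intro conjI allI f)
  show "f (lact \<sigma> p) = lact \<sigma> (f p)" for \<sigma> p
    by (rule additive_eqI_UNIV[of "\<lambda>p. f (lact \<sigma> p)" "\<lambda>p. lact \<sigma> (f p)"])
      (use assms in \<open>auto intro: additive_comp additive_lact\<close>)
  show "f (ract p \<tau>) = ract (f p) \<tau>" for \<tau> p
    by (rule additive_eqI_UNIV[of "\<lambda>p. f (ract p \<tau>)" "\<lambda>p. ract (f p) \<tau>"])
      (use assms in \<open>auto intro: additive_comp additive_ract\<close>)
qed

lemma bihom_comp: "bihom f \<Longrightarrow> bihom g \<Longrightarrow> bihom (\<lambda>x. f (g x))"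
  by (simp add: bihom_def additive_def)

lemma bihom_diff: "bihom f \<Longrightarrow> bihom g \<Longrightarrow> bihom (\<lambda>x. f x - g x)"
  by (simp add: bihom_def additive_minus lact_simps ract_simps)

lemma bihom_id: "bihom (\<lambda>x. x)"
  by (simp add: bihom_def additive_id)

lemma bihom_zero: "bihom (\<lambda>x. 0)"
  by (simp add: bihom_def additive_zero_map lact_simps ract_simps)

definition bext :: "('g \<Rightarrow> (nat set \<times> 'h \<times> nat set \<Rightarrow>\<^sub>0 int)) \<Rightarrow>
    (nat set \<times> 'g \<times> nat set \<Rightarrow>\<^sub>0 int) \<Rightarrow> (nat set \<times> 'h \<times> nat set \<Rightarrow>\<^sub>0 int)" where
  "bext \<phi> = frag_extend (\<lambda>(a, g, b). lact a (ract (\<phi> g) b))"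

lemma additive_bext: "additive (bext \<phi>)"
  unfolding bext_def by (rule additive_frag_extend)

lemma bext_of: "bext \<phi> (frag_of (a, g, b)) = lact a (ract (\<phi> g) b)"
  by (simp add: bext_def)

lemma bihom_bext: "bihom (bext \<phi>)"
  by (rule bihomI_basis)
    (simp_all add: additive_bext lact_of ract_of bext_of additive_frag_cmul[OF additive_bext] lact_lact
      lact_ract[symmetric] ract_ract lact_simps)

lemma lact_empty: "lact {} p = p"
  by (rule additive_eqI_UNIV[of "lact {}" "\<lambda>p. p"]) (auto simp: additive_lact additive_id lact_of)

lemma ract_empty: "ract p {} = p"
  by (rule additive_eqI_UNIV[of "\<lambda>p. ract p {}" "\<lambda>p. p"]) (auto simp: additive_ract additive_id ract_of)

text \<open>The type admits triples over arbitrary sets, so the sign identities hold without side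
  conditions; \<open>PM\<close> singles out the bimodule on the generators \<open>G\<close> over the
  actual exterior algebra in \<open>n\<close> variables.\<close>

definition PM :: "'g set \<Rightarrow> (nat set \<times> 'g \<times> nat set \<Rightarrow>\<^sub>0 int) set" where
  "PM G = {p. Poly_Mapping.keys p \<subseteq> XS \<times> G \<times> XS}"

lemma lact_PM: "p \<in> PM G \<Longrightarrow> \<sigma> \<in> XS \<Longrightarrow> lact \<sigma> p \<in> PM G"
  unfolding PM_def mem_Collect_eq
  by (rule keys_additive[OF additive_lact], assumption)
    (elim SigmaE, simp only: lact_of, rule keys_cmul_frag_of_subset, blast)

lemma ract_PM: "p \<in> PM G \<Longrightarrow> \<tau> \<in> XS \<Longrightarrow> ract p \<tau> \<in> PM G"
  unfolding PM_def mem_Collect_eq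
  by (rule keys_additive[OF additive_ract], assumption)
    (elim SigmaE, simp only: ract_of, rule keys_cmul_frag_of_subset, blast)

lemma bihom_eqI:
  assumes "bihom f" "bihom f'" "p \<in> PM G"
    and "\<And>g. g \<in> G \<Longrightarrow> f (frag_of ({}, g, {})) = f' (frag_of ({}, g, {}))"
  shows "f p = f' p"
proof (rule additive_eqI[OF bihomD(1)[OF assms(1)] bihomD(1)[OF assms(2)]])
  show "Poly_Mapping.keys p \<subseteq> XS \<times> G \<times> XS" using assms(3) by (simp add: PM_def)
  fix x assume "x \<in> XS \<times> G \<times> XS"
  then obtain a g b where x: "x = (a, g, b)" "g \<in> G" by auto
  show "f (frag_of x) = f' (frag_of x)"
    unfolding x(1) frag_of_triple[of a g b]
    using assms(4)[OF x(2)] by (simp add: bihomD[OF assms(1)] bihomD[OF assms(2)])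
qed

lemma bihom_PM:
  assumes f: "bihom f" and p: "p \<in> PM G"
    and "\<And>g. g \<in> G \<Longrightarrow> f (frag_of ({}, g, {})) \<in> PM G'"
  shows "f p \<in> PM G'"
proof -
  have "f (frag_of x) \<in> PM G'" if "x \<in> XS \<times> G \<times> XS" for x
  proof -
    obtain a g b where x: "x = (a, g, b)" by (cases x)
    have "g \<in> G" "a \<in> XS" "b \<in> XS" using that by (simp_all add: x)
    then show ?thesis
      unfolding x frag_of_triple[of a g b] bihomD[OF f]
      by (intro lact_PM ract_PM assms(3))
  qed
  then show ?thesis
    using p keys_additive[OF bihomD(1)[OF f], of p "XS \<times> G \<times> XS" "XS \<times> G' \<times> XS"]
    by (simp only: PM_def mem_Collect_eq)
qed

text \<open>Projectivity of a free bimodule: preimages are chosen for the generators only, and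
  \<open>bext\<close> extends the choice.\<close>

lemma bihom_lift:
  assumes u: "bihom u" and d: "bihom d"
    and ex: "\<And>g. g \<in> G \<Longrightarrow> \<exists>y \<in> PM G'. d y = u (frag_of ({}, g, {}))"
  shows "\<exists>f. bihom f \<and> (\<forall>p \<in> PM G. f p \<in> PM G' \<and> d (f p) = u p)"
proof -
  obtain \<phi> where \<phi>: "\<And>g. g \<in> G \<Longrightarrow> \<phi> g \<in> PM G' \<and> d (\<phi> g) = u (frag_of ({}, g, {}))"
    using ex by metis
  have gen: "bext \<phi> (frag_of ({}, g, {})) = \<phi> g" for g
    by (simp add: bext_of lact_empty ract_empty)
  have "bext \<phi> p \<in> PM G'" if "p \<in> PM G" for p
    by (rule bihom_PM[OF bihom_bext that]) (simp add: gen \<phi>)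
  moreover have "d (bext \<phi> p) = u p" if "p \<in> PM G" for p
    by (rule bihom_eqI[OF bihom_comp[OF d bihom_bext] u that]) (simp add: gen \<phi>)
  ultimately show ?thesis using bihom_bext by blast
qed

section \<open>Resolutions and their comparison\<close>

lemma PM_gen: "g \<in> G \<Longrightarrow> frag_of ({}, g, {}) \<in> PM G"
  by (simp add: PM_def)

lemma PM_diff: "p \<in> PM G \<Longrightarrow> q \<in> PM G \<Longrightarrow> p - q \<in> PM G"
  by (simp add: PM_def keys_diff_subset)

lemma PM_add: "p \<in> PM G \<Longrightarrow> q \<in> PM G \<Longrightarrow> p + q \<in> PM G"
  by (simp add: PM_def keys_add_subset)

text \<open>One map \<open>d\<close> serves all degrees, the degree being carried by the generating
  set. Exactness is required in positive degrees only; the augmented end enters through the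
  hypothesis \<open>aug\<close> of \<open>chain_map_exists\<close>.\<close>

definition resolution ::
    "(nat \<Rightarrow> 'g set) \<Rightarrow> ((nat set \<times> 'g \<times> nat set \<Rightarrow>\<^sub>0 int) \<Rightarrow> (nat set \<times> 'g \<times> nat set \<Rightarrow>\<^sub>0 int)) \<Rightarrow> bool" where
  "resolution G d \<longleftrightarrow> bihom d \<and> (\<forall>k. \<forall>p \<in> PM (G (Suc k)). d p \<in> PM (G k)) \<and>
    (\<forall>k. \<forall>p \<in> PM (G (Suc k)). d (d p) = 0) \<and>
    (\<forall>k. \<forall>p \<in> PM (G (Suc k)). d p = 0 \<longrightarrow> (\<exists>y \<in> PM (G (Suc (Suc k))). d y = p))"

lemma resolutionD:
  assumes "resolution G d"
  shows "bihom d" "p \<in> PM (G (Suc k)) \<Longrightarrow> d p \<in> PM (G k)"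
    "p \<in> PM (G (Suc k)) \<Longrightarrow> d (d p) = 0"
    "p \<in> PM (G (Suc k)) \<Longrightarrow> d p = 0 \<Longrightarrow> \<exists>y \<in> PM (G (Suc (Suc k))). d y = p"
  using assms by (auto simp: resolution_def)

lemma chain_map_exists:
  assumes G: "resolution G d" and G': "resolution G' d'"
    and f0: "bihom f0" "\<And>p. p \<in> PM (G 0) \<Longrightarrow> f0 p \<in> PM (G' 0)"
    and aug: "\<And>p. p \<in> PM (G (Suc 0)) \<Longrightarrow> \<exists>y \<in> PM (G' (Suc 0)). d' y = f0 (d p)"
  shows "\<exists>f. f 0 = f0 \<and> (\<forall>k. bihom (f k) \<and> (\<forall>p \<in> PM (G k). f k p \<in> PM (G' k)) \<and>
    (\<forall>p \<in> PM (G (Suc k)). d' (f (Suc k) p) = f k (d p)))"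
proof -
  \<comment> \<open>The invariant carries the one fact about degree \<open>k\<close> that the next
    lift needs: \<open>f\<close> after \<open>d\<close> lands in the image of \<open>d'\<close>. In
    degree 0 this is \<open>aug\<close>; afterwards it follows from exactness.\<close>
  define I where "I k f \<longleftrightarrow> (k = 0 \<longrightarrow> f = f0) \<and> bihom f \<and> (\<forall>p \<in> PM (G k). f p \<in> PM (G' k)) \<and>
    (\<forall>p \<in> PM (G (Suc k)). \<exists>y \<in> PM (G' (Suc k)). d' y = f (d p))" for k f
  define Q where "Q k f f' \<longleftrightarrow> (\<forall>p \<in> PM (G (Suc k)). d' (f' p) = f (d p))" for k and f f' :: "_ \<Rightarrow> _"
  have ex: "\<exists>f. \<forall>k. I k (f k) \<and> Q k (f k) (f (Suc k))"
  proof (rule dependent_nat_choice)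
    show "\<exists>f. I 0 f" using f0 aug by (auto simp: I_def)
    fix f k assume f: "I k f"
    then have bf: "bihom f" by (simp add: I_def)
    have "\<exists>f'. bihom f' \<and> (\<forall>p \<in> PM (G (Suc k)). f' p \<in> PM (G' (Suc k)) \<and> d' (f' p) = f (d p))"
      using f by (intro bihom_lift bihom_comp[OF bf] resolutionD(1)[OF G] resolutionD(1)[OF G'])
        (auto simp: I_def PM_gen)
    then obtain f' where f': "bihom f'" "\<And>p. p \<in> PM (G (Suc k)) \<Longrightarrow> f' p \<in> PM (G' (Suc k))"
      "\<And>p. p \<in> PM (G (Suc k)) \<Longrightarrow> d' (f' p) = f (d p)" by blast
    have "\<exists>y \<in> PM (G' (Suc (Suc k))). d' y = f' (d p)" if p: "p \<in> PM (G (Suc (Suc k)))" for p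
    proof (rule resolutionD(4)[OF G'])
      have dp: "d p \<in> PM (G (Suc k))" using resolutionD(2)[OF G p] .
      then show "f' (d p) \<in> PM (G' (Suc k))" by (rule f')
      show "d' (f' (d p)) = 0"
        using f'(3)[OF dp] resolutionD(3)[OF G p] additive_zero[OF bihomD(1)[OF bf]] by simp
    qed
    then have "I (Suc k) f'" "Q k f f'" using f' by (auto simp: I_def Q_def)
    then show "\<exists>f'. I (Suc k) f' \<and> Q k f f'" by blast
  qed
  from ex obtain f where f: "\<And>k. I k (f k)" "\<And>k. Q k (f k) (f (Suc k))" by blast
  show ?thesis
    by (rule exI[of _ f]) (use f(1)[unfolded I_def] f(2)[unfolded Q_def] in simp)
qed

lemma homotopy_exists:
  assumes G: "resolution G d"
    and f: "\<And>k. bihom (f k)" "\<And>k p. p \<in> PM (G k) \<Longrightarrow> f k p \<in> PM (G k)"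
      "\<And>k p. p \<in> PM (G (Suc k)) \<Longrightarrow> d (f (Suc k) p) = f k (d p)"
    and f0: "\<And>p. p \<in> PM (G 0) \<Longrightarrow> f 0 p = p"
  shows "\<exists>h. h 0 = (\<lambda>_. 0) \<and> (\<forall>k. bihom (h k) \<and> (\<forall>p \<in> PM (G k). h k p \<in> PM (G (Suc k))) \<and>
    (\<forall>p \<in> PM (G (Suc k)). d (h (Suc k) p) + h k (d p) = p - f (Suc k) p))"
proof -
  note d = bihomD(1)[OF resolutionD(1)[OF G]]
  \<comment> \<open>The last clause makes p - f p - h (d p) a cycle in the next degree, hence a
    boundary. The homotopy can start with 0 because \<open>f 0\<close> is the identity.\<close>
  define I where "I k h \<longleftrightarrow> (k = 0 \<longrightarrow> h = (\<lambda>_. 0)) \<and> bihom h \<and> (\<forall>p \<in> PM (G k). h p \<in> PM (G (Suc k))) \<and>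
    (\<forall>p \<in> PM (G (Suc k)). d (h (d p)) = d p - f k (d p))" for k h
  define Q where "Q k h h' \<longleftrightarrow> (\<forall>p \<in> PM (G (Suc k)). d (h' p) + h (d p) = p - f (Suc k) p)"
    for k and h h' :: "_ \<Rightarrow> _"
  have ex: "\<exists>h. \<forall>k. I k (h k) \<and> Q k (h k) (h (Suc k))"
  proof (rule dependent_nat_choice)
    show "\<exists>h. I 0 h"
      using f0 resolutionD(2)[OF G] by (auto simp: I_def bihom_zero PM_def additive_zero[OF d])
    fix h k assume h: "I k h"
    then have bh: "bihom h" by (simp add: I_def)
    let ?u = "\<lambda>p. p - f (Suc k) p - h (d p)"
    have bu: "bihom ?u"
      by (intro bihom_diff bihom_id f bihom_comp[OF bh] resolutionD(1)[OF G])
    have du: "d (?u p) = 0" if p: "p \<in> PM (G (Suc k))" for p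
      using h p f(3)[OF p] by (simp add: additive_diff[OF d] I_def)
    have uP: "?u p \<in> PM (G (Suc k))" if p: "p \<in> PM (G (Suc k))" for p
      using h p resolutionD(2)[OF G p] f(2) by (intro PM_diff) (auto simp: I_def)
    have "\<exists>h'. bihom h' \<and> (\<forall>p \<in> PM (G (Suc k)). h' p \<in> PM (G (Suc (Suc k))) \<and> d (h' p) = ?u p)"
      by (intro bihom_lift bu resolutionD(1)[OF G] resolutionD(4)[OF G] uP du PM_gen)
    then obtain h' where h': "bihom h'" "\<And>p. p \<in> PM (G (Suc k)) \<Longrightarrow> h' p \<in> PM (G (Suc (Suc k)))"
      "\<And>p. p \<in> PM (G (Suc k)) \<Longrightarrow> d (h' p) = ?u p" by blast
    have "d (h' (d p)) = d p - f (Suc k) (d p)" if p: "p \<in> PM (G (Suc (Suc k)))" for p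
      using h'(3)[OF resolutionD(2)[OF G p]] resolutionD(3)[OF G p] additive_zero[OF bihomD(1)[OF bh]] by simp
    then have "I (Suc k) h'" "Q k h h'" using h' by (auto simp: I_def Q_def)
    then show "\<exists>h'. I (Suc k) h' \<and> Q k h h'" by blast
  qed
  from ex obtain h where h: "\<And>k. I k (h k)" "\<And>k. Q k (h k) (h (Suc k))" by blast
  show ?thesis
    by (rule exI[of _ h]) (use h(1)[unfolded I_def] h(2)[unfolded Q_def] in simp)
qed

end

lemma frag_cmul_minus_right: "frag_cmul c (p - q) = frag_cmul c p - frag_cmul c q"
  by (rule additive_diff[OF additive_cmul[OF additive_id]])

context exterior
begin

section \<open>The bar resolution\<close>

text \<open>The former left factor becomes the first bar letter. For \<open>a = {}\<close> this is
  the standard contraction of the bar resolution, p to 1 \<otimes> p; general \<open>a\<close>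
  serves to write the differential recursively.\<close>

definition shiftr :: "nat set \<Rightarrow> (nat set \<times> nat set list \<times> nat set \<Rightarrow>\<^sub>0 int) \<Rightarrow> (nat set \<times> nat set list \<times> nat set \<Rightarrow>\<^sub>0 int)" where
  "shiftr a = frag_extend (\<lambda>(c, us, d). frag_of (a, c # us, d))"

lemma additive_shiftr: "additive (shiftr a)"
  unfolding shiftr_def by (rule additive_frag_extend)

lemma shiftr_of: "shiftr a (frag_of (c, us, d)) = frag_of (a, c # us, d)"
  by (simp add: shiftr_def)

lemmas shiftr_simps = shiftr_of additive_frag_cmul[OF additive_shiftr]
  additive_diff[OF additive_shiftr] additive_zero[OF additive_shiftr]

text \<open>The alternating bar sum as a recursion: the first merge minus the differential of the
  rest with \<open>a\<close> put in front. The empty word gets 0 because the resolution stops in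
  degree 0.\<close>

fun barb :: "nat set \<Rightarrow> nat set list \<Rightarrow> nat set \<Rightarrow> (nat set \<times> nat set list \<times> nat set \<Rightarrow>\<^sub>0 int)" where
  "barb a [] b = 0"
| "barb a [w] b = frag_cmul (sg a w) (frag_of (a \<union> w, [], b)) - frag_cmul (sg w b) (frag_of (a, [], w \<union> b))"
| "barb a (w # v # ws) b = frag_cmul (sg a w) (frag_of (a \<union> w, v # ws, b)) - shiftr a (barb w (v # ws) b)"

definition bard :: "(nat set \<times> nat set list \<times> nat set \<Rightarrow>\<^sub>0 int) \<Rightarrow> (nat set \<times> nat set list \<times> nat set \<Rightarrow>\<^sub>0 int)" where
  "bard = frag_extend (\<lambda>(a, ws, b). barb a ws b)"

lemma additive_bard: "additive bard"
  unfolding bard_def by (rule additive_frag_extend)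

lemma bard_of: "bard (frag_of (a, ws, b)) = barb a ws b"
  by (simp add: bard_def)

lemmas bard_simps = bard_of additive_frag_cmul[OF additive_bard]
  additive_diff[OF additive_bard] additive_zero[OF additive_bard]

lemma lact_shiftr: "lact \<sigma> (shiftr a p) = frag_cmul (sg \<sigma> a) (shiftr (\<sigma> \<union> a) p)"
proof (rule additive_eqI_UNIV[of "\<lambda>p. lact \<sigma> (shiftr a p)"])
  fix x :: "nat set \<times> nat set list \<times> nat set"
  show "lact \<sigma> (shiftr a (frag_of x)) = frag_cmul (sg \<sigma> a) (shiftr (\<sigma> \<union> a) (frag_of x))"
    by (cases x) (simp add: shiftr_simps lact_simps)
qed (intro additive_intros additive_comp[OF additive_lact] additive_shiftr)+

lemma ract_shiftr: "ract (shiftr a p) \<tau> = shiftr a (ract p \<tau>)"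
proof (rule additive_eqI_UNIV[of "\<lambda>p. ract (shiftr a p) \<tau>"])
  fix x :: "nat set \<times> nat set list \<times> nat set"
  show "ract (shiftr a (frag_of x)) \<tau> = shiftr a (ract (frag_of x) \<tau>)"
    by (cases x) (simp add: shiftr_simps ract_simps)
qed (intro additive_comp[OF additive_ract] additive_comp[OF additive_shiftr] additive_shiftr additive_ract)+

lemma lact_barb: "lact \<sigma> (barb a ws b) = frag_cmul (sg \<sigma> a) (barb (\<sigma> \<union> a) ws b)"
proof (cases "(a, ws, b)" rule: barb.cases)
  case (2 a' w b')
  then show ?thesis using sg_assoc[of \<sigma> a w]
    by (simp add: lact_simps frag_cmul_minus_right Un_assoc mult.commute)
next
  case (3 a' w v ws' b')
  then show ?thesis using sg_assoc[of \<sigma> a w]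
    by (simp add: lact_simps lact_shiftr frag_cmul_minus_right Un_assoc mult.commute)
qed (auto simp: lact_simps)

lemma ract_barb: "ract (barb a ws b) \<tau> = frag_cmul (sg b \<tau>) (barb a ws (b \<union> \<tau>))"
proof (induction a ws b rule: barb.induct)
  case (2 a w b)
  then show ?case using sg_assoc[of w b \<tau>]
    by (simp add: ract_simps frag_cmul_minus_right Un_assoc mult.commute)
next
  case (3 a w v ws b)
  then show ?case
    by (simp add: ract_simps ract_shiftr shiftr_simps frag_cmul_minus_right Un_assoc mult.commute)
qed (auto simp: ract_simps)

lemma bihom_bard: "bihom bard"
  by (rule bihomI_basis) (simp_all add: additive_bard lact_of ract_of bard_simps lact_barb ract_barb)

definition bdeg :: "nat \<Rightarrow> nat set list set" where
  "bdeg k = {ws. length ws = k \<and> set ws \<subseteq> XS}"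

lemma shiftr_PM:
  assumes "p \<in> PM (bdeg k)" "a \<in> XS" shows "shiftr a p \<in> PM (bdeg (Suc k))"
  using assms(1) unfolding PM_def mem_Collect_eq
proof (rule keys_additive[OF additive_shiftr])
  fix x assume "x \<in> XS \<times> bdeg k \<times> XS"
  then show "Poly_Mapping.keys (shiftr a (frag_of x)) \<subseteq> XS \<times> bdeg (Suc k) \<times> XS"
    using assms(2) by (cases x) (auto simp: shiftr_of bdeg_def)
qed

lemma cmul_frag_of_PM: "(c \<noteq> 0 \<Longrightarrow> a \<in> XS \<and> g \<in> G \<and> b \<in> XS) \<Longrightarrow> frag_cmul c (frag_of (a, g, b)) \<in> PM G"
  unfolding PM_def mem_Collect_eq by (rule keys_cmul_frag_of_subset) blast

lemma barb_PM: "a \<in> XS \<Longrightarrow> b \<in> XS \<Longrightarrow> ws \<in> bdeg (Suc k) \<Longrightarrow> barb a ws b \<in> PM (bdeg k)"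
proof (induction a ws b arbitrary: k rule: barb.induct)
  case (2 a w b)
  then show ?case by (auto simp: bdeg_def intro!: PM_diff cmul_frag_of_PM)
next
  case (3 a w v ws b)
  obtain k' where k: "k = Suc k'" using 3(4) by (auto simp: bdeg_def)
  have "barb w (v # ws) b \<in> PM (bdeg k')" using 3 k by (auto simp: bdeg_def)
  then have "shiftr a (barb w (v # ws) b) \<in> PM (bdeg k)" unfolding k by (rule shiftr_PM) (rule 3)
  moreover have "frag_cmul (sg a w) (frag_of (a \<union> w, v # ws, b)) \<in> PM (bdeg k)"
    using 3(2-4) by (intro cmul_frag_of_PM) (auto simp: bdeg_def)
  ultimately show ?case by (simp add: PM_diff)
qed (simp add: bdeg_def)

lemma bard_PM: "p \<in> PM (bdeg (Suc k)) \<Longrightarrow> bard p \<in> PM (bdeg k)"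
  by (erule bihom_PM[OF bihom_bard]) (simp add: bard_of barb_PM)

lemma bard_contraction:
  assumes "p \<in> PM (bdeg (Suc k))"
  shows "bard (shiftr {} p) = p - shiftr {} (bard p)"
  using assms unfolding PM_def mem_Collect_eq
proof (rule additive_eqI[rotated 2])
  fix x assume "x \<in> XS \<times> bdeg (Suc k) \<times> XS"
  then obtain a w ws b where "x = (a, w # ws, b)" by (auto simp: bdeg_def length_Suc_conv)
  then show "bard (shiftr {} (frag_of x)) = frag_of x - shiftr {} (bard (frag_of x))"
    by (simp add: shiftr_of bard_of)
qed (intro additive_intros additive_comp[OF additive_bard] additive_comp[OF additive_shiftr] additive_shiftr additive_bard)+

text \<open>Left linearity reduces to the outer factor 1. There the differential of 1 \<otimes> q is
  q - 1 \<otimes> dq, and applying d once more gives dq - (dq - 1 \<otimes> ddq), which is 0 by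
  induction.\<close>

lemma bard_barb: "bard (barb a ws b) = 0"
proof (induction a ws b rule: barb.induct)
  case (3 a w v ws b)
  have l: "barb a (w # v # ws) b = lact a (barb {} (w # v # ws) b)" by (simp add: lact_barb del: barb.simps)
  have "bard (shiftr {} (barb w (v # ws) b)) = barb w (v # ws) b"
  \<comment> \<open>The contraction identity holds only for words of positive length. If
    \<open>v\<close> is the last letter, dq consists of empty words, and the two extra terms cancel
    by \<open>sg_assoc\<close>.\<close>
  proof (cases ws)
    case Nil
    then show ?thesis using sg_assoc[of w v b]
      by (simp add: shiftr_simps bard_simps frag_cmul_minus_right Un_assoc algebra_simps)
  next
    case (Cons u us)
    have "barb w (v # ws) b - shiftr {} (bard (barb w (v # ws) b)) = barb w (v # ws) b"
      using 3 by (simp add: shiftr_simps)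
    moreover have "bard (shiftr {} (barb w (v # ws) b)) =
        barb w (v # ws) b - shiftr {} (bard (barb w (v # ws) b))"
    proof -
      have keys: "Poly_Mapping.keys (barb w (v # ws) b) \<subseteq> {(a, us, b). us \<noteq> []}"
        unfolding Cons
      proof -
        have sh: "Poly_Mapping.keys (shiftr w p) \<subseteq> {(a, us, b). us \<noteq> []}" for w p
          by (rule keys_additive[OF additive_shiftr subset_UNIV]) (auto simp: shiftr_of)
        show "Poly_Mapping.keys (barb w (v # u # us) b) \<subseteq> {(a, us, b). us \<noteq> []}"
          unfolding barb.simps by (intro keys_diff_subset keys_cmul_frag_of_subset sh) simp
      qed
      show ?thesis
      proof (rule additive_eqI[OF _ _ keys])
        fix x :: "nat set \<times> nat set list \<times> nat set" assume "x \<in> {(a, us, b). us \<noteq> []}"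
        then obtain a w ws b where "x = (a, w # ws, b)" by (auto simp: neq_Nil_conv)
        then show "bard (shiftr {} (frag_of x)) = frag_of x - shiftr {} (bard (frag_of x))"
          by (simp add: shiftr_of bard_of)
      qed (intro additive_intros additive_comp[OF additive_bard] additive_comp[OF additive_shiftr] additive_shiftr additive_bard)+
    qed
    ultimately show ?thesis by simp
  qed
  then have z: "bard (barb {} (w # v # ws) b) = 0"
    by (simp add: bard_simps)
  show ?case unfolding l bihomD(2)[OF bihom_bard] z by (simp add: lact_simps)
qed (auto simp: bard_simps)

lemma bard_bard: "bard (bard p) = 0"
  by (rule additive_eqI_UNIV[of "\<lambda>p. bard (bard p)" "\<lambda>p. 0"])
    (auto simp: bard_of bard_barb intro: additive_intros additive_comp additive_bard)

lemma resolution_bar: "resolution bdeg bard"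
  unfolding resolution_def
proof (intro conjI allI ballI impI bihom_bard)
  fix k p assume p: "p \<in> PM (bdeg (Suc k))"
  then show "bard p \<in> PM (bdeg k)" by (rule bard_PM)
  show "bard (bard p) = 0" by (rule bard_bard)
  assume "bard p = 0"
  then show "\<exists>y \<in> PM (bdeg (Suc (Suc k))). bard y = p"
    using bard_contraction[OF p] shiftr_PM[OF p, of "{}"]
    by (intro bexI[of _ "shiftr {} p"]) (auto simp: shiftr_simps)
qed

section \<open>The Koszul resolution\<close>

text \<open>\<open>y\<^sup>m\<close> is a divided power monomial, represented by a multiset \<open>m\<close>.\<close>

definition kapb :: "nat set \<Rightarrow> nat multiset \<Rightarrow> (nat set \<times> nat multiset \<Rightarrow>\<^sub>0 int)" where
  "kapb a m = (\<Sum>i\<in>set_mset m. frag_cmul (sg a {i}) (frag_of (insert i a, m - {#i#})))"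

definition kap :: "(nat set \<times> nat multiset \<Rightarrow>\<^sub>0 int) \<Rightarrow> (nat set \<times> nat multiset \<Rightarrow>\<^sub>0 int)" where
  "kap = frag_extend (\<lambda>(a, m). kapb a m)"

text \<open>For \<open>a = {}\<close> and \<open>m = {#}\<close> the value of \<open>Max {}\<close>
  is unspecified, yet the membership test fails and the result is 0. There is no sign because
  \<open>kapb\<close> multiplies on the right and the largest variable stands last in x_a.\<close>

definition ctrb :: "nat set \<Rightarrow> nat multiset \<Rightarrow> (nat set \<times> nat multiset \<Rightarrow>\<^sub>0 int)" where
  "ctrb a m = (let M = Max (a \<union> set_mset m) in
    if M \<in> a then frag_of (a - {M}, add_mset M m) else 0)"

definition ctr :: "(nat set \<times> nat multiset \<Rightarrow>\<^sub>0 int) \<Rightarrow> (nat set \<times> nat multiset \<Rightarrow>\<^sub>0 int)" where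
  "ctr = frag_extend (\<lambda>(a, m). ctrb a m)"

lemma additive_kap: "additive kap"
  unfolding kap_def by (rule additive_frag_extend)

lemma additive_ctr: "additive ctr"
  unfolding ctr_def by (rule additive_frag_extend)

lemma kap_of: "kap (frag_of (a, m)) = kapb a m"
  by (simp add: kap_def)

lemma ctr_of: "ctr (frag_of (a, m)) = ctrb a m"
  by (simp add: ctr_def)

lemmas kap_simps = kap_of additive_frag_cmul[OF additive_kap] additive_sum[OF additive_kap]
  additive_diff[OF additive_kap] additive_zero[OF additive_kap] additive_add[OF additive_kap]

lemmas ctr_simps = ctr_of additive_frag_cmul[OF additive_ctr] additive_sum[OF additive_ctr]
  additive_diff[OF additive_ctr] additive_zero[OF additive_ctr] additive_add[OF additive_ctr]

lemma frag_cmul_sum_right: "frag_cmul c (sum f I) = (\<Sum>i\<in>I. frag_cmul c (f i))"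
  by (rule additive_sum[OF additive_cmul[OF additive_id]])

text \<open>The index pairs are those \<open>i\<close>, \<open>j\<close> that can be removed from
  \<open>m\<close> one after the other, a symmetric condition. The diagonal occurs where the
  multiplicity is at least 2.\<close>

lemma sum_mset_pairs_swap:
  fixes F :: "nat \<Rightarrow> nat \<Rightarrow> 'a :: comm_monoid_add"
  shows "(\<Sum>i\<in>set_mset m. \<Sum>j\<in>set_mset (m - {#i#}). F i j) = (\<Sum>i\<in>set_mset m. \<Sum>j\<in>set_mset (m - {#i#}). F j i)"
proof -
  have iff: "i \<in># m \<and> j \<in># m - {#i#} \<longleftrightarrow> j \<in># m \<and> i \<in># m - {#j#}" for i j
  proof (cases "i = j")
    case False
    then show ?thesis by (simp add: in_diff_count not_in_iff flip: count_greater_zero_iff) auto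
  qed simp
  let ?S = "Sigma (set_mset m) (\<lambda>i. set_mset (m - {#i#}))"
  have "(\<Sum>i\<in>set_mset m. \<Sum>j\<in>set_mset (m - {#i#}). F i j) = (\<Sum>(i, j)\<in>?S. F i j)"
    by (simp add: sum.Sigma)
  also have "\<dots> = (\<Sum>(i, j)\<in>?S. F j i)"
    by (rule sum.reindex_bij_witness[of _ prod.swap prod.swap]) (use iff in auto)
  also have "\<dots> = (\<Sum>i\<in>set_mset m. \<Sum>j\<in>set_mset (m - {#i#}). F j i)"
    by (simp add: sum.Sigma)
  finally show ?thesis .
qed

lemma sg_singletons:
  assumes "i \<le> n" "j \<le> n" "i \<noteq> j"
  shows "sg {i} {j} = - sg {j} {i}"
proof -
  have "inv_pairs {i} {j} = (if j < i then {(i, j)} else {})" "inv_pairs {j} {i} = (if i < j then {(j, i)} else {})"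
    using assms by (auto simp: inv_pairs_def)
  then show ?thesis using assms by (auto simp: sg_def)
qed

lemma sg_insert_insert:
  assumes "i \<le> n" "j \<le> n"
  shows "sg a {i} * sg (insert i a) {j} = - (sg a {j} * sg (insert j a) {i})"
proof (cases "i = j")
  case True
  then show ?thesis by (simp add: sg_def)
next
  case False
  have "sg a {i} * sg (insert i a) {j} = sg {i} {j} * sg a {i, j}"
    using sg_assoc[of a "{i}" "{j}"] by (simp add: insert_commute)
  moreover have "sg a {j} * sg (insert j a) {i} = sg {j} {i} * sg a {i, j}"
    using sg_assoc[of a "{j}" "{i}"] by (simp add: insert_commute)
  ultimately show ?thesis using sg_singletons[OF assms False] by simp
qed

lemma sg_insert_insert':
  assumes "i \<le> n" "j \<le> n"
  shows "sg {i} a * sg {j} (insert i a) = - (sg {j} a * sg {i} (insert j a))"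
proof (cases "i = j")
  case True
  then show ?thesis by (simp add: sg_def)
next
  case False
  have "sg {i} a * sg {j} (insert i a) = sg {j} {i} * sg {i, j} a"
    using sg_assoc[of "{j}" "{i}" a] by (simp add: insert_commute)
  moreover have "sg {j} a * sg {i} (insert j a) = sg {i} {j} * sg {i, j} a"
    using sg_assoc[of "{i}" "{j}" a] by (simp add: insert_commute)
  ultimately show ?thesis using sg_singletons[OF assms False] by simp
qed

definition kdeg :: "nat \<Rightarrow> nat multiset set" where
  "kdeg k = {m. size m = k \<and> set_mset m \<subseteq> {1..n}}"

text \<open>By the symmetry of the index set the sum equals its own negative, and free abelian
  groups have no 2-torsion. This covers the diagonal pairs as well.\<close>

lemma antisym_sum_eq_0:
  fixes F :: "nat \<Rightarrow> nat \<Rightarrow> 'b \<Rightarrow>\<^sub>0 int"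
  assumes "\<And>i j. i \<in># m \<Longrightarrow> j \<in># m \<Longrightarrow> F j i = - F i j"
  shows "(\<Sum>i\<in>set_mset m. \<Sum>j\<in>set_mset (m - {#i#}). F i j) = 0"
proof (rule frag_add_self_eq_0)
  have "(\<Sum>i\<in>set_mset m. \<Sum>j\<in>set_mset (m - {#i#}). F i j) + (\<Sum>i\<in>set_mset m. \<Sum>j\<in>set_mset (m - {#i#}). F i j)
      = (\<Sum>i\<in>set_mset m. \<Sum>j\<in>set_mset (m - {#i#}). F i j) + (\<Sum>i\<in>set_mset m. \<Sum>j\<in>set_mset (m - {#i#}). F j i)"
    by (subst sum_mset_pairs_swap) (rule refl)
  also have "\<dots> = (\<Sum>i\<in>set_mset m. \<Sum>j\<in>set_mset (m - {#i#}). F i j + F j i)"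
    by (simp add: sum.distrib)
  also have "\<dots> = 0"
  proof (intro sum.neutral ballI)
    fix i j assume "i \<in># m" "j \<in># m - {#i#}"
    then have "F j i = - F i j" using assms by (blast dest: in_diffD)
    then show "F i j + F j i = 0" by (simp only: right_minus)
  qed
  finally show "(\<Sum>i\<in>set_mset m. \<Sum>j\<in>set_mset (m - {#i#}). F i j) + (\<Sum>i\<in>set_mset m. \<Sum>j\<in>set_mset (m - {#i#}). F i j) = 0" .
qed

lemma kap_kapb:
  assumes "set_mset m \<subseteq> {1..n}" shows "kap (kapb a m) = 0"
proof -
  have "kap (kapb a m) = (\<Sum>i\<in>set_mset m. \<Sum>j\<in>set_mset (m - {#i#}).
      frag_cmul (sg a {i} * sg (insert i a) {j}) (frag_of (insert j (insert i a), m - {#i#} - {#j#})))"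
    by (simp add: kapb_def kap_simps frag_cmul_sum_right)
  also have "\<dots> = 0"
  proof (rule antisym_sum_eq_0)
    fix i j assume "i \<in># m" "j \<in># m"
    then have "i \<le> n" "j \<le> n" using assms by auto
    then show "frag_cmul (sg a {j} * sg (insert j a) {i}) (frag_of (insert i (insert j a), m - {#j#} - {#i#})) =
        - frag_cmul (sg a {i} * sg (insert i a) {j}) (frag_of (insert j (insert i a), m - {#i#} - {#j#}))"
      using sg_insert_insert[of j i a] by (simp add: insert_commute add_mset_commute)
  qed
  finally show ?thesis .
qed

text \<open>The contraction \<open>ctr\<close> moves the largest variable from the exterior to the divided power part.\<close>

lemma kap_ctr_basis:
  assumes a: "a \<subseteq> {1..n}" and m: "set_mset m \<subseteq> {1..n}" and ne: "a \<noteq> {} \<or> m \<noteq> {#}"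
  shows "kap (ctrb a m) + ctr (kapb a m) = frag_of (a, m)"
proof -
  define M where "M = Max (a \<union> set_mset m)"
  have fin: "finite (a \<union> set_mset m)" using a by (auto intro: finite_subset)
  have Min: "M \<in> a \<union> set_mset m" unfolding M_def using fin ne by (intro Max_in) auto
  have le: "x \<le> M" if "x \<in> a \<union> set_mset m" for x unfolding M_def using fin that by (rule Max_ge)
  have Mn: "M \<le> n" using Min a m by auto
  have mx: "Max S = M" if "S \<subseteq> a \<union> set_mset m" "M \<in> S" for S
    using that le fin by (intro Max_eqI) (auto intro: finite_subset)
  show ?thesis
  \<comment> \<open>If \<open>M\<close> lies only in \<open>m\<close>, the contraction kills the
    element itself and every summand of its differential except that with \<open>i = M\<close>,
    which it maps back. If \<open>M\<close> lies in \<open>a\<close>, the summand with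
    \<open>i = M\<close> of \<open>kap (ctrb a m)\<close> is the element, and all others cancel
    between the two composites.\<close>
  proof (cases "M \<in> a")
    case False
    then have Mm: "M \<in># m" using Min by auto
    have "ctr (kapb a m) = (\<Sum>i\<in>set_mset m. frag_cmul (sg a {i}) (ctrb (insert i a) (m - {#i#})))"
      by (simp add: kapb_def ctr_simps)
    also have "\<dots> = (\<Sum>i\<in>{M}. frag_cmul (sg a {i}) (ctrb (insert i a) (m - {#i#})))"
    proof (rule sum.mono_neutral_right)
      show "\<forall>i\<in>set_mset m - {M}. frag_cmul (sg a {i}) (ctrb (insert i a) (m - {#i#})) = 0"
      proof
        fix i assume i: "i \<in> set_mset m - {M}"
        have "Max (insert i a \<union> set_mset (m - {#i#})) = M"
          using i Mm by (intro mx) (auto dest: in_diffD simp: in_diff_count)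
        then show "frag_cmul (sg a {i}) (ctrb (insert i a) (m - {#i#})) = 0"
          using i False by (simp add: ctrb_def Let_def)
      qed
    qed (use Mm in auto)
    also have "\<dots> = frag_of (a, m)"
    proof -
      have "Max (insert M a \<union> set_mset (m - {#M#})) = M"
        using Mm by (intro mx) (auto dest: in_diffD)
      moreover have "inv_pairs a {M} = {}" using le by (auto simp: inv_pairs_def dest: leD)
      ultimately show ?thesis using False Mm by (simp add: ctrb_def Let_def sg_def)
    qed
    finally show ?thesis using False by (simp add: ctrb_def M_def[symmetric] kap_simps)
  next
    case True
    define c where "c = a - {M}"
    have ac: "a = insert M c" "M \<notin> c" using True by (auto simp: c_def)
    have sM: "sg c {M} = 1"
    proof -
      have "inv_pairs c {M} = {}" using le by (auto simp: inv_pairs_def c_def dest: leD)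
      then show ?thesis using ac by (simp add: sg_def)
    qed
    \<comment> \<open>Restoring the larger variable \<open>M\<close> to \<open>c\<close> adds
      exactly the inversion \<open>(M, i)\<close>.\<close>
    have sa: "sg a {i} = - sg c {i}" if "i \<in># m" "i \<noteq> M" for i
    proof (cases "i \<in> c")
      case False
      have "i < M" using le[of i] that by auto
      then have "inv_pairs a {i} = insert (M, i) (inv_pairs c {i})" using Mn by (auto simp: inv_pairs_def ac)
      moreover have "(M, i) \<notin> inv_pairs c {i}" using ac by (auto simp: inv_pairs_def)
      ultimately have "card (inv_pairs a {i}) = Suc (card (inv_pairs c {i}))" by (simp add: finite_inv_pairs)
      then show ?thesis using False that by (simp add: sg_def ac)
    qed (auto simp: sg_def ac)
    let ?I = "set_mset m - {M}"
    have h: "ctrb a m = frag_of (c, add_mset M m)" using True by (simp add: ctrb_def M_def[symmetric] c_def)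
    have "kap (ctrb a m) = (\<Sum>i\<in>insert M ?I. frag_cmul (sg c {i}) (frag_of (insert i c, add_mset M m - {#i#})))"
      by (simp add: h kap_simps kapb_def)
    also have "\<dots> = frag_of (a, m) + (\<Sum>i\<in>?I. frag_cmul (sg c {i}) (frag_of (insert i c, add_mset M m - {#i#})))"
      using sM ac by (subst sum.insert) auto
    finally have k: "kap (ctrb a m) = frag_of (a, m) + (\<Sum>i\<in>?I. frag_cmul (sg c {i}) (frag_of (insert i c, add_mset M m - {#i#})))" .
    have "ctr (kapb a m) = (\<Sum>i\<in>set_mset m. frag_cmul (sg a {i}) (ctrb (insert i a) (m - {#i#})))"
      by (simp add: kapb_def ctr_simps)
    also have "\<dots> = (\<Sum>i\<in>?I. frag_cmul (sg a {i}) (ctrb (insert i a) (m - {#i#})))"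
      by (rule sum.mono_neutral_right) (use True in \<open>auto simp: sg_def\<close>)
    also have "\<dots> = (\<Sum>i\<in>?I. - frag_cmul (sg c {i}) (frag_of (insert i c, add_mset M m - {#i#})))"
    proof (rule sum.cong[OF refl])
      fix i assume i: "i \<in> ?I"
      have "Max (insert i a \<union> set_mset (m - {#i#})) = M"
        using i True by (intro mx) (auto dest: in_diffD)
      then have "ctrb (insert i a) (m - {#i#}) = frag_of (insert i a - {M}, add_mset M (m - {#i#}))"
        using True by (simp add: ctrb_def Let_def)
      moreover have "insert i a - {M} = insert i c" "add_mset M (m - {#i#}) = add_mset M m - {#i#}"
        using i by (auto simp: c_def)
      ultimately have "ctrb (insert i a) (m - {#i#}) = frag_of (insert i c, add_mset M m - {#i#})"
        by (simp only:)
      then show "frag_cmul (sg a {i}) (ctrb (insert i a) (m - {#i#})) =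
          - frag_cmul (sg c {i}) (frag_of (insert i c, add_mset M m - {#i#}))"
        using sa[of i] i by simp
    qed
    finally show ?thesis unfolding k by (simp add: sum_negf del: minus_frag_cmul)
  qed
qed


lemma kap_kap:
  assumes "Poly_Mapping.keys p \<subseteq> {(a, m). set_mset m \<subseteq> {1..n}}"
  shows "kap (kap p) = 0"
  by (rule additive_eqI[OF _ _ assms])
    (auto simp: kap_of kap_kapb intro!: additive_intros additive_comp[OF additive_kap] additive_kap)

definition rat :: "nat set \<Rightarrow> (nat set \<times> nat multiset \<Rightarrow>\<^sub>0 int) \<Rightarrow> (nat set \<times> nat multiset \<times> nat set \<Rightarrow>\<^sub>0 int)" where
  "rat b = frag_extend (\<lambda>(a, m). frag_of (a, m, b))"

lemma additive_rat: "additive (rat b)"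
  unfolding rat_def by (rule additive_frag_extend)

lemma rat_of: "rat b (frag_of (a, m)) = frag_of (a, m, b)"
  by (simp add: rat_def)

lemmas rat_simps = rat_of additive_frag_cmul[OF additive_rat] additive_sum[OF additive_rat]
  additive_diff[OF additive_rat] additive_zero[OF additive_rat] additive_add[OF additive_rat]

definition kosl :: "(nat set \<times> nat multiset \<times> nat set \<Rightarrow>\<^sub>0 int) \<Rightarrow> (nat set \<times> nat multiset \<times> nat set \<Rightarrow>\<^sub>0 int)" where
  "kosl = frag_extend (\<lambda>(a, m, b). rat b (kapb a m))"

text \<open>The right half of the Koszul differential. Its sign depends on the degree so that it
  anticommutes with the left half; in degree 1 the two halves give x_i \<otimes> 1 - 1 \<otimes>
  x_i.\<close>

definition kosrb :: "nat set \<Rightarrow> nat multiset \<Rightarrow> nat set \<Rightarrow> (nat set \<times> nat multiset \<times> nat set \<Rightarrow>\<^sub>0 int)" where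
  "kosrb a m b = (\<Sum>i\<in>set_mset m. frag_cmul ((-1) ^ size m * sg {i} b) (frag_of (a, m - {#i#}, insert i b)))"

definition kosr :: "(nat set \<times> nat multiset \<times> nat set \<Rightarrow>\<^sub>0 int) \<Rightarrow> (nat set \<times> nat multiset \<times> nat set \<Rightarrow>\<^sub>0 int)" where
  "kosr = frag_extend (\<lambda>(a, m, b). kosrb a m b)"

definition ctr3 :: "(nat set \<times> nat multiset \<times> nat set \<Rightarrow>\<^sub>0 int) \<Rightarrow> (nat set \<times> nat multiset \<times> nat set \<Rightarrow>\<^sub>0 int)" where
  "ctr3 = frag_extend (\<lambda>(a, m, b). rat b (ctrb a m))"

definition kosd :: "(nat set \<times> nat multiset \<times> nat set \<Rightarrow>\<^sub>0 int) \<Rightarrow> (nat set \<times> nat multiset \<times> nat set \<Rightarrow>\<^sub>0 int)" where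
  "kosd p = kosl p + kosr p"

lemma additive_kosl: "additive kosl"
  unfolding kosl_def by (rule additive_frag_extend)

lemma additive_kosr: "additive kosr"
  unfolding kosr_def by (rule additive_frag_extend)

lemma additive_ctr3: "additive ctr3"
  unfolding ctr3_def by (rule additive_frag_extend)

lemma additive_kosd: "additive kosd"
  unfolding kosd_def[abs_def] by (intro additive_plus additive_kosl additive_kosr)

lemma kosl_of: "kosl (frag_of (a, m, b)) = rat b (kapb a m)"
  by (simp add: kosl_def)

lemma kosr_of: "kosr (frag_of (a, m, b)) = kosrb a m b"
  by (simp add: kosr_def)

lemma ctr3_of: "ctr3 (frag_of (a, m, b)) = rat b (ctrb a m)"
  by (simp add: ctr3_def)

lemma kosl_rat: "kosl (rat b p) = rat b (kap p)"
  by (rule additive_eqI_UNIV[of "\<lambda>p. kosl (rat b p)"])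
    (auto simp: kosl_of rat_of kap_of intro!: additive_comp[OF additive_kosl] additive_comp[OF additive_rat] additive_rat additive_kap)

lemma ctr3_rat: "ctr3 (rat b p) = rat b (ctr p)"
  by (rule additive_eqI_UNIV[of "\<lambda>p. ctr3 (rat b p)"])
    (auto simp: ctr3_of rat_of ctr_of intro!: additive_comp[OF additive_ctr3] additive_comp[OF additive_rat] additive_rat additive_ctr)

lemmas kosl_simps = kosl_of additive_frag_cmul[OF additive_kosl] additive_sum[OF additive_kosl]
  additive_diff[OF additive_kosl] additive_zero[OF additive_kosl] additive_add[OF additive_kosl]

lemmas kosr_simps = kosr_of additive_frag_cmul[OF additive_kosr] additive_sum[OF additive_kosr]
  additive_diff[OF additive_kosr] additive_zero[OF additive_kosr] additive_add[OF additive_kosr]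

lemma rat_kapb: "rat b (kapb a m) = (\<Sum>i\<in>set_mset m. frag_cmul (sg a {i}) (frag_of (insert i a, m - {#i#}, b)))"
  by (simp add: kapb_def rat_simps)

lemma bihom_kosd: "bihom kosd"
proof (rule bihomI_basis[OF additive_kosd])
  fix \<sigma> a :: "nat set" and m :: "nat multiset" and b :: "nat set"
  have "sg \<sigma> a * sg (\<sigma> \<union> a) {i} = sg a {i} * sg \<sigma> (insert i a)" for i
    using sg_assoc[of \<sigma> a "{i}"] by simp
  then show "kosd (lact \<sigma> (frag_of (a, m, b))) = lact \<sigma> (kosd (frag_of (a, m, b)))"
    by (simp add: kosd_def lact_simps kosl_simps kosr_simps rat_kapb kosrb_def frag_cmul_sum_right
        frag_cmul_distrib2 mult.commute mult.left_commute)
  have "sg b \<sigma> * sg {i} (b \<union> \<sigma>) = sg {i} b * sg (insert i b) \<sigma>" for i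
    using sg_assoc[of "{i}" b \<sigma>] by simp
  then have eq: "sg b \<sigma> * ((-1) ^ size m * sg {i} (b \<union> \<sigma>)) = (-1) ^ size m * sg {i} b * sg (insert i b) \<sigma>" for i
    by (simp add: mult.left_commute[of "sg b \<sigma>"] mult.assoc)
  show "kosd (ract (frag_of (a, m, b)) \<sigma>) = ract (kosd (frag_of (a, m, b))) \<sigma>"
    by (simp add: kosd_def ract_simps kosl_simps kosr_simps rat_kapb kosrb_def frag_cmul_sum_right
        frag_cmul_distrib2 mult.commute[of "sg b \<sigma>" "sg _ {_}"] eq)
qed

definition kset :: "(nat set \<times> nat multiset \<times> nat set) set" where
  "kset = {(a, m, b). a \<subseteq> {1..n} \<and> set_mset m \<subseteq> {1..n}}"

text \<open>Each half squares to zero because exchanging the two removed variables changes the sign.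
  The mixed terms cancel because products on the left and on the right do not interfere, while
  removing a variable first flips (-1)^|m|.\<close>

lemma kosd_kosd:
  assumes p: "Poly_Mapping.keys p \<subseteq> kset"
  shows "kosd (kosd p) = 0"
proof (rule additive_eqI[OF additive_comp[OF additive_kosd additive_kosd] additive_zero_map p])
  fix x assume "x \<in> kset"
  then obtain a m b where x: "x = (a, m, b)" and m: "set_mset m \<subseteq> {1..n}" by (auto simp: kset_def)
  have le: "i \<le> n" if "i \<in># m" for i using that m by auto
  have ll: "kosl (kosl (frag_of x)) = 0"
    using kap_kapb[OF m] by (simp add: x kosl_of kosl_rat rat_simps)
  have sz: "(-1::int) ^ size (m - {#i#}) = - ((-1) ^ size m)" if i: "i \<in># m" for i
  proof -
    have "size m = Suc (size (m - {#i#}))" using i by (metis insert_DiffM size_add_mset)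
    then show ?thesis by simp
  qed
  have "kosr (kosr (frag_of x)) = (\<Sum>i\<in>set_mset m. \<Sum>j\<in>set_mset (m - {#i#}).
      frag_cmul ((-1) ^ size m * (-1) ^ size (m - {#i#}) * (sg {i} b * sg {j} (insert i b)))
        (frag_of (a, m - {#i#} - {#j#}, insert j (insert i b))))"
    by (simp add: x kosr_simps kosrb_def frag_cmul_sum_right mult.assoc mult.left_commute)
  also have "\<dots> = 0"
  proof (rule antisym_sum_eq_0)
    fix i j assume ij: "i \<in># m" "j \<in># m"
    show "frag_cmul ((-1) ^ size m * (-1) ^ size (m - {#j#}) * (sg {j} b * sg {i} (insert j b)))
        (frag_of (a, m - {#j#} - {#i#}, insert i (insert j b))) =
      - frag_cmul ((-1) ^ size m * (-1) ^ size (m - {#i#}) * (sg {i} b * sg {j} (insert i b)))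
        (frag_of (a, m - {#i#} - {#j#}, insert j (insert i b)))"
      using sg_insert_insert'[OF le le, OF ij(2,1), of b]
      by (simp add: sz[OF ij(1)] sz[OF ij(2)] insert_commute add_mset_commute)
  qed
  finally have rr: "kosr (kosr (frag_of x)) = 0" .
  have "kosl (kosr (frag_of x)) = (\<Sum>i\<in>set_mset m. \<Sum>j\<in>set_mset (m - {#i#}).
      frag_cmul ((-1) ^ size m * (sg {i} b * sg a {j})) (frag_of (insert j a, m - {#i#} - {#j#}, insert i b)))"
    by (simp add: x kosr_simps kosl_simps kosrb_def rat_kapb frag_cmul_sum_right mult.assoc)
  also have "\<dots> = (\<Sum>i\<in>set_mset m. \<Sum>j\<in>set_mset (m - {#i#}).
      frag_cmul ((-1) ^ size m * (sg {j} b * sg a {i})) (frag_of (insert i a, m - {#j#} - {#i#}, insert j b)))"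
    by (rule sum_mset_pairs_swap)
  finally have lr: "kosl (kosr (frag_of x)) = \<dots>" .
  have "kosr (kosl (frag_of x)) = (\<Sum>i\<in>set_mset m. \<Sum>j\<in>set_mset (m - {#i#}).
      frag_cmul (sg a {i} * ((-1) ^ size (m - {#i#}) * sg {j} b)) (frag_of (insert i a, m - {#i#} - {#j#}, insert j b)))"
    by (simp add: x kosr_simps kosl_simps kosrb_def rat_kapb frag_cmul_sum_right mult.assoc)
  also have "\<dots> = (\<Sum>i\<in>set_mset m. \<Sum>j\<in>set_mset (m - {#i#}).
      - frag_cmul ((-1) ^ size m * (sg {j} b * sg a {i})) (frag_of (insert i a, m - {#j#} - {#i#}, insert j b)))"
    by (intro sum.cong refl) (simp add: sz add_mset_commute mult.commute mult.left_commute)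
  finally have rl: "kosr (kosl (frag_of x)) = - kosl (kosr (frag_of x))"
    unfolding lr by (simp add: sum_negf del: minus_frag_cmul)
  show "kosd (kosd (frag_of x)) = 0"
    by (simp add: kosd_def kosl_simps kosr_simps ll rr rl)
qed

lemma PM_kdeg_keys: "p \<in> PM (kdeg k) \<Longrightarrow> Poly_Mapping.keys p \<subseteq> kset"
  unfolding PM_def kdeg_def kset_def by blast

lemma frag_of_PM: "a \<in> XS \<Longrightarrow> g \<in> G \<Longrightarrow> b \<in> XS \<Longrightarrow> frag_of (a, g, b) \<in> PM G"
  using cmul_frag_of_PM[of 1 a g G b] by simp

lemma kdeg_diff: "m \<in> kdeg (Suc k) \<Longrightarrow> i \<in># m \<Longrightarrow> m - {#i#} \<in> kdeg k"
  by (auto simp: kdeg_def size_Diff_singleton dest: in_diffD)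

lemma PM_sum: "(\<And>i. i \<in> I \<Longrightarrow> f i \<in> PM G) \<Longrightarrow> sum f I \<in> PM G"
  by (simp add: PM_def keys_sum_subset)

lemma kosd_PM:
  assumes "p \<in> PM (kdeg (Suc k))" shows "kosd p \<in> PM (kdeg k)"
proof (rule bihom_PM[OF bihom_kosd assms])
  fix m assume m: "m \<in> kdeg (Suc k)"
  then have "i \<in> {1..n}" if "i \<in># m" for i using that by (auto simp: kdeg_def)
  then show "kosd (frag_of ({}, m, {})) \<in> PM (kdeg k)"
    using m by (auto simp: kosd_def kosl_of kosr_of rat_kapb kosrb_def
        intro!: PM_add PM_sum cmul_frag_of_PM frag_of_PM kdeg_diff)
qed

text \<open>Subtracting \<open>kosd (ctr3 z)\<close> from a cycle \<open>z\<close> pushes it into higher right exterior degree.\<close>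

definition rfilt :: "nat \<Rightarrow> nat \<Rightarrow> (nat set \<times> nat multiset \<times> nat set) set" where
  "rfilt k j = {(a, m, b). a \<in> XS \<and> m \<in> kdeg k \<and> b \<in> XS \<and> j \<le> card b}"

lemma ctr3_rfilt:
  assumes "Poly_Mapping.keys p \<subseteq> rfilt k j"
  shows "Poly_Mapping.keys (ctr3 p) \<subseteq> rfilt (Suc k) j"
proof (rule keys_additive[OF additive_ctr3 assms])
  fix x assume "x \<in> rfilt k j"
  then obtain a m b where x: "x = (a, m, b)" "a \<in> XS" "m \<in> kdeg k" "b \<in> XS" "j \<le> card b"
    by (auto simp: rfilt_def)
  then show "Poly_Mapping.keys (ctr3 (frag_of x)) \<subseteq> rfilt (Suc k) j"
    by (auto simp: ctr3_of ctrb_def Let_def rat_simps rfilt_def kdeg_def)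
qed

lemma kosr_rfilt:
  assumes "Poly_Mapping.keys p \<subseteq> rfilt (Suc k) j"
  shows "Poly_Mapping.keys (kosr p) \<subseteq> rfilt k (Suc j)"
proof (rule keys_additive[OF additive_kosr assms])
  fix x assume "x \<in> rfilt (Suc k) j"
  then obtain a m b where x: "x = (a, m, b)" "a \<in> XS" "m \<in> kdeg (Suc k)" "b \<in> XS" "j \<le> card b"
    by (auto simp: rfilt_def)
  have mem: "(a, m - {#i#}, insert i b) \<in> rfilt k (Suc j)" if i: "i \<in># m" and s: "sg {i} b \<noteq> 0" for i
  proof -
    have "i \<notin> b" "finite b" using s x by (auto simp: sg_nonzero intro: finite_subset)
    moreover have "i \<in> {1..n}" using i x by (auto simp: kdeg_def)
    ultimately show ?thesis using x i kdeg_diff[OF x(3) i] by (simp add: rfilt_def)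
  qed
  show "Poly_Mapping.keys (kosr (frag_of x)) \<subseteq> rfilt k (Suc j)"
    unfolding x(1) kosr_of kosrb_def
  proof (intro keys_sum_subset keys_cmul_frag_of_subset)
    fix i assume "i \<in># m" "(- 1) ^ size m * sg {i} b \<noteq> 0"
    then show "(a, m - {#i#}, insert i b) \<in> rfilt k (Suc j)" by (intro mem) auto
  qed
qed

lemma kosl_ctr3:
  assumes p: "p \<in> PM (kdeg (Suc k))"
  shows "kosl (ctr3 p) + ctr3 (kosl p) = p"
proof (rule additive_eqI[OF _ _ p[unfolded PM_def mem_Collect_eq]])
  fix x assume "x \<in> XS \<times> kdeg (Suc k) \<times> XS"
  then obtain a m b where xx: "x = (a, m, b)" "a \<in> XS" "m \<in> kdeg (Suc k)" by blast
  then have x: "x = (a, m, b)" "a \<subseteq> {1..n}" "set_mset m \<subseteq> {1..n}" "m \<noteq> {#}" by (auto simp: kdeg_def)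
  have "rat b (kap (ctrb a m) + ctr (kapb a m)) = frag_of x"
    using kap_ctr_basis[OF x(2,3)] x by (simp add: rat_of)
  then show "kosl (ctr3 (frag_of x)) + ctr3 (kosl (frag_of x)) = frag_of x"
    by (simp add: x ctr3_of kosl_of kosl_rat ctr3_rat rat_simps)
qed (intro additive_intros additive_comp[OF additive_kosl] additive_comp[OF additive_ctr3] additive_kosl additive_ctr3)+

lemma rfilt_PM: "Poly_Mapping.keys p \<subseteq> rfilt k j \<Longrightarrow> p \<in> PM (kdeg k)"
  unfolding PM_def rfilt_def by blast

text \<open>\<open>ctr3\<close> contracts the left half only, so it yields a primitive up to an
  error of higher right exterior degree. The induction ends when that degree exceeds
  \<open>n\<close>, where the error vanishes.\<close>

lemma kos_exact_filt:
  assumes "Poly_Mapping.keys z \<subseteq> rfilt (Suc k) j" "kosd z = 0"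
  shows "\<exists>y \<in> PM (kdeg (Suc (Suc k))). kosd y = z"
  using assms
proof (induction "Suc n - j" arbitrary: j z rule: less_induct)
  case less
  show ?case
  proof (cases "j \<le> n")
    case False
    have "rfilt (Suc k) j = {}"
    proof -
      have card: "card b \<le> n" if "b \<in> XS" for b using card_mono[of "{1..n}" b] that by simp
      have "x \<notin> rfilt (Suc k) j" for x
      proof
        assume "x \<in> rfilt (Suc k) j"
        then obtain b where "b \<in> XS" "j \<le> card b" unfolding rfilt_def by blast
        then show False using card[of b] False by simp
      qed
      then show ?thesis by blast
    qed
    then have "z = 0" using less(2) by (simp add: keys_eq_empty)
    then show ?thesis by (intro bexI[of _ 0]) (auto simp: additive_zero[OF additive_kosd] PM_def)
  next
    case True
    let ?y = "ctr3 z"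
    define z' where "z' = z - kosd ?y"
    have z: "z \<in> PM (kdeg (Suc k))" using less(2) by (rule rfilt_PM)
    have yk: "Poly_Mapping.keys ?y \<subseteq> rfilt (Suc (Suc k)) j" using less(2) by (rule ctr3_rfilt)
    then have y: "?y \<in> PM (kdeg (Suc (Suc k)))" by (rule rfilt_PM)
    have lz: "kosl z = - kosr z" using less(3) by (simp add: kosd_def eq_neg_iff_add_eq_0)
    \<comment> \<open>For a cycle \<open>kosl z = - kosr z\<close>, so the contraction identity
      expresses the error by two terms that both contain \<open>kosr\<close>, and
      \<open>kosr\<close> adds a variable on the right.\<close>
    have "z' = - ctr3 (kosr z) - kosr ?y"
      using kosl_ctr3[OF z] by (simp add: z'_def kosd_def lz additive_uminus[OF additive_ctr3] algebra_simps)
    moreover have "Poly_Mapping.keys (ctr3 (kosr z)) \<subseteq> rfilt (Suc k) (Suc j)"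
      by (rule ctr3_rfilt[OF kosr_rfilt[OF less(2)]])
    moreover have "Poly_Mapping.keys (kosr ?y) \<subseteq> rfilt (Suc k) (Suc j)"
      by (rule kosr_rfilt[OF yk])
    ultimately have "Poly_Mapping.keys z' \<subseteq> rfilt (Suc k) (Suc j)"
      by (simp add: keys_diff_subset)
    moreover have "kosd z' = 0"
      using kosd_kosd[OF PM_kdeg_keys[OF y]] less(3) by (simp add: z'_def additive_diff[OF additive_kosd])
    moreover have "Suc n - Suc j < Suc n - j" using True by auto
    ultimately obtain y' where y': "y' \<in> PM (kdeg (Suc (Suc k)))" "kosd y' = z'"
      using less(1)[of "Suc j" z'] by blast
    then have "kosd (y' + ?y) = z" by (simp add: additive_add[OF additive_kosd] z'_def)
    then show ?thesis using PM_add[OF y'(1) y] by blast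
  qed
qed

lemma resolution_koszul: "resolution kdeg kosd"
  unfolding resolution_def
proof (intro conjI allI ballI impI bihom_kosd)
  fix k p assume p: "p \<in> PM (kdeg (Suc k))"
  then show "kosd p \<in> PM (kdeg k)" by (rule kosd_PM)
  show "kosd (kosd p) = 0" using PM_kdeg_keys[OF p] by (rule kosd_kosd)
  assume "kosd p = 0"
  moreover have "Poly_Mapping.keys p \<subseteq> rfilt (Suc k) 0" using p by (auto simp: PM_def rfilt_def)
  ultimately show "\<exists>y \<in> PM (kdeg (Suc (Suc k))). kosd y = p" by (intro kos_exact_filt)
qed

end

context exterior
begin

section \<open>Comparison of the two resolutions\<close>

text \<open>The generator y_i corresponds to the bar word with the single letter x_i: both have
  boundary x_i \<otimes> 1 - 1 \<otimes> x_i.\<close>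

lemma koszul_to_bar_aug:
  assumes "p \<in> PM (kdeg (Suc 0))"
  shows "\<exists>y \<in> PM (bdeg (Suc 0)). bard y = bext (\<lambda>_. frag_of ({}, [], {})) (kosd p)"
proof -
  have "\<exists>f. bihom f \<and> (\<forall>p \<in> PM (kdeg (Suc 0)). f p \<in> PM (bdeg (Suc 0)) \<and>
      bard (f p) = bext (\<lambda>_. frag_of ({}, [], {})) (kosd p))"
  proof (rule bihom_lift[OF bihom_comp[OF bihom_bext bihom_kosd] bihom_bard])
    fix m assume "m \<in> kdeg (Suc 0)"
    then have sz: "size m = 1" "set_mset m \<subseteq> {1..n}" by (auto simp: kdeg_def)
    obtain i where m: "m = {#i#}" using size_1_singleton_mset[OF sz(1)] by blast
    have i: "i \<in> {1..n}" using sz(2) m by simp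
    have "bard (frag_of ({}, [{i}], {})) = bext (\<lambda>_. frag_of ({}, [], {})) (kosd (frag_of ({}, m, {})))"
      by (simp add: m bard_of kosd_def kosl_of kosr_of rat_kapb kosrb_def additive_diff[OF additive_bext]
          bext_of lact_of ract_of)
    moreover have "frag_of ({}, [{i}], {}) \<in> PM (bdeg (Suc 0))"
      using i by (intro frag_of_PM) (auto simp: bdeg_def)
    ultimately show "\<exists>y \<in> PM (bdeg (Suc 0)). bard y = bext (\<lambda>_. frag_of ({}, [], {})) (kosd (frag_of ({}, m, {})))"
      by blast
  qed
  then show ?thesis using assms by blast
qed

lemma sg_greater_eq_1: "(\<And>j. j \<in> w \<Longrightarrow> j < i) \<Longrightarrow> sg w {i} = 1"
proof -
  assume less: "\<And>j. j \<in> w \<Longrightarrow> j < i"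
  then have "inv_pairs w {i} = {}" by (auto simp: inv_pairs_def dest: less_asym)
  then show ?thesis using less by (auto simp: sg_def)
qed

text \<open>The difference x_w \<otimes> 1 - 1 \<otimes> x_w telescopes over the variables of w.
  Adding a new largest variable x_i writes it as x_w times the difference for x_i, plus the
  difference for x_w times x_i; in increasing order no signs appear.\<close>

lemma bar_to_koszul_telescope:
  assumes "finite w" "w \<subseteq> {1..n}"
  shows "\<exists>y \<in> PM (kdeg (Suc 0)). kosd y = frag_of (w, {#}, {}) - frag_of ({}, {#}, w)"
  using assms
proof (induction w rule: finite_linorder_max_induct)
  case empty
  show ?case by (intro bexI[of _ 0]) (auto simp: additive_zero[OF additive_kosd] PM_def)
next
  case (insert i w)
  obtain y where y: "y \<in> PM (kdeg (Suc 0))" "kosd y = frag_of (w, {#}, {}) - frag_of ({}, {#}, w)"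
    using insert by auto
  let ?e = "frag_of ({}, {#i#}, {})"
  have e: "?e \<in> PM (kdeg (Suc 0))" using insert by (intro frag_of_PM) (auto simp: kdeg_def)
  have s: "sg w {i} = 1" using insert by (intro sg_greater_eq_1) auto
  have ke: "kosd ?e = frag_of ({i}, {#}, {}) - frag_of ({}, {#}, {i})"
    by (simp add: kosd_def kosl_of kosr_of rat_kapb kosrb_def)
  have "kosd (lact w ?e + ract y {i}) = frag_of (insert i w, {#}, {}) - frag_of ({}, {#}, insert i w)"
    unfolding additive_add[OF additive_kosd] bihomD(2,3)[OF bihom_kosd] ke y(2)
    by (simp add: lact_simps ract_simps s)
  moreover have "lact w ?e + ract y {i} \<in> PM (kdeg (Suc 0))"
    using insert y e by (intro PM_add lact_PM ract_PM) auto
  ultimately show ?case by blast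
qed

lemma bar_to_koszul_aug:
  assumes "p \<in> PM (bdeg (Suc 0))"
  shows "\<exists>y \<in> PM (kdeg (Suc 0)). kosd y = bext (\<lambda>_. frag_of ({}, {#}, {})) (bard p)"
proof -
  have "\<exists>f. bihom f \<and> (\<forall>p \<in> PM (bdeg (Suc 0)). f p \<in> PM (kdeg (Suc 0)) \<and>
      kosd (f p) = bext (\<lambda>_. frag_of ({}, {#}, {})) (bard p))"
  proof (rule bihom_lift[OF bihom_comp[OF bihom_bext bihom_bard] bihom_kosd])
    fix ws assume "ws \<in> bdeg (Suc 0)"
    then have len: "length ws = Suc 0" "set ws \<subseteq> XS" by (auto simp: bdeg_def)
    then obtain w where ws: "ws = [w]" by (cases ws) auto
    then have w: "w \<subseteq> {1..n}" "finite w" using len finite_subset[of w "{1..n}"] by auto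
    have eq: "bext (\<lambda>_. frag_of ({}, {#}, {})) (bard (frag_of ({}, ws, {}))) = frag_of (w, {#}, {}) - frag_of ({}, {#}, w)"
      by (simp add: ws bard_of additive_diff[OF additive_bext] bext_of lact_of ract_of)
    show "\<exists>y \<in> PM (kdeg (Suc 0)). kosd y = bext (\<lambda>_. frag_of ({}, {#}, {})) (bard (frag_of ({}, ws, {})))"
      unfolding eq using w(2,1) by (rule bar_to_koszul_telescope)
  qed
  then show ?thesis using assms by blast
qed

section \<open>Tensoring down\<close>

text \<open>Tensoring with the algebra over its enveloping algebra, the right factor being rotated
  to the front. The algebra is ungraded, so the rotation brings no sign beyond that of the product
  x_b x_a. \<open>tup\<close> is a section.\<close>

definition tdown :: "(nat set \<times> 'g \<times> nat set \<Rightarrow>\<^sub>0 int) \<Rightarrow> (nat set \<times> 'g \<Rightarrow>\<^sub>0 int)" where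
  "tdown = frag_extend (\<lambda>(a, g, b). frag_cmul (sg b a) (frag_of (b \<union> a, g)))"

definition tup :: "(nat set \<times> 'g \<Rightarrow>\<^sub>0 int) \<Rightarrow> (nat set \<times> 'g \<times> nat set \<Rightarrow>\<^sub>0 int)" where
  "tup = frag_extend (\<lambda>(a, g). frag_of (a, g, {}))"

definition tind :: "((nat set \<times> 'g \<times> nat set \<Rightarrow>\<^sub>0 int) \<Rightarrow> (nat set \<times> 'h \<times> nat set \<Rightarrow>\<^sub>0 int)) \<Rightarrow>
    (nat set \<times> 'g \<Rightarrow>\<^sub>0 int) \<Rightarrow> (nat set \<times> 'h \<Rightarrow>\<^sub>0 int)" where
  "tind F p = tdown (F (tup p))"

lemma additive_tdown: "additive tdown"
  unfolding tdown_def by (rule additive_frag_extend)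

lemma additive_tup: "additive tup"
  unfolding tup_def by (rule additive_frag_extend)

lemma tdown_of: "tdown (frag_of (a, g, b)) = frag_cmul (sg b a) (frag_of (b \<union> a, g))"
  by (simp add: tdown_def)

lemma tup_of: "tup (frag_of (a, g)) = frag_of (a, g, {})"
  by (simp add: tup_def)

lemmas tdown_simps = tdown_of additive_frag_cmul[OF additive_tdown] additive_sum[OF additive_tdown]
  additive_diff[OF additive_tdown] additive_zero[OF additive_tdown] additive_add[OF additive_tdown]

lemma additive_tind: "additive F \<Longrightarrow> additive (tind F)"
  unfolding tind_def[abs_def] by (rule additive_comp[OF additive_tdown additive_comp[OF _ additive_tup]])

lemma tdown_tup: "tdown (tup p) = p"
  by (rule additive_eqI_UNIV[of "\<lambda>p. tdown (tup p)" "\<lambda>p. p"])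
    (auto simp: tup_of tdown_of intro!: additive_comp[OF additive_tdown additive_tup] additive_id)

lemma tdown_cyclic: "tdown (lact a (ract p b)) = frag_cmul (sg b a) (tdown (lact (b \<union> a) p))"
proof (rule additive_eqI_UNIV[of "\<lambda>p. tdown (lact a (ract p b))"])
  fix t :: "nat set \<times> 'g \<times> nat set"
  obtain x g y where t: "t = (x, g, y)" by (cases t)
  have "sg y b * sg a x * sg (y \<union> b) (a \<union> x) = sg a x * (sg b (a \<union> x) * sg y (b \<union> (a \<union> x)))"
    using sg_assoc[of y b "a \<union> x"] by (simp add: mult.commute mult.left_commute)
  also have "\<dots> = sg b a * sg (b \<union> a) x * sg y (b \<union> a \<union> x)"
    using sg_assoc[of b a x] by (simp add: Un_assoc mult.assoc[symmetric])
  finally show "tdown (lact a (ract (frag_of t) b)) = frag_cmul (sg b a) (tdown (lact (b \<union> a) (frag_of t)))"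
    by (simp add: t lact_simps ract_simps tdown_simps Un_assoc mult.assoc)
qed (intro additive_intros additive_comp[OF additive_tdown] additive_comp[OF additive_lact] additive_lact additive_ract)+

text \<open>\<open>tind\<close> evaluates \<open>F\<close> on the lift with trivial right factor.
  For a bimodule map every other lift gives the same result, by \<open>tdown_cyclic\<close>;
  functoriality of \<open>tind\<close> follows.\<close>

lemma tind_tdown:
  assumes F: "bihom F" shows "tind F (tdown p) = tdown (F p)"
proof (rule additive_eqI_UNIV[of "\<lambda>p. tind F (tdown p)" "\<lambda>p. tdown (F p)"])
  note aF = bihomD(1)[OF F]
  fix t :: "nat set \<times> 'a \<times> nat set"
  obtain a g b where t: "t = (a, g, b)" by (cases t)
  let ?e = "frag_of ({}, g, {})"
  have "tdown (F (frag_of t)) = tdown (lact a (ract (F ?e) b))"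
    unfolding t frag_of_triple[of a g b] bihomD[OF F] ..
  also have "\<dots> = frag_cmul (sg b a) (tdown (F (lact (b \<union> a) ?e)))"
    by (simp only: tdown_cyclic bihomD(2)[OF F])
  also have "\<dots> = tind F (tdown (frag_of t))"
    by (simp add: t tdown_of tind_def additive_frag_cmul[OF additive_tup] tup_of lact_of
        additive_frag_cmul[OF aF] additive_frag_cmul[OF additive_tdown])
  finally show "tind F (tdown (frag_of t)) = tdown (F (frag_of t))" by simp
qed (intro additive_comp[OF additive_tind additive_tdown] additive_comp[OF additive_tdown] bihomD(1)[OF F])+

lemma tind_comp: "bihom F \<Longrightarrow> tind F (tind G p) = tdown (F (G (tup p)))"
  by (simp add: tind_def[of G] tind_tdown)

definition PP :: "'g set \<Rightarrow> (nat set \<times> 'g \<Rightarrow>\<^sub>0 int) set" where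
  "PP G = {p. Poly_Mapping.keys p \<subseteq> XS \<times> G}"

lemma tup_PM: "p \<in> PP G \<Longrightarrow> tup p \<in> PM G"
  unfolding PP_def PM_def mem_Collect_eq
  by (rule keys_additive[OF additive_tup], assumption) (auto simp: tup_of)

lemma tdown_PP:
  assumes "p \<in> PM G" shows "tdown p \<in> PP G"
  using assms unfolding PP_def PM_def mem_Collect_eq
proof (rule keys_additive[OF additive_tdown])
  fix t assume "t \<in> XS \<times> G \<times> XS"
  then obtain a g b where t: "t = (a, g, b)" "a \<in> XS" "g \<in> G" "b \<in> XS" by blast
  show "Poly_Mapping.keys (tdown (frag_of t)) \<subseteq> XS \<times> G"
    unfolding t(1) tdown_of by (rule keys_cmul_frag_of_subset) (use t in blast)
qed

lemma tind_PP: "(\<And>p. p \<in> PM G \<Longrightarrow> F p \<in> PM G') \<Longrightarrow> p \<in> PP G \<Longrightarrow> tind F p \<in> PP G'"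
  by (simp add: tind_def tdown_PP tup_PM)

abbreviation "bdiff \<equiv> tind bard"
abbreviation "kdiff \<equiv> tind kosd"

text \<open>The comparison is stated for integral chains after tensoring, ready for base change. In
  degree 0 both resolutions have one generator and the comparison maps exchange the two, so the
  composites there are identities and no homotopy enters.\<close>

theorem bar_koszul_equivalence:
  obtains \<phi> \<psi> hb hk where
    "\<And>k. additive (\<phi> k)" "\<And>k. additive (\<psi> k)" "\<And>k. additive (hb k)" "\<And>k. additive (hk k)"
    "\<And>k p. p \<in> PP (bdeg k) \<Longrightarrow> \<phi> k p \<in> PP (kdeg k)"
    "\<And>k p. p \<in> PP (kdeg k) \<Longrightarrow> \<psi> k p \<in> PP (bdeg k)"
    "\<And>k p. p \<in> PP (bdeg k) \<Longrightarrow> hb k p \<in> PP (bdeg (Suc k))"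
    "\<And>k p. p \<in> PP (kdeg k) \<Longrightarrow> hk k p \<in> PP (kdeg (Suc k))"
    "\<And>k p. p \<in> PP (bdeg (Suc k)) \<Longrightarrow> kdiff (\<phi> (Suc k) p) = \<phi> k (bdiff p)"
    "\<And>k p. p \<in> PP (kdeg (Suc k)) \<Longrightarrow> bdiff (\<psi> (Suc k) p) = \<psi> k (kdiff p)"
    "\<And>k p. p \<in> PP (bdeg (Suc k)) \<Longrightarrow> bdiff (hb (Suc k) p) + hb k (bdiff p) = p - \<psi> (Suc k) (\<phi> (Suc k) p)"
    "\<And>k p. p \<in> PP (kdeg (Suc k)) \<Longrightarrow> kdiff (hk (Suc k) p) + hk k (kdiff p) = p - \<phi> (Suc k) (\<psi> (Suc k) p)"
    "\<And>p. p \<in> PP (bdeg 0) \<Longrightarrow> \<psi> 0 (\<phi> 0 p) = p"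
    "\<And>p. p \<in> PP (kdeg 0) \<Longrightarrow> \<phi> 0 (\<psi> 0 p) = p"
proof -
  let ?f0 = "bext (\<lambda>_ :: nat multiset. frag_of ({}, [] :: nat set list, {}))"
  let ?g0 = "bext (\<lambda>_ :: nat set list. frag_of ({}, {#} :: nat multiset, {}))"
  have f0P: "?f0 p \<in> PM (bdeg 0)" if "p \<in> PM (kdeg 0)" for p
    by (rule bihom_PM[OF bihom_bext that]) (auto simp: bext_of lact_of ract_of bdeg_def intro: frag_of_PM)
  have g0P: "?g0 p \<in> PM (kdeg 0)" if "p \<in> PM (bdeg 0)" for p
    by (rule bihom_PM[OF bihom_bext that]) (auto simp: bext_of lact_of ract_of kdeg_def intro: frag_of_PM)
  obtain f where f: "f 0 = ?f0" "\<And>k. bihom (f k)" "\<And>k p. p \<in> PM (kdeg k) \<Longrightarrow> f k p \<in> PM (bdeg k)"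
    "\<And>k p. p \<in> PM (kdeg (Suc k)) \<Longrightarrow> bard (f (Suc k) p) = f k (kosd p)"
    using chain_map_exists[OF resolution_koszul resolution_bar bihom_bext f0P koszul_to_bar_aug] by blast
  obtain g where g: "g 0 = ?g0" "\<And>k. bihom (g k)" "\<And>k p. p \<in> PM (bdeg k) \<Longrightarrow> g k p \<in> PM (kdeg k)"
    "\<And>k p. p \<in> PM (bdeg (Suc k)) \<Longrightarrow> kosd (g (Suc k) p) = g k (bard p)"
    using chain_map_exists[OF resolution_bar resolution_koszul bihom_bext g0P bar_to_koszul_aug] by blast
  have fg0: "f 0 (g 0 p) = p" if "p \<in> PM (bdeg 0)" for p
    by (rule bihom_eqI[OF bihom_comp[OF f(2) g(2)] bihom_id that])
      (simp add: f(1) g(1) bext_of lact_of ract_of bdeg_def)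
  have gf0: "g 0 (f 0 p) = p" if "p \<in> PM (kdeg 0)" for p
    by (rule bihom_eqI[OF bihom_comp[OF g(2) f(2)] bihom_id that])
      (simp add: f(1) g(1) bext_of lact_of ract_of kdeg_def)
  have "\<exists>h. h 0 = (\<lambda>_. 0) \<and> (\<forall>k. bihom (h k) \<and> (\<forall>p \<in> PM (bdeg k). h k p \<in> PM (bdeg (Suc k))) \<and>
    (\<forall>p \<in> PM (bdeg (Suc k)). bard (h (Suc k) p) + h k (bard p) = p - f (Suc k) (g (Suc k) p)))"
    by (rule homotopy_exists[OF resolution_bar, of "\<lambda>k p. f k (g k p)"])
      (simp_all add: f(2-4) g(2-4) fg0 bihom_comp)
  then obtain hb where hb: "\<And>k. bihom (hb k)" "\<And>k p. p \<in> PM (bdeg k) \<Longrightarrow> hb k p \<in> PM (bdeg (Suc k))"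
    "\<And>k p. p \<in> PM (bdeg (Suc k)) \<Longrightarrow> bard (hb (Suc k) p) + hb k (bard p) = p - f (Suc k) (g (Suc k) p)"
    by blast
  have "\<exists>h. h 0 = (\<lambda>_. 0) \<and> (\<forall>k. bihom (h k) \<and> (\<forall>p \<in> PM (kdeg k). h k p \<in> PM (kdeg (Suc k))) \<and>
    (\<forall>p \<in> PM (kdeg (Suc k)). kosd (h (Suc k) p) + h k (kosd p) = p - g (Suc k) (f (Suc k) p)))"
    by (rule homotopy_exists[OF resolution_koszul, of "\<lambda>k p. g k (f k p)"])
      (simp_all add: f(2-4) g(2-4) gf0 bihom_comp)
  then obtain hk where hk: "\<And>k. bihom (hk k)" "\<And>k p. p \<in> PM (kdeg k) \<Longrightarrow> hk k p \<in> PM (kdeg (Suc k))"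
    "\<And>k p. p \<in> PM (kdeg (Suc k)) \<Longrightarrow> kosd (hk (Suc k) p) + hk k (kosd p) = p - g (Suc k) (f (Suc k) p)"
    by blast
  show thesis
  proof (rule that[of "\<lambda>k. tind (g k)" "\<lambda>k. tind (f k)" "\<lambda>k. tind (hb k)" "\<lambda>k. tind (hk k)"])
    fix k
    show "additive (tind (g k))" "additive (tind (f k))" "additive (tind (hb k))" "additive (tind (hk k))"
      by (intro additive_tind bihomD(1)[OF f(2)] bihomD(1)[OF g(2)] bihomD(1)[OF hb(1)] bihomD(1)[OF hk(1)])+
    {
      fix p :: "nat set \<times> nat set list \<Rightarrow>\<^sub>0 int" assume p: "p \<in> PP (bdeg k)"
      show "tind (g k) p \<in> PP (kdeg k)" using g(3) p by (rule tind_PP)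
      show "tind (hb k) p \<in> PP (bdeg (Suc k))" using hb(2) p by (rule tind_PP)
    }
    {
      fix p :: "nat set \<times> nat multiset \<Rightarrow>\<^sub>0 int" assume p: "p \<in> PP (kdeg k)"
      show "tind (f k) p \<in> PP (bdeg k)" using f(3) p by (rule tind_PP)
      show "tind (hk k) p \<in> PP (kdeg (Suc k))" using hk(2) p by (rule tind_PP)
    }
    {
      fix p :: "nat set \<times> nat set list \<Rightarrow>\<^sub>0 int" assume p: "p \<in> PP (bdeg (Suc k))"
      note tp = tup_PM[OF p]
      show "kdiff (tind (g (Suc k)) p) = tind (g k) (bdiff p)"
        by (simp add: tind_comp bihom_kosd g(2,4) tp)
      have "bdiff (tind (hb (Suc k)) p) + tind (hb k) (bdiff p) =
          tdown (bard (hb (Suc k) (tup p)) + hb k (bard (tup p)))"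
        by (simp add: tind_comp bihom_bard hb(1) tdown_simps)
      also have "\<dots> = p - tind (f (Suc k)) (tind (g (Suc k)) p)"
        by (simp add: hb(3)[OF tp] tdown_simps tdown_tup tind_comp f(2))
      finally show "bdiff (tind (hb (Suc k)) p) + tind (hb k) (bdiff p) = p - tind (f (Suc k)) (tind (g (Suc k)) p)" .
    }
    {
      fix p :: "nat set \<times> nat multiset \<Rightarrow>\<^sub>0 int" assume p: "p \<in> PP (kdeg (Suc k))"
      note tp = tup_PM[OF p]
      show "bdiff (tind (f (Suc k)) p) = tind (f k) (kdiff p)"
        by (simp add: tind_comp bihom_bard f(2,4) tp)
      have "kdiff (tind (hk (Suc k)) p) + tind (hk k) (kdiff p) =
          tdown (kosd (hk (Suc k) (tup p)) + hk k (kosd (tup p)))"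
        by (simp add: tind_comp bihom_kosd hk(1) tdown_simps)
      also have "\<dots> = p - tind (g (Suc k)) (tind (f (Suc k)) p)"
        by (simp add: hk(3)[OF tp] tdown_simps tdown_tup tind_comp g(2))
      finally show "kdiff (tind (hk (Suc k)) p) + tind (hk k) (kdiff p) = p - tind (g (Suc k)) (tind (f (Suc k)) p)" .
    }
  next
    show "tind (f 0) (tind (g 0) p) = p" if "p \<in> PP (bdeg 0)" for p
      using fg0[OF tup_PM[OF that]] by (simp add: tind_comp f(2) tdown_tup)
    show "tind (g 0) (tind (f 0) p) = p" if "p \<in> PP (kdeg 0)" for p
      using gf0[OF tup_PM[OF that]] by (simp add: tind_comp g(2) tdown_tup)
  qed
qed

section \<open>The small complex\<close>

text \<open>Carrying x_i across x_c passes each variable of x_c once. The inversions on the two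
  sides are the elements of \<open>c\<close> below and above \<open>i\<close>.\<close>

lemma sg_commute_singleton:
  assumes "c \<subseteq> {1..n}" "i \<in> {1..n}"
  shows "sg {i} c = (-1) ^ card c * sg c {i}"
proof (cases "i \<in> c")
  case False
  have fc: "finite c" using assms finite_subset by auto
  have "inv_pairs {i} c = Pair i ` {j \<in> c. j < i}" "inv_pairs c {i} = (\<lambda>j. (j, i)) ` {j \<in> c. i < j}"
    using assms by (auto simp: inv_pairs_def)
  then have "card (inv_pairs {i} c) = card {j \<in> c. j < i}" "card (inv_pairs c {i}) = card {j \<in> c. i < j}"
    by (simp_all add: card_image inj_on_def)
  moreover have "card c = card {j \<in> c. j < i} + card {j \<in> c. i < j}"
  proof -
    have "j < i \<or> i < j" if "j \<in> c" for j using False that by (metis nat_neq_iff)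
    then have "c = {j \<in> c. j < i} \<union> {j \<in> c. i < j}" by blast
    moreover have "card ({j \<in> c. j < i} \<union> {j \<in> c. i < j}) = card {j \<in> c. j < i} + card {j \<in> c. i < j}"
      using fc by (intro card_Un_disjoint) auto
    ultimately show ?thesis by simp
  qed
  ultimately show ?thesis using False
    by (simp add: sg_def power_add mult.assoc)
qed (simp add: sg_def)

text \<open>Both halves lead to the same basis elements. The right half has the sign (-1)^|m|, and
  x_i x_c = (-1)^|c| x_c x_i, so the coefficients combine to 1 + (-1)^(|c| + |m|).\<close>

lemma kdiff_of:
  assumes "c \<subseteq> {1..n}" "set_mset m \<subseteq> {1..n}"
  shows "kdiff (frag_of (c, m)) = (if even (card c + size m) then frag_cmul 2 (kapb c m) else 0)"
proof -
  have "kdiff (frag_of (c, m)) = (\<Sum>i\<in>set_mset m. frag_cmul (sg c {i}) (frag_of (insert i c, m - {#i#})) +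
      frag_cmul ((-1) ^ size m * sg {i} c) (frag_of (insert i c, m - {#i#})))"
    by (simp add: tind_def tup_of kosd_def kosl_of kosr_of rat_kapb kosrb_def tdown_simps sum.distrib)
  also have "\<dots> = (\<Sum>i\<in>set_mset m. frag_cmul (1 + (-1) ^ (card c + size m))
      (frag_cmul (sg c {i}) (frag_of (insert i c, m - {#i#}))))"
    using assms by (intro sum.cong refl)
      (auto simp: sg_commute_singleton subset_iff frag_cmul_distrib[symmetric] power_add algebra_simps)
  finally show ?thesis
    by (auto simp: kapb_def frag_cmul_sum_right)
qed

end

text \<open>Pascal's rule: a multiset either avoids the new largest element or contains a copy that
  can be removed. With truncated subtraction the formula is also right for \<open>n = 0\<close>: 1
  if \<open>k = 0\<close>, and 0 otherwise.\<close>

lemma finite_card_multisets: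
  "finite {m. size m = k \<and> set_mset m \<subseteq> {1..n}} \<and>
   card {m. size m = k \<and> set_mset m \<subseteq> {1..n}} = (n + k - 1) choose k"
proof (induction n arbitrary: k)
  case 0
  have eq: "{m :: nat multiset. size m = k \<and> set_mset m \<subseteq> {1..0}} = (if k = 0 then {{#}} else {})" by auto
  show ?case unfolding eq by (cases k) auto
next
  case (Suc n)
  note n = Suc
  let ?M = "\<lambda>n k. {m. size m = k \<and> set_mset m \<subseteq> {1..n}}"
  show ?case
  proof (induction k)
    case 0
    have "?M (Suc n) 0 = {{#}}" by auto
    then show ?case by simp
  next
    case (Suc k)
    have "?M (Suc n) (Suc k) \<subseteq> ?M n (Suc k) \<union> add_mset (Suc n) ` ?M (Suc n) k"
    proof
      fix m assume m: "m \<in> ?M (Suc n) (Suc k)"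
      show "m \<in> ?M n (Suc k) \<union> add_mset (Suc n) ` ?M (Suc n) k"
      proof (cases "Suc n \<in># m")
        case True
        then have "m = add_mset (Suc n) (m - {#Suc n#})" by simp
        moreover have "m - {#Suc n#} \<in> ?M (Suc n) k"
          using m True by (auto simp: size_Diff_singleton dest: in_diffD)
        ultimately show ?thesis by blast
      next
        case False
        then have "x \<noteq> Suc n" if "x \<in># m" for x using that by auto
        then have "set_mset m \<subseteq> {1..n}" using m by (fastforce simp: le_Suc_eq)
        then show ?thesis using m by simp
      qed
    qed
    moreover have "?M n (Suc k) \<union> add_mset (Suc n) ` ?M (Suc n) k \<subseteq> ?M (Suc n) (Suc k)" by auto
    ultimately have eq: "?M (Suc n) (Suc k) = ?M n (Suc k) \<union> add_mset (Suc n) ` ?M (Suc n) k" by blast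
    have "?M n (Suc k) \<inter> add_mset (Suc n) ` ?M (Suc n) k = {}" by auto
    moreover have "card (add_mset (Suc n) ` ?M (Suc n) k) = card (?M (Suc n) k)"
      by (rule card_image) (simp add: inj_on_def)
    ultimately have "card (?M (Suc n) (Suc k)) = card (?M n (Suc k)) + card (?M (Suc n) k)"
      unfolding eq using n[of "Suc k"] Suc by (subst card_Un_disjoint) simp_all
    also have "\<dots> = ((n + k) choose (Suc k)) + ((n + k) choose k)"
      using n[of "Suc k"] Suc by simp
    finally have "card (?M (Suc n) (Suc k)) = (Suc n + Suc k - 1) choose (Suc k)" by simp
    then show ?case using eq n[of "Suc k"] Suc by simp
  qed
qed

section \<open>Cycles and boundaries of the small complex\<close>

context exterior
begin

definition pproj :: "(nat set \<times> nat multiset \<Rightarrow> bool) \<Rightarrow> (nat set \<times> nat multiset \<Rightarrow>\<^sub>0 int) \<Rightarrow> (nat set \<times> nat multiset \<Rightarrow>\<^sub>0 int)" where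
  "pproj P = frag_extend (\<lambda>x. if P x then frag_of x else 0)"

lemma additive_pproj: "additive (pproj P)"
  unfolding pproj_def by (rule additive_frag_extend)

lemma pproj_of: "pproj P (frag_of x) = (if P x then frag_of x else 0)"
  by (simp add: pproj_def)

lemmas pproj_simps = pproj_of additive_frag_cmul[OF additive_pproj] additive_sum[OF additive_pproj]
  additive_diff[OF additive_pproj] additive_zero[OF additive_pproj] additive_add[OF additive_pproj]

lemma lookup_pproj: "Poly_Mapping.lookup (pproj P p) x = (if P x then Poly_Mapping.lookup p x else 0)"
proof (induction p rule: frag_induction[OF subset_UNIV])
  case (3 a b)
  then show ?case by (simp add: pproj_simps Poly_Mapping.lookup_minus)
qed (auto simp: pproj_simps)

text \<open>The total degree in both kinds of variables. \<open>kap\<close> and \<open>ctr\<close>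
  preserve it, so the complex splits by its parity.\<close>

definition wt :: "nat set \<times> nat multiset \<Rightarrow> nat" where
  "wt = (\<lambda>(c, m). card c + size m)"

abbreviation "evp \<equiv> pproj (\<lambda>x. even (wt x))"

text \<open>The generators contributing free summands to the homology.\<close>

definition freegen :: "nat set \<times> nat multiset \<Rightarrow> bool" where
  "freegen x \<longleftrightarrow> odd (wt x) \<or> x = ({}, {#})"

abbreviation "pfree \<equiv> pproj freegen"

text \<open>The basis elements in the image of the contraction: the largest variable occurs in the
  divided power part only. The clause \<open>m \<noteq> {#}\<close> excludes the empty monomial,
  where \<open>Max\<close> is unspecified.\<close>

definition top_out :: "nat set \<times> nat multiset \<Rightarrow> bool" where
  "top_out = (\<lambda>(c, m). m \<noteq> {#} \<and> Max (c \<union> set_mset m) \<notin> c)"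

definition FS :: "nat \<Rightarrow> (nat set \<times> nat multiset) set" where
  "FS k = {x \<in> XS \<times> kdeg k. freegen x}"

text \<open>The images of the contraction in even weight, each contributing a torsion summand one degree
  lower.\<close>

definition US :: "nat \<Rightarrow> (nat set \<times> nat multiset) set" where
  "US k = {x \<in> XS \<times> kdeg k. even (wt x) \<and> top_out x}"

lemma PP_keysD: "p \<in> PP G \<Longrightarrow> Poly_Mapping.keys p \<subseteq> XS \<times> G"
  by (simp add: PP_def)

lemma PP_add: "p \<in> PP G \<Longrightarrow> q \<in> PP G \<Longrightarrow> p + q \<in> PP G"
  by (simp add: PP_def keys_add_subset)

lemma pproj_PP: "p \<in> PP G \<Longrightarrow> pproj P p \<in> PP G"
  unfolding PP_def mem_Collect_eq
  by (erule keys_additive[OF additive_pproj]) (simp add: pproj_of)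

lemma kdiff_PP: "p \<in> PP (kdeg (Suc k)) \<Longrightarrow> kdiff p \<in> PP (kdeg k)"
  by (rule tind_PP[OF kosd_PM])

lemma additive_kdiff: "additive kdiff"
  by (rule additive_tind[OF additive_kosd])

lemmas kdiff_simps = additive_frag_cmul[OF additive_kdiff] additive_sum[OF additive_kdiff]
  additive_diff[OF additive_kdiff] additive_zero[OF additive_kdiff] additive_add[OF additive_kdiff]

lemma wt_insert:
  assumes "finite c" "sg c {i} \<noteq> 0" "i \<in># m"
  shows "wt (insert i c, m - {#i#}) = wt (c, m)"
proof -
  have "i \<notin> c" using assms(2) by (simp add: sg_nonzero)
  moreover have "size m = Suc (size (m - {#i#}))" using assms(3) by (metis insert_DiffM size_add_mset)
  ultimately show ?thesis using assms(1) by (simp add: wt_def)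
qed

lemma keys_kapb:
  assumes "finite c"
  shows "Poly_Mapping.keys (kapb c m) \<subseteq> {x. wt x = wt (c, m) \<and> fst x \<noteq> {}}"
  unfolding kapb_def
proof (intro keys_sum_subset keys_cmul_frag_of_subset)
  fix i assume "i \<in># m" "sg c {i} \<noteq> 0"
  then show "(insert i c, m - {#i#}) \<in> {x. wt x = wt (c, m) \<and> fst x \<noteq> {}}"
    using wt_insert[OF assms] by simp
qed

lemma ctrb_cases:
  assumes "finite c"
  obtains "ctrb c m = 0" "Max (c \<union> set_mset m) \<notin> c"
  | M where "M \<in> c" "M = Max (c \<union> set_mset m)" "ctrb c m = frag_of (c - {M}, add_mset M m)"
    "wt (c - {M}, add_mset M m) = wt (c, m)" "top_out (c - {M}, add_mset M m)"
proof (cases "Max (c \<union> set_mset m) \<in> c")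
  case True
  define M where "M = Max (c \<union> set_mset m)"
  have M: "M \<in> c" using True by (simp add: M_def)
  have "c - {M} \<union> set_mset (add_mset M m) = c \<union> set_mset m \<union> {M}" using M by auto
  also have "\<dots> = c \<union> set_mset m" using M by auto
  finally have "top_out (c - {M}, add_mset M m)" by (simp add: top_out_def M_def)
  moreover have "wt (c - {M}, add_mset M m) = wt (c, m)"
    using M assms card_Suc_Diff1[of c M] by (simp add: wt_def)
  ultimately show thesis using M that(2)[of M] by (simp add: ctrb_def Let_def M_def)
next
  case False
  then show thesis using that(1) by (simp add: ctrb_def Let_def)
qed

lemma additive_eqI_PP:
  fixes f g :: "(nat set \<times> 'g \<Rightarrow>\<^sub>0 int) \<Rightarrow> ('b \<Rightarrow>\<^sub>0 int)"
  assumes "additive f" "additive g" "p \<in> PP G"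
    and "\<And>c m. c \<subseteq> {1..n} \<Longrightarrow> finite c \<Longrightarrow> m \<in> G \<Longrightarrow> f (frag_of (c, m)) = g (frag_of (c, m))"
  shows "f p = g p"
proof (rule additive_eqI[OF assms(1,2) PP_keysD[OF assms(3)]])
  fix x assume "x \<in> XS \<times> G"
  then obtain c m where "x = (c, m)" "c \<subseteq> {1..n}" "m \<in> G" by blast
  moreover from this have "finite c" using finite_subset by blast
  ultimately show "f (frag_of x) = g (frag_of x)" using assms(4) by simp
qed

lemma kdegD: "m \<in> kdeg k \<Longrightarrow> set_mset m \<subseteq> {1..n}"
  by (simp add: kdeg_def)

lemma kdiff_basis:
  assumes "c \<subseteq> {1..n}" "m \<in> kdeg k"
  shows "kdiff (frag_of (c, m)) = (if even (wt (c, m)) then frag_cmul 2 (kapb c m) else 0)"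
  using kdiff_of[OF assms(1) kdegD[OF assms(2)]] by (simp add: wt_def)

lemma kdiff_eq:
  assumes "p \<in> PP (kdeg k)" shows "kdiff p = frag_cmul 2 (kap (evp p))"
proof (rule additive_eqI_PP[OF additive_kdiff _ assms])
  show "additive (\<lambda>p. frag_cmul 2 (kap (evp p)))"
    by (intro additive_cmul additive_comp[OF additive_kap additive_pproj])
  fix c m assume "c \<subseteq> {1..n}" "m \<in> kdeg k"
  then show "kdiff (frag_of (c, m)) = frag_cmul 2 (kap (evp (frag_of (c, m))))"
    by (simp add: kdiff_basis pproj_of kap_of kap_simps)
qed

text \<open>The terms of a boundary have even weight and a nonempty exterior part, while a free
  generator has odd weight or is 1.\<close>

lemma pfree_kdiff: assumes "p \<in> PP (kdeg k)" shows "pfree (kdiff p) = 0"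
proof (rule additive_eqI_PP[OF additive_comp[OF additive_pproj additive_kdiff] additive_zero_map assms])
  fix c m assume c: "c \<subseteq> {1..n}" "finite c" and m: "m \<in> kdeg k"
  have "pfree (kapb c m) = 0" if "even (wt (c, m))"
    using keys_kapb[OF c(2), of m] by (rule additive_eqI[OF additive_pproj additive_zero_map])
      (use that in \<open>auto simp: pproj_of freegen_def\<close>)
  then show "pfree (kdiff (frag_of (c, m))) = 0"
    using c m by (simp add: kdiff_basis pproj_simps)
qed

lemma kapb_empty: "kapb c {#} = 0"
  by (simp add: kapb_def)

lemma kdiff_pfree: assumes "p \<in> PP (kdeg k)" shows "kdiff (pfree p) = 0"
proof (rule additive_eqI_PP[OF additive_comp[OF additive_kdiff additive_pproj] additive_zero_map assms])
  fix c m assume "c \<subseteq> {1..n}" "m \<in> kdeg k"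
  then show "kdiff (pfree (frag_of (c, m))) = 0"
    by (auto simp: pproj_of freegen_def kdiff_basis kdiff_simps kapb_empty)
qed

lemma ctr_PP:
  assumes "p \<in> PP (kdeg k)" shows "ctr p \<in> PP (kdeg (Suc k))"
  using assms unfolding PP_def mem_Collect_eq
proof (rule keys_additive[OF additive_ctr])
  fix x assume "x \<in> XS \<times> kdeg k"
  then obtain c m where x: "x = (c, m)" "c \<subseteq> {1..n}" "m \<in> kdeg k" by blast
  have "finite c" using x finite_subset by blast
  then show "Poly_Mapping.keys (ctr (frag_of x)) \<subseteq> XS \<times> kdeg (Suc k)"
    by (cases rule: ctrb_cases[of c m]) (use x in \<open>auto simp: ctr_of kdeg_def\<close>)
qed

text \<open>In even weight, apart from 1, this is twice the identity of
  \<open>kap_ctr_basis\<close>, since the differential is twice \<open>kap\<close>. On the remaining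
  basis elements both composites vanish and the last term takes over. Being integral, the identity
  survives base change to any ring.\<close>

lemma two_eq:
  assumes "p \<in> PP (kdeg k)"
  shows "frag_cmul 2 p = kdiff (ctr p) + ctr (kdiff p) + frag_cmul 2 (pfree p)"
proof (rule additive_eqI_PP[OF _ _ assms])
  show "additive (\<lambda>p. kdiff (ctr p) + ctr (kdiff p) + frag_cmul 2 (pfree p))"
    by (intro additive_plus additive_cmul additive_pproj additive_comp[OF additive_kdiff additive_ctr]
        additive_comp[OF additive_ctr additive_kdiff])
  show "additive (frag_cmul 2)" by (rule additive_cmul[OF additive_id])
  fix c m assume c: "c \<subseteq> {1..n}" "finite c" and m: "m \<in> kdeg k"
  have PPcm: "frag_of (c, m) \<in> PP (kdeg k)" using c m by (auto simp: PP_def)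
  have kc: "kdiff (ctrb c m) = (if even (wt (c, m)) then frag_cmul 2 (kap (ctrb c m)) else 0)"
  proof (cases rule: ctrb_cases[OF c(2), of m])
    case 1
    then show ?thesis by (simp add: kdiff_simps kap_simps)
  next
    case (2 M)
    have "add_mset M m \<in> kdeg (Suc k)" "c - {M} \<subseteq> {1..n}" using 2 c m by (auto simp: kdeg_def)
    then show ?thesis using 2 by (simp add: kdiff_basis kap_of)
  qed
  show "frag_cmul 2 (frag_of (c, m)) = kdiff (ctr (frag_of (c, m))) + ctr (kdiff (frag_of (c, m))) + frag_cmul 2 (pfree (frag_of (c, m)))"
  proof (cases "freegen (c, m)")
    case True
    show ?thesis
    proof (cases "odd (wt (c, m))")
      case False
      then have "c = {}" "m = {#}" using True by (auto simp: freegen_def)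
      then show ?thesis using True c m
        by (simp add: pproj_of ctr_of ctrb_def Let_def kdiff_simps kdiff_basis kapb_empty ctr_simps)
    qed (use True kc c m in \<open>simp add: pproj_of ctr_of kdiff_basis ctr_simps\<close>)
  next
    case False
    then have e: "even (wt (c, m))" "c \<noteq> {} \<or> m \<noteq> {#}" by (auto simp: freegen_def)
    have "kap (ctrb c m) + ctr (kapb c m) = frag_of (c, m)"
      using kap_ctr_basis[OF c(1) kdegD[OF m] e(2)] .
    then have "frag_cmul 2 (frag_of (c, m)) = frag_cmul 2 (kap (ctrb c m)) + frag_cmul 2 (ctr (kapb c m))"
      by (metis frag_cmul_distrib2)
    then show ?thesis using False e c m kc by (simp add: pproj_of ctr_of kdiff_basis ctr_simps)
  qed
qed

lemma keys_ctr:
  assumes "p \<in> PP (kdeg k)" shows "Poly_Mapping.keys (ctr p) \<subseteq> {x. top_out x}"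
proof (rule keys_additive[OF additive_ctr PP_keysD[OF assms]])
  fix x assume "x \<in> XS \<times> kdeg k"
  then obtain c m where x: "x = (c, m)" "c \<subseteq> {1..n}" "m \<in> kdeg k" by blast
  have "finite c" using x finite_subset by blast
  then show "Poly_Mapping.keys (ctr (frag_of x)) \<subseteq> {x. top_out x}"
    by (cases rule: ctrb_cases[of c m]) (use x in \<open>auto simp: ctr_of\<close>)
qed

lemma ctr_top_out: assumes "Poly_Mapping.keys p \<subseteq> {x. top_out x}" shows "ctr p = 0"
  by (rule additive_eqI[OF additive_ctr additive_zero_map assms])
    (auto simp: ctr_of top_out_def ctrb_def Let_def)

lemma evp_kap: assumes "p \<in> PP (kdeg k)" shows "evp (kap p) = kap (evp p)"
proof (rule additive_eqI_PP[OF additive_comp[OF additive_pproj additive_kap] additive_comp[OF additive_kap additive_pproj] assms])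
  fix c :: "nat set" and m assume c: "finite c"
  have "evp (kapb c m) = (if even (wt (c, m)) then kapb c m else 0)"
  proof (cases "even (wt (c, m))")
    case True
    then have "evp (kapb c m) = kapb c m"
      by (intro additive_eqI[OF additive_pproj additive_id keys_kapb[OF c, of m]]) (auto simp: pproj_of)
    then show ?thesis using True by simp
  next
    case False
    then have "evp (kapb c m) = 0"
      by (intro additive_eqI[OF additive_pproj additive_zero_map keys_kapb[OF c, of m]]) (auto simp: pproj_of)
    then show ?thesis using False by simp
  qed
  then show "evp (kap (frag_of (c, m))) = kap (evp (frag_of (c, m)))"
    by (simp add: kap_of pproj_of kap_simps)
qed

lemma evp_ctr: assumes "p \<in> PP (kdeg k)" shows "evp (ctr p) = ctr (evp p)"
proof (rule additive_eqI_PP[OF additive_comp[OF additive_pproj additive_ctr] additive_comp[OF additive_ctr additive_pproj] assms])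
  fix c :: "nat set" and m assume c: "finite c"
  show "evp (ctr (frag_of (c, m))) = ctr (evp (frag_of (c, m)))"
    by (cases rule: ctrb_cases[OF c, of m]) (auto simp: ctr_of pproj_simps ctr_simps)
qed

lemma kap_PP:
  assumes "p \<in> PP (kdeg (Suc k))" shows "kap p \<in> PP (kdeg k)"
  using assms unfolding PP_def mem_Collect_eq
proof (rule keys_additive[OF additive_kap])
  fix x assume "x \<in> XS \<times> kdeg (Suc k)"
  then obtain c m where x: "x = (c, m)" "c \<in> XS" "m \<in> kdeg (Suc k)" by blast
  show "Poly_Mapping.keys (kap (frag_of x)) \<subseteq> XS \<times> kdeg k"
    unfolding x(1) kap_of kapb_def
  proof (intro keys_sum_subset keys_cmul_frag_of_subset)
    fix i assume i: "i \<in># m"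
    then have "i \<in> {1..n}" using kdegD[OF x(3)] by blast
    then show "(insert i c, m - {#i#}) \<in> XS \<times> kdeg k" using x i by (simp add: kdeg_diff)
  qed
qed

lemma frag_cmul_cancel: "frag_cmul 2 p = frag_cmul 2 q \<Longrightarrow> p = (q :: 'a \<Rightarrow>\<^sub>0 int)"
  by (metis eq_iff_diff_eq_0 frag_cmul_eq_0_iff frag_cmul_minus_right zero_neq_numeral)

text \<open>A cycle without free part equals \<open>kap d\<close> for
  \<open>d = ctr (evp c)\<close>. As the differential is twice \<open>kap\<close> in even weight,
  such a cycle is a boundary exactly when \<open>d\<close> can be halved, and \<open>d\<close> is
  supported on \<open>US (Suc k)\<close>.\<close>

lemma boundary_iff:
  assumes c: "c \<in> PP (kdeg k)" and cyc: "kdiff c = 0"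
  shows "c \<in> kdiff ` PP (kdeg (Suc k)) \<longleftrightarrow>
    (\<forall>x \<in> FS k. Poly_Mapping.lookup c x = 0) \<and> (\<forall>u \<in> US (Suc k). even (Poly_Mapping.lookup (ctr (evp c)) u))"
proof
  assume "c \<in> kdiff ` PP (kdeg (Suc k))"
  then obtain y where y: "y \<in> PP (kdeg (Suc k))" "c = kdiff y" by blast
  have "Poly_Mapping.lookup c x = 0" if "x \<in> FS k" for x
    using pfree_kdiff[OF y(1)] lookup_pproj[of freegen c x] that y(2) by (simp add: FS_def)
  moreover have "even (Poly_Mapping.lookup (ctr (evp c)) u)" for u
    using y by (simp add: kdiff_eq pproj_simps ctr_simps)
  ultimately show "(\<forall>x \<in> FS k. Poly_Mapping.lookup c x = 0) \<and> (\<forall>u \<in> US (Suc k). even (Poly_Mapping.lookup (ctr (evp c)) u))"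
    by blast
next
  assume *: "(\<forall>x \<in> FS k. Poly_Mapping.lookup c x = 0) \<and> (\<forall>u \<in> US (Suc k). even (Poly_Mapping.lookup (ctr (evp c)) u))"
  have pf: "pfree c = 0"
  proof (rule poly_mapping_eqI)
    fix x
    show "Poly_Mapping.lookup (pfree c) x = Poly_Mapping.lookup 0 x"
    proof (cases "x \<in> FS k \<or> \<not> freegen x")
      case False
      then have "x \<notin> Poly_Mapping.keys c" using PP_keysD[OF c] by (auto simp: FS_def)
      then show ?thesis by (simp add: lookup_pproj in_keys_iff)
    qed (use * in \<open>auto simp: lookup_pproj\<close>)
  qed
  define d where "d = ctr (evp c)"
  have d: "d \<in> PP (kdeg (Suc k))" unfolding d_def by (intro ctr_PP pproj_PP c)
  have dUS: "Poly_Mapping.keys d \<subseteq> US (Suc k)"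
  proof
    fix x assume x: "x \<in> Poly_Mapping.keys d"
    have "even (wt x)"
    proof (rule ccontr)
      assume "odd (wt x)"
      then have "Poly_Mapping.lookup (evp (ctr c)) x = 0" by (simp add: lookup_pproj)
      then show False using x evp_ctr[OF c] by (simp add: d_def in_keys_iff)
    qed
    moreover have "top_out x" using x keys_ctr[OF pproj_PP[OF c]] by (auto simp: d_def)
    ultimately show "x \<in> US (Suc k)" using x PP_keysD[OF d] by (auto simp: US_def)
  qed
  have ev: "even (Poly_Mapping.lookup d x)" for x
  proof (cases "x \<in> Poly_Mapping.keys d")
    case True
    then show ?thesis using dUS * by (auto simp: d_def)
  qed (simp add: in_keys_iff)
  \<comment> \<open>Half of \<open>d\<close>, coefficient by coefficient; this is the chain whose
    boundary is \<open>c\<close>.\<close>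
  define u where "u = frag_extend (\<lambda>x. frag_cmul (Poly_Mapping.lookup d x div 2) (frag_of x)) (\<Sum>x\<in>Poly_Mapping.keys d. frag_of x)"
  have u_sum: "u = (\<Sum>x\<in>Poly_Mapping.keys d. frag_cmul (Poly_Mapping.lookup d x div 2) (frag_of x))"
    by (simp add: u_def additive_sum[OF additive_frag_extend])
  have "frag_cmul 2 u = (\<Sum>x\<in>Poly_Mapping.keys d. frag_cmul (Poly_Mapping.lookup d x) (frag_of x))"
    using ev by (simp add: u_sum frag_cmul_sum_right)
  also have "\<dots> = d" using frag_expansion[of d] by (simp add: frag_extend_def)
  finally have du: "frag_cmul 2 u = d" .
  have uPP: "u \<in> PP (kdeg (Suc k))"
    unfolding u_sum PP_def mem_Collect_eq
    using PP_keysD[OF d] by (intro keys_sum_subset keys_cmul_frag_of_subset) blast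
  have "frag_cmul 2 c = kdiff (ctr c)"
    using two_eq[OF c] cyc pf by (simp add: ctr_simps)
  also have "\<dots> = frag_cmul 2 (kap d)"
    by (simp add: kdiff_eq[OF ctr_PP[OF c]] evp_ctr[OF c] d_def)
  finally have cd: "c = kap d" by (rule frag_cmul_cancel)
  have "evp u = u"
  proof (rule frag_cmul_cancel)
    have "frag_cmul 2 (evp u) = evp d" by (simp add: du[symmetric] pproj_simps)
    also have "\<dots> = evp (evp (ctr c))" by (simp add: d_def evp_ctr[OF c])
    also have "\<dots> = d" by (rule poly_mapping_eqI) (simp add: lookup_pproj d_def evp_ctr[OF c, symmetric])
    finally show "frag_cmul 2 (evp u) = frag_cmul 2 u" by (simp add: du)
  qed
  then have "kdiff u = c"
    using kdiff_eq[OF uPP] cd by (simp add: du[symmetric] kap_simps)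
  then show "c \<in> kdiff ` PP (kdeg (Suc k))" using uPP by blast
qed

lemma finite_kdeg: "finite (kdeg k)"
  using finite_card_multisets[of k n] by (simp add: kdeg_def)

lemma card_kdeg: "card (kdeg k) = (n + k - 1) choose k"
  using finite_card_multisets[of k n] by (simp add: kdeg_def)

text \<open>The cycle is a combination \<open>a\<close> of free generators plus
  \<open>kap u\<close>. The contraction kills the elements of \<open>US\<close>, hence
  \<open>ctr (kap u) = u\<close>. Moreover \<open>kap u\<close> is a cycle because
  \<open>kap\<close> squares to zero, although only its double is known to be a boundary.\<close>

lemma coeffs_surj:
  obtains c where "c \<in> PP (kdeg k)" "kdiff c = 0" "\<And>x. x \<in> FS k \<Longrightarrow> Poly_Mapping.lookup c x = f x"
    "\<And>u. u \<in> US (Suc k) \<Longrightarrow> Poly_Mapping.lookup (ctr (evp c)) u = g u"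
proof -
  have fin: "finite (XS \<times> kdeg k)" for k by (simp add: finite_kdeg)
  define a where "a = (\<Sum>x\<in>FS k. frag_cmul (f x) (frag_of x))"
  define u where "u = (\<Sum>x\<in>US (Suc k). frag_cmul (g x) (frag_of x))"
  have la: "Poly_Mapping.lookup a x = (if x \<in> FS k then f x else 0)" for x
    using fin[of k] by (simp add: a_def lookup_sum FS_def when_def sum.delta' if_distrib cong: if_cong)
  have lu: "Poly_Mapping.lookup u x = (if x \<in> US (Suc k) then g x else 0)" for x
    using fin[of "Suc k"] by (simp add: u_def lookup_sum US_def when_def sum.delta' if_distrib cong: if_cong)
  have aPP: "a \<in> PP (kdeg k)" unfolding a_def PP_def mem_Collect_eq
    by (intro keys_sum_subset keys_cmul_frag_of_subset) (auto simp: FS_def)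
  have uPP: "u \<in> PP (kdeg (Suc k))" unfolding u_def PP_def mem_Collect_eq
    by (intro keys_sum_subset keys_cmul_frag_of_subset) (auto simp: US_def)
  have pa: "pfree a = a" by (rule poly_mapping_eqI) (auto simp: lookup_pproj la FS_def)
  have eu: "evp u = u" by (rule poly_mapping_eqI) (auto simp: lookup_pproj lu US_def)
  have pu: "pfree u = 0" by (rule poly_mapping_eqI) (auto simp: lookup_pproj lu US_def freegen_def top_out_def)
  have "Poly_Mapping.keys u \<subseteq> {x. top_out x}" unfolding u_def
    by (intro keys_sum_subset keys_cmul_frag_of_subset) (auto simp: US_def)
  then have cu: "ctr u = 0" by (rule ctr_top_out)
  have kuPP: "kap u \<in> PP (kdeg k)" using uPP by (rule kap_PP)
  have kd: "frag_cmul 2 (kap u) = kdiff u" using kdiff_eq[OF uPP] eu by simp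
  have pk: "pfree (kap u) = 0"
  proof (rule frag_cmul_cancel)
    show "frag_cmul 2 (pfree (kap u)) = frag_cmul 2 0"
      using pfree_kdiff[OF uPP] kd by (simp add: additive_frag_cmul[OF additive_pproj, symmetric])
  qed
  have ck: "ctr (kap u) = u"
  proof (rule frag_cmul_cancel)
    show "frag_cmul 2 (ctr (kap u)) = frag_cmul 2 u"
      using two_eq[OF uPP] cu pu kd by (simp add: kdiff_simps additive_frag_cmul[OF additive_ctr, symmetric])
  qed
  \<comment> \<open>Among the free generators only 1 has even weight, and the contraction kills
    it.\<close>
  have ea: "ctr (evp a) = 0"
  proof -
    have "evp a = frag_cmul (Poly_Mapping.lookup a ({}, {#})) (frag_of ({}, {#}))"
    proof (rule poly_mapping_eqI)
      fix x
      show "Poly_Mapping.lookup (evp a) x = Poly_Mapping.lookup (frag_cmul (Poly_Mapping.lookup a ({}, {#})) (frag_of ({}, {#}))) x"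
        using la by (auto simp: lookup_pproj FS_def freegen_def wt_def when_def)
    qed
    then show ?thesis by (simp add: ctr_simps ctrb_def Let_def)
  qed
  define c where "c = a + kap u"
  show thesis
  proof (rule that)
    show "c \<in> PP (kdeg k)" unfolding c_def by (rule PP_add[OF aPP kuPP])
    show "kdiff c = 0"
    proof -
      have "kdiff a = 0" using kdiff_pfree[OF aPP] pa by simp
      moreover have "kdiff (kap u) = 0"
      proof -
        have "Poly_Mapping.keys u \<subseteq> {(a, m). set_mset m \<subseteq> {1..n}}"
          using PP_keysD[OF uPP] kdegD by blast
        then have "kap (kap u) = 0" by (rule kap_kap)
        then show ?thesis using kdiff_eq[OF kuPP] evp_kap[OF uPP] eu by simp
      qed
      ultimately show ?thesis by (simp add: c_def kdiff_simps)
    qed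
    show "Poly_Mapping.lookup c x = f x" if "x \<in> FS k" for x
      using lookup_pproj[of freegen c x] pa pk la that by (simp add: c_def pproj_simps FS_def)
    show "Poly_Mapping.lookup (ctr (evp c)) x = g x" if "x \<in> US (Suc k)" for x
      using evp_kap[OF uPP] eu ck ea lu that by (simp add: c_def pproj_simps ctr_simps)
  qed
qed


section \<open>Counting the generators\<close>

text \<open>Toggling the element 1, available because \<open>n \<ge> 1\<close>, exchanges the two
  parities.\<close>

lemma card_even_subsets:
  assumes "n \<ge> 1" shows "card {c \<in> XS. even (card c + s)} = 2 ^ (n - 1)"
    and "card {c \<in> XS. odd (card c + s)} = 2 ^ (n - 1)"
proof -
  let ?E = "{c \<in> XS. even (card c + s)}" and ?O = "{c \<in> XS. odd (card c + s)}"
  define t where "t c = (if (1::nat) \<in> c then c - {1} else insert 1 c)" for c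
  have fin: "finite c" if "c \<in> XS" for c using that finite_subset by auto
  have tX: "t c \<in> XS" if "c \<in> XS" for c using that assms by (auto simp: t_def)
  have tt: "t (t c) = c" for c by (auto simp: t_def)
  have tc: "odd (card (t c) + card c)" if "c \<in> XS" for c
  proof (cases "1 \<in> c")
    case True
    then have "card c = Suc (card (c - {1}))" using fin[OF that] by (metis card_Suc_Diff1)
    then show ?thesis using True by (simp add: t_def)
  next
    case False
    then show ?thesis using fin[OF that] by (simp add: t_def)
  qed
  have "bij_betw t ?E ?O"
  proof (rule bij_betw_byWitness[where f' = t])
    have par: "even (card (t c) + s) \<longleftrightarrow> odd (card c + s)" if "c \<in> XS" for c
      using tc[OF that] by auto
    show "t ` ?E \<subseteq> ?O" using tX par by blast
    show "t ` ?O \<subseteq> ?E" using tX par by blast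
  qed (simp_all add: tt)
  then have eq: "card ?E = card ?O" by (rule bij_betw_same_card)
  have "card ?E + card ?O = card (?E \<union> ?O)"
    by (rule card_Un_disjoint[symmetric]) auto
  also have "?E \<union> ?O = XS" by auto
  also have "card XS = 2 ^ n" by (simp add: card_Pow)
  finally have "card ?E + card ?O = 2 * 2 ^ (n - 1)" using assms by (cases n) auto
  then show "card ?E = 2 ^ (n - 1)" "card ?O = 2 ^ (n - 1)" using eq by linarith+
qed

lemma card_XS_kdeg: "card (XS \<times> kdeg k) = 2 ^ n * ((n + k - 1) choose k)"
  by (simp add: card_cartesian_product card_Pow card_kdeg)

lemma card_wt_parity:
  assumes "n \<ge> 1"
  shows "card {x \<in> XS \<times> kdeg k. even (wt x)} = 2 ^ (n - 1) * ((n + k - 1) choose k)"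
    and "card {x \<in> XS \<times> kdeg k. odd (wt x)} = 2 ^ (n - 1) * ((n + k - 1) choose k)"
proof -
  have e: "{x \<in> XS \<times> kdeg k. even (wt x)} = {c \<in> XS. even (card c + k)} \<times> kdeg k"
    by (auto simp: wt_def kdeg_def)
  show "card {x \<in> XS \<times> kdeg k. even (wt x)} = 2 ^ (n - 1) * ((n + k - 1) choose k)"
    unfolding e card_cartesian_product card_even_subsets(1)[OF assms] card_kdeg ..
  have o: "{x \<in> XS \<times> kdeg k. odd (wt x)} = {c \<in> XS. odd (card c + k)} \<times> kdeg k"
    by (auto simp: wt_def kdeg_def)
  show "card {x \<in> XS \<times> kdeg k. odd (wt x)} = 2 ^ (n - 1) * ((n + k - 1) choose k)"
    unfolding o card_cartesian_product card_even_subsets(2)[OF assms] card_kdeg ..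
qed

lemma finite_FS: "finite (FS k)" and finite_US: "finite (US k)"
  by (simp_all add: FS_def US_def finite_kdeg)

lemma card_FS:
  assumes "n \<ge> 1"
  shows "card (FS k) = 2 ^ (n - 1) * ((n + k - 1) choose k) + (if k = 0 then 1 else 0)"
proof (cases "k = 0")
  case True
  then have "FS k = insert ({}, {#}) {x \<in> XS \<times> kdeg k. odd (wt x)}"
    by (auto simp: FS_def freegen_def kdeg_def)
  moreover have "({}, {#}) \<notin> {x \<in> XS \<times> kdeg k. odd (wt x)}" by (simp add: wt_def)
  moreover have "finite {x \<in> XS \<times> kdeg k. odd (wt x)}" by (simp add: finite_kdeg)
  ultimately show ?thesis using True card_wt_parity(2)[OF assms, of k] by simp
next
  case False
  then have "FS k = {x \<in> XS \<times> kdeg k. odd (wt x)}"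
    by (auto simp: FS_def freegen_def kdeg_def)
  then show ?thesis using False card_wt_parity(2)[OF assms, of k] by simp
qed

lemma US_0: "US 0 = {}"
  by (auto simp: US_def top_out_def kdeg_def)

text \<open>In even weight the basis of degree \<open>k\<close> splits into the elements whose
  largest variable lies in the exterior part (\<open>V\<close>), those where it does not
  (\<open>US k\<close>), and 1 if \<open>k = 0\<close>. The contraction maps \<open>V\<close>
  bijectively onto \<open>US (Suc k)\<close>.\<close>

lemma card_US_Suc:
  assumes "n \<ge> 1"
  shows "card (US (Suc k)) + card (US k) + (if k = 0 then 1 else 0) = 2 ^ (n - 1) * ((n + k - 1) choose k)"
proof -
  define V where "V = {(c, m). c \<in> XS \<and> m \<in> kdeg k \<and> even (wt (c, m)) \<and> Max (c \<union> set_mset m) \<in> c \<and> c \<noteq> {}}"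
  define F where "F = (\<lambda>(c, m). let M = Max (c \<union> set_mset m :: nat set) in (c - {M}, add_mset M m))"
  define G where "G = (\<lambda>(c, m). let M = Max (c \<union> set_mset m :: nat set) in (insert M c, m - {#M#}))"
  have fin: "finite c" if "c \<in> XS" for c using that finite_subset by auto
  have "bij_betw F V (US (Suc k))"
  proof (rule bij_betw_byWitness[where f' = G])
    show "\<forall>x\<in>V. G (F x) = x"
    proof
      fix x assume "x \<in> V"
      then obtain c m where x: "x = (c, m)" and M: "Max (c \<union> set_mset m) \<in> c" by (auto simp: V_def)
      have "c - {Max (c \<union> set_mset m)} \<union> set_mset (add_mset (Max (c \<union> set_mset m)) m) = c \<union> set_mset m"
        using M by auto
      then show "G (F x) = x" using M by (simp add: x F_def G_def Let_def insert_absorb)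
    qed
    show "\<forall>x\<in>US (Suc k). F (G x) = x"
    proof
      fix x assume "x \<in> US (Suc k)"
      then obtain c m where x: "x = (c, m)" and M: "Max (c \<union> set_mset m) \<notin> c" "m \<noteq> {#}" and c: "c \<in> XS"
        by (auto simp: US_def top_out_def)
      let ?M = "Max (c \<union> set_mset m)"
      have "?M \<in> c \<union> set_mset m" using fin[OF c] M by (intro Max_in) auto
      then have Mm: "?M \<in># m" using M by simp
      have "set_mset m = insert ?M (set_mset (m - {#?M#}))"
        using Mm by (metis insert_DiffM set_mset_add_mset_insert)
      then have "insert ?M c \<union> set_mset (m - {#?M#}) = c \<union> set_mset m" by blast
      then have "Max (insert ?M c \<union> set_mset (m - {#?M#})) = ?M" by (rule arg_cong)
      then show "F (G x) = x" using M Mm unfolding x F_def G_def Let_def by simp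
    qed
    show "F ` V \<subseteq> US (Suc k)"
    proof
      fix y assume "y \<in> F ` V"
      then obtain c m where y: "y = F (c, m)" and v: "c \<in> XS" "m \<in> kdeg k" "even (wt (c, m))" "Max (c \<union> set_mset m) \<in> c"
        by (auto simp: V_def)
      show "y \<in> US (Suc k)"
        by (cases rule: ctrb_cases[OF fin[OF v(1)], of m])
          (use v in \<open>auto simp: y F_def US_def Let_def kdeg_def\<close>)
    qed
    show "G ` US (Suc k) \<subseteq> V"
    proof
      fix y assume "y \<in> G ` US (Suc k)"
      then obtain c m where y: "y = G (c, m)" and M: "Max (c \<union> set_mset m) \<notin> c" "m \<noteq> {#}"
        and c: "c \<in> XS" and m: "m \<in> kdeg (Suc k)" and e: "even (wt (c, m))"
        by (auto simp: US_def top_out_def)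
      let ?M = "Max (c \<union> set_mset m)"
      have "?M \<in> c \<union> set_mset m" using fin[OF c] M by (intro Max_in) auto
      then have Mm: "?M \<in># m" using M by simp
      have "set_mset m = insert ?M (set_mset (m - {#?M#}))"
        using Mm by (metis insert_DiffM set_mset_add_mset_insert)
      then have "insert ?M c \<union> set_mset (m - {#?M#}) = c \<union> set_mset m" by blast
      then have mx: "Max (insert ?M c \<union> set_mset (m - {#?M#})) = ?M" by (rule arg_cong)
      have "sg c {?M} \<noteq> 0" using M by (simp add: sg_nonzero)
      then have w: "wt (insert ?M c, m - {#?M#}) = wt (c, m)" using wt_insert[OF fin[OF c] _ Mm] by blast
      have "?M \<in> {1..n}" using Mm kdegD[OF m] by blast
      then have "insert ?M c \<in> XS" using c by simp
      moreover have "m - {#?M#} \<in> kdeg k" using m Mm by (rule kdeg_diff)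
      ultimately have "(insert ?M c, m - {#?M#}) \<in> V" using mx w e unfolding V_def by simp
      then show "y \<in> V" unfolding y G_def Let_def by simp
    qed
  qed
  then have cV: "card V = card (US (Suc k))" by (rule bij_betw_same_card)
  define Z where "Z = (if k = 0 then {({}, {#})} else {} :: (nat set \<times> nat multiset) set)"
  have "{x \<in> XS \<times> kdeg k. even (wt x)} = V \<union> US k \<union> Z"
  proof (intro equalityI subsetI)
    fix x assume x: "x \<in> {x \<in> XS \<times> kdeg k. even (wt x)}"
    then obtain c m where cm: "x = (c, m)" "c \<in> XS" "m \<in> kdeg k" by blast
    show "x \<in> V \<union> US k \<union> Z"
    proof (cases "Max (c \<union> set_mset m) \<in> c")
      case True
      then show ?thesis using x cm unfolding V_def by auto
    next
      case False
      show ?thesis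
      proof (cases "m = {#}")
        case True
        have "c = {}" using False True fin[OF cm(2)] Max_in by auto
        then show ?thesis using True cm by (auto simp: Z_def kdeg_def)
      next
        case m: False
        then show ?thesis using x cm False by (auto simp: US_def top_out_def)
      qed
    qed
  next
    fix x assume "x \<in> V \<union> US k \<union> Z"
    then show "x \<in> {x \<in> XS \<times> kdeg k. even (wt x)}"
      by (auto simp: V_def US_def Z_def kdeg_def wt_def split: if_splits)
  qed
  moreover have "finite V"
    by (rule finite_subset[of _ "XS \<times> kdeg k"]) (auto simp: V_def finite_kdeg)
  moreover have "V \<inter> US k = {}" by (auto simp: V_def US_def top_out_def)
  moreover have "(V \<union> US k) \<inter> Z = {}" by (auto simp: V_def US_def top_out_def Z_def)
  ultimately have "card {x \<in> XS \<times> kdeg k. even (wt x)} = card V + card (US k) + card Z"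
    by (simp add: card_Un_disjoint finite_US Z_def)
  moreover have "card Z = (if k = 0 then 1 else 0)" by (simp add: Z_def)
  ultimately show ?thesis unfolding card_wt_parity(1)[OF assms] cV by simp
qed

text \<open>This unrolls the recursion of \<open>card_US_Suc\<close>: the alternating signs come
  from moving \<open>card (US k)\<close> to the other side, and the leading sign from the extra 1 in
  degree 0.\<close>

lemma card_US:
  assumes "n \<ge> 1"
  shows "int (card (US (Suc k))) = (-1) ^ (k + 1) +
    2 ^ (n - 1) * (\<Sum>i\<in>{0..k}. (-1) ^ (k - i) * int ((n + i - 1) choose i))"
proof (induction k)
  case 0
  have "card (US (Suc 0)) + 1 = 2 ^ (n - 1)" using card_US_Suc[OF assms, of 0] by (simp add: US_0)
  then have "int (card (US (Suc 0)) + 1) = int (2 ^ (n - 1))" by (rule arg_cong)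
  then show ?case by simp
next
  case (Suc k)
  have "card (US (Suc (Suc k))) + card (US (Suc k)) = 2 ^ (n - 1) * ((n + Suc k - 1) choose Suc k)"
    using card_US_Suc[OF assms, of "Suc k"] by simp
  then have "int (card (US (Suc (Suc k))) + card (US (Suc k))) = int (2 ^ (n - 1) * ((n + Suc k - 1) choose Suc k))"
    by (rule arg_cong)
  then have s1: "int (card (US (Suc (Suc k)))) = 2 ^ (n - 1) * int ((n + Suc k - 1) choose Suc k) - int (card (US (Suc k)))"
    by simp
  have s2: "(\<Sum>i\<in>{0..Suc k}. (-1) ^ (Suc k - i) * int ((n + i - 1) choose i)) =
      int ((n + Suc k - 1) choose Suc k) - (\<Sum>i\<in>{0..k}. (-1) ^ (k - i) * int ((n + i - 1) choose i))"
  proof -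
    have "(\<Sum>i\<in>{0..k}. (-1) ^ (Suc k - i) * int ((n + i - 1) choose i)) =
        (\<Sum>i\<in>{0..k}. - ((-1) ^ (k - i) * int ((n + i - 1) choose i)))"
      by (rule sum.cong[OF refl]) (simp add: Suc_diff_le)
    then show ?thesis by (simp add: sum_negf)
  qed
  show ?case unfolding s1 s2 Suc.IH by (simp add: algebra_simps)
qed

end

section \<open>Base change from the integers\<close>

context cring
begin

text \<open>The canonical homomorphism from the integers to \<open>R\<close>, through which all
  signs and the coefficient 2 enter.\<close>

definition zr :: "int \<Rightarrow> 'a" where "zr z = [z] \<cdot> \<one>"

lemma zr_closed [simp]: "zr z \<in> carrier R"
  by (simp add: zr_def)

lemma zr_add: "zr (a + b) = zr a \<oplus> zr b"
  by (simp add: zr_def add.int_pow_mult)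

lemma zr_0 [simp]: "zr 0 = \<zero>"
  by (simp add: zr_def add_pow_def)

lemma zr_1 [simp]: "zr 1 = \<one>"
  by (simp add: zr_def)

lemma zr_uminus: "zr (- a) = \<ominus> zr a"
  by (simp add: zr_def add.int_pow_neg)

lemma zr_mult: "zr (a * b) = zr a \<otimes> zr b"
proof -
  have "zr a \<otimes> zr b = [b] \<cdot> zr a"
    using add_pow_rdistr_int[of "zr a" \<one> b] by (simp add: zr_def)
  also have "\<dots> = zr (a * b)" by (simp add: zr_def add.int_pow_pow mult.commute)
  finally show ?thesis by simp
qed

lemma ring_sign_zr: "ring_sign R i = zr ((-1) ^ i)"
  by (induction i) (simp_all add: ring_sign_def zr_mult zr_uminus m_comm l_minus)

definition emb :: "('x \<Rightarrow>\<^sub>0 int) \<Rightarrow> 'x \<Rightarrow> 'a" where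
  "emb c = (\<lambda>x. zr (Poly_Mapping.lookup c x))"

lemma emb_closed: "Poly_Mapping.keys c \<subseteq> S \<Longrightarrow> emb c \<in> carrier (free_module R S)"
proof -
  assume c: "Poly_Mapping.keys c \<subseteq> S"
  have "{x. emb c x \<noteq> \<zero>} \<subseteq> Poly_Mapping.keys c" by (auto simp: emb_def in_keys_iff)
  moreover have "emb c x = \<zero>" if "x \<notin> S" for x
  proof -
    have "x \<notin> Poly_Mapping.keys c" using that c by blast
    then show ?thesis by (simp add: emb_def in_keys_iff)
  qed
  ultimately show ?thesis
    by (auto simp: free_module_def emb_def intro: finite_subset)
qed

lemma emb_of: "emb (frag_of x) = basis_vec R x"
  by (auto simp: emb_def basis_vec_def)

lemma emb_0: "emb 0 = \<zero>\<^bsub>free_module R S\<^esub>"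
  by (simp add: emb_def free_module_simps)

lemma emb_add: "emb (a + b) = emb a \<oplus>\<^bsub>free_module R S\<^esub> emb b"
  by (simp add: emb_def free_module_simps lookup_add zr_add)

lemma emb_cmul: "emb (frag_cmul z c) = zr z \<odot>\<^bsub>free_module R S\<^esub> emb c"
  by (simp add: emb_def free_module_simps zr_mult)

lemma emb_diff:
  assumes "Poly_Mapping.keys a \<subseteq> S" "Poly_Mapping.keys b \<subseteq> S"
  shows "emb (a - b) = emb a \<ominus>\<^bsub>free_module R S\<^esub> emb b"
proof -
  interpret F: module R "free_module R S" by (rule module_free_module)
  have "emb (a - b) \<oplus>\<^bsub>free_module R S\<^esub> emb b = emb a" by (simp add: emb_add[symmetric])
  moreover have "emb (a - b) \<in> carrier (free_module R S)"
    using assms by (intro emb_closed keys_diff_subset)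
  ultimately show ?thesis
    using emb_closed[OF assms(1)] emb_closed[OF assms(2)]
    by (metis F.M.minus_eq F.M.a_assoc F.M.r_neg F.M.r_zero F.M.a_inv_closed)
qed

text \<open>The base change of \<open>F\<close> along the homomorphism \<open>zr\<close> from the integers.\<close>

definition bc :: "'y set \<Rightarrow> (('x \<Rightarrow>\<^sub>0 int) \<Rightarrow> ('y \<Rightarrow>\<^sub>0 int)) \<Rightarrow> ('x \<Rightarrow> 'a) \<Rightarrow> 'y \<Rightarrow> 'a" where
  "bc T F = lin_ext R (free_module R T) (\<lambda>x. emb (F (frag_of x)))"

lemma bc_hom:
  assumes "\<And>x. x \<in> S \<Longrightarrow> Poly_Mapping.keys (F (frag_of x)) \<subseteq> T"
  shows "bc T F \<in> module_hom R (free_module R S) (free_module R T)"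
  unfolding bc_def using assms by (intro lin_ext_hom module_free_module emb_closed)

lemma bc_basis:
  assumes "\<And>x. x \<in> S \<Longrightarrow> Poly_Mapping.keys (F (frag_of x)) \<subseteq> T" "x \<in> S"
  shows "bc T F (basis_vec R x) = emb (F (frag_of x))"
  unfolding bc_def using assms by (intro lin_ext_basis_vec module_free_module emb_closed)

lemma hom_emb_eqI:
  assumes P: "module R P"
    and h: "h \<in> module_hom R (free_module R S) P" "h' \<in> module_hom R (free_module R S) P"
    and eq: "\<And>x. x \<in> S \<Longrightarrow> h (emb (frag_of x)) = h' (emb (frag_of x))"
    and f: "f \<in> carrier (free_module R S)"
  shows "h f = h' f"
  by (rule free_module_hom_eqI[OF P h _ f]) (use eq in \<open>simp add: emb_of\<close>)

lemma hom_emb_additive: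
  fixes F :: "('x \<Rightarrow>\<^sub>0 int) \<Rightarrow> ('y \<Rightarrow>\<^sub>0 int)"
  assumes h: "h \<in> module_hom R (free_module R S) (free_module R T)" and F: "additive F"
    and keys: "\<And>x. x \<in> S \<Longrightarrow> Poly_Mapping.keys (F (frag_of x)) \<subseteq> T"
    and eq: "\<And>x. x \<in> S \<Longrightarrow> h (emb (frag_of x)) = emb (F (frag_of x))"
    and c: "Poly_Mapping.keys c \<subseteq> S"
  shows "h (emb c) = emb (F c)"
proof -
  have Fk: "Poly_Mapping.keys (F p) \<subseteq> T" if "Poly_Mapping.keys p \<subseteq> S" for p
    by (rule keys_additive[OF F that keys])
  have "Poly_Mapping.keys c \<subseteq> S \<and> h (emb c) = emb (F c)"
    using c
  proof (induction rule: frag_induction)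
    case zero
    show ?case
      unfolding additive_zero[OF F] emb_0[of T] emb_0[of S]
      using module_hom_zero[OF module_free_module module_free_module h] by simp
  next
    case (one x)
    then show ?case using eq by simp
  next
    case (diff a b)
    then have a: "Poly_Mapping.keys a \<subseteq> S" and b: "Poly_Mapping.keys b \<subseteq> S" by auto
    have "h (emb (a - b)) = h (emb a) \<ominus>\<^bsub>free_module R T\<^esub> h (emb b)"
      unfolding emb_diff[OF a b]
      by (rule module_hom_minus[OF module_free_module module_free_module h emb_closed[OF a] emb_closed[OF b]])
    also have "\<dots> = emb (F (a - b))"
      using diff by (simp add: additive_diff[OF F] emb_diff[OF Fk[OF a] Fk[OF b]])
    finally show ?case using keys_diff_subset[OF a b] by blast
  qed
  then show ?thesis ..
qed

lemma bc_emb: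
  assumes "additive F" "\<And>x. x \<in> S \<Longrightarrow> Poly_Mapping.keys (F (frag_of x)) \<subseteq> T" "Poly_Mapping.keys c \<subseteq> S"
  shows "bc T F (emb c) = emb (F c)"
proof (rule hom_emb_additive[OF bc_hom[of S F T, OF assms(2)] assms(1) assms(2) _ assms(3)])
  show "bc T F (emb (frag_of x)) = emb (F (frag_of x))" if "x \<in> S" for x
    unfolding emb_of by (rule bc_basis[of S F T, OF assms(2) that])
qed

end

section \<open>The exterior algebra over a commutative ring\<close>

locale exterior_ring = cring R + exterior n for R (structure) and n
begin

text \<open>Keeps index sets in the form \<open>{1..n}\<close>; otherwise simplification rewrites 1
  to \<open>Suc 0\<close> and facts about these sets no longer match.\<close>

declare One_nat_def [simp del]

abbreviation "A \<equiv> exterior_algebra R n"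
abbreviation "F \<equiv> free_module R XS"
abbreviation "e \<equiv> basis_vec R :: nat set \<Rightarrow> nat set \<Rightarrow> 'a"

text \<open>\<open>A\<close> and its underlying free module \<open>F\<close> differ only in the
  fields \<open>mult\<close> and \<open>one\<close>, so linear maps are the same for both.\<close>

lemma A_simps:
  "carrier A = carrier F" "\<zero>\<^bsub>A\<^esub> = \<zero>\<^bsub>F\<^esub>" "a \<oplus>\<^bsub>A\<^esub> b = a \<oplus>\<^bsub>F\<^esub> b"
  "r \<odot>\<^bsub>A\<^esub> a = r \<odot>\<^bsub>F\<^esub> a" "\<one>\<^bsub>A\<^esub> = e {}"
  by (simp_all add: exterior_algebra_def Let_def)

sublocale F: module R F by (rule module_free_module)

lemma module_A: "module R A"
proof (rule module_criteria)
  show "\<forall>v\<in>carrier A. \<exists>w\<in>carrier A. v \<oplus>\<^bsub>A\<^esub> w = \<zero>\<^bsub>A\<^esub>"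
    using F.M.r_neg F.M.a_inv_closed by (metis A_simps(1-3))
qed (auto simp: A_simps F.M.a_ac F.smult_l_distr F.smult_r_distr F.smult_assoc1 is_cring)

lemma module_hom_A: "module_hom R A P = module_hom R F P" "module_hom R P A = module_hom R P F"
  by (simp_all add: module_hom_def A_simps)

lemma e_closed: "\<sigma> \<in> XS \<Longrightarrow> e \<sigma> \<in> carrier F"
  by (rule basis_vec_closed)

lemma ext_basis_mult_sg:
  assumes "\<sigma> \<in> XS" "\<tau> \<in> XS"
  shows "ext_basis_mult R n \<sigma> \<tau> = zr (sg \<sigma> \<tau>) \<odot>\<^bsub>F\<^esub> e (\<sigma> \<union> \<tau>)"
proof -
  have "{(i, j). i \<in> \<sigma> \<and> j \<in> \<tau> \<and> j < i} = inv_pairs \<sigma> \<tau>"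
    using assms by (auto simp: inv_pairs_def)
  moreover have "e (\<sigma> \<union> \<tau>) \<in> carrier F" using assms by (intro e_closed) auto
  ultimately show ?thesis
    by (auto simp: ext_basis_mult_def Let_def sg_def ring_sign_zr)
qed

lemma emul:
  assumes "\<sigma> \<in> XS" "\<tau> \<in> XS"
  shows "e \<sigma> \<otimes>\<^bsub>A\<^esub> e \<tau> = zr (sg \<sigma> \<tau>) \<odot>\<^bsub>F\<^esub> e (\<sigma> \<union> \<tau>)"
  using exterior_mult_basis[of \<sigma> n \<tau>] ext_basis_mult_sg[OF assms] assms by simp

lemma inner_hom:
  "\<sigma> \<in> XS \<Longrightarrow> lin_ext R F (\<lambda>\<tau>. ext_basis_mult R n \<sigma> \<tau>) \<in> module_hom R F F"
  using ext_basis_mult_closed by (intro lin_ext_hom F.module_axioms) auto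

lemma mult_eq: "f \<otimes>\<^bsub>A\<^esub> g = lin_ext R F (\<lambda>\<sigma>. lin_ext R F (\<lambda>\<tau>. ext_basis_mult R n \<sigma> \<tau>) g) f"
  by (simp add: exterior_algebra_def Let_def)

lemma mult_hom_left: "g \<in> carrier F \<Longrightarrow> (\<lambda>f. f \<otimes>\<^bsub>A\<^esub> g) \<in> module_hom R F F"
  unfolding mult_eq by (rule lin_ext_hom[OF F.module_axioms module_hom_in_carrier[OF inner_hom]])

lemma mult_hom_right: "f \<in> carrier F \<Longrightarrow> (\<lambda>g. f \<otimes>\<^bsub>A\<^esub> g) \<in> module_hom R F F"
proof (induction rule: free_module_induct)
  case zero
  have "\<zero>\<^bsub>F\<^esub> \<otimes>\<^bsub>A\<^esub> g = \<zero>\<^bsub>F\<^esub>" if "g \<in> carrier F" for g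
    using module_hom_zero[OF F.module_axioms F.module_axioms mult_hom_left[OF that]] .
  then show ?case by (intro module_homI) auto
next
  case (add f r \<sigma>)
  have e: "e \<sigma> \<otimes>\<^bsub>A\<^esub> g = lin_ext R F (\<lambda>\<tau>. ext_basis_mult R n \<sigma> \<tau>) g" if "g \<in> carrier F" for g
    unfolding mult_eq using add that module_hom_in_carrier[OF inner_hom]
    by (intro lin_ext_basis_vec F.module_axioms) auto
  have "(\<lambda>g. e \<sigma> \<otimes>\<^bsub>A\<^esub> g) \<in> module_hom R F F"
    by (rule module_hom_cong[OF inner_hom[OF add(3)] e[symmetric] F.module_axioms])
  then have "(\<lambda>g. (f \<otimes>\<^bsub>A\<^esub> g) \<oplus>\<^bsub>F\<^esub> r \<odot>\<^bsub>F\<^esub> (e \<sigma> \<otimes>\<^bsub>A\<^esub> g)) \<in> module_hom R F F"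
    using add by (intro F.module_hom_pointwise_add F.module_hom_pointwise_smult)
  then show ?case
    by (rule module_hom_cong[OF _ _ F.module_axioms])
      (use add e_closed[OF add(3)] in \<open>simp add: module_hom_add[OF mult_hom_left] module_hom_smult[OF mult_hom_left]\<close>)
qed

lemma mult_closed: "f \<in> carrier F \<Longrightarrow> g \<in> carrier F \<Longrightarrow> f \<otimes>\<^bsub>A\<^esub> g \<in> carrier F"
  using module_hom_in_carrier[OF mult_hom_right] .

text \<open>Both sides are linear in each of the three arguments, which reduces the claim to basis
  elements, where it is \<open>sg_assoc\<close>.\<close>

lemma mult_assoc:
  assumes f: "f \<in> carrier F" and g: "g \<in> carrier F" and h: "h \<in> carrier F"
  shows "(f \<otimes>\<^bsub>A\<^esub> g) \<otimes>\<^bsub>A\<^esub> h = f \<otimes>\<^bsub>A\<^esub> (g \<otimes>\<^bsub>A\<^esub> h)"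
proof (rule free_module_hom_eqI[OF F.module_axioms _ _ _ f])
  show "(\<lambda>f. (f \<otimes>\<^bsub>A\<^esub> g) \<otimes>\<^bsub>A\<^esub> h) \<in> module_hom R F F"
    using module_hom_comp[OF mult_hom_left[OF g] mult_hom_left[OF h]] .
  show "(\<lambda>f. f \<otimes>\<^bsub>A\<^esub> (g \<otimes>\<^bsub>A\<^esub> h)) \<in> module_hom R F F"
    by (rule mult_hom_left[OF mult_closed[OF g h]])
  fix \<sigma> assume \<sigma>: "\<sigma> \<in> XS"
  note e\<sigma> = e_closed[OF \<sigma>]
  show "(e \<sigma> \<otimes>\<^bsub>A\<^esub> g) \<otimes>\<^bsub>A\<^esub> h = e \<sigma> \<otimes>\<^bsub>A\<^esub> (g \<otimes>\<^bsub>A\<^esub> h)"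
  proof (rule free_module_hom_eqI[OF F.module_axioms _ _ _ g])
    show "(\<lambda>g. (e \<sigma> \<otimes>\<^bsub>A\<^esub> g) \<otimes>\<^bsub>A\<^esub> h) \<in> module_hom R F F"
      using module_hom_comp[OF mult_hom_right[OF e\<sigma>] mult_hom_left[OF h]] .
    show "(\<lambda>g. e \<sigma> \<otimes>\<^bsub>A\<^esub> (g \<otimes>\<^bsub>A\<^esub> h)) \<in> module_hom R F F"
      using module_hom_comp[OF mult_hom_left[OF h] mult_hom_right[OF e\<sigma>]] .
    fix \<tau> assume \<tau>: "\<tau> \<in> XS"
    note e\<tau> = e_closed[OF \<tau>]
    show "(e \<sigma> \<otimes>\<^bsub>A\<^esub> e \<tau>) \<otimes>\<^bsub>A\<^esub> h = e \<sigma> \<otimes>\<^bsub>A\<^esub> (e \<tau> \<otimes>\<^bsub>A\<^esub> h)"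
    proof (rule free_module_hom_eqI[OF F.module_axioms _ _ _ h])
      show "(\<lambda>h. (e \<sigma> \<otimes>\<^bsub>A\<^esub> e \<tau>) \<otimes>\<^bsub>A\<^esub> h) \<in> module_hom R F F"
        by (rule mult_hom_right[OF mult_closed[OF e\<sigma> e\<tau>]])
      show "(\<lambda>h. e \<sigma> \<otimes>\<^bsub>A\<^esub> (e \<tau> \<otimes>\<^bsub>A\<^esub> h)) \<in> module_hom R F F"
        using module_hom_comp[OF mult_hom_right[OF e\<tau>] mult_hom_right[OF e\<sigma>]] .
      fix \<rho> assume \<rho>: "\<rho> \<in> XS"
      note e\<rho> = e_closed[OF \<rho>]
      have u: "\<sigma> \<union> \<tau> \<in> XS" "\<tau> \<union> \<rho> \<in> XS" "\<sigma> \<union> \<tau> \<union> \<rho> \<in> XS" using \<sigma> \<tau> \<rho> by auto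
      have "(e \<sigma> \<otimes>\<^bsub>A\<^esub> e \<tau>) \<otimes>\<^bsub>A\<^esub> e \<rho> = zr (sg \<sigma> \<tau> * sg (\<sigma> \<union> \<tau>) \<rho>) \<odot>\<^bsub>F\<^esub> e (\<sigma> \<union> \<tau> \<union> \<rho>)"
        using e_closed[OF u(1)] e_closed[OF u(3)] e\<rho>
        by (simp add: emul[OF \<sigma> \<tau>] emul[OF u(1) \<rho>] module_hom_smult[OF mult_hom_left] F.smult_assoc1 zr_mult)
      also have "\<dots> = zr (sg \<tau> \<rho> * sg \<sigma> (\<tau> \<union> \<rho>)) \<odot>\<^bsub>F\<^esub> e (\<sigma> \<union> (\<tau> \<union> \<rho>))"
        by (simp only: sg_assoc Un_assoc)
      also have "\<dots> = e \<sigma> \<otimes>\<^bsub>A\<^esub> (e \<tau> \<otimes>\<^bsub>A\<^esub> e \<rho>)"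
        using e_closed[OF u(2)] e_closed[OF u(3)] e\<sigma>
        by (simp add: emul[OF \<tau> \<rho>] emul[OF \<sigma> u(2)] module_hom_smult[OF mult_hom_right] F.smult_assoc1 zr_mult Un_assoc)
      finally show "(e \<sigma> \<otimes>\<^bsub>A\<^esub> e \<tau>) \<otimes>\<^bsub>A\<^esub> e \<rho> = e \<sigma> \<otimes>\<^bsub>A\<^esub> (e \<tau> \<otimes>\<^bsub>A\<^esub> e \<rho>)" .
    qed
  qed
qed

lemma one_mult: assumes f: "f \<in> carrier F" shows "e {} \<otimes>\<^bsub>A\<^esub> f = f" "f \<otimes>\<^bsub>A\<^esub> e {} = f"
proof -
  have e0: "e {} \<in> carrier F" by (rule e_closed) simp
  show "e {} \<otimes>\<^bsub>A\<^esub> f = f"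
    by (rule free_module_hom_eqI[OF F.module_axioms mult_hom_right[OF e0] F.module_hom_id _ f])
      (simp add: emul e_closed)
  show "f \<otimes>\<^bsub>A\<^esub> e {} = f"
    by (rule free_module_hom_eqI[OF F.module_axioms mult_hom_left[OF e0] F.module_hom_id _ f])
      (simp add: emul e_closed)
qed

lemma assoc_algebra_A: "assoc_algebra R A"
proof -
  interpret M: module R A by (rule module_A)
  show ?thesis
  proof
    fix a assume a: "a \<in> carrier A"
    then have a': "a \<in> carrier F" by (simp only: A_simps)
    show "\<one>\<^bsub>A\<^esub> \<otimes>\<^bsub>A\<^esub> a = a" "a \<otimes>\<^bsub>A\<^esub> \<one>\<^bsub>A\<^esub> = a" unfolding A_simps by (fact one_mult[OF a'])+
    show "(\<lambda>b. a \<otimes>\<^bsub>A\<^esub> b) \<in> module_hom R A A" "(\<lambda>b. b \<otimes>\<^bsub>A\<^esub> a) \<in> module_hom R A A"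
      unfolding module_hom_A by (fact mult_hom_right[OF a'] mult_hom_left[OF a'])+
    fix b assume b: "b \<in> carrier A"
    then have b': "b \<in> carrier F" by (simp only: A_simps)
    show "a \<otimes>\<^bsub>A\<^esub> b \<in> carrier A" unfolding A_simps by (rule mult_closed[OF a' b'])
    fix c assume "c \<in> carrier A"
    then have c': "c \<in> carrier F" by (simp only: A_simps)
    show "a \<otimes>\<^bsub>A\<^esub> b \<otimes>\<^bsub>A\<^esub> c = a \<otimes>\<^bsub>A\<^esub> (b \<otimes>\<^bsub>A\<^esub> c)" by (rule mult_assoc[OF a' b' c'])
  next
    show "\<one>\<^bsub>A\<^esub> \<in> carrier A" unfolding A_simps by (rule e_closed) simp
  qed
qed

sublocale A: assoc_algebra R A by (rule assoc_algebra_A)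


section \<open>A basis of the Hochschild modules\<close>

lemma multilin_eqI:
  assumes P: "module R P" and \<phi>: "multilin R A m P \<phi>" and \<psi>: "multilin R A m P \<psi>"
    and eq: "\<And>us. length us = m \<Longrightarrow> set us \<subseteq> XS \<Longrightarrow> \<phi> (map e us) = \<psi> (map e us)"
    and v: "v \<in> tensor_words A m"
  shows "\<phi> v = \<psi> v"
proof -
  have eA: "e \<sigma> \<in> carrier A" if "\<sigma> \<in> XS" for \<sigma> unfolding A_simps using that by (rule e_closed)
  \<comment> \<open>Induction on the number \<open>j\<close> of leading letters that are still
    arbitrary: by linearity in one slot, the last of them may be taken from the basis.\<close>
  have "\<forall>v \<in> tensor_words A m. (\<forall>i. j \<le> i \<and> i < m \<longrightarrow> v ! i \<in> e ` XS) \<longrightarrow> \<phi> v = \<psi> v" for j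
  proof (induction j)
    case 0
    show ?case
    proof (intro ballI impI)
      fix v assume v: "v \<in> tensor_words A m" and *: "\<forall>i. 0 \<le> i \<and> i < m \<longrightarrow> v ! i \<in> e ` XS"
      have len: "length v = m" using v by (rule tensor_words_length)
      have "set v \<subseteq> e ` XS" using * len by (auto simp: in_set_conv_nth)
      then have "\<exists>us. v = map e us \<and> set us \<subseteq> XS"
      proof (induction v)
        case (Cons a v)
        then obtain \<sigma> us where "\<sigma> \<in> XS" "a = e \<sigma>" "v = map e us" "set us \<subseteq> XS" by auto
        then show ?case by (intro exI[of _ "\<sigma> # us"]) simp
      qed simp
      then obtain us where "v = map e us" "set us \<subseteq> XS" by blast
      then show "\<phi> v = \<psi> v" using eq[of us] len by simp
    qed
  next
    case (Suc j)
    show ?case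
    proof (intro ballI impI)
      fix v assume v: "v \<in> tensor_words A m" and *: "\<forall>i. Suc j \<le> i \<and> i < m \<longrightarrow> v ! i \<in> e ` XS"
      show "\<phi> v = \<psi> v"
      proof (cases "j < m")
        case False
        then show ?thesis using Suc v * by simp
      next
        case True
        have len: "length v = m" using v by (rule tensor_words_length)
        have upd: "(\<lambda>a. \<chi> (v[j := a])) \<in> module_hom R F P" if \<chi>: "multilin R A m P \<chi>" for \<chi>
          unfolding module_hom_A(1)[symmetric]
          by (rule module_homI)
            (simp_all add: multilinD(1)[OF \<chi> tensor_words_update[OF v]]
              multilinD(2)[OF \<chi> v True] multilinD(3)[OF \<chi> v True])
        have vj: "v ! j \<in> carrier F" using tensor_words_nth[OF v True] by (simp add: A_simps)
        have "\<phi> (v[j := v ! j]) = \<psi> (v[j := v ! j])"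
        proof (rule free_module_hom_eqI[where h = "\<lambda>a. \<phi> (v[j := a])" and h' = "\<lambda>a. \<psi> (v[j := a])", OF P _ _ _ vj])
          show "(\<lambda>a. \<phi> (v[j := a])) \<in> module_hom R F P" by (rule upd[OF \<phi>])
          show "(\<lambda>a. \<psi> (v[j := a])) \<in> module_hom R F P" by (rule upd[OF \<psi>])
          fix \<sigma> assume \<sigma>: "\<sigma> \<in> XS"
          have "v[j := e \<sigma>] \<in> tensor_words A m" by (rule tensor_words_update[OF v eA[OF \<sigma>]])
          moreover have "\<forall>i. j \<le> i \<and> i < m \<longrightarrow> v[j := e \<sigma>] ! i \<in> e ` XS"
            using * \<sigma> len by (auto simp: nth_list_update)
          ultimately show "\<phi> (v[j := e \<sigma>]) = \<psi> (v[j := e \<sigma>])" using Suc by blast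
        qed
        then show ?thesis by simp
      qed
    qed
  qed
  note all = this
  show ?thesis by (rule all[of m, rule_format, OF v]) (metis not_less)
qed

text \<open>The coefficient of a basis word in a pure tensor.\<close>

fun lprod :: "(nat set \<Rightarrow> 'a) list \<Rightarrow> nat set list \<Rightarrow> 'a" where
  "lprod (a # v) (u # us) = a u \<otimes> lprod v us"
| "lprod _ _ = \<one>"

lemma lprod_closed: "set v \<subseteq> carrier F \<Longrightarrow> lprod v us \<in> carrier R"
  by (induction v us rule: lprod.induct) (auto simp: carrier_free_moduleD)

lemma lprod_add:
  "i < length v \<Longrightarrow> length us = length v \<Longrightarrow> set v \<subseteq> carrier F \<Longrightarrow> a \<in> carrier F \<Longrightarrow> b \<in> carrier F \<Longrightarrow>
    lprod (v[i := a \<oplus>\<^bsub>F\<^esub> b]) us = lprod (v[i := a]) us \<oplus> lprod (v[i := b]) us"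
proof (induction v us arbitrary: i rule: lprod.induct)
  case (1 c v u us)
  have cl: "set (v[j := x]) \<subseteq> carrier F" if "x \<in> carrier F" for j x
    using set_update_subset_insert[of v j x] 1(4) that by auto
  show ?case
    using 1 by (cases i) (auto simp: free_module_simps l_distr r_distr lprod_closed carrier_free_moduleD(1)[where S = XS] cl)
qed auto

lemma lprod_smult:
  "i < length v \<Longrightarrow> length us = length v \<Longrightarrow> set v \<subseteq> carrier F \<Longrightarrow> a \<in> carrier F \<Longrightarrow> r \<in> carrier R \<Longrightarrow>
    lprod (v[i := r \<odot>\<^bsub>F\<^esub> a]) us = r \<otimes> lprod (v[i := a]) us"
proof (induction v us arbitrary: i rule: lprod.induct)
  case (1 c v u us)
  have cl: "set (v[j := x]) \<subseteq> carrier F" if "x \<in> carrier F" for j x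
    using set_update_subset_insert[of v j x] 1(4) that by auto
  show ?case
    using 1 by (cases i) (auto simp: free_module_simps m_ac lprod_closed carrier_free_moduleD(1)[where S = XS] cl)
qed auto

lemma lprod_basis: "length us = length vs \<Longrightarrow> lprod (map e vs) us = (if us = vs then \<one> else \<zero>)"
proof (induction vs arbitrary: us)
  case (Cons v vs)
  then show ?case by (cases us) (auto simp: basis_vec_def)
qed simp

text \<open>The expansion of a word in the tensor basis. The guard keeps the support inside
  \<open>XS \<times> bdeg k\<close>; for index words of another length the default value of
  \<open>lprod\<close> has no meaning.\<close>

definition mexp :: "nat \<Rightarrow> (nat set \<Rightarrow> 'a) list \<Rightarrow> nat set \<times> nat set list \<Rightarrow> 'a" where
  "mexp k v = (\<lambda>(c, ws). if (c, ws) \<in> XS \<times> bdeg k then lprod v (c # ws) else \<zero>)"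

abbreviation "C k \<equiv> free_module R (XS \<times> bdeg k)"

lemma finite_bdeg: "finite (bdeg k)"
proof -
  have "bdeg k = {ws. set ws \<subseteq> XS \<and> length ws = k}" by (auto simp: bdeg_def)
  then show ?thesis using finite_lists_length_eq[of XS k] by simp
qed

lemma multilin_mexp: "multilin R A (Suc k) (C k) (mexp k)"
proof (rule multilinI)
  fix v assume "v \<in> tensor_words A (Suc k)"
  then have v: "length v = Suc k" "set v \<subseteq> carrier F" by (auto simp: tensor_words_def A_simps)
  have out: "mexp k v x = \<zero>" if "x \<notin> XS \<times> bdeg k" for x
    using that by (cases x) (auto simp: mexp_def)
  moreover have "finite {x. mexp k v x \<noteq> \<zero>}"
    by (rule finite_subset[of _ "XS \<times> bdeg k"]) (use out finite_bdeg in blast)+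
  moreover have "mexp k v x \<in> carrier R" for x
    by (cases x) (simp add: mexp_def lprod_closed v(2))
  ultimately show "mexp k v \<in> carrier (C k)" unfolding free_module_def by simp
  fix i a assume i: "i < Suc k" and a: "a \<in> carrier A"
  have len: "length (c # ws) = length v" if "ws \<in> bdeg k" for c ws using that v by (simp add: bdeg_def)
  show "mexp k (v[i := a \<oplus>\<^bsub>A\<^esub> b]) = mexp k (v[i := a]) \<oplus>\<^bsub>C k\<^esub> mexp k (v[i := b])" if b: "b \<in> carrier A" for b
  proof
    fix x :: "nat set \<times> nat set list"
    obtain c ws where x: "x = (c, ws)" by (cases x)
    show "mexp k (v[i := a \<oplus>\<^bsub>A\<^esub> b]) x = (mexp k (v[i := a]) \<oplus>\<^bsub>C k\<^esub> mexp k (v[i := b])) x"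
      using lprod_add[OF _ len v(2), of i ws a b c] i a b v by (simp add: x mexp_def A_simps free_module_simps(1)[where S = "XS \<times> bdeg k"])
  qed
  show "mexp k (v[i := r \<odot>\<^bsub>A\<^esub> a]) = r \<odot>\<^bsub>C k\<^esub> mexp k (v[i := a])" if r: "r \<in> carrier R" for r
  proof
    fix x :: "nat set \<times> nat set list"
    obtain c ws where x: "x = (c, ws)" by (cases x)
    show "mexp k (v[i := r \<odot>\<^bsub>A\<^esub> a]) x = (r \<odot>\<^bsub>C k\<^esub> mexp k (v[i := a])) x"
      using lprod_smult[OF _ len v(2), of i ws a r c] i a r v by (simp add: x mexp_def A_simps free_module_simps(2)[where S = "XS \<times> bdeg k"])
  qed
qed

lemma mexp_basis: "(c, ws) \<in> XS \<times> bdeg k \<Longrightarrow> mexp k (e c # map e ws) = basis_vec R (c, ws)"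
proof
  fix x :: "nat set \<times> nat set list"
  assume w: "(c, ws) \<in> XS \<times> bdeg k"
  obtain c' ws' where x: "x = (c', ws')" by (cases x)
  show "mexp k (e c # map e ws) x = basis_vec R (c, ws) x"
    using w lprod_basis[of "c' # ws'" "c # ws"] by (auto simp: x mexp_def basis_vec_def bdeg_def)
qed

abbreviation "HM \<equiv> hochschild_module R A"
abbreviation "hcl c ws \<equiv> A.hcls (e c) (map e ws)"

lemma hcl_closed: "x \<in> XS \<times> bdeg k \<Longrightarrow> (\<lambda>(c, ws). hcl c ws) x \<in> carrier (HM k)"
proof -
  assume "x \<in> XS \<times> bdeg k"
  then obtain c ws where x: "x = (c, ws)" "c \<in> XS" "length ws = k" "set ws \<subseteq> XS" by (auto simp: bdeg_def)
  have "map e ws \<in> tensor_words A k" using x e_closed by (auto simp: tensor_words_def A_simps)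
  then show ?thesis using x A.hcls_closed[of "e c" "map e ws" k] e_closed by (simp add: A_simps)
qed

text \<open>The identification of the free module on the pairs \<open>(c, ws)\<close> with the
  Hochschild module. It carries the integral bar complex, after base change, to the Hochschild
  complex over \<open>R\<close>.\<close>

definition Th :: "nat \<Rightarrow> (nat set \<times> nat set list \<Rightarrow> 'a) \<Rightarrow> ((nat set \<Rightarrow> 'a) \<times> ((nat set \<Rightarrow> 'a) list \<Rightarrow> 'a) set \<Rightarrow> 'a) set" where
  "Th k = lin_ext R (HM k) (\<lambda>(c, ws). hcl c ws)"

lemma Th_hom: "Th k \<in> module_hom R (C k) (HM k)"
  unfolding Th_def by (rule lin_ext_hom[OF A.module_hochschild hcl_closed])

lemma Th_basis: "c \<in> XS \<Longrightarrow> ws \<in> bdeg k \<Longrightarrow> Th k (basis_vec R (c, ws)) = hcl c ws"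
  unfolding Th_def using hcl_closed[of "(c, ws)" k] by (subst lin_ext_basis_vec[OF A.module_hochschild]) auto

text \<open>The inverse is the lift of \<open>mexp\<close>. One composite is checked on the basis of
  the free module; the other on \<open>hcls\<close> with arbitrary letters, which
  \<open>multilin_eqI\<close> reduces to basis letters.\<close>

lemma Th_inverse:
  obtains T where "T \<in> module_hom R (HM k) (C k)"
    "\<And>z. z \<in> carrier (HM k) \<Longrightarrow> Th k (T z) = z" "\<And>w. w \<in> carrier (C k) \<Longrightarrow> T (Th k w) = w"
proof -
  interpret Ck: module R "C k" by (rule module_free_module)
  interpret Hk: module R "HM k" by (rule A.module_hochschild)
  obtain T where T: "T \<in> module_hom R (HM k) (C k)"
    "\<And>a ws. a \<in> carrier A \<Longrightarrow> ws \<in> tensor_words A k \<Longrightarrow> T (A.hcls a ws) = mexp k (a # ws)"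
    using A.hochschild_lift[OF Ck.module_axioms multilin_mexp] by blast
  have Tb: "T (hcl c ws) = basis_vec R (c, ws)" if "c \<in> XS" "ws \<in> bdeg k" for c ws
  proof -
    have "map e ws \<in> tensor_words A k" using that e_closed by (auto simp: tensor_words_def A_simps bdeg_def)
    then show ?thesis using T(2)[of "e c" "map e ws"] that mexp_basis e_closed by (simp add: A_simps)
  qed
  have "Th k (T z) = z" if z: "z \<in> carrier (HM k)" for z
  proof (rule A.hochschild_hom_eqI[OF Hk.module_axioms module_hom_comp[OF T(1) Th_hom] Hk.module_hom_id _ z])
    fix a ws assume a: "a \<in> carrier A" and ws: "ws \<in> tensor_words A k"
    have w: "a # ws \<in> tensor_words A (Suc k)" using a ws by (auto simp: tensor_words_def)
    have "Th k (mexp k (a # ws)) = A.hcls (hd (a # ws)) (tl (a # ws))"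
    proof (rule multilin_eqI[OF Hk.module_axioms A.multilin_comp_hom[OF multilin_mexp Th_hom] A.multilin_hcls _ w])
      fix us assume "length us = Suc k" "set us \<subseteq> XS"
      then obtain c vs where us: "us = c # vs" "c \<in> XS" "vs \<in> bdeg k" by (cases us) (auto simp: bdeg_def)
      then show "Th k (mexp k (map e us)) = A.hcls (hd (map e us)) (tl (map e us))"
        by (simp add: mexp_basis Th_basis)
    qed
    then show "Th k (T (A.hcls a ws)) = A.hcls a ws" using T(2)[OF a ws] by simp
  qed
  moreover have "T (Th k w) = w" if w: "w \<in> carrier (C k)" for w
    by (rule free_module_hom_eqI[OF Ck.module_axioms module_hom_comp[OF Th_hom T(1)] Ck.module_hom_id _ w])
      (use Th_basis Tb in auto)
  ultimately show thesis using that T(1) by blast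
qed

end

section \<open>Functoriality of base change\<close>

context cring
begin

lemma hom_emb:
  assumes P: "module R P" and h: "h \<in> module_hom R (free_module R S) P"
  shows "Poly_Mapping.keys a \<subseteq> S \<Longrightarrow> Poly_Mapping.keys b \<subseteq> S \<Longrightarrow> h (emb (a - b)) = h (emb a) \<ominus>\<^bsub>P\<^esub> h (emb b)"
    and "Poly_Mapping.keys a \<subseteq> S \<Longrightarrow> h (emb (frag_cmul z a)) = zr z \<odot>\<^bsub>P\<^esub> h (emb a)"
proof -
  assume a: "Poly_Mapping.keys a \<subseteq> S"
  show "h (emb (frag_cmul z a)) = zr z \<odot>\<^bsub>P\<^esub> h (emb a)"
    unfolding emb_cmul[of z a S] by (rule module_hom_smult[OF h zr_closed emb_closed[OF a]])
  assume b: "Poly_Mapping.keys b \<subseteq> S"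
  show "h (emb (a - b)) = h (emb a) \<ominus>\<^bsub>P\<^esub> h (emb b)"
    unfolding emb_diff[OF a b]
    by (rule module_hom_minus[OF module_free_module P h emb_closed[OF a] emb_closed[OF b]])
qed

context
  fixes S :: "'x set" and T :: "'y set"
begin

lemma bc_cong: "(\<And>x. x \<in> S \<Longrightarrow> F (frag_of x) = G (frag_of x)) \<Longrightarrow>
    (\<And>x. x \<in> S \<Longrightarrow> Poly_Mapping.keys (F (frag_of x)) \<subseteq> T) \<Longrightarrow> v \<in> carrier (free_module R S) \<Longrightarrow> bc T F v = bc T G v"
proof -
  assume eq: "\<And>x. x \<in> S \<Longrightarrow> F (frag_of x) = G (frag_of x)"
    and F: "\<And>x. x \<in> S \<Longrightarrow> Poly_Mapping.keys (F (frag_of x)) \<subseteq> T" and v: "v \<in> carrier (free_module R S)"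
  have G: "Poly_Mapping.keys (G (frag_of x)) \<subseteq> T" if "x \<in> S" for x using eq[OF that] F[OF that] by simp
  show ?thesis
  proof (rule free_module_hom_eqI[OF module_free_module bc_hom[of S F T, OF F] bc_hom[of S G T, OF G] _ v])
    fix x assume x: "x \<in> S"
    show "bc T F (basis_vec R x) = bc T G (basis_vec R x)"
      using bc_basis[of S F T, OF F x] bc_basis[of S G T, OF G x] eq[OF x] by simp
  qed
qed

lemma bc_add:
  assumes "\<And>x. x \<in> S \<Longrightarrow> Poly_Mapping.keys (F (frag_of x)) \<subseteq> T" "\<And>x. x \<in> S \<Longrightarrow> Poly_Mapping.keys (G (frag_of x)) \<subseteq> T"
    and v: "v \<in> carrier (free_module R S)"
  shows "bc T (\<lambda>p. F p + G p) v = bc T F v \<oplus>\<^bsub>free_module R T\<^esub> bc T G v"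
proof -
  interpret T: module R "free_module R T" by (rule module_free_module)
  have FG: "Poly_Mapping.keys (F (frag_of x) + G (frag_of x)) \<subseteq> T" if "x \<in> S" for x
    using assms(1,2)[OF that] by (rule keys_add_subset)
  show ?thesis
  proof (rule free_module_hom_eqI[OF module_free_module bc_hom[of S "\<lambda>p. F p + G p" T, OF FG]
          T.module_hom_pointwise_add[OF bc_hom[of S F T, OF assms(1)] bc_hom[of S G T, OF assms(2)]] _ v])
    fix x assume x: "x \<in> S"
    show "bc T (\<lambda>p. F p + G p) (basis_vec R x) =
        bc T F (basis_vec R x) \<oplus>\<^bsub>free_module R T\<^esub> bc T G (basis_vec R x)"
      using bc_basis[of S F T, OF assms(1) x] bc_basis[of S G T, OF assms(2) x]
        bc_basis[of S "\<lambda>p. F p + G p" T, OF FG x] by (simp add: emb_add[of _ _ T])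
  qed
qed

lemma bc_cmul:
  assumes "\<And>x. x \<in> S \<Longrightarrow> Poly_Mapping.keys (F (frag_of x)) \<subseteq> T" and v: "v \<in> carrier (free_module R S)"
  shows "bc T (\<lambda>p. frag_cmul z (F p)) v = zr z \<odot>\<^bsub>free_module R T\<^esub> bc T F v"
proof -
  interpret T: module R "free_module R T" by (rule module_free_module)
  have zF: "Poly_Mapping.keys (frag_cmul z (F (frag_of x))) \<subseteq> T" if "x \<in> S" for x
    using assms(1)[OF that] keys_cmul[of z "F (frag_of x)"] by blast
  show ?thesis
  proof (rule free_module_hom_eqI[OF module_free_module bc_hom[of S "\<lambda>p. frag_cmul z (F p)" T, OF zF]
          T.module_hom_pointwise_smult[OF bc_hom[of S F T, OF assms(1)] zr_closed] _ v])
    fix x assume x: "x \<in> S"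
    show "bc T (\<lambda>p. frag_cmul z (F p)) (basis_vec R x) = zr z \<odot>\<^bsub>free_module R T\<^esub> bc T F (basis_vec R x)"
      using bc_basis[of S F T, OF assms(1) x] bc_basis[of S "\<lambda>p. frag_cmul z (F p)" T, OF zF x]
      by (simp add: emb_cmul[of _ _ T])
  qed
qed

lemma bc_comp:
  assumes "\<And>x. x \<in> S \<Longrightarrow> Poly_Mapping.keys (F (frag_of x)) \<subseteq> T" and G: "additive G"
    and GU: "\<And>x. x \<in> T \<Longrightarrow> Poly_Mapping.keys (G (frag_of x)) \<subseteq> U"
    and v: "v \<in> carrier (free_module R S)"
  shows "bc U G (bc T F v) = bc U (\<lambda>p. G (F p)) v"
proof -
  have GF: "Poly_Mapping.keys (G (F (frag_of x))) \<subseteq> U" if "x \<in> S" for x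
    by (rule keys_additive[OF G assms(1)[OF that] GU])
  show ?thesis
  proof (rule free_module_hom_eqI[OF module_free_module module_hom_comp[OF bc_hom[of S F T, OF assms(1)] bc_hom[of T G U, OF GU]]
          bc_hom[of S "\<lambda>p. G (F p)" U, OF GF] _ v])
    fix x assume x: "x \<in> S"
    show "bc U G (bc T F (basis_vec R x)) = bc U (\<lambda>p. G (F p)) (basis_vec R x)"
      using bc_basis[of S F T, OF assms(1) x] bc_basis[of S "\<lambda>p. G (F p)" U, OF GF x]
        bc_emb[of G T U, OF G GU assms(1)[OF x]] by simp
  qed
qed

end

lemma bc_id:
  assumes v: "v \<in> carrier (free_module R S)" shows "bc S (\<lambda>p. p) v = v"
proof -
  interpret S: module R "free_module R S" by (rule module_free_module)
  have k: "Poly_Mapping.keys (frag_of x) \<subseteq> S" if "x \<in> S" for x using that by simp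
  show ?thesis
  proof (rule free_module_hom_eqI[OF module_free_module bc_hom[of S "\<lambda>p. p" S, OF k] S.module_hom_id _ v])
    fix x assume x: "x \<in> S"
    show "bc S (\<lambda>p. p) (basis_vec R x) = basis_vec R x"
      using bc_basis[of S "\<lambda>p. p" S, OF k x] by (simp add: emb_of)
  qed
qed

end

context exterior_ring
begin

section \<open>The Hochschild differential on basis words\<close>

lemma e_A: "\<sigma> \<in> XS \<Longrightarrow> e \<sigma> \<in> carrier A"
  unfolding A_simps by (rule e_closed)

lemma map_e_A: "set us \<subseteq> XS \<Longrightarrow> set (map e us) \<subseteq> carrier A"
  unfolding set_map using e_A by blast

lemma map_e_TW: "set us \<subseteq> XS \<Longrightarrow> length us = m \<Longrightarrow> map e us \<in> tensor_words A m"
  using e_A by (auto simp: tensor_words_def)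

abbreviation "pt us \<equiv> pure_tensor R A (map e us)"

lemma pure_smult_mid:
  assumes "set ps \<subseteq> carrier A" "set qs \<subseteq> carrier A" "x \<in> carrier A" "r \<in> carrier R" "m = Suc (length ps + length qs)"
  shows "pure_tensor R A (ps @ (r \<odot>\<^bsub>A\<^esub> x) # qs) = r \<odot>\<^bsub>A.TP m\<^esub> pure_tensor R A (ps @ x # qs)"
proof -
  have "ps @ x # qs \<in> tensor_words A m" using assms by (auto simp: tensor_words_def)
  from multilinD(3)[OF A.multilin_pure this, of "length ps" x r] show ?thesis using assms by simp
qed

lemma pt_mult_mid:
  assumes "set ps \<subseteq> XS" "set qs \<subseteq> XS" "\<sigma> \<in> XS" "\<tau> \<in> XS" "m = Suc (length ps + length qs)"
  shows "pure_tensor R A (map e ps @ (e \<sigma> \<otimes>\<^bsub>A\<^esub> e \<tau>) # map e qs) = zr (sg \<sigma> \<tau>) \<odot>\<^bsub>A.TP m\<^esub> pt (ps @ (\<sigma> \<union> \<tau>) # qs)"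
proof -
  have "\<sigma> \<union> \<tau> \<in> XS" using assms by auto
  then have "pure_tensor R A (map e ps @ (zr (sg \<sigma> \<tau>) \<odot>\<^bsub>A\<^esub> e (\<sigma> \<union> \<tau>)) # map e qs)
      = zr (sg \<sigma> \<tau>) \<odot>\<^bsub>A.TP m\<^esub> pure_tensor R A (map e ps @ e (\<sigma> \<union> \<tau>) # map e qs)"
    using assms e_A map_e_A by (intro pure_smult_mid) simp_all
  then show ?thesis by (simp add: emul[OF assms(3,4)] A_simps)
qed

text \<open>The alternating sum of merges behind a fixed prefix \<open>ps\<close>. The prefix makes
  its recursion match that of \<open>barb\<close>: the first letter of \<open>xs\<close> is passed
  to the prefix when the remaining merges are formed.\<close>

definition msum :: "nat \<Rightarrow> (nat set \<Rightarrow> 'a) list \<Rightarrow> (nat set \<Rightarrow> 'a) list \<Rightarrow> ((nat set \<Rightarrow> 'a) list \<Rightarrow> 'a) set" where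
  "msum m ps xs = (\<Oplus>\<^bsub>A.TP m\<^esub>i\<in>{..length xs - 2}. ring_sign R i \<odot>\<^bsub>A.TP m\<^esub> pure_tensor R A (ps @ merge_at A i xs))"

lemma msum_two:
  assumes "set ps \<subseteq> carrier A" "x \<in> carrier A" "y \<in> carrier A" "m = Suc (length ps)"
  shows "msum m ps [x, y] = pure_tensor R A (ps @ [x \<otimes>\<^bsub>A\<^esub> y])"
proof -
  interpret T: module R "A.TP m" by (rule A.module_tensor_power)
  have "ps @ [x \<otimes>\<^bsub>A\<^esub> y] \<in> tensor_words A m" using assms by (auto simp: tensor_words_def A.amult_closed)
  then have "pure_tensor R A (ps @ [x \<otimes>\<^bsub>A\<^esub> y]) \<in> carrier (A.TP m)" by (rule A.pure_tensor_closed)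
  then show ?thesis by (simp add: msum_def merge_at_def ring_sign_def)
qed

text \<open>The merge at position 0 is split off. The remaining merges leave the first letter alone,
  and shifting their index by one reverses all signs.\<close>

lemma msum_Cons:
  assumes ps: "set ps \<subseteq> carrier A" and xs: "set (x # y # z # zs) \<subseteq> carrier A"
    and m: "m = Suc (Suc (length ps + length zs))"
  shows "msum m ps (x # y # z # zs) = pure_tensor R A (ps @ (x \<otimes>\<^bsub>A\<^esub> y) # z # zs) \<ominus>\<^bsub>A.TP m\<^esub> msum m (ps @ [x]) (y # z # zs)"
proof -
  interpret T: module R "A.TP m" by (rule A.module_tensor_power)
  let ?f = "\<lambda>i. ring_sign R i \<odot>\<^bsub>A.TP m\<^esub> pure_tensor R A (ps @ merge_at A i (x # y # z # zs))"
  let ?g = "\<lambda>i. ring_sign R i \<odot>\<^bsub>A.TP m\<^esub> pure_tensor R A (ps @ x # merge_at A i (y # z # zs))"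
  have tw: "ps @ merge_at A i (x # y # z # zs) \<in> tensor_words A m" if "i \<le> Suc (length zs)" for i
  proof -
    have "x # y # z # zs \<in> tensor_words A (Suc (Suc (Suc (length zs))))" using xs by (auto simp: tensor_words_def)
    then have "merge_at A i (x # y # z # zs) \<in> tensor_words A (Suc (Suc (length zs)))"
      using that by (intro A.merge_at_closed)
    then show ?thesis using ps m by (auto simp: tensor_words_def)
  qed
  have fc: "?f i \<in> carrier (A.TP m)" if "i \<le> Suc (length zs)" for i
    using A.pure_tensor_closed[OF tw[OF that]] ring_sign_closed by simp
  have mS: "merge_at A (Suc i) (x # y # z # zs) = x # merge_at A i (y # z # zs)" for i
    by (simp add: merge_at_def)
  have gc: "?g i \<in> carrier (A.TP m)" if "i \<le> length zs" for i
    using A.pure_tensor_closed[OF tw[of "Suc i"]] that ring_sign_closed by (simp add: mS)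
  have fS: "?f (Suc i) = \<ominus>\<^bsub>A.TP m\<^esub> ?g i" if "i \<le> length zs" for i
    using A.pure_tensor_closed[OF tw[of "Suc i"]] that
    by (simp add: mS ring_sign_zr zr_uminus T.smult_l_minus)
  have "msum m ps (x # y # z # zs) = finsum (A.TP m) ?f {..Suc (length zs)}"
    by (simp add: msum_def)
  also have "\<dots> = (\<Oplus>\<^bsub>A.TP m\<^esub>i\<in>{..length zs}. ?f (Suc i)) \<oplus>\<^bsub>A.TP m\<^esub> ?f 0"
    by (rule T.finsum_Suc2) (use fc in auto)
  also have "(\<Oplus>\<^bsub>A.TP m\<^esub>i\<in>{..length zs}. ?f (Suc i)) = (\<Oplus>\<^bsub>A.TP m\<^esub>i\<in>{..length zs}. (\<ominus> \<one>) \<odot>\<^bsub>A.TP m\<^esub> ?g i)"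
    by (rule T.finsum_cong') (use gc fS in \<open>auto simp: T.smult_l_minus\<close>)
  also have "\<dots> = (\<ominus> \<one>) \<odot>\<^bsub>A.TP m\<^esub> (\<Oplus>\<^bsub>A.TP m\<^esub>i\<in>{..length zs}. ?g i)"
    by (rule T.finsum_smult[symmetric]) (use gc in auto)
  also have "\<dots> = \<ominus>\<^bsub>A.TP m\<^esub> msum m (ps @ [x]) (y # z # zs)"
  proof -
    have "(\<Oplus>\<^bsub>A.TP m\<^esub>i\<in>{..length zs}. ?g i) \<in> carrier (A.TP m)" using gc by (intro T.finsum_closed) auto
    then show ?thesis by (simp add: msum_def T.smult_l_minus)
  qed
  also have "?f 0 = pure_tensor R A (ps @ (x \<otimes>\<^bsub>A\<^esub> y) # z # zs)"
    using A.pure_tensor_closed[OF tw[of 0]] by (simp add: merge_at_def ring_sign_def)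
  finally have eq: "msum m ps (x # y # z # zs) =
      \<ominus>\<^bsub>A.TP m\<^esub> msum m (ps @ [x]) (y # z # zs) \<oplus>\<^bsub>A.TP m\<^esub> pure_tensor R A (ps @ (x \<otimes>\<^bsub>A\<^esub> y) # z # zs)" .
  have "pure_tensor R A (ps @ (x \<otimes>\<^bsub>A\<^esub> y) # z # zs) \<in> carrier (A.TP m)"
    using A.pure_tensor_closed[OF tw[of 0]] by (simp add: merge_at_def)
  moreover have "msum m (ps @ [x]) (y # z # zs) \<in> carrier (A.TP m)"
    unfolding msum_def using gc by (intro T.finsum_closed) auto
  ultimately show ?thesis unfolding eq by (simp add: T.M.minus_eq T.M.a_comm)
qed

definition wmap :: "nat \<Rightarrow> nat set list \<Rightarrow> (nat set \<times> nat set list \<times> nat set \<Rightarrow> 'a) \<Rightarrow> ((nat set \<Rightarrow> 'a) list \<Rightarrow> 'a) set" where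
  "wmap m ps = lin_ext R (A.TP m) (\<lambda>(a, us, b). pt (ps @ a # us @ [b]))"

abbreviation "W j \<equiv> XS \<times> bdeg j \<times> XS"

lemma wmap_val_closed:
  assumes "set ps \<subseteq> XS" "m = Suc (Suc (length ps + j))" "x \<in> W j"
  shows "(\<lambda>(a, us, b). pt (ps @ a # us @ [b])) x \<in> carrier (A.TP m)"
proof -
  obtain a us b where x: "x = (a, us, b)" "a \<in> XS" "us \<in> bdeg j" "b \<in> XS" using assms by blast
  then have "map e (ps @ a # us @ [b]) \<in> tensor_words A m"
    using assms by (intro map_e_TW) (auto simp: bdeg_def simp del: Pow_iff)
  then show ?thesis using A.pure_tensor_closed by (simp add: x(1))
qed

lemma wmap_hom:
  assumes "set ps \<subseteq> XS" "m = Suc (Suc (length ps + j))"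
  shows "wmap m ps \<in> module_hom R (free_module R (W j)) (A.TP m)"
  unfolding wmap_def by (rule lin_ext_hom[OF A.module_tensor_power wmap_val_closed[OF assms]])

lemma wmap_of:
  assumes "set ps \<subseteq> XS" "m = Suc (Suc (length ps + j))" "(a, us, b) \<in> W j"
  shows "wmap m ps (emb (frag_of (a, us, b))) = pt (ps @ a # us @ [b])"
  unfolding wmap_def emb_of using wmap_val_closed[OF assms]
  by (subst lin_ext_basis_vec[OF A.module_tensor_power]) auto

text \<open>The recursive call of \<open>barb\<close> is wrapped in \<open>shiftr a\<close>; this
  translates the wrapping into the longer prefix of the recursive call of
  \<open>msum\<close>.\<close>

lemma wmap_shiftr:
  assumes ps: "set ps \<subseteq> XS" and a: "a \<in> XS" and m: "m = Suc (Suc (length ps + Suc j))" and p: "p \<in> PM (bdeg j)"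
  shows "wmap m ps (emb (shiftr a p)) = wmap m (ps @ [a]) (emb p)"
proof -
  have psa: "set (ps @ [a]) \<subseteq> XS" "m = Suc (Suc (length (ps @ [a]) + j))" using ps a m by auto
  have sk: "Poly_Mapping.keys (shiftr a (frag_of x)) \<subseteq> W (Suc j)" if "x \<in> W j" for x
    using shiftr_PM[of "frag_of x" j a] that a by (simp only: PM_def mem_Collect_eq) simp
  have pk: "Poly_Mapping.keys p \<subseteq> W j" using p by (simp only: PM_def mem_Collect_eq)
  have "wmap m ps (bc (W (Suc j)) (shiftr a) (emb p)) = wmap m (ps @ [a]) (emb p)"
  proof (rule hom_emb_eqI[OF A.module_tensor_power
        module_hom_comp[OF bc_hom[of "W j" "shiftr a" "W (Suc j)", OF sk] wmap_hom[OF ps m]] wmap_hom[OF psa] _ emb_closed[OF pk]])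
    fix x assume x: "x \<in> W j"
    obtain c us d where xx: "x = (c, us, d)" by (cases x)
    have "(a, c # us, d) \<in> W (Suc j)" using x a by (auto simp: xx bdeg_def simp del: Pow_iff)
    then show "wmap m ps (bc (W (Suc j)) (shiftr a) (emb (frag_of x))) = wmap m (ps @ [a]) (emb (frag_of x))"
      using x wmap_of[OF ps m, of a "c # us" d] wmap_of[OF psa, of c us d]
      by (simp add: bc_emb[OF additive_shiftr sk] shiftr_of xx)
  qed
  then show ?thesis by (simp only: bc_emb[OF additive_shiftr sk pk])
qed

text \<open>The link between the integral differential and the bar differential over
  \<open>R\<close>. Both sides obey the recursion "first merge minus the rest", so the induction
  follows \<open>barb\<close>, with the prefix generalised.\<close>

lemma msum_barb:
  assumes "set ps \<subseteq> XS" "a \<in> XS" "b \<in> XS" "ws \<in> bdeg (Suc j)" "m = Suc (Suc (length ps + j))"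
  shows "msum m (map e ps) (map e (a # ws @ [b])) = wmap m ps (emb (barb a ws b))"
  using assms
proof (induction a ws b arbitrary: ps j rule: barb.induct)
  case (1 a b)
  then show ?case by (simp add: bdeg_def)
next
  case (2 a w b)
  interpret T: module R "A.TP m" by (rule A.module_tensor_power)
  have j: "j = 0" "w \<in> XS" using 2(4) by (auto simp: bdeg_def)
  have m: "m = Suc (Suc (length ps))" using 2 j by simp
  have mem: "(a \<union> w, [], b) \<in> W 0" "(a, [], w \<union> b) \<in> W 0" using 2 j by (auto simp: bdeg_def)
  note hm = wmap_hom[OF 2(1), of m 0]
  have k: "Poly_Mapping.keys (frag_cmul (sg a w) (frag_of (a \<union> w, [], b))) \<subseteq> W 0"
    "Poly_Mapping.keys (frag_cmul (sg w b) (frag_of (a, [], w \<union> b))) \<subseteq> W 0"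
    using mem by (intro keys_cmul_frag_of_subset; blast)+
  have eA: "e a \<in> carrier A" "e w \<in> carrier A" "e b \<in> carrier A" "set (map e ps) \<subseteq> carrier A" using 2 j e_A by auto
  have "msum m (map e ps) (map e (a # [w] @ [b])) = pure_tensor R A (map e ps @ (e a \<otimes>\<^bsub>A\<^esub> e w) # [e b]) \<ominus>\<^bsub>A.TP m\<^esub>
      pure_tensor R A ((map e ps @ [e a]) @ [e w \<otimes>\<^bsub>A\<^esub> e b])"
    using msum_Cons[of "map e ps" "e a" "e w" "e b" "[]" m] msum_two[of "map e ps @ [e a]" "e w" "e b" m] eA m by simp
  also have "\<dots> = zr (sg a w) \<odot>\<^bsub>A.TP m\<^esub> pt (ps @ (a \<union> w) # [b]) \<ominus>\<^bsub>A.TP m\<^esub> zr (sg w b) \<odot>\<^bsub>A.TP m\<^esub> pt ((ps @ [a]) @ (w \<union> b) # [])"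
    using pt_mult_mid[of ps "[b]" a w m] pt_mult_mid[of "ps @ [a]" "[]" w b m] 2 j m by (simp del: Pow_iff)
  also have "\<dots> = wmap m ps (emb (barb a [w] b))"
    using hom_emb[OF A.module_tensor_power hm] k wmap_of[OF 2(1), of m 0] mem m by simp
  finally show ?case .
next
  case (3 a w v ws b)
  interpret T: module R "A.TP m" by (rule A.module_tensor_power)
  obtain j' where j: "j = Suc j'" using 3(5) by (auto simp: bdeg_def)
  have w: "w \<in> XS" "v # ws \<in> bdeg (Suc j')" using 3(5) j by (auto simp: bdeg_def)
  have m: "m = Suc (Suc (length ps + Suc j'))" "m = Suc (Suc (length (ps @ [a]) + j'))" using 3 j by auto
  have psa: "set (ps @ [a]) \<subseteq> XS" using 3 by auto
  have vw: "v \<in> XS" "set ws \<subseteq> XS" "length ws = j'" using w by (auto simp: bdeg_def)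
  have mem: "(a \<union> w, v # ws, b) \<in> W (Suc j')" using 3(3,4) w by (auto simp: bdeg_def)
  note hm = wmap_hom[OF 3(2) m(1)]
  have k1: "Poly_Mapping.keys (frag_cmul (sg a w) (frag_of (a \<union> w, v # ws, b))) \<subseteq> W (Suc j')"
    using mem by (intro keys_cmul_frag_of_subset)
  have bP: "barb w (v # ws) b \<in> PM (bdeg j')" by (rule barb_PM[OF w(1) 3(4) w(2)])
  have k2: "Poly_Mapping.keys (shiftr a (barb w (v # ws) b)) \<subseteq> W (Suc j')"
    using shiftr_PM[OF bP 3(3)] by (simp only: PM_def mem_Collect_eq)
  have IH: "msum m (map e (ps @ [a])) (map e (w # (v # ws) @ [b])) = wmap m (ps @ [a]) (emb (barb w (v # ws) b))"
    by (rule 3(1)[OF psa w(1) 3(4) w(2) m(2)])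
  have zs: "\<exists>z zs. map e (ws @ [b]) = z # zs" by (cases ws) auto
  have cA: "set (map e (a # w # v # ws @ [b])) \<subseteq> carrier A" "set (map e ps) \<subseteq> carrier A"
    using map_e_A[of "a # w # v # ws @ [b]"] map_e_A[OF 3(2)] 3(3,4) w vw by simp_all
  have "msum m (map e ps) (map e (a # (w # v # ws) @ [b])) =
      pure_tensor R A (map e ps @ (e a \<otimes>\<^bsub>A\<^esub> e w) # e v # map e (ws @ [b])) \<ominus>\<^bsub>A.TP m\<^esub>
      msum m (map e ps @ [e a]) (e w # e v # map e (ws @ [b]))"
    using msum_Cons[of "map e ps" "e a" "e w" "e v" "map e (ws @ [b])" m] cA m vw(3) by simp
  also have "msum m (map e ps @ [e a]) (e w # e v # map e (ws @ [b])) = wmap m ps (emb (shiftr a (barb w (v # ws) b)))"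
    using IH wmap_shiftr[OF 3(2,3) m(1) bP] by simp
  also have "pure_tensor R A (map e ps @ (e a \<otimes>\<^bsub>A\<^esub> e w) # e v # map e (ws @ [b])) =
      zr (sg a w) \<odot>\<^bsub>A.TP m\<^esub> pt (ps @ (a \<union> w) # v # ws @ [b])"
    using pt_mult_mid[OF 3(2) _ 3(3) w(1), of "v # ws @ [b]" m] vw 3(4) m by (simp del: Pow_iff)
  also have "\<dots> = wmap m ps (emb (frag_cmul (sg a w) (frag_of (a \<union> w, v # ws, b))))"
    using hom_emb(2)[OF A.module_tensor_power hm, of "frag_of (a \<union> w, v # ws, b)"] mem
      wmap_of[OF 3(2) m(1) mem] by simp
  finally show ?case
    using hom_emb(1)[OF A.module_tensor_power hm k1 k2] by simp
qed

text \<open>The two forms of tensoring down agree: \<open>hochschild_pure_word\<close> with left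
  factor 1 turns the outer letters x_a and x_b into the product x_b x_a, as \<open>tdown\<close>
  does.\<close>

lemma Th_tdown:
  assumes p: "p \<in> PM (bdeg k)"
  shows "Th k (emb (tdown p)) = hochschild_pure R A k (e {}) (wmap (Suc (Suc k)) [] (emb p))"
proof -
  have pk: "Poly_Mapping.keys p \<subseteq> W k" using p by (simp only: PM_def mem_Collect_eq)
  have dk: "Poly_Mapping.keys (tdown (frag_of x)) \<subseteq> XS \<times> bdeg k" if "x \<in> W k" for x
    using tdown_PP[of "frag_of x" "bdeg k"] that by (simp only: PM_def PP_def mem_Collect_eq) simp
  interpret Bk: balanced R A "A.TP (Suc (Suc k))" "enveloping R A" "env_right_act R A" "bar_left_act R A k"
    by (rule A.balanced_bar)
  have e0: "e {} \<in> carrier A" by (rule e_A) simp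
  have hph: "hochschild_pure R A k (e {}) \<in> module_hom R (A.TP (Suc (Suc k))) (HM k)"
    using Bk.pure_hom_right[OF e0] unfolding A.HM_eq A.hochschild_pure_eq .
  have "Th k (bc (XS \<times> bdeg k) tdown (emb p)) = hochschild_pure R A k (e {}) (wmap (Suc (Suc k)) [] (emb p))"
  proof (rule hom_emb_eqI[OF A.module_hochschild module_hom_comp[OF bc_hom[of "W k" tdown "XS \<times> bdeg k", OF dk] Th_hom]
        module_hom_comp[OF wmap_hom[of "[]" "Suc (Suc k)" k] hph] _ emb_closed[OF pk]])
    fix x assume "x \<in> W k"
    then obtain a us b where x: "x = (a, us, b)" "a \<in> XS" "us \<in> bdeg k" "b \<in> XS" by blast
    have xW: "x \<in> W k" using x by simp
    have us: "map e us \<in> tensor_words A k" using x by (intro map_e_TW) (auto simp: bdeg_def)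
    have ba: "b \<union> a \<in> XS" using x by auto
    have "hochschild_pure R A k (e {}) (wmap (Suc (Suc k)) [] (emb (frag_of x))) =
        hochschild_pure R A k (e {}) (pure_tensor R A (e a # map e us @ [e b]))"
      using wmap_of[of "[]" "Suc (Suc k)" k a us b] x by (simp del: Pow_iff)
    also have "\<dots> = A.hcls (e b \<otimes>\<^bsub>A\<^esub> e {} \<otimes>\<^bsub>A\<^esub> e a) (map e us)"
      by (rule A.hochschild_pure_word[OF e0 e_A e_A us]) (rule x)+
    also have "e b \<otimes>\<^bsub>A\<^esub> e {} \<otimes>\<^bsub>A\<^esub> e a = zr (sg b a) \<odot>\<^bsub>A\<^esub> e (b \<union> a)"
      using one_mult(2)[OF e_closed[OF x(4)]] emul[OF x(4,2)] by (simp add: A_simps)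
    also have "A.hcls (zr (sg b a) \<odot>\<^bsub>A\<^esub> e (b \<union> a)) (map e us) = zr (sg b a) \<odot>\<^bsub>HM k\<^esub> hcl (b \<union> a) us"
    proof -
      have "e (b \<union> a) # map e us \<in> tensor_words A (Suc k)" using us e_A[OF ba] by (auto simp: tensor_words_def)
      from multilinD(3)[OF A.multilin_hcls this, of 0 "e (b \<union> a)" "zr (sg b a)"] show ?thesis
        using e_A[OF ba] by simp
    qed
    also have "\<dots> = Th k (emb (tdown (frag_of x)))"
      using hom_emb(2)[OF A.module_hochschild Th_hom, of "frag_of (b \<union> a, us)"] x ba
      by (simp add: x(1) tdown_of emb_of Th_basis)
    finally show "Th k (bc (XS \<times> bdeg k) tdown (emb (frag_of x))) =
        hochschild_pure R A k (e {}) (wmap (Suc (Suc k)) [] (emb (frag_of x)))"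
      using bc_emb[OF additive_tdown dk, of "W k" "frag_of x"] xW by simp
  qed auto
  then show ?thesis by (simp only: bc_emb[OF additive_tdown dk pk])
qed

lemma keys_bdiff: "x \<in> XS \<times> bdeg (Suc k) \<Longrightarrow> Poly_Mapping.keys (bdiff (frag_of x)) \<subseteq> XS \<times> bdeg k"
  using tind_PP[OF bard_PM, where p = "frag_of x"] by (simp only: PP_def mem_Collect_eq) simp

lemma additive_bdiff: "additive bdiff"
  by (rule additive_tind[OF additive_bard])

abbreviation "Cd k \<equiv> bc (XS \<times> bdeg k) bdiff"

lemma Th_diff:
  assumes w: "w \<in> carrier (C (Suc k))"
  shows "hochschild_diff R A (Suc k) (Th (Suc k) w) = Th k (Cd k w)"
proof (rule free_module_hom_eqI[OF A.module_hochschild module_hom_comp[OF Th_hom A.hochschild_diff_hom]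
      module_hom_comp[OF bc_hom[of "XS \<times> bdeg (Suc k)" bdiff "XS \<times> bdeg k", OF keys_bdiff] Th_hom] _ w])
  fix x assume "x \<in> XS \<times> bdeg (Suc k)"
  then obtain c ws where x: "x = (c, ws)" "c \<in> XS" "ws \<in> bdeg (Suc k)" by blast
  have e0: "e {} \<in> carrier A" by (rule e_A) simp
  have ws: "map e ws \<in> tensor_words A (Suc k)" using x by (intro map_e_TW) (auto simp: bdeg_def)
  have len: "length ws = Suc k" "set ws \<subseteq> XS" using x by (auto simp: bdeg_def)
  \<comment> \<open>Another representative of the class of \<open>hcl c ws\<close>: x_c is moved
    from the left tensor factor into the first letter of the word, so that its bar differential is
    realised by \<open>barb c ws {}\<close>.\<close>
  let ?v = "e c # map e ws @ [e {}]"
  have v: "?v \<in> tensor_words A (Suc (Suc (Suc k)))" using ws e_A[OF x(2)] e0 by (auto simp: tensor_words_def)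
  have "hochschild_pure R A (Suc k) (e {}) (pure_tensor R A ?v) = A.hcls (e {} \<otimes>\<^bsub>A\<^esub> e {} \<otimes>\<^bsub>A\<^esub> e c) (map e ws)"
    by (rule A.hochschild_pure_word[OF e0 e_A[OF x(2)] e0 ws])
  also have "e {} \<otimes>\<^bsub>A\<^esub> e {} \<otimes>\<^bsub>A\<^esub> e c = e c"
    using one_mult e_closed[of "{}"] e_closed[OF x(2)] by simp
  finally have hc: "hcl c ws = hochschild_pure R A (Suc k) (e {}) (pure_tensor R A ?v)" by simp
  have "hochschild_diff R A (Suc k) (hcl c ws) = hochschild_pure R A k (e {}) (bar_diff R A (Suc k) (pure_tensor R A ?v))"
    unfolding hc by (rule A.hochschild_diff_pure[OF e0 A.pure_tensor_closed[OF v]])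
  also have "bar_diff R A (Suc k) (pure_tensor R A ?v) = msum (Suc (Suc k)) (map e []) (map e (c # ws @ [{}]))"
    using A.bar_diff_pure[OF v] len by (simp add: msum_def atLeast0AtMost)
  also have "\<dots> = wmap (Suc (Suc k)) [] (emb (barb c ws {}))"
    by (rule msum_barb[OF _ x(2) _ x(3)]) auto
  also have "hochschild_pure R A k (e {}) \<dots> = Th k (emb (tdown (barb c ws {})))"
    by (rule Th_tdown[symmetric, OF barb_PM[OF x(2) _ x(3)]]) simp
  also have "tdown (barb c ws {}) = bdiff (frag_of (c, ws))"
    by (simp add: tind_def tup_of bard_of)
  finally show "hochschild_diff R A (Suc k) (Th (Suc k) (basis_vec R x)) = Th k (Cd k (basis_vec R x))"
    using bc_basis[of "XS \<times> bdeg (Suc k)" bdiff "XS \<times> bdeg k" x, OF keys_bdiff] x Th_basis by simp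
qed

end

context cring
begin

lemma bc_subset:
  assumes F: "\<And>x. x \<in> S \<Longrightarrow> Poly_Mapping.keys (F (frag_of x)) \<subseteq> T" and "T \<subseteq> T'"
    and v: "v \<in> carrier (free_module R S)"
  shows "bc T F v = bc T' F v"
proof -
  have F': "Poly_Mapping.keys (F (frag_of x)) \<subseteq> T'" if "x \<in> S" for x using F[OF that] assms(2) by blast
  have inc: "(\<lambda>x. x) \<in> module_hom R (free_module R T) (free_module R T')"
    using assms(2) by (auto simp: module_hom_def free_module_def)
  show ?thesis
  proof (rule free_module_hom_eqI[OF module_free_module module_hom_comp[OF bc_hom[of S F T, OF F] inc] bc_hom[of S F T', OF F'] _ v])
    fix x assume x: "x \<in> S"
    show "bc T F (basis_vec R x) = bc T' F (basis_vec R x)"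
      using bc_basis[of S F T, OF F x] bc_basis[of S F T', OF F' x] by simp
  qed
qed

end

context exterior_ring
begin

section \<open>Hochschild homology by the small complex\<close>

abbreviation "D k \<equiv> free_module R (XS \<times> kdeg k)"
abbreviation "Kd k \<equiv> bc (XS \<times> kdeg k) kdiff"

lemma PP_keys: "(\<And>p. p \<in> PP G \<Longrightarrow> f p \<in> PP G') \<Longrightarrow> x \<in> XS \<times> G \<Longrightarrow> Poly_Mapping.keys (f (frag_of x)) \<subseteq> XS \<times> G'"
  unfolding PP_def by simp

lemma PP_of: "x \<in> XS \<times> G \<Longrightarrow> frag_of x \<in> PP G"
  unfolding PP_def by simp

lemma keys_kdiff: "x \<in> XS \<times> kdeg (Suc k) \<Longrightarrow> Poly_Mapping.keys (kdiff (frag_of x)) \<subseteq> XS \<times> kdeg k"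
  by (rule PP_keys[OF kdiff_PP])

lemma Kd_hom: "Kd k \<in> module_hom R (D (Suc k)) (D k)"
  by (rule bc_hom[of "XS \<times> kdeg (Suc k)" kdiff "XS \<times> kdeg k", OF keys_kdiff])

lemma Cd_hom: "Cd k \<in> module_hom R (C (Suc k)) (C k)"
  by (rule bc_hom[of "XS \<times> bdeg (Suc k)" bdiff "XS \<times> bdeg k", OF keys_bdiff])

lemma bc_square:
  assumes F: "\<And>p. p \<in> PP G \<Longrightarrow> f p \<in> PP G1" "\<And>p. p \<in> PP G1 \<Longrightarrow> g p \<in> PP G'" "additive g"
    and F': "\<And>p. p \<in> PP G \<Longrightarrow> f' p \<in> PP G2" "\<And>p. p \<in> PP G2 \<Longrightarrow> g' p \<in> PP G'" "additive g'"
    and eq: "\<And>p. p \<in> PP G \<Longrightarrow> g (f p) = g' (f' p)"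
    and v: "v \<in> carrier (free_module R (XS \<times> G))"
  shows "bc (XS \<times> G') g (bc (XS \<times> G1) f v) = bc (XS \<times> G') g' (bc (XS \<times> G2) f' v)"
proof -
  have "bc (XS \<times> G') g (bc (XS \<times> G1) f v) = bc (XS \<times> G') (\<lambda>p. g (f p)) v"
    by (rule bc_comp[of "XS \<times> G" f "XS \<times> G1" g "XS \<times> G'", OF PP_keys[of G f G1, OF F(1)] F(3) PP_keys[of G1 g G', OF F(2)] v])
  also have "\<dots> = bc (XS \<times> G') (\<lambda>p. g' (f' p)) v"
    by (rule bc_cong[of "XS \<times> G" "\<lambda>p. g (f p)", OF _ PP_keys[of G "\<lambda>p. g (f p)"] v]) (auto intro: eq PP_of F)
  also have "\<dots> = bc (XS \<times> G') g' (bc (XS \<times> G2) f' v)"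
    by (rule bc_comp[of "XS \<times> G" f' "XS \<times> G2" g' "XS \<times> G'", OF PP_keys[of G f' G2, OF F'(1)] F'(3) PP_keys[of G2 g' G', OF F'(2)] v, symmetric])
  finally show ?thesis .
qed

text \<open>Base change of the integral identity dh + hd = id - (round trip), applied to a cycle
  \<open>v\<close>: the pair \<open>a1\<close>, \<open>a2\<close> is homotopy then differential,
  \<open>b1\<close>, \<open>b2\<close> is differential then homotopy, which vanishes on
  \<open>v\<close>, and \<open>c1\<close>, \<open>c2\<close> is the round trip.\<close>

lemma bc_homotopy:
  assumes a: "\<And>p. p \<in> PP G \<Longrightarrow> a1 p \<in> PP G1" "\<And>p. p \<in> PP G1 \<Longrightarrow> a2 p \<in> PP G" "additive a2"
    and b: "\<And>p. p \<in> PP G \<Longrightarrow> b1 p \<in> PP G2" "\<And>p. p \<in> PP G2 \<Longrightarrow> b2 p \<in> PP G" "additive b2"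
    and c: "\<And>p. p \<in> PP G \<Longrightarrow> c1 p \<in> PP G3" "\<And>p. p \<in> PP G3 \<Longrightarrow> c2 p \<in> PP G" "additive c2"
    and eq: "\<And>p. p \<in> PP G \<Longrightarrow> a2 (a1 p) + b2 (b1 p) = p - c2 (c1 p)"
    and v: "v \<in> carrier (free_module R (XS \<times> G))" "bc (XS \<times> G2) b1 v = \<zero>\<^bsub>free_module R (XS \<times> G2)\<^esub>"
  shows "v = bc (XS \<times> G) a2 (bc (XS \<times> G1) a1 v) \<oplus>\<^bsub>free_module R (XS \<times> G)\<^esub> bc (XS \<times> G) c2 (bc (XS \<times> G3) c1 v)"
proof -
  let ?S = "XS \<times> G"
  interpret S: module R "free_module R ?S" by (rule module_free_module)
  have aP: "a2 (a1 p) \<in> PP G" and bP: "b2 (b1 p) \<in> PP G" and cP: "c2 (c1 p) \<in> PP G" if "p \<in> PP G" for p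
    using a b c that by auto
  have ka: "Poly_Mapping.keys (a2 (a1 (frag_of x))) \<subseteq> ?S" if "x \<in> ?S" for x
    using PP_keys[of G "\<lambda>p. a2 (a1 p)" G] aP that by blast
  have kb: "Poly_Mapping.keys (b2 (b1 (frag_of x))) \<subseteq> ?S" if "x \<in> ?S" for x
    using PP_keys[of G "\<lambda>p. b2 (b1 p)" G] bP that by blast
  have kc: "Poly_Mapping.keys (c2 (c1 (frag_of x))) \<subseteq> ?S" if "x \<in> ?S" for x
    using PP_keys[of G "\<lambda>p. c2 (c1 p)" G] cP that by blast
  have kab: "Poly_Mapping.keys (a2 (a1 (frag_of x)) + b2 (b1 (frag_of x))) \<subseteq> ?S" if "x \<in> ?S" for x
    using ka[OF that] kb[OF that] by (rule keys_add_subset)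
  have b0: "bc ?S (\<lambda>p. b2 (b1 p)) v = \<zero>\<^bsub>free_module R ?S\<^esub>"
  proof -
    have "bc ?S (\<lambda>p. b2 (b1 p)) v = bc ?S b2 (bc (XS \<times> G2) b1 v)"
      by (rule bc_comp[of ?S b1 "XS \<times> G2" b2 ?S, OF PP_keys[of G b1 G2, OF b(1)] b(3) PP_keys[of G2 b2 G, OF b(2)] v(1), symmetric])
    moreover have "bc ?S b2 \<in> module_hom R (free_module R (XS \<times> G2)) (free_module R ?S)"
      by (rule bc_hom[of "XS \<times> G2" b2 ?S, OF PP_keys[of G2 b2 G, OF b(2)]])
    ultimately show ?thesis using module_hom_zero[OF module_free_module module_free_module] v(2) by metis
  qed
  have ac: "bc ?S (\<lambda>p. a2 (a1 p)) v \<in> carrier (free_module R ?S)"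
    by (rule module_hom_in_carrier[OF bc_hom[of ?S "\<lambda>p. a2 (a1 p)" ?S, OF ka] v(1)])
  have "v = bc ?S (\<lambda>p. p) v" using bc_id[OF v(1)] by simp
  also have "\<dots> = bc ?S (\<lambda>p. (a2 (a1 p) + b2 (b1 p)) + c2 (c1 p)) v"
    using eq[OF PP_of] v by (intro bc_cong[of ?S]) (simp_all del: mem_Sigma_iff Pow_iff)
  also have "\<dots> = bc ?S (\<lambda>p. a2 (a1 p) + b2 (b1 p)) v \<oplus>\<^bsub>free_module R ?S\<^esub> bc ?S (\<lambda>p. c2 (c1 p)) v"
    by (rule bc_add[of ?S "\<lambda>p. a2 (a1 p) + b2 (b1 p)" ?S "\<lambda>p. c2 (c1 p)", OF kab kc v(1)])
  also have "bc ?S (\<lambda>p. a2 (a1 p) + b2 (b1 p)) v = bc ?S (\<lambda>p. a2 (a1 p)) v \<oplus>\<^bsub>free_module R ?S\<^esub> bc ?S (\<lambda>p. b2 (b1 p)) v"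
    by (rule bc_add[of ?S "\<lambda>p. a2 (a1 p)" ?S "\<lambda>p. b2 (b1 p)", OF ka kb v(1)])
  also have "\<dots> = bc ?S (\<lambda>p. a2 (a1 p)) v" using ac b0 by simp
  also have "\<dots> = bc ?S a2 (bc (XS \<times> G1) a1 v)"
    by (rule bc_comp[of ?S a1 "XS \<times> G1" a2 ?S, OF PP_keys[of G a1 G1, OF a(1)] a(3) PP_keys[of G1 a2 G, OF a(2)] v(1), symmetric])
  also have "bc ?S (\<lambda>p. c2 (c1 p)) v = bc ?S c2 (bc (XS \<times> G3) c1 v)"
    by (rule bc_comp[of ?S c1 "XS \<times> G3" c2 ?S, OF PP_keys[of G c1 G3, OF c(1)] c(3) PP_keys[of G3 c2 G, OF c(2)] v(1), symmetric])
  finally show ?thesis .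
qed

text \<open>Quantifying over the predecessors \<open>j\<close> of \<open>k\<close> leaves degree 0
  without a condition.\<close>

definition kcyc :: "nat \<Rightarrow> (nat set \<times> nat multiset \<Rightarrow> 'a) set" where
  "kcyc k = {y \<in> carrier (D k). \<forall>j. k = Suc j \<longrightarrow> Kd j y = \<zero>\<^bsub>D j\<^esub>}"

definition kbnd :: "nat \<Rightarrow> (nat set \<times> nat multiset \<Rightarrow> 'a) set" where
  "kbnd k = Kd k ` carrier (D (Suc k))"

lemma hochschild_cycles_iff:
  "z \<in> hochschild_cycles R A k \<longleftrightarrow> z \<in> carrier (HM k) \<and> (\<forall>j. k = Suc j \<longrightarrow> hochschild_diff R A (Suc j) z = \<zero>\<^bsub>HM j\<^esub>)"
  by (cases k) (auto simp: hochschild_cycles_def)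

lemma bdiff_PP: "p \<in> PP (bdeg (Suc k)) \<Longrightarrow> bdiff p \<in> PP (bdeg k)"
  by (rule tind_PP[OF bard_PM])

text \<open>The isomorphism on homology in terms of elements: \<open>\<Phi>\<close> preserves
  cycles, detects boundaries (injectivity) and reaches every cycle up to a boundary (surjectivity).
  In this form it composes directly with further maps out of the small complex.\<close>

theorem hochschild_koszul:
  obtains \<Phi> where "\<Phi> \<in> module_hom R (HM k) (D k)"
    and "\<And>z. z \<in> hochschild_cycles R A k \<Longrightarrow> \<Phi> z \<in> kcyc k"
    and "\<And>z. z \<in> hochschild_cycles R A k \<Longrightarrow> z \<in> hochschild_boundaries R A k \<longleftrightarrow> \<Phi> z \<in> kbnd k"
    and "\<And>y. y \<in> kcyc k \<Longrightarrow> \<exists>z \<in> hochschild_cycles R A k. \<exists>b \<in> kbnd k. y = \<Phi> z \<oplus>\<^bsub>D k\<^esub> b"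
proof (rule bar_koszul_equivalence)
  fix \<phi> \<psi> hb hk assume add: "\<And>k. additive (\<phi> k)" "\<And>k. additive (\<psi> k)" "\<And>k. additive (hb k)" "\<And>k. additive (hk k)"
    and P: "\<And>k p. p \<in> PP (bdeg k) \<Longrightarrow> \<phi> k p \<in> PP (kdeg k)"
      "\<And>k p. p \<in> PP (kdeg k) \<Longrightarrow> \<psi> k p \<in> PP (bdeg k)"
      "\<And>k p. p \<in> PP (bdeg k) \<Longrightarrow> hb k p \<in> PP (bdeg (Suc k))"
      "\<And>k p. p \<in> PP (kdeg k) \<Longrightarrow> hk k p \<in> PP (kdeg (Suc k))"
    and \<phi>d: "\<And>k p. p \<in> PP (bdeg (Suc k)) \<Longrightarrow> kdiff (\<phi> (Suc k) p) = \<phi> k (bdiff p)"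
    and \<psi>d: "\<And>k p. p \<in> PP (kdeg (Suc k)) \<Longrightarrow> bdiff (\<psi> (Suc k) p) = \<psi> k (kdiff p)"
    and hb: "\<And>k p. p \<in> PP (bdeg (Suc k)) \<Longrightarrow> bdiff (hb (Suc k) p) + hb k (bdiff p) = p - \<psi> (Suc k) (\<phi> (Suc k) p)"
    and hk: "\<And>k p. p \<in> PP (kdeg (Suc k)) \<Longrightarrow> kdiff (hk (Suc k) p) + hk k (kdiff p) = p - \<phi> (Suc k) (\<psi> (Suc k) p)"
    and b0: "\<And>p. p \<in> PP (bdeg 0) \<Longrightarrow> \<psi> 0 (\<phi> 0 p) = p"
    and k0: "\<And>p. p \<in> PP (kdeg 0) \<Longrightarrow> \<phi> 0 (\<psi> 0 p) = p"
  define f where "f k = bc (XS \<times> kdeg k) (\<phi> k)" for k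
  define g where "g k = bc (XS \<times> bdeg k) (\<psi> k)" for k
  have f: "f k \<in> module_hom R (C k) (D k)" for k
    unfolding f_def by (rule bc_hom[of "XS \<times> bdeg k" "\<phi> k" "XS \<times> kdeg k", OF PP_keys[of "bdeg k" "\<phi> k" "kdeg k", OF P(1)]])
  have g: "g k \<in> module_hom R (D k) (C k)" for k
    unfolding g_def by (rule bc_hom[of "XS \<times> kdeg k" "\<psi> k" "XS \<times> bdeg k", OF PP_keys[of "kdeg k" "\<psi> k" "bdeg k", OF P(2)]])
  have fd: "Kd k (f (Suc k) w) = f k (Cd k w)" if "w \<in> carrier (C (Suc k))" for k w
    unfolding f_def by (rule bc_square[OF P(1) kdiff_PP additive_kdiff bdiff_PP P(1) add(1) \<phi>d that])
  have gd: "Cd k (g (Suc k) y) = g k (Kd k y)" if "y \<in> carrier (D (Suc k))" for k y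
    unfolding g_def by (rule bc_square[OF P(2) bdiff_PP additive_bdiff kdiff_PP P(2) add(2) \<psi>d that])
  \<comment> \<open>Every cycle is its round trip plus a boundary. In degree 0 the round trip is the
    identity, and the boundary is that of 0.\<close>
  have gf: "\<exists>u \<in> carrier (C (Suc k)). w = Cd k u \<oplus>\<^bsub>C k\<^esub> g k (f k w)"
    if w: "w \<in> carrier (C k)" and cyc: "\<And>j. k = Suc j \<Longrightarrow> Cd j w = \<zero>\<^bsub>C j\<^esub>" for k w
  proof (cases k)
    case 0
    interpret Ck: module R "C k" by (rule module_free_module)
    interpret Ck1: module R "C (Suc k)" by (rule module_free_module)
    have "g k (f k w) = bc (XS \<times> bdeg k) (\<lambda>p. \<psi> k (\<phi> k p)) w"
      unfolding f_def g_def by (rule bc_comp[of "XS \<times> bdeg k" "\<phi> k" "XS \<times> kdeg k" "\<psi> k" "XS \<times> bdeg k", OF PP_keys[of "bdeg k" "\<phi> k" "kdeg k", OF P(1)] add(2) PP_keys[of "kdeg k" "\<psi> k" "bdeg k", OF P(2)] w])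
    also have "\<dots> = bc (XS \<times> bdeg k) (\<lambda>p. p) w"
      using b0[OF PP_of] w unfolding 0 by (intro bc_cong[of "XS \<times> bdeg 0"]) (simp_all del: mem_Sigma_iff Pow_iff)
    also have "\<dots> = w" by (rule bc_id[OF w])
    finally show ?thesis
      using w module_hom_zero[OF module_free_module module_free_module Cd_hom[of k]]
      by (intro bexI[of _ "\<zero>\<^bsub>C (Suc k)\<^esub>"]) simp_all
  next
    case (Suc j)
    have "w = Cd k (bc (XS \<times> bdeg (Suc k)) (hb k) w) \<oplus>\<^bsub>C k\<^esub> g k (f k w)"
      unfolding f_def g_def Suc
      by (rule bc_homotopy[OF P(3) bdiff_PP additive_bdiff bdiff_PP P(3) add(3) P(1) P(2) add(2) hb])
        (use w cyc[OF Suc] in \<open>simp_all add: Suc\<close>)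
    moreover have "bc (XS \<times> bdeg (Suc k)) (hb k) w \<in> carrier (C (Suc k))"
      by (rule module_hom_in_carrier[OF bc_hom[of "XS \<times> bdeg k" "hb k" "XS \<times> bdeg (Suc k)", OF PP_keys[of "bdeg k" "hb k" "bdeg (Suc k)", OF P(3)]] w])
    ultimately show ?thesis by blast
  qed
  have fg: "\<exists>u \<in> carrier (D (Suc k)). w = Kd k u \<oplus>\<^bsub>D k\<^esub> f k (g k w)"
    if w: "w \<in> carrier (D k)" and cyc: "\<And>j. k = Suc j \<Longrightarrow> Kd j w = \<zero>\<^bsub>D j\<^esub>" for k w
  proof (cases k)
    case 0
    interpret Ck: module R "D k" by (rule module_free_module)
    interpret Ck1: module R "D (Suc k)" by (rule module_free_module)
    have "f k (g k w) = bc (XS \<times> kdeg k) (\<lambda>p. \<phi> k (\<psi> k p)) w"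
      unfolding f_def g_def by (rule bc_comp[of "XS \<times> kdeg k" "\<psi> k" "XS \<times> bdeg k" "\<phi> k" "XS \<times> kdeg k", OF PP_keys[of "kdeg k" "\<psi> k" "bdeg k", OF P(2)] add(1) PP_keys[of "bdeg k" "\<phi> k" "kdeg k", OF P(1)] w])
    also have "\<dots> = bc (XS \<times> kdeg k) (\<lambda>p. p) w"
      using k0[OF PP_of] w unfolding 0 by (intro bc_cong[of "XS \<times> kdeg 0"]) (simp_all del: mem_Sigma_iff Pow_iff)
    also have "\<dots> = w" by (rule bc_id[OF w])
    finally show ?thesis
      using w module_hom_zero[OF module_free_module module_free_module Kd_hom[of k]]
      by (intro bexI[of _ "\<zero>\<^bsub>D (Suc k)\<^esub>"]) simp_all
  next
    case (Suc j)
    have "w = Kd k (bc (XS \<times> kdeg (Suc k)) (hk k) w) \<oplus>\<^bsub>D k\<^esub> f k (g k w)"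
      unfolding f_def g_def Suc
      by (rule bc_homotopy[OF P(4) kdiff_PP additive_kdiff kdiff_PP P(4) add(4) P(2) P(1) add(1) hk])
        (use w cyc[OF Suc] in \<open>simp_all add: Suc\<close>)
    moreover have "bc (XS \<times> kdeg (Suc k)) (hk k) w \<in> carrier (D (Suc k))"
      by (rule module_hom_in_carrier[OF bc_hom[of "XS \<times> kdeg k" "hk k" "XS \<times> kdeg (Suc k)", OF PP_keys[of "kdeg k" "hk k" "kdeg (Suc k)", OF P(4)]] w])
    ultimately show ?thesis by blast
  qed
  \<comment> \<open>\<open>Th_inverse\<close> yields an inverse for one degree at a time; packing
    its properties into a predicate allows the choice of a family \<open>T\<close> for all
    degrees.\<close>
  define inv_Th where "inv_Th k T \<longleftrightarrow> T \<in> module_hom R (HM k) (C k) \<and> (\<forall>z \<in> carrier (HM k). Th k (T z) = z) \<and>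
      (\<forall>w \<in> carrier (C k). T (Th k w) = w)" for k T
  have "\<exists>T. inv_Th k T" for k
    by (rule Th_inverse[of k]) (auto simp: inv_Th_def)
  then obtain T where "\<And>k. inv_Th k (T k)" by metis
  then have T: "\<And>k. T k \<in> module_hom R (HM k) (C k)"
    "\<And>k z. z \<in> carrier (HM k) \<Longrightarrow> Th k (T k z) = z" "\<And>k w. w \<in> carrier (C k) \<Longrightarrow> T k (Th k w) = w"
    by (simp_all add: inv_Th_def)
  note Tc = module_hom_in_carrier[OF T(1)] and Thc = module_hom_in_carrier[OF Th_hom]
  note fc = module_hom_in_carrier[OF f] and gc = module_hom_in_carrier[OF g]
  have Td: "T k (hochschild_diff R A (Suc k) z) = Cd k (T (Suc k) z)" if z: "z \<in> carrier (HM (Suc k))" for k z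
    using Th_diff[OF Tc[OF z]] T(2)[OF z] T(3)[OF module_hom_in_carrier[OF Cd_hom Tc[OF z]]] by simp
  note zeros = module_hom_zero[OF module_free_module module_free_module]
  show thesis
  proof (rule that[of "\<lambda>z. f k (T k z)"])
    show "(\<lambda>z. f k (T k z)) \<in> module_hom R (HM k) (D k)" by (rule module_hom_comp[OF T(1) f])
    fix z assume "z \<in> hochschild_cycles R A k"
    then have z: "z \<in> carrier (HM k)" and cyc: "\<And>j. k = Suc j \<Longrightarrow> hochschild_diff R A (Suc j) z = \<zero>\<^bsub>HM j\<^esub>"
      by (auto simp: hochschild_cycles_iff)
    have Tcyc: "Cd j (T k z) = \<zero>\<^bsub>C j\<^esub>" if k: "k = Suc j" for j
      using Td[of z j] z cyc[OF k] module_hom_zero[OF A.module_hochschild module_free_module T(1)] by (simp add: k)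
    show "f k (T k z) \<in> kcyc k"
      using fd Tc[OF z] fc Tcyc zeros[OF f] by (auto simp: kcyc_def)
    show "z \<in> hochschild_boundaries R A k \<longleftrightarrow> f k (T k z) \<in> kbnd k"
    proof
      assume "z \<in> hochschild_boundaries R A k"
      then obtain x where x: "x \<in> carrier (HM (Suc k))" "z = hochschild_diff R A (Suc k) x"
        by (auto simp: hochschild_boundaries_def Suc_eq_plus1)
      then have "f k (T k z) = Kd k (f (Suc k) (T (Suc k) x))" using Td fd Tc by simp
      then show "f k (T k z) \<in> kbnd k" using x Tc fc by (auto simp: kbnd_def)
    next
      assume "f k (T k z) \<in> kbnd k"
      then obtain y where y: "y \<in> carrier (D (Suc k))" "f k (T k z) = Kd k y" by (auto simp: kbnd_def)
      obtain u where u: "u \<in> carrier (C (Suc k))" "T k z = Cd k u \<oplus>\<^bsub>C k\<^esub> g k (f k (T k z))"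
        using gf[OF Tc[OF z] Tcyc] by blast
      interpret Ck1: module R "C (Suc k)" by (rule module_free_module)
      have uy: "u \<oplus>\<^bsub>C (Suc k)\<^esub> g (Suc k) y \<in> carrier (C (Suc k))" using u(1) gc[OF y(1)] by simp
      \<comment> \<open>Since \<open>f k (T k z) = Kd k y\<close>, the round trip of
        \<open>T k z\<close> is the boundary of \<open>g (Suc k) y\<close>, which joins
        \<open>u\<close>.\<close>
      have "T k z = Cd k (u \<oplus>\<^bsub>C (Suc k)\<^esub> g (Suc k) y)"
        using u y gd gc by (simp add: module_hom_add[OF Cd_hom])
      then have "z = hochschild_diff R A (Suc k) (Th (Suc k) (u \<oplus>\<^bsub>C (Suc k)\<^esub> g (Suc k) y))"
        using Th_diff[OF uy] T(2)[OF z] by simp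
      then show "z \<in> hochschild_boundaries R A k"
        using Thc[OF uy] by (auto simp: hochschild_boundaries_def Suc_eq_plus1[symmetric] simp del: Suc_eq_plus1)
    qed
  next
    fix y assume "y \<in> kcyc k"
    then have y: "y \<in> carrier (D k)" and cyc: "\<And>j. k = Suc j \<Longrightarrow> Kd j y = \<zero>\<^bsub>D j\<^esub>" by (auto simp: kcyc_def)
    interpret Dk: module R "D k" by (rule module_free_module)
    obtain u where u: "u \<in> carrier (D (Suc k))" "y = Kd k u \<oplus>\<^bsub>D k\<^esub> f k (g k y)"
      using fg[OF y cyc] by blast
    have "hochschild_diff R A (Suc j) (Th k (g k y)) = \<zero>\<^bsub>HM j\<^esub>" if k: "k = Suc j" for j
      using Th_diff[of "g k y" j] gc[OF y] gd[of y j] y cyc[OF k] zeros[OF g]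
        module_hom_zero[OF module_free_module A.module_hochschild Th_hom] by (simp add: k)
    then have "Th k (g k y) \<in> hochschild_cycles R A k"
      using Thc[OF gc[OF y]] by (simp add: hochschild_cycles_iff)
    moreover have "y = f k (T k (Th k (g k y))) \<oplus>\<^bsub>D k\<^esub> Kd k u"
      using u y T(3)[OF gc[OF y]] fc[OF gc[OF y]] module_hom_in_carrier[OF Kd_hom u(1)] by (metis Dk.M.a_comm)
    moreover have "Kd k u \<in> kbnd k" using u by (auto simp: kbnd_def)
    ultimately show "\<exists>z \<in> hochschild_cycles R A k. \<exists>b \<in> kbnd k. y = f k (T k z) \<oplus>\<^bsub>D k\<^esub> b" by blast
  qed
qed

lemma hochschild_cycles_submodule: "submodule R (hochschild_cycles R A k) (HM k)"
proof (cases k)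
  case 0
  then show ?thesis
    using A.module_hochschild[of 0] by (simp add: hochschild_cycles_def submodule_def module.axioms
        abelian_group.axioms abelian_monoid.a_closed module.smult_closed abelian_monoid.zero_closed)
next
  case (Suc j)
  have "hochschild_cycles R A k = {z \<in> carrier (HM (Suc j)). hochschild_diff R A (Suc j) z = \<zero>\<^bsub>HM j\<^esub>}"
    by (simp add: hochschild_cycles_def Suc)
  then show ?thesis
    using module_hom_kernel_submodule[OF A.module_hochschild A.module_hochschild A.hochschild_diff_hom[of j]] Suc by simp
qed

end

section \<open>Dimension of free modules over a field\<close>

lemma (in field) free_module_dim:
  assumes "finite S"
  shows "vectorspace R (free_module R S)" "vectorspace.fin_dim R (free_module R S)"
    "vectorspace.dim R (free_module R S) = card S"
proof -
  let ?V = "free_module R S" and ?B = "basis_vec R ` S"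
  interpret V: module R ?V by (rule module_free_module)
  interpret V: vectorspace R ?V by unfold_locales
  show "vectorspace R ?V" by (rule V.vectorspace_axioms)
  have inj: "inj_on (basis_vec R) S"
  proof (rule inj_onI)
    fix x y assume "basis_vec R x = basis_vec R y"
    then have "basis_vec R x x = basis_vec R y x" by simp
    then show "x = y" by (auto simp: basis_vec_def split: if_splits)
  qed
  have B: "?B \<subseteq> carrier ?V" "finite ?B" using basis_vec_closed assms by auto
  have gen: "V.span ?B = carrier ?V"
  proof
    show "V.span ?B \<subseteq> carrier ?V" by (rule V.span_is_subset2[OF B(1)])
    have sm: "submodule R (V.span ?B) ?V" by (rule V.span_is_submodule[OF B(1)])
    show "carrier ?V \<subseteq> V.span ?B"
    proof
      fix v assume "v \<in> carrier ?V"
      then show "v \<in> V.span ?B"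
      proof (induction rule: free_module_induct)
        case zero show ?case by (rule submodule.zero_closed[OF sm])
      next
        case (add f r x)
        have "basis_vec R x \<in> V.span ?B" using V.in_own_span[OF B(1)] add by auto
        then show ?case using add sm by (simp add: submodule.m_closed submodule.smult_closed)
      qed
    qed
  qed
  have li: "V.lin_indpt ?B"
  proof (rule V.finite_lin_indpt2[OF B(2,1)])
    fix a assume a: "a \<in> ?B \<rightarrow> carrier R" and l: "V.lincomb a ?B = \<zero>\<^bsub>?V\<^esub>"
    define f where "f = (\<lambda>x. if x \<in> S then a (basis_vec R x) else \<zero>)"
    have f: "f \<in> carrier ?V"
      using a assms by (auto simp: f_def free_module_def intro: finite_subset[of _ S])
    have "\<zero>\<^bsub>?V\<^esub> = (\<Oplus>\<^bsub>?V\<^esub>x\<in>S. a (basis_vec R x) \<odot>\<^bsub>?V\<^esub> basis_vec R x)"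
      unfolding l[symmetric] V.lincomb_def
      by (rule V.M.add.finprod_reindex[OF _ inj]) (use a B(1) in \<open>auto intro!: V.smult_closed\<close>)
    also have "\<dots> = (\<Oplus>\<^bsub>?V\<^esub>x\<in>S. f x \<odot>\<^bsub>?V\<^esub> basis_vec R x)"
      by (rule V.M.add.finprod_cong') (use a B(1) in \<open>auto simp: f_def intro!: V.smult_closed\<close>)
    also have "\<dots> = lin_ext R ?V (basis_vec R) f"
      by (rule lin_ext_superset[symmetric, OF V.module_axioms basis_vec_closed f assms])
        (auto simp: f_def)
    also have "\<dots> = f"
      by (rule free_module_hom_eqI[OF V.module_axioms lin_ext_hom[OF V.module_axioms] V.module_hom_id _ f])
        (auto intro: lin_ext_basis_vec[OF V.module_axioms] basis_vec_closed)
    finally have "f = (\<lambda>_. \<zero>)" by (simp add: free_module_simps)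
    then have "f x = \<zero>" for x by (rule fun_cong)
    moreover have "f x = a (basis_vec R x)" if "x \<in> S" for x using that by (simp add: f_def)
    ultimately have "a (basis_vec R x) = \<zero>" if "x \<in> S" for x using that by metis
    then show "\<forall>v\<in>?B. a v = \<zero>" by blast
  qed
  have basis: "V.basis ?B" using li gen B by (simp add: V.basis_def)
  show "V.fin_dim" using gen B by (auto simp: V.fin_dim_def)
  show "V.dim = card S" using V.dim_basis[OF B(2) basis] card_image[OF inj] by simp
qed

lemma vectorspace_dim_iso:
  assumes "vectorspace K V" "vectorspace.fin_dim K V" "module K W"
    and g: "g \<in> module_hom K V W" "bij_betw g (carrier V) (carrier W)"
  shows "vectorspace K W" "vectorspace.fin_dim K W" "vectorspace.dim K W = vectorspace.dim K V"
proof -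
  interpret V: vectorspace K V by fact
  interpret W: module K W by fact
  interpret W: vectorspace K W by unfold_locales
  interpret g: linear_map K V W g by unfold_locales (rule g)
  show "vectorspace K W" by (rule W.vectorspace_axioms)
  show "W.fin_dim" using g.surj_fin_dim[OF assms(2)] g(2) by (simp add: bij_betw_def)
  show "W.dim = V.dim" using g.dim_eq[OF assms(2)] g(2) by (simp add: bij_betw_def)
qed

text \<open>The first isomorphism theorem, directed from the target to the quotient. The chosen
  preimages \<open>s\<close> need not be linear, but their cosets are determined by their images.
  This direction carries a dimension known for \<open>V\<close> over to the quotient.\<close>

lemma module_first_iso:
  assumes M: "module R M" and V: "module R V" and f: "f \<in> module_hom R M V"
    and surj: "f ` carrier M = carrier V" and N: "N = {x \<in> carrier M. f x = \<zero>\<^bsub>V\<^esub>}"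
  obtains g where "g \<in> module_hom R V (quot_module M N)" "bij_betw g (carrier V) (carrier (quot_module M N))"
proof -
  interpret M: module R M by (rule M)
  interpret V: module R V by (rule V)
  have sub: "submodule R N M" unfolding N by (rule module_hom_kernel_submodule[OF M V f])
  define s where "s y = (SOME x. x \<in> carrier M \<and> f x = y)" for y
  have s: "s y \<in> carrier M" "f (s y) = y" if "y \<in> carrier V" for y
  proof -
    have "\<exists>x. x \<in> carrier M \<and> f x = y" using that unfolding surj[symmetric] by auto
    from someI_ex[OF this] show "s y \<in> carrier M" "f (s y) = y" by (auto simp: s_def)
  qed
  have eq: "N +>\<^bsub>M\<^esub> x = N +>\<^bsub>M\<^esub> y \<longleftrightarrow> f x = f y" if "x \<in> carrier M" "y \<in> carrier M" for x y
  proof -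
    have "f x \<ominus>\<^bsub>V\<^esub> f y = \<zero>\<^bsub>V\<^esub> \<longleftrightarrow> f x = f y"
      using module_hom_in_carrier[OF f that(1)] module_hom_in_carrier[OF f that(2)]
      by (metis V.M.minus_eq V.M.minus_equality V.M.a_inv_closed V.M.minus_minus V.M.r_neg)
    then show ?thesis
      using that M.quot_rep_eq_iff[OF sub that] module_hom_minus[OF M V f that] by (simp add: N M.M.minus_closed)
  qed
  note fadd = module_hom_add[OF f] and fsm = module_hom_smult[OF f]
  show thesis
  proof (rule that[of "\<lambda>y. N +>\<^bsub>M\<^esub> s y"])
    show "(\<lambda>y. N +>\<^bsub>M\<^esub> s y) \<in> module_hom R V (quot_module M N)"
    proof (rule module_homI)
      fix x y assume "x \<in> carrier V" "y \<in> carrier V"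
      then show "N +>\<^bsub>M\<^esub> s (x \<oplus>\<^bsub>V\<^esub> y) = (N +>\<^bsub>M\<^esub> s x) \<oplus>\<^bsub>quot_module M N\<^esub> (N +>\<^bsub>M\<^esub> s y)"
        using s fadd by (simp add: M.quot_add[OF sub] eq)
    next
      fix r x assume "r \<in> carrier R" "x \<in> carrier V"
      then show "N +>\<^bsub>M\<^esub> s (r \<odot>\<^bsub>V\<^esub> x) = r \<odot>\<^bsub>quot_module M N\<^esub> (N +>\<^bsub>M\<^esub> s x)"
        using s fsm by (simp add: M.quot_smult[OF sub] eq)
    qed (use s in \<open>simp add: M.carrier_quot[OF sub]\<close>)
    show "bij_betw (\<lambda>y. N +>\<^bsub>M\<^esub> s y) (carrier V) (carrier (quot_module M N))"
    proof (rule bij_betwI')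
      fix x y assume "x \<in> carrier V" "y \<in> carrier V"
      then show "N +>\<^bsub>M\<^esub> s x = N +>\<^bsub>M\<^esub> s y \<longleftrightarrow> x = y" using s eq by simp
    next
      fix X assume "X \<in> carrier (quot_module M N)"
      then obtain x where x: "x \<in> carrier M" "X = N +>\<^bsub>M\<^esub> x" by (auto simp: M.carrier_quot[OF sub])
      then have "f x \<in> carrier V" by (simp add: module_hom_in_carrier[OF f])
      moreover have "X = N +>\<^bsub>M\<^esub> s (f x)" using x s[OF \<open>f x \<in> carrier V\<close>] eq by simp
      ultimately show "\<exists>y \<in> carrier V. X = N +>\<^bsub>M\<^esub> s y" by blast
    qed (use s in \<open>simp add: M.carrier_quot[OF sub]\<close>)
  qed
qed

context cring
begin

lemma bc_zero:
  assumes "\<And>x. x \<in> S \<Longrightarrow> F (frag_of x) = 0" and v: "v \<in> carrier (free_module R S)"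
  shows "bc T F v = \<zero>\<^bsub>free_module R T\<^esub>"
proof -
  interpret T: module R "free_module R T" by (rule module_free_module)
  have k: "Poly_Mapping.keys (F (frag_of x)) \<subseteq> T" if "x \<in> S" for x using assms(1)[OF that] by simp
  have "bc T F v = bc T (\<lambda>p. frag_cmul 0 (F p)) v"
    by (rule bc_cong[of S F, OF _ k v]) (simp_all add: assms(1))
  also have "\<dots> = \<zero>\<^bsub>free_module R T\<^esub>"
    using bc_cmul[of S F T v 0, OF k v] module_hom_in_carrier[OF bc_hom[of S F T, OF k] v] by simp
  finally show ?thesis .
qed

end

section \<open>Homology computed by maps out of the small complex\<close>

context exterior_ring
begin

lemma bdiff_bdiff: assumes "p \<in> PP (bdeg (Suc k))" shows "bdiff (bdiff p) = 0"
  unfolding tind_comp[OF resolutionD(1)[OF resolution_bar]]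
  using resolutionD(3)[OF resolution_bar tup_PM[OF assms]] by (simp add: additive_zero[OF additive_tdown])

text \<open>Read off from the integral bar complex through \<open>Th\<close>: there the differential
  squares to zero by \<open>bdiff_bdiff\<close>, and base change preserves this.\<close>

lemma hochschild_boundaries_cycles: "hochschild_boundaries R A k \<subseteq> hochschild_cycles R A k"
proof
  fix z assume "z \<in> hochschild_boundaries R A k"
  then obtain x where x: "x \<in> carrier (HM (Suc k))" "z = hochschild_diff R A (Suc k) x"
    by (auto simp: hochschild_boundaries_def Suc_eq_plus1)
  obtain T where T: "T \<in> module_hom R (HM (Suc k)) (C (Suc k))" "\<And>z. z \<in> carrier (HM (Suc k)) \<Longrightarrow> Th (Suc k) (T z) = z"
    by (rule Th_inverse[of "Suc k"]) (rule that)
  let ?w = "T x"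
  have w: "?w \<in> carrier (C (Suc k))" by (rule module_hom_in_carrier[OF T(1) x(1)])
  have z: "z = Th k (Cd k ?w)" using Th_diff[OF w] T(2)[OF x(1)] x(2) by simp
  have Cw: "Cd k ?w \<in> carrier (C k)" by (rule module_hom_in_carrier[OF Cd_hom w])
  have "hochschild_diff R A (Suc j) z = \<zero>\<^bsub>HM j\<^esub>" if k: "k = Suc j" for j
  proof -
    have kb: "x \<in> XS \<times> bdeg (Suc k) \<Longrightarrow> Poly_Mapping.keys (bdiff (frag_of x)) \<subseteq> XS \<times> bdeg (Suc j)" for x
      using keys_bdiff[of x k] k by simp
    have "Cd j (Cd k ?w) = bc (XS \<times> bdeg j) (\<lambda>p. bdiff (bdiff p)) ?w"
      unfolding k by (rule bc_comp[of "XS \<times> bdeg (Suc k)" bdiff "XS \<times> bdeg (Suc j)" bdiff "XS \<times> bdeg j", OF kb additive_bdiff keys_bdiff w])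
    also have "\<dots> = \<zero>\<^bsub>C j\<^esub>"
      by (rule bc_zero[of "XS \<times> bdeg (Suc k)" "\<lambda>p. bdiff (bdiff p)", OF bdiff_bdiff[OF PP_of] w])
    finally show ?thesis
      using Th_diff[of "Cd k ?w" j] Cw z k module_hom_zero[OF module_free_module A.module_hochschild Th_hom[of j]] by simp
  qed
  then show "z \<in> hochschild_cycles R A k"
    using module_hom_in_carrier[OF Th_hom Cw] z by (simp add: hochschild_cycles_iff)
qed

abbreviation "HH k \<equiv> hochschild_homology R A k"

text \<open>The first isomorphism theorem is applied to \<open>f\<close> composed with the
  comparison map on Hochschild cycles. The kernel consists of the boundaries, since both maps detect
  boundaries; the composite is onto because \<open>f\<close> kills the boundary by which a small
  cycle may differ from an image.\<close>

lemma homology_iso: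
  assumes V: "module R V" and f: "f \<in> module_hom R (D k) V"
    and ker: "\<And>y. y \<in> kcyc k \<Longrightarrow> f y = \<zero>\<^bsub>V\<^esub> \<longleftrightarrow> y \<in> kbnd k" and surj: "carrier V \<subseteq> f ` kcyc k"
    and kbnd: "kbnd k \<subseteq> kcyc k"
  obtains g where "module R (HH k)" "g \<in> module_hom R V (HH k)" "bij_betw g (carrier V) (carrier (HH k))"
proof (rule hochschild_koszul[of k])
  fix \<Phi> assume \<Phi>: "\<Phi> \<in> module_hom R (HM k) (D k)"
    "\<And>z. z \<in> hochschild_cycles R A k \<Longrightarrow> \<Phi> z \<in> kcyc k"
    "\<And>z. z \<in> hochschild_cycles R A k \<Longrightarrow> z \<in> hochschild_boundaries R A k \<longleftrightarrow> \<Phi> z \<in> kbnd k"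
    "\<And>y. y \<in> kcyc k \<Longrightarrow> \<exists>z \<in> hochschild_cycles R A k. \<exists>b \<in> kbnd k. y = \<Phi> z \<oplus>\<^bsub>D k\<^esub> b"
  interpret V: module R V by (rule V)
  interpret Hk: module R "HM k" by (rule A.module_hochschild)
  let ?Z = "(HM k)\<lparr>carrier := hochschild_cycles R A k\<rparr>"
  have Z: "module R ?Z" by (rule Hk.submodule_is_module[OF hochschild_cycles_submodule])
  have Zc: "hochschild_cycles R A k \<subseteq> carrier (HM k)" by (auto simp: hochschild_cycles_iff)
  have h: "(\<lambda>z. f (\<Phi> z)) \<in> module_hom R ?Z V"
    using module_hom_comp[OF \<Phi>(1) f] Zc by (auto simp: module_hom_def subset_iff)
  have cyc: "kcyc k \<subseteq> carrier (D k)" by (auto simp: kcyc_def)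
  have "hochschild_boundaries R A k = {x \<in> carrier ?Z. f (\<Phi> x) = \<zero>\<^bsub>V\<^esub>}"
    using \<Phi>(2,3) ker hochschild_boundaries_cycles[of k] by auto
  moreover have "(\<lambda>z. f (\<Phi> z)) ` carrier ?Z = carrier V"
  proof
    show "(\<lambda>z. f (\<Phi> z)) ` carrier ?Z \<subseteq> carrier V" using h by (auto simp: module_hom_def)
    show "carrier V \<subseteq> (\<lambda>z. f (\<Phi> z)) ` carrier ?Z"
    proof
      fix v assume "v \<in> carrier V"
      then obtain y where y: "y \<in> kcyc k" "v = f y" using surj by blast
      obtain z b where z: "z \<in> hochschild_cycles R A k" "b \<in> kbnd k" "y = \<Phi> z \<oplus>\<^bsub>D k\<^esub> b" using \<Phi>(4)[OF y(1)] by blast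
      have "b \<in> kcyc k" using z kbnd by blast
      have c: "\<Phi> z \<in> carrier (D k)" "b \<in> carrier (D k)" using \<Phi>(2)[OF z(1)] \<open>b \<in> kcyc k\<close> cyc by auto
      have "v = f (\<Phi> z)"
        using ker[OF \<open>b \<in> kcyc k\<close>] z y module_hom_add[OF f c] module_hom_in_carrier[OF f c(1)] by simp
      then show "v \<in> (\<lambda>z. f (\<Phi> z)) ` carrier ?Z" using z by simp
    qed
  qed
  ultimately obtain g where g: "g \<in> module_hom R V (HH k)" "bij_betw g (carrier V) (carrier (HH k))"
    unfolding hochschild_homology_def using module_first_iso[OF Z V h] by blast
  have "submodule R {x \<in> carrier ?Z. f (\<Phi> x) = \<zero>\<^bsub>V\<^esub>} ?Z" by (rule module_hom_kernel_submodule[OF Z V h])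
  then have "module R (HH k)"
    unfolding hochschild_homology_def \<open>hochschild_boundaries R A k = _\<close> by (rule module.module_quot_module[OF Z])
  then show thesis using g by (rule that)
qed

end

context exterior_ring
begin

section \<open>Hochschild homology over a field\<close>

text \<open>\<open>kdiff\<close> is twice the integral map \<open>kap\<close> on the even part.
  Where 2 is zero this makes the whole differential vanish.\<close>

lemma Kd_eq_smult: "u \<in> carrier (D (Suc k)) \<Longrightarrow> \<exists>w \<in> carrier (D k). Kd k u = zr 2 \<odot>\<^bsub>D k\<^esub> w"
proof -
  assume u: "u \<in> carrier (D (Suc k))"
  have k: "Poly_Mapping.keys (kap (evp (frag_of x))) \<subseteq> XS \<times> kdeg k" if "x \<in> XS \<times> kdeg (Suc k)" for x
    using PP_keysD[OF kap_PP[OF pproj_PP[OF PP_of[OF that]]]] .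
  have "Kd k u = bc (XS \<times> kdeg k) (\<lambda>p. frag_cmul 2 (kap (evp p))) u"
    by (rule bc_cong[of "XS \<times> kdeg (Suc k)" kdiff, OF kdiff_eq[OF PP_of] keys_kdiff u])
  also have "\<dots> = zr 2 \<odot>\<^bsub>D k\<^esub> bc (XS \<times> kdeg k) (\<lambda>p. kap (evp p)) u"
    by (rule bc_cmul[of "XS \<times> kdeg (Suc k)" "\<lambda>p. kap (evp p)", OF k u])
  finally show ?thesis
    using module_hom_in_carrier[OF bc_hom[of "XS \<times> kdeg (Suc k)" "\<lambda>p. kap (evp p)" "XS \<times> kdeg k", OF k] u] by blast
qed

lemma kbnd_kcyc: "kbnd k \<subseteq> kcyc k"
proof
  fix y assume "y \<in> kbnd k"
  then obtain u where u: "u \<in> carrier (D (Suc k))" "y = Kd k u" by (auto simp: kbnd_def)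
  have "Kd j y = \<zero>\<^bsub>D j\<^esub>" if k: "k = Suc j" for j
  proof -
    have kb: "x \<in> XS \<times> kdeg (Suc k) \<Longrightarrow> Poly_Mapping.keys (kdiff (frag_of x)) \<subseteq> XS \<times> kdeg (Suc j)" for x
      using keys_kdiff[of x k] k by simp
    have z: "kdiff (kdiff (frag_of x)) = 0" if "x \<in> XS \<times> kdeg (Suc k)" for x
      unfolding tind_comp[OF resolutionD(1)[OF resolution_koszul]]
      using resolutionD(3)[OF resolution_koszul tup_PM[OF PP_of[OF that]]] by (simp add: additive_zero[OF additive_tdown])
    have "Kd j (Kd k u) = bc (XS \<times> kdeg j) (\<lambda>p. kdiff (kdiff p)) u"
      unfolding k by (rule bc_comp[of "XS \<times> kdeg (Suc k)" kdiff "XS \<times> kdeg (Suc j)" kdiff "XS \<times> kdeg j", OF kb additive_kdiff keys_kdiff u(1)])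
    also have "\<dots> = \<zero>\<^bsub>D j\<^esub>"
      by (rule bc_zero[of "XS \<times> kdeg (Suc k)" "\<lambda>p. kdiff (kdiff p)", OF z u(1)])
    finally show ?thesis using u by simp
  qed
  then show "y \<in> kcyc k" using u module_hom_in_carrier[OF Kd_hom] by (auto simp: kcyc_def)
qed

abbreviation "Pf k \<equiv> bc (FS k) pfree"

lemma FS_sub: "FS k \<subseteq> XS \<times> kdeg k"
  by (auto simp: FS_def)

lemma keys_pfree: "x \<in> XS \<times> kdeg k \<Longrightarrow> Poly_Mapping.keys (pfree (frag_of x)) \<subseteq> FS k"
  by (simp add: pproj_of FS_def del: mem_Sigma_iff Pow_iff)

lemma Pf_hom: "Pf k \<in> module_hom R (D k) (free_module R (FS k))"
  by (rule bc_hom[of "XS \<times> kdeg k" pfree "FS k", OF keys_pfree])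

lemma Pf_kbnd: assumes "y \<in> kbnd k" shows "Pf k y = \<zero>\<^bsub>free_module R (FS k)\<^esub>"
proof -
  obtain u where u: "u \<in> carrier (D (Suc k))" "y = Kd k u" using assms by (auto simp: kbnd_def)
  have "Pf k (Kd k u) = bc (FS k) (\<lambda>p. pfree (kdiff p)) u"
    by (rule bc_comp[of "XS \<times> kdeg (Suc k)" kdiff "XS \<times> kdeg k" pfree "FS k", OF keys_kdiff additive_pproj keys_pfree u(1)])
  also have "\<dots> = \<zero>\<^bsub>free_module R (FS k)\<^esub>"
    by (rule bc_zero[of "XS \<times> kdeg (Suc k)" "\<lambda>p. pfree (kdiff p)", OF pfree_kdiff[OF PP_of] u(1)])
  finally show ?thesis using u by simp
qed

text \<open>A vector supported on the free generators is its own projection, and it is a cycle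
  because \<open>kdiff\<close> kills the free generators.\<close>

lemma Pf_surj: "carrier (free_module R (FS k)) \<subseteq> Pf k ` kcyc k"
proof
  fix v assume v: "v \<in> carrier (free_module R (FS k))"
  have vD: "v \<in> carrier (D k)" using v FS_sub by (fastforce simp: free_module_def simp del: mem_Sigma_iff Pow_iff)
  have kF: "Poly_Mapping.keys (pfree (frag_of x)) \<subseteq> FS k" if "x \<in> FS k" for x
    using keys_pfree FS_sub that by blast
  have fx: "pfree (frag_of x) = frag_of x" if "x \<in> FS k" for x using that by (simp add: pproj_of FS_def)
  have kD: "Poly_Mapping.keys (pfree (frag_of x)) \<subseteq> XS \<times> kdeg k" if "x \<in> XS \<times> kdeg k" for x
    using keys_pfree[OF that] FS_sub by blast
  have Pfv: "Pf k v = v"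
  proof -
    have "Pf k v = bc (FS k) (\<lambda>p. p) v" by (rule bc_cong[of "FS k" pfree, OF fx kF v])
    then show ?thesis using bc_id[OF v] by simp
  qed
  have v': "v = bc (XS \<times> kdeg k) pfree v"
    using bc_subset[of "XS \<times> kdeg k" pfree "FS k" "XS \<times> kdeg k" v, OF keys_pfree FS_sub vD] Pfv by simp
  have "Kd j v = \<zero>\<^bsub>D j\<^esub>" if k: "k = Suc j" for j
  proof -
    have kk: "x \<in> XS \<times> kdeg k \<Longrightarrow> Poly_Mapping.keys (kdiff (frag_of x)) \<subseteq> XS \<times> kdeg j" for x
      using keys_kdiff k by simp
    have "Kd j v = Kd j (bc (XS \<times> kdeg k) pfree v)" using v' by simp
    also have "\<dots> = bc (XS \<times> kdeg j) (\<lambda>p. kdiff (pfree p)) v"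
      by (rule bc_comp[of "XS \<times> kdeg k" pfree "XS \<times> kdeg k" kdiff "XS \<times> kdeg j", OF kD additive_kdiff kk vD])
    also have "\<dots> = \<zero>\<^bsub>D j\<^esub>"
      by (rule bc_zero[of "XS \<times> kdeg k" "\<lambda>p. kdiff (pfree p)", OF kdiff_pfree[OF PP_of] vD])
    finally show ?thesis .
  qed
  then have "v \<in> kcyc k" using vD by (auto simp: kcyc_def)
  then show "v \<in> Pf k ` kcyc k" using Pfv by (metis imageI)
qed

text \<open>Base change of \<open>two_eq\<close>: on a cycle without free part two of its three
  terms vanish and the remaining one is a boundary. The factor 2 stays because \<open>R\<close> is
  an arbitrary commutative ring here.\<close>

lemma two_kcyc:
  assumes y: "y \<in> kcyc k" and P: "Pf k y = \<zero>\<^bsub>free_module R (FS k)\<^esub>"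
  shows "\<exists>u \<in> carrier (D (Suc k)). zr 2 \<odot>\<^bsub>D k\<^esub> y = Kd k u"
proof -
  let ?S = "XS \<times> kdeg k"
  interpret S: module R "D k" by (rule module_free_module)
  have yD: "y \<in> carrier (D k)" using y by (simp add: kcyc_def)
  have kid: "Poly_Mapping.keys (frag_of x) \<subseteq> ?S" if "x \<in> ?S" for x using that by simp
  have kc: "Poly_Mapping.keys (ctr (frag_of x)) \<subseteq> XS \<times> kdeg (Suc k)" if "x \<in> ?S" for x
    using PP_keysD[OF ctr_PP[OF PP_of[OF that]]] .
  have k1: "Poly_Mapping.keys (kdiff (ctr (frag_of x))) \<subseteq> ?S" if "x \<in> ?S" for x
    using PP_keysD[OF kdiff_PP[OF ctr_PP[OF PP_of[OF that]]]] .
  have k3: "Poly_Mapping.keys (pfree (frag_of x)) \<subseteq> ?S" if "x \<in> ?S" for x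
    using keys_pfree[OF that] FS_sub by blast
  have k3': "Poly_Mapping.keys (frag_cmul 2 (pfree (frag_of x))) \<subseteq> ?S" if "x \<in> ?S" for x
    using keys_cmul[of 2 "pfree (frag_of x)"] k3[OF that] by blast
  have k123: "Poly_Mapping.keys (frag_cmul 2 (frag_of x)) \<subseteq> ?S" if "x \<in> ?S" for x
    using keys_cmul[of 2 "frag_of x"] kid[OF that] by blast
  \<comment> \<open>The support is read off from \<open>two_eq\<close>, since the argument through
    \<open>kdiff_PP\<close> passes through a lower degree and says nothing in degree 0.\<close>
  have k2: "Poly_Mapping.keys (ctr (kdiff (frag_of x))) \<subseteq> ?S" if x: "x \<in> ?S" for x
  proof -
    have "ctr (kdiff (frag_of x)) = frag_cmul 2 (frag_of x) - kdiff (ctr (frag_of x)) - frag_cmul 2 (pfree (frag_of x))"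
      using two_eq[OF PP_of[OF x]] by simp
    then show ?thesis
      using keys_diff_subset[OF keys_diff_subset[OF k123[OF x] k1[OF x]] k3'[OF x]] by simp
  qed
  have k12: "Poly_Mapping.keys (kdiff (ctr (frag_of x)) + ctr (kdiff (frag_of x))) \<subseteq> ?S" if "x \<in> ?S" for x
    using k1[OF that] k2[OF that] by (rule keys_add_subset)
  have "bc ?S (\<lambda>p. ctr (kdiff p)) y = \<zero>\<^bsub>D k\<^esub>"
  proof (cases k)
    case 0
    show ?thesis
    proof (rule bc_zero[OF _ yD])
      fix x assume "x \<in> ?S"
      then obtain c where x: "x = (c, {#})" "c \<subseteq> {1..n}" by (auto simp: 0 kdeg_def)
      have "kdiff (frag_of x) = 0" using x kdiff_basis[OF x(2), of "{#}" 0] by (simp add: kapb_empty kdeg_def)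
      then show "ctr (kdiff (frag_of x)) = 0" by (simp add: additive_zero[OF additive_ctr])
    qed
  next
    case (Suc j)
    have kk: "x \<in> ?S \<Longrightarrow> Poly_Mapping.keys (kdiff (frag_of x)) \<subseteq> XS \<times> kdeg j" for x
      using keys_kdiff Suc by simp
    have kcj: "Poly_Mapping.keys (ctr (frag_of x)) \<subseteq> ?S" if "x \<in> XS \<times> kdeg j" for x
      unfolding Suc using PP_keysD[OF ctr_PP[OF PP_of[OF that]]] .
    have "bc ?S (\<lambda>p. ctr (kdiff p)) y = bc ?S ctr (Kd j y)"
      by (rule bc_comp[of ?S kdiff "XS \<times> kdeg j" ctr ?S, OF kk additive_ctr kcj yD, symmetric])
    also have "Kd j y = \<zero>\<^bsub>D j\<^esub>" using y Suc by (simp add: kcyc_def)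
    finally show ?thesis
      using module_hom_zero[OF module_free_module module_free_module bc_hom[of "XS \<times> kdeg j" ctr ?S]] kcj by metis
  qed
  moreover have "bc ?S pfree y = \<zero>\<^bsub>D k\<^esub>"
    using bc_subset[of ?S pfree "FS k" ?S y, OF keys_pfree FS_sub yD] P by (simp add: free_module_simps)
  moreover have "zr 2 \<odot>\<^bsub>D k\<^esub> y = (bc ?S (\<lambda>p. kdiff (ctr p)) y \<oplus>\<^bsub>D k\<^esub> bc ?S (\<lambda>p. ctr (kdiff p)) y) \<oplus>\<^bsub>D k\<^esub> zr 2 \<odot>\<^bsub>D k\<^esub> bc ?S pfree y"
  proof -
    have "zr 2 \<odot>\<^bsub>D k\<^esub> y = bc ?S (\<lambda>p. frag_cmul 2 p) y"
      using bc_cmul[of ?S "\<lambda>p. p" ?S y 2, OF kid yD] bc_id[OF yD] by simp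
    also have "\<dots> = bc ?S (\<lambda>p. kdiff (ctr p) + ctr (kdiff p) + frag_cmul 2 (pfree p)) y"
      by (rule bc_cong[of ?S "\<lambda>p. frag_cmul 2 p", OF two_eq[OF PP_of] k123 yD])
    also have "\<dots> = bc ?S (\<lambda>p. kdiff (ctr p) + ctr (kdiff p)) y \<oplus>\<^bsub>D k\<^esub> bc ?S (\<lambda>p. frag_cmul 2 (pfree p)) y"
      by (rule bc_add[of ?S "\<lambda>p. kdiff (ctr p) + ctr (kdiff p)" ?S "\<lambda>p. frag_cmul 2 (pfree p)", OF k12 k3' yD])
    also have "bc ?S (\<lambda>p. kdiff (ctr p) + ctr (kdiff p)) y = bc ?S (\<lambda>p. kdiff (ctr p)) y \<oplus>\<^bsub>D k\<^esub> bc ?S (\<lambda>p. ctr (kdiff p)) y"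
      by (rule bc_add[of ?S "\<lambda>p. kdiff (ctr p)" ?S "\<lambda>p. ctr (kdiff p)", OF k1 k2 yD])
    also have "bc ?S (\<lambda>p. frag_cmul 2 (pfree p)) y = zr 2 \<odot>\<^bsub>D k\<^esub> bc ?S pfree y"
      by (rule bc_cmul[of ?S pfree, OF k3 yD])
    finally show ?thesis .
  qed
  moreover have "bc ?S (\<lambda>p. kdiff (ctr p)) y = Kd k (bc (XS \<times> kdeg (Suc k)) ctr y)"
    by (rule bc_comp[of ?S ctr "XS \<times> kdeg (Suc k)" kdiff ?S, OF kc additive_kdiff keys_kdiff yD, symmetric])
  moreover have u: "bc (XS \<times> kdeg (Suc k)) ctr y \<in> carrier (D (Suc k))"
    by (rule module_hom_in_carrier[OF bc_hom[of ?S ctr "XS \<times> kdeg (Suc k)", OF kc] yD])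
  ultimately have "zr 2 \<odot>\<^bsub>D k\<^esub> y = Kd k (bc (XS \<times> kdeg (Suc k)) ctr y)"
    using module_hom_in_carrier[OF Kd_hom u] by simp
  then show ?thesis using u by blast
qed

end

locale exterior_field = field R + exterior n for R (structure) and n
begin

sublocale exterior_ring R n ..

text \<open>All differentials vanish, so the homology is the chain module itself and its dimension
  the number of basis elements.\<close>

lemma homology_dim_char_2:
  assumes "zr 2 = \<zero>"
  shows "vectorspace R (HH k)" "vectorspace.fin_dim R (HH k)"
    "vectorspace.dim R (HH k) = 2 ^ n * ((n + k - 1) choose k)"
proof -
  interpret Dk: module R "D k" by (rule module_free_module)
  have Kd0: "Kd j u = \<zero>\<^bsub>D j\<^esub>" if "u \<in> carrier (D (Suc j))" for j u
  proof -
    interpret Dj: module R "D j" by (rule module_free_module)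
    show ?thesis using Kd_eq_smult[OF that] assms by auto
  qed
  have cyc: "kcyc k = carrier (D k)" using Kd0 by (auto simp: kcyc_def)
  have "kbnd k \<subseteq> {\<zero>\<^bsub>D k\<^esub>}" using Kd0 by (auto simp: kbnd_def)
  moreover have "\<zero>\<^bsub>D k\<^esub> \<in> kbnd k"
    using module_hom_zero[OF module_free_module module_free_module Kd_hom[of k]]
      abelian_monoid.zero_closed[OF abelian_group.axioms(1)[OF module.axioms(2)[OF module_free_module]]]
    unfolding kbnd_def by (metis image_eqI)
  ultimately have bnd: "kbnd k = {\<zero>\<^bsub>D k\<^esub>}" by blast
  have fin: "finite (XS \<times> kdeg k)" by (simp add: finite_kdeg)
  note vs = free_module_dim[OF fin]
  obtain g where g: "module R (HH k)" "g \<in> module_hom R (D k) (HH k)" "bij_betw g (carrier (D k)) (carrier (HH k))"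
    by (rule homology_iso[OF Dk.module_axioms Dk.module_hom_id _ _ kbnd_kcyc]) (simp add: bnd, simp add: cyc, rule that)
  show "vectorspace R (HH k)" "vectorspace.fin_dim R (HH k)"
    "vectorspace.dim R (HH k) = 2 ^ n * ((n + k - 1) choose k)"
    using vectorspace_dim_iso[OF vs(1,2) g] vs(3) card_XS_kdeg by simp_all
qed

text \<open>With 2 invertible, \<open>two_kcyc\<close> makes every cycle without free part a
  boundary, so the free coordinates determine the class.\<close>

lemma homology_dim:
  assumes "zr 2 \<noteq> \<zero>"
  shows "vectorspace R (HH k)" "vectorspace.fin_dim R (HH k)" "vectorspace.dim R (HH k) = card (FS k)"
proof -
  let ?V = "free_module R (FS k)"
  interpret Dk: module R "D k" by (rule module_free_module)
  interpret Dk1: module R "D (Suc k)" by (rule module_free_module)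
  interpret V: module R ?V by (rule module_free_module)
  have u: "zr 2 \<in> Units R" using assms by (simp add: field_Units)
  have ker: "Pf k y = \<zero>\<^bsub>?V\<^esub> \<longleftrightarrow> y \<in> kbnd k" if y: "y \<in> kcyc k" for y
  proof
    assume "Pf k y = \<zero>\<^bsub>?V\<^esub>"
    then obtain w where w: "w \<in> carrier (D (Suc k))" "zr 2 \<odot>\<^bsub>D k\<^esub> y = Kd k w" using two_kcyc[OF y] by blast
    have yD: "y \<in> carrier (D k)" using y by (simp add: kcyc_def)
    have "y = inv zr 2 \<odot>\<^bsub>D k\<^esub> (zr 2 \<odot>\<^bsub>D k\<^esub> y)"
      using u yD by (simp add: Dk.smult_assoc1[symmetric])
    also have "\<dots> = Kd k (inv zr 2 \<odot>\<^bsub>D (Suc k)\<^esub> w)"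
      using u w module_hom_smult[OF Kd_hom[of k], of "inv zr 2" w] by simp
    finally show "y \<in> kbnd k" using u w unfolding kbnd_def by (metis Dk1.smult_closed Units_inv_closed imageI)
  qed (rule Pf_kbnd)
  note vs = free_module_dim[OF finite_FS[of k]]
  obtain g where g: "module R (HH k)" "g \<in> module_hom R ?V (HH k)" "bij_betw g (carrier ?V) (carrier (HH k))"
    by (rule homology_iso[OF V.module_axioms Pf_hom ker Pf_surj kbnd_kcyc]) (assumption, rule that)
  show "vectorspace R (HH k)" "vectorspace.fin_dim R (HH k)" "vectorspace.dim R (HH k) = card (FS k)"
    using vectorspace_dim_iso[OF vs(1,2) g] vs(3) by simp_all
qed

lemma ring_characteristic_2: "ring_characteristic R = 2 \<longleftrightarrow> zr 2 = \<zero>"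
proof -
  have e: "[m] \<cdot> \<one> = zr (int m)" for m :: nat by (simp add: zr_def add_pow_def int_pow_int)
  have 1: "zr 1 \<noteq> \<zero>" by simp
  show ?thesis
  proof
    assume c: "ring_characteristic R = 2"
    then have ex: "\<exists>m::nat. m > 0 \<and> [m] \<cdot> \<one> = \<zero>" by (auto simp: ring_characteristic_def split: if_splits)
    then have "ring_characteristic R = (LEAST m::nat. m > 0 \<and> [m] \<cdot> \<one> = \<zero>)" by (simp add: ring_characteristic_def)
    with LeastI_ex[OF ex] c have "[(2::nat)] \<cdot> \<one> = \<zero>" by simp
    then show "zr 2 = \<zero>" using e[of 2] by simp
  next
    assume z: "zr 2 = \<zero>"
    then have 2: "(0::nat) < 2 \<and> [(2::nat)] \<cdot> \<one> = \<zero>" using e[of 2] by simp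
    have "(LEAST m::nat. m > 0 \<and> [m] \<cdot> \<one> = \<zero>) = 2"
    proof (rule Least_equality, rule 2)
      fix m :: nat assume m: "m > 0 \<and> [m] \<cdot> \<one> = \<zero>"
      then have "m \<noteq> 1" using e[of 1] 1 by auto
      then show "2 \<le> m" using m by linarith
    qed
    then show "ring_characteristic R = 2" using 2 unfolding ring_characteristic_def by metis
  qed
qed

end

section \<open>Hochschild homology over the integers\<close>

context exterior_ring
begin

text \<open>The counterpart of \<open>homology_iso\<close> for a target given as a group and not as
  a module. It rests on the first isomorphism theorem for groups, so \<open>f\<close> need only be
  additive on cycles.\<close>

lemma homology_group_iso:
  assumes G: "group G"
    and add: "\<And>x y. x \<in> kcyc k \<Longrightarrow> y \<in> kcyc k \<Longrightarrow> f (x \<oplus>\<^bsub>D k\<^esub> y) = f x \<otimes>\<^bsub>G\<^esub> f y"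
    and surj: "f ` kcyc k = carrier G"
    and ker: "\<And>y. y \<in> kcyc k \<Longrightarrow> f y = \<one>\<^bsub>G\<^esub> \<longleftrightarrow> y \<in> kbnd k"
  shows "add_monoid (HH k) \<cong> G"
proof (rule hochschild_koszul[of k])
  fix \<Phi> assume \<Phi>: "\<Phi> \<in> module_hom R (HM k) (D k)"
    "\<And>z. z \<in> hochschild_cycles R A k \<Longrightarrow> \<Phi> z \<in> kcyc k"
    "\<And>z. z \<in> hochschild_cycles R A k \<Longrightarrow> z \<in> hochschild_boundaries R A k \<longleftrightarrow> \<Phi> z \<in> kbnd k"
    "\<And>y. y \<in> kcyc k \<Longrightarrow> \<exists>z \<in> hochschild_cycles R A k. \<exists>b \<in> kbnd k. y = \<Phi> z \<oplus>\<^bsub>D k\<^esub> b"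
  interpret G: group G by (rule G)
  interpret Hk: module R "HM k" by (rule A.module_hochschild)
  let ?Z = "(HM k)\<lparr>carrier := hochschild_cycles R A k\<rparr>"
  interpret Z: module R ?Z by (rule Hk.submodule_is_module[OF hochschild_cycles_submodule])
  have Zc: "hochschild_cycles R A k \<subseteq> carrier (HM k)" by (auto simp: hochschild_cycles_iff)
  have cl: "f (\<Phi> z) \<in> carrier G" if "z \<in> hochschild_cycles R A k" for z using \<Phi>(2)[OF that] surj by blast
  interpret h: group_hom "add_monoid ?Z" G "\<lambda>z. f (\<Phi> z)"
  proof (intro group_hom.intro group_hom_axioms.intro homI)
    show "group (add_monoid ?Z)" by (rule Z.M.a_group)
    fix x y assume "x \<in> carrier (add_monoid ?Z)" "y \<in> carrier (add_monoid ?Z)"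
    then have "x \<in> hochschild_cycles R A k" "y \<in> hochschild_cycles R A k" by auto
    then show "f (\<Phi> (x \<otimes>\<^bsub>add_monoid ?Z\<^esub> y)) = f (\<Phi> x) \<otimes>\<^bsub>G\<^esub> f (\<Phi> y)"
      using Zc add \<Phi>(2) module_hom_add[OF \<Phi>(1)] by (simp add: subset_iff)
  qed (use cl G in auto)
  have ker: "kernel (add_monoid ?Z) G (\<lambda>z. f (\<Phi> z)) = hochschild_boundaries R A k"
    using \<Phi>(2,3) ker hochschild_boundaries_cycles[of k] by (auto simp: kernel_def)
  have "carrier G \<subseteq> (\<lambda>z. f (\<Phi> z)) ` carrier (add_monoid ?Z)"
  proof
    fix v assume "v \<in> carrier G"
    then obtain y where y: "y \<in> kcyc k" "v = f y" using surj by blast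
    obtain z b where z: "z \<in> hochschild_cycles R A k" "b \<in> kbnd k" "y = \<Phi> z \<oplus>\<^bsub>D k\<^esub> b" using \<Phi>(4)[OF y(1)] by blast
    have b: "b \<in> kcyc k" using z kbnd_kcyc by blast
    have "v = f (\<Phi> z)" using assms(4)[OF b] z y add[OF \<Phi>(2)[OF z(1)] b] cl by simp
    then show "v \<in> (\<lambda>z. f (\<Phi> z)) ` carrier (add_monoid ?Z)" using z by simp
  qed
  moreover have "(\<lambda>z. f (\<Phi> z)) ` carrier (add_monoid ?Z) \<subseteq> carrier G" using cl by auto
  ultimately have "add_monoid ?Z Mod hochschild_boundaries R A k \<cong> G"
    using h.FactGroup_iso unfolding ker by (metis subset_antisym)
  \<comment> \<open>The factor group and \<open>add_monoid (HH k)\<close> consist of the same cosets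
    with the same setwise sum, so unfolding the definitions identifies them.\<close>
  then show ?thesis
    by (simp add: is_iso_def iso_def hom_def hochschild_homology_def quot_module_def FactGroup_def A_RCOSETS_def set_add_def)
qed

end

lemma zr_int: "cring.zr \<Z> z = z"
proof (induction z rule: int_induct[of _ 0])
  case (step2 i)
  have "cring.zr \<Z> (i - 1) = cring.zr \<Z> i \<oplus>\<^bsub>\<Z>\<^esub> cring.zr \<Z> (- 1)"
    unfolding cring.zr_add[OF int_is_cring, symmetric] by simp
  also have "cring.zr \<Z> (- 1) = \<ominus>\<^bsub>\<Z>\<^esub> \<one>\<^bsub>\<Z>\<^esub>"
    by (simp add: cring.zr_uminus[OF int_is_cring] cring.zr_1[OF int_is_cring])
  also have "\<ominus>\<^bsub>\<Z>\<^esub> \<one>\<^bsub>\<Z>\<^esub> = - 1"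
    by (rule abelian_group.minus_equality[OF ring.axioms(1)[OF cring.axioms(1)[OF int_is_cring]]]) simp_all
  finally show ?case using step2 by simp
qed (simp_all add: cring.zr_add[OF int_is_cring] cring.zr_0[OF int_is_cring] cring.zr_1[OF int_is_cring])

context exterior
begin

lemma exterior_ring_int: "exterior_ring \<Z>"
  by (simp add: exterior_ring_def int_is_cring)

interpretation Z: exterior_ring \<Z> n by (rule exterior_ring_int)

lemma emb_int: "cring.emb \<Z> c = Poly_Mapping.lookup c"
  by (simp add: cring.emb_def[OF int_is_cring] zr_int)

text \<open>Finite support is built into \<open>free_module\<close>, so its elements over the
  integers are the coefficient functions of integral chains. Cycles and boundaries can then be
  handled by the integral lemmas.\<close>

lemma carrier_free_int: "carrier (free_module \<Z> S) = Poly_Mapping.lookup ` {c. Poly_Mapping.keys c \<subseteq> S}"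
proof
  show "carrier (free_module \<Z> S) \<subseteq> Poly_Mapping.lookup ` {c. Poly_Mapping.keys c \<subseteq> S}"
  proof
    fix f assume f: "f \<in> carrier (free_module \<Z> S)"
    have l: "Poly_Mapping.lookup (Abs_poly_mapping f) = f"
      using cring.carrier_free_moduleD(3)[OF int_is_cring f] by (simp add: Abs_poly_mapping_inverse)
    then have "Poly_Mapping.keys (Abs_poly_mapping f) \<subseteq> S"
      using cring.carrier_free_moduleD(4)[OF int_is_cring f] by (auto simp: in_keys_iff)
    then show "f \<in> Poly_Mapping.lookup ` {c. Poly_Mapping.keys c \<subseteq> S}" using l by (metis image_eqI mem_Collect_eq)
  qed
  show "Poly_Mapping.lookup ` {c. Poly_Mapping.keys c \<subseteq> S} \<subseteq> carrier (free_module \<Z> S)"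
    using cring.emb_closed[OF int_is_cring] by (auto simp: emb_int)
qed

lemma carrier_D_int: "carrier (free_module \<Z> (XS \<times> G)) = Poly_Mapping.lookup ` PP G"
  unfolding carrier_free_int PP_def ..

lemma Kd_int: "c \<in> PP (kdeg (Suc k)) \<Longrightarrow> cring.bc \<Z> (XS \<times> kdeg k) kdiff (Poly_Mapping.lookup c) = Poly_Mapping.lookup (kdiff c)"
  using cring.bc_emb[OF int_is_cring additive_kdiff Z.keys_kdiff PP_keysD] by (simp add: emb_int)

lemma kdiff_0: assumes "c \<in> PP (kdeg 0)" shows "kdiff c = 0"
proof (rule additive_eqI_PP[OF additive_kdiff additive_zero_map assms])
  fix c :: "nat set" and m assume "c \<subseteq> {1..n}" "finite c" "m \<in> kdeg 0"
  then show "kdiff (frag_of (c, m)) = 0" by (simp add: kdiff_basis kapb_empty kdeg_def)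
qed

lemma kcyc_int: "Z.kcyc k = Poly_Mapping.lookup ` {c \<in> PP (kdeg k). kdiff c = 0}"
proof -
  have "(\<forall>j. k = Suc j \<longrightarrow> cring.bc \<Z> (XS \<times> kdeg j) kdiff (Poly_Mapping.lookup c) = \<zero>\<^bsub>free_module \<Z> (XS \<times> kdeg j)\<^esub>) \<longleftrightarrow> kdiff c = 0"
    if c: "c \<in> PP (kdeg k)" for c
  proof (cases k)
    case 0
    then show ?thesis using c kdiff_0 by simp
  next
    case (Suc j)
    have "Poly_Mapping.lookup (kdiff c) = (\<lambda>_. 0) \<longleftrightarrow> kdiff c = 0"
      by (metis lookup_zero poly_mapping_eqI)
    then show ?thesis using c Kd_int[of c j] Suc by (simp add: cring.free_module_simps[OF int_is_cring])
  qed
  then show ?thesis by (auto simp: Z.kcyc_def carrier_D_int)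
qed

lemma kbnd_int: "Z.kbnd k = Poly_Mapping.lookup ` kdiff ` PP (kdeg (Suc k))"
  unfolding Z.kbnd_def carrier_D_int using Kd_int by (auto simp: image_iff)

theorem homology_int:
  "add_monoid (hochschild_homology \<Z> (exterior_algebra \<Z> n) k) \<cong>
    product_group {..<card (FS k)} (\<lambda>_. integer_group) \<times>\<times> product_group {..<card (US (Suc k))} (\<lambda>_. integer_mod_group 2)"
proof -
  let ?m = "card (FS k)" and ?t = "card (US (Suc k))"
  let ?G = "product_group {..<?m} (\<lambda>_. integer_group) \<times>\<times> product_group {..<?t} (\<lambda>_. integer_mod_group 2)"
  obtain p where p: "bij_betw p {..<?m} (FS k)"
    using ex_bij_betw_nat_finite[OF finite_FS] by (auto simp: atLeast0LessThan)
  obtain q where q: "bij_betw q {..<?t} (US (Suc k))"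
    using ex_bij_betw_nat_finite[OF finite_US] by (auto simp: atLeast0LessThan)
  \<comment> \<open>Complete invariants of a class: the free coordinates, and the coordinates of the
    contraction modulo 2. The enumerations \<open>p\<close> and \<open>q\<close> merely renumber the
    generators.\<close>
  define f where "f y = (\<lambda>i\<in>{..<?m}. y (p i), \<lambda>i\<in>{..<?t}. Poly_Mapping.lookup (ctr (evp (Abs_poly_mapping y))) (q i) mod 2)" for y
  have f: "f (Poly_Mapping.lookup c) = (\<lambda>i\<in>{..<?m}. Poly_Mapping.lookup c (p i), \<lambda>i\<in>{..<?t}. Poly_Mapping.lookup (ctr (evp c)) (q i) mod 2)" for c
    by (simp add: f_def)
  have ball: "(\<forall>x\<in>S. P x) \<longleftrightarrow> (\<forall>i\<in>{..<m}. P (h i))" if "bij_betw h {..<m} S"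
    for h and m :: nat and S :: "(nat set \<times> nat multiset) set" and P
    using that by (auto simp: bij_betw_def)
  have restr: "restrict g I = (\<lambda>i\<in>I. 0) \<longleftrightarrow> (\<forall>i\<in>I. g i = (0::int))" for g :: "nat \<Rightarrow> int" and I
    by (metis restrict_apply' restrict_ext)
  have G: "group ?G" by (intro DirProd_group) simp_all
  show ?thesis
  proof (rule Z.homology_group_iso[OF G, of k f])
    fix x y assume "x \<in> Z.kcyc k" "y \<in> Z.kcyc k"
    then obtain c d where cd: "x = Poly_Mapping.lookup c" "y = Poly_Mapping.lookup d" by (auto simp: kcyc_int)
    have "x \<oplus>\<^bsub>free_module \<Z> (XS \<times> kdeg k)\<^esub> y = Poly_Mapping.lookup (c + d)"
      by (auto simp: cd cring.free_module_simps[OF int_is_cring] lookup_add)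
    then show "f (x \<oplus>\<^bsub>free_module \<Z> (XS \<times> kdeg k)\<^esub> y) = f x \<otimes>\<^bsub>?G\<^esub> f y"
      by (auto simp: f cd lookup_add additive_add[OF additive_pproj] additive_add[OF additive_ctr] mod_simps intro!: restrict_ext)
  next
    show "f ` Z.kcyc k = carrier ?G"
    proof
      show "f ` Z.kcyc k \<subseteq> carrier ?G"
        by (auto simp: kcyc_int f carrier_integer_mod_group)
      show "carrier ?G \<subseteq> f ` Z.kcyc k"
      proof
        fix w assume w: "w \<in> carrier ?G"
        obtain a b where ab: "w = (a, b)" by (cases w)
        have a: "a \<in> extensional {..<?m}" and b: "b \<in> {..<?t} \<rightarrow>\<^sub>E {0..<2}"
          using w by (auto simp: ab carrier_integer_mod_group PiE_def)
        obtain c where c: "c \<in> PP (kdeg k)" "kdiff c = 0"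
          "\<And>x. x \<in> FS k \<Longrightarrow> Poly_Mapping.lookup c x = a (inv_into {..<?m} p x)"
          "\<And>u. u \<in> US (Suc k) \<Longrightarrow> Poly_Mapping.lookup (ctr (evp c)) u = b (inv_into {..<?t} q u)"
          by (rule coeffs_surj[of k "\<lambda>x. a (inv_into {..<?m} p x)" "\<lambda>x. b (inv_into {..<?t} q x)"]) (rule that)
        have "Poly_Mapping.lookup c (p i) = a i" if "i < ?m" for i
          using c(3)[of "p i"] bij_betwE[OF p] bij_betw_inv_into_left[OF p] that by simp
        moreover have "Poly_Mapping.lookup (ctr (evp c)) (q i) mod 2 = b i" if "i < ?t" for i
        proof -
          have "b i \<in> {0..<2}" by (rule PiE_mem[OF b]) (simp add: that)
          then have "b i mod 2 = b i" by simp
          then show ?thesis using c(4)[of "q i"] bij_betwE[OF q] bij_betw_inv_into_left[OF q] that by simp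
        qed
        ultimately have "f (Poly_Mapping.lookup c) = w"
          using a b unfolding f ab PiE_def prod.inject
          by (intro conjI extensionalityI[of _ "{..<?m}"] extensionalityI[of _ "{..<?t}"]) simp_all
        then show "w \<in> f ` Z.kcyc k" using c(1,2) by (auto simp: kcyc_int)
      qed
    qed
  next
    fix y assume "y \<in> Z.kcyc k"
    then obtain c where c: "y = Poly_Mapping.lookup c" "c \<in> PP (kdeg k)" "kdiff c = 0" by (auto simp: kcyc_int)
    have "y \<in> Z.kbnd k \<longleftrightarrow> c \<in> kdiff ` PP (kdeg (Suc k))"
      unfolding kbnd_int c(1) by (metis (no_types, lifting) image_iff poly_mapping_eqI)
    also have "\<dots> \<longleftrightarrow> (\<forall>x \<in> FS k. Poly_Mapping.lookup c x = 0) \<and> (\<forall>u \<in> US (Suc k). even (Poly_Mapping.lookup (ctr (evp c)) u))"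
      by (rule boundary_iff[OF c(2,3)])
    also have "\<dots> \<longleftrightarrow> (\<forall>i\<in>{..<?m}. Poly_Mapping.lookup c (p i) = 0) \<and> (\<forall>i\<in>{..<?t}. Poly_Mapping.lookup (ctr (evp c)) (q i) mod 2 = 0)"
      unfolding ball[OF p] ball[OF q] even_iff_mod_2_eq_zero ..
    also have "\<dots> \<longleftrightarrow> f y = \<one>\<^bsub>?G\<^esub>"
      unfolding f c(1) by (simp add: restr)
    finally show "f y = \<one>\<^bsub>?G\<^esub> \<longleftrightarrow> y \<in> Z.kbnd k" by simp
  qed
qed

end

theorem theorem3:
  fixes n :: nat and K :: "('k, 'm) ring_scheme"
  assumes "n \<ge> 1"
  shows
    "(\<forall>k. \<exists>F T :: nat.
        F = 2 ^ (n - 1) * ((n + k - 1) choose k) + (if k = 0 then 1 else 0) \<and>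
        int T = (-1) ^ (k + 1) +
          2 ^ (n - 1) * (\<Sum>i\<in>{0..k}. (-1) ^ (k - i) * int ((n + i - 1) choose i)) \<and>
        add_monoid (hochschild_homology \<Z> (exterior_algebra \<Z> n) k) \<cong>
          product_group {..<F} (\<lambda>_. integer_group) \<times>\<times>
          product_group {..<T} (\<lambda>_. integer_mod_group 2)) \<and>
     (field K \<longrightarrow>
       (\<forall>k. let H = hochschild_homology K (exterior_algebra K n) k in
          vectorspace K H \<and> vectorspace.fin_dim K H \<and>
          vectorspace.dim K H =
            (if ring_characteristic K = 2 then 2 ^ n * ((n + k - 1) choose k)
             else if k \<ge> 1 then 2 ^ (n - 1) * ((n + k - 1) choose k)
             else 2 ^ (n - 1) + 1)))"
proof (intro conjI allI impI)
  fix k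
  have T: "int (card (exterior.US n (Suc k))) = (-1) ^ (k + 1) +
      2 ^ (n - 1) * (\<Sum>i\<in>{0..k}. (-1) ^ (k - i) * int ((n + i - 1) choose i))"
    by (rule exterior.card_US[OF assms])
  show "\<exists>F T :: nat.
      F = 2 ^ (n - 1) * ((n + k - 1) choose k) + (if k = 0 then 1 else 0) \<and>
      int T = (-1) ^ (k + 1) +
        2 ^ (n - 1) * (\<Sum>i\<in>{0..k}. (-1) ^ (k - i) * int ((n + i - 1) choose i)) \<and>
      add_monoid (hochschild_homology \<Z> (exterior_algebra \<Z> n) k) \<cong>
        product_group {..<F} (\<lambda>_. integer_group) \<times>\<times>
        product_group {..<T} (\<lambda>_. integer_mod_group 2)"
    \<comment> \<open>The torsion of degree \<open>k\<close> is counted in degree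
      \<open>k + 1\<close>, where the contraction of a chain of degree \<open>k\<close> has its
      coordinates.\<close>
    by (intro exI[of _ "card (exterior.FS n k)"] exI[of _ "card (exterior.US n (Suc k))"] conjI
        exterior.card_FS[OF assms] T exterior.homology_int)
next
  fix k
  assume K: "field K"
  interpret exterior_field K n by (rule exterior_field.intro[OF K])
  show "let H = hochschild_homology K (exterior_algebra K n) k in
      vectorspace K H \<and> vectorspace.fin_dim K H \<and>
      vectorspace.dim K H =
        (if ring_characteristic K = 2 then 2 ^ n * ((n + k - 1) choose k)
         else if k \<ge> 1 then 2 ^ (n - 1) * ((n + k - 1) choose k)
         else 2 ^ (n - 1) + 1)"
  proof (cases "ring_characteristic K = 2")
    case True
    then have "zr 2 = \<zero>\<^bsub>K\<^esub>" by (simp only: ring_characteristic_2)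
    note H = homology_dim_char_2[OF this, of k]
    show ?thesis unfolding Let_def if_P[OF True] by (intro conjI H)
  next
    case False
    then have "zr 2 \<noteq> \<zero>\<^bsub>K\<^esub>" by (simp only: ring_characteristic_2 not_False_eq_True)
    note H = homology_dim[OF this, of k]
    have c: "card (FS k) = (if k \<ge> 1 then 2 ^ (n - 1) * ((n + k - 1) choose k) else 2 ^ (n - 1) + 1)"
      using card_FS[OF assms, of k] by (cases k) auto
    show ?thesis unfolding Let_def if_not_P[OF False] c[symmetric] by (intro conjI H)
  qed
qed

end
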